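(* Let $\mathcal V=(V,\eta,\xi)$ be a left cyclic polarized arrangement of $n$ hyperplanes in $k$-space. The maps $\Phi:\mathcal B_l(n,k)\to\tilde B(\mathcal V)$ and $\Psi:\tilde B(\mathcal V)\to\mathcal B_l(n,k)$ defined in the context are mutually inverse isomorphisms of multi-graded $\mathbb Z$-algebras (gradings by $\mathbb Z\langle e_1,\dots,e_n\rangle$), and they intertwine the anti-involution $\psi_{OSz}$ of $\mathcal B_l(n,k)$ with the anti-involution $\psi^{\mathcal V}$ of $\tilde B(\mathcal V)$.
   Context: **Arrangements.** An arrangement of $n$ hyperplanes in $k$-space is a pair $(V,\eta)$ with $V\subset\mathbb R^n$ a linear subspace of dimension $k$ and $\eta\in\mathbb R^n/V$ such that every representative of $\eta$ has at least $n-k$ nonzero entries. View $V+\eta$ as an affine subspace of $\mathbb R^n$; $H_i=\{x\in V+\eta: x_i=0\}$, $H_S=\bigcap_{i\in S}H_i$, and for $\alpha\in\{+,-\}^n$, $\Delta_\alpha=\{x\in V+\eta:\alpha(i)x_i\ge0\ \forall i\}$. A polarized arrangement is $(V,\eta,\xi)$ with also $\xi\in V^*=(\mathbb R^n)^*/V^\perp$, every representative of $\xi$ having at least $k$ nonzero entries. $\alpha$ is feasible if $\Delta_\alpha\ne\emptyset$, bounded if an affine function on $V+\eta$ with linear part $\xi$ is bounded above on $\Delta_\alpha$; $\mathcal P$ is the set of bounded feasible $\alpha$. **Left cyclic.** $\mathrm{Gr}^{>0}_{k,n}$: $k$-dimensional subspaces of $\mathbb R^n$ with all Plücker coordinates nonzero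 and of the same sign. $(V,\eta,\xi)$ is left cyclic if $V+\langle\eta\rangle\in\mathrm{Gr}^{>0}_{k+1,n}$, $\{(\xi(v),v):v\in V\}\in\mathrm{Gr}^{>0}_{k,n+1}$, and the first coordinate of the orthogonal projection of a representative of $\eta$ onto $V^\perp$ is positive. **$\tilde B(\mathcal V)$.** For $\alpha,\beta\in\mathcal P$, $\tilde R_{\alpha\beta}=\mathbb Z[u_1,\dots,u_n]/(u_S:\Delta_\alpha\cap\Delta_\beta\cap H_S=\emptyset)$, $u_S=\prod_{i\in S}u_i$, and $f_{\alpha,\beta}$ is the class of $1$. $\tilde B(\mathcal V)=\bigoplus_{\alpha,\beta\in\mathcal P}\tilde R_{\alpha\beta}$ with $\mathbb Z[u_1,\dots,u_n]$-bilinear product $f_{\alpha,\beta}f_{\beta,\gamma}=u_{S(\alpha\beta\gamma)}f_{\alpha,\gamma}$, $S(\alpha\beta\gamma)=\{i:\alpha(i)=\gamma(i)\ne\beta(i)\}$ (other products $0$). Multi-degree: $\deg u_i=2e_i$, $\deg f_{\alpha,\beta}=\sum_{i:\alpha(i)\ne\beta(i)}e_i$. $\psi^{\mathcal V}$ is the anti-automorphism given by the identity maps $\tilde R_{\alpha\beta}\to\tilde R_{\beta\alpha}$ ($f_{\alpha,\beta}\mapsto f_{\beta,\alpha}$, $u_i\mapsto u_i$). **Quiver description of $\tilde B(\mathcal V)$ for left cyclic $\mathcal V$.** Put $\mathrm{var}_l(\alpha)=$ number of sign changes in the sequence $+\alpha$ (a plus prepended to $\alpha$); $\mathcal P=\{\alpha:\mathrm{var}_l(\alpha)=k\}$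 and $\alpha$ is bounded iff $\mathrm{var}_l(\alpha)\ge k$. Write $\alpha\leftrightarrow\beta$ if $\alpha,\beta$ differ in exactly one entry, and $\beta=\alpha^i$ if they differ only in entry $i$. Let $Q$ be the quiver with vertices all $\alpha$ with $\mathrm{var}_l(\alpha)\ge k$ and arrows $p(\alpha,\beta)$ from $\alpha$ to $\beta$ when $\alpha\leftrightarrow\beta$. Then $\tilde B(\mathcal V)$ is $P(Q)\otimes_{\mathbb Z}\mathbb Z[u_1,\dots,u_n]$ modulo: $e_\alpha=0$ if $\mathrm{var}_l(\alpha)>k$; $p(\alpha,\beta)p(\beta,\gamma)=p(\alpha,\delta)p(\delta,\gamma)$ for distinct vertices $\alpha\leftrightarrow\beta\leftrightarrow\gamma\leftrightarrow\delta\leftrightarrow\alpha$; $p(\alpha,\beta)p(\beta,\alpha)=u_ie_\alpha$ if $\beta=\alpha^i$. For $\alpha,\beta\in\mathcal P$, $e_\alpha$ corresponds to $f_{\alpha,\alpha}$ and $p(\alpha,\beta)$ to $f_{\alpha,\beta}$. **Ozsváth–Szabó algebra.** $V(n,k)$ is the set of $k$-element subsets of $\{0,\dots,n\}$. $\mathcal B(n,k)$ is the path algebra over $\mathbb Z$ (paths composed left to right) of the quiver with vertex set $V(n,k)$ and arrows: for $1\le i\le n$, $R_i:\mathbf x\to\mathbf y$ and $L_i:\mathbf y\to\mathbf x$ whenever $\mathbf x\cap\{i-1,i\}=\{i-1\}$ and $\mathbf y=(\mathbf x\setminus\{i-1\})\cup\{i\}$; $U_i:\mathbf x\to\mathbf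 x$ for all $\mathbf x$; modulo (whenever the paths make sense) $R_iU_j=U_jR_i$, $L_iU_j=U_jL_i$, $U_iU_j=U_jU_i$; $R_iL_i=U_i$, $L_iR_i=U_i$; $R_iR_j=R_jR_i$, $L_iL_j=L_jL_i$, $L_iR_j=R_jL_i$ for $|i-j|>1$; $R_{i-1}R_i=0$, $L_iL_{i-1}=0$; $U_i\mathbf I_{\mathbf x}=0$ if $\mathbf x\cap\{i-1,i\}=\emptyset$ ($\mathbf I_{\mathbf x}$ = trivial path). Multi-degree: $\deg R_i=\deg L_i=e_i$, $\deg U_i=2e_i$. With $V_l(n,k)$ the set of $k$-element subsets of $\{0,\dots,n-1\}$, $\mathcal B_l(n,k)=\bigoplus_{\mathbf x,\mathbf x'\in V_l(n,k)}\mathbf I_{\mathbf x}\mathcal B(n,k)\mathbf I_{\mathbf x'}$; it is generated by the $\mathbf I_{\mathbf x}$ and the arrows $R_i,L_i,U_i$ between vertices in $V_l(n,k)$. $\psi_{OSz}$ is the anti-automorphism fixing each $\mathbf I_{\mathbf x}$ with $R_i\mapsto L_i$, $L_i\mapsto R_i$, $U_i\mapsto U_i$. **Bijection.** $\mathcal P\to V_l(n,k)$, $\alpha\mapsto\mathbf x_\alpha=\{i\in\{0,\dots,n-1\}:\alpha(i)\ne\alpha(i+1)\}$ with the convention $\alpha(0)=+$; the inverse is written $\mathbf x\mapsto\alpha_{\mathbf x}$. **Maps.** $\Phi$ sends $\mathbf I_{\mathbf x}\mapsto e_{\alpha_{\mathbf x}}$; each arrow $R_i$ or $L_i$ from $\mathbf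 x$ to $\mathbf y$ to $p(\alpha_{\mathbf x},\alpha_{\mathbf y})$; each arrow $U_i:\mathbf x\to\mathbf x$ to $u_ie_{\alpha_{\mathbf x}}$. $\Psi$ sends $e_\alpha\mapsto\mathbf I_{\mathbf x_\alpha}$ if $\mathrm{var}_l(\alpha)=k$ and $e_\alpha\mapsto0$ (hence arrows at $\alpha$ to $0$) if $\mathrm{var}_l(\alpha)>k$; for $\alpha,\beta\in\mathcal P$ with $\beta=\alpha^i$, $p(\alpha,\beta)\mapsto(R_i:\mathbf x_\alpha\to\mathbf x_\beta)$ if $\mathbf x_\beta=(\mathbf x_\alpha\setminus\{i-1\})\cup\{i\}$ (a sign change is delayed), and $p(\alpha,\beta)\mapsto(L_i:\mathbf x_\alpha\to\mathbf x_\beta)$ if $\mathbf x_\beta=(\mathbf x_\alpha\setminus\{i\})\cup\{i-1\}$ (a sign change is advanced); $u_i\mapsto\sum_{\mathbf x\in V_l(n,k)}U_i\mathbf I_{\mathbf x}$. *)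

theory Defs
  imports
    "HOL-Library.Poly_Mapping"
    "HOL-Library.FuncSet"
    "HOL-Algebra.QuotRing"
    "Jordan_Normal_Form.VS_Connect"
    "Jordan_Normal_Form.DL_Submatrix"
    "Graph_Theory.Arc_Walk"
begin

section \<open>Polarized arrangements\<close>

text \<open>Coordinates of \<open>real vec\<close> are numbered from 0, so the coordinate \<open>x\<^sub>i\<close>,
  \<open>1 \<le> i \<le> n\<close>, is \<open>x $ (i - 1)\<close>. Covectors are identified with vectors by the scalar product,
  so that the annihilator of \<open>V\<close> is its orthogonal complement.\<close>

definition linear_subspace :: "nat \<Rightarrow> nat \<Rightarrow> real vec set \<Rightarrow> bool" where
  "linear_subspace n k V \<longleftrightarrow>
     VectorSpace.subspace class_ring V (module_vec TYPE(real) n) \<and>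
     vectorspace.dim class_ring ((module_vec TYPE(real) n)\<lparr>carrier := V\<rparr>) = k"

abbreviation orth :: "nat \<Rightarrow> real vec set \<Rightarrow> real vec set" where
  "orth n V \<equiv> vec_module.orthogonal_complement n V"

text \<open>The element of \<open>\<real>\<^sup>n/V\<close> and the element of \<open>(\<real>\<^sup>n)\<^sup>*/V\<^sup>\<bottom>\<close> are cosets, whose elements are
  the representatives. In particular the affine space \<open>V + \<eta>\<close> is the set \<open>eta\<close> itself.\<close>

definition arrangement :: "nat \<Rightarrow> nat \<Rightarrow> real vec set \<Rightarrow> real vec set \<Rightarrow> bool" where
  "arrangement n k V eta \<longleftrightarrow>
     linear_subspace n k V \<and>
     eta \<in> a_rcosets\<^bsub>module_vec TYPE(real) n\<^esub> V \<and>
     (\<forall>y\<in>eta. n - k \<le> card {i \<in> {0..<n}. y $ i \<noteq> 0})"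

definition polarized_arrangement ::
  "nat \<Rightarrow> nat \<Rightarrow> real vec set \<Rightarrow> real vec set \<Rightarrow> real vec set \<Rightarrow> bool" where
  "polarized_arrangement n k V eta xi \<longleftrightarrow>
     arrangement n k V eta \<and>
     xi \<in> a_rcosets\<^bsub>module_vec TYPE(real) n\<^esub> (orth n V) \<and>
     (\<forall>w\<in>xi. k \<le> card {i \<in> {0..<n}. w $ i \<noteq> 0})"

definition functional :: "real vec set \<Rightarrow> real vec \<Rightarrow> real" where
  "functional xi v = (THE c. \<forall>w\<in>xi. w \<bullet> v = c)"

text \<open>Sign vectors in \<open>{+,-}\<^sup>n\<close> are functions into \<open>{1,-1}\<close> with the value \<open>1\<close>
  outside \<open>{1..n}\<close>; this makes the convention \<open>\<alpha>(0) = +\<close> automatic.\<close>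

definition sign_vectors :: "nat \<Rightarrow> (nat \<Rightarrow> int) set" where
  "sign_vectors n = {\<alpha>. (\<forall>i. \<alpha> i = 1 \<or> \<alpha> i = -1) \<and> (\<forall>i. i \<notin> {1..n} \<longrightarrow> \<alpha> i = 1)}"

definition hyperplanes :: "real vec set \<Rightarrow> nat set \<Rightarrow> real vec set" where
  "hyperplanes eta S = {x\<in>eta. \<forall>i\<in>S. x $ (i - 1) = 0}"

definition region :: "nat \<Rightarrow> real vec set \<Rightarrow> (nat \<Rightarrow> int) \<Rightarrow> real vec set" where
  "region n eta \<alpha> = {x\<in>eta. \<forall>i\<in>{1..n}. of_int (\<alpha> i) * x $ (i - 1) \<ge> 0}"

definition feasible :: "nat \<Rightarrow> real vec set \<Rightarrow> (nat \<Rightarrow> int) \<Rightarrow> bool" where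
  "feasible n eta \<alpha> \<longleftrightarrow> region n eta \<alpha> \<noteq> {}"

definition bounded_sign ::
  "nat \<Rightarrow> real vec set \<Rightarrow> real vec set \<Rightarrow> real vec set \<Rightarrow> (nat \<Rightarrow> int) \<Rightarrow> bool" where
  "bounded_sign n V eta xi \<alpha> \<longleftrightarrow>
     (\<exists>h :: real vec \<Rightarrow> real.
        (\<forall>x\<in>eta. \<forall>v\<in>V. h (x + v) = h x + functional xi v) \<and>
        (\<exists>M. \<forall>x\<in>region n eta \<alpha>. h x \<le> M))"

definition PP ::
  "nat \<Rightarrow> real vec set \<Rightarrow> real vec set \<Rightarrow> real vec set \<Rightarrow> (nat \<Rightarrow> int) set" where
  "PP n V eta xi = {\<alpha> \<in> sign_vectors n. feasible n eta \<alpha> \<and> bounded_sign n V eta xi \<alpha>}"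

section \<open>Left cyclic arrangements\<close>

definition Gr_pos :: "nat \<Rightarrow> nat \<Rightarrow> real vec set set" where
  "Gr_pos m N = {W. linear_subspace N m W \<and>
     (\<exists>A\<in>carrier_mat m N. vec_space.row_space N A = W \<and>
        ((\<forall>J. J \<subseteq> {0..<N} \<and> card J = m \<longrightarrow> det (submatrix A UNIV J) > 0) \<or>
         (\<forall>J. J \<subseteq> {0..<N} \<and> card J = m \<longrightarrow> det (submatrix A UNIV J) < 0)))}"

definition orth_proj :: "nat \<Rightarrow> real vec set \<Rightarrow> real vec \<Rightarrow> real vec" where
  "orth_proj n W y = (THE p. p \<in> W \<and> y - p \<in> orth n W)"

definition left_cyclic ::
  "nat \<Rightarrow> nat \<Rightarrow> real vec set \<Rightarrow> real vec set \<Rightarrow> real vec set \<Rightarrow> bool" where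
  "left_cyclic n k V eta xi \<longleftrightarrow>
     {v + c \<cdot>\<^sub>v y | v c y. v \<in> V \<and> y \<in> eta} \<in> Gr_pos (k + 1) n \<and>
     (\<lambda>v. vCons (functional xi v) v) ` V \<in> Gr_pos k (n + 1) \<and>
     (\<forall>y\<in>eta. orth_proj n (orth n V) y $ 0 > 0)"

section \<open>The convolution algebra of an arrangement\<close>

text \<open>Monomials are finitely supported exponent vectors.\<close>

type_synonym mpoly = "(nat \<Rightarrow>\<^sub>0 nat) \<Rightarrow>\<^sub>0 int"

definition Zu :: "nat \<Rightarrow> mpoly ring" where
  "Zu n = \<lparr>carrier = {p. \<forall>m\<in>Poly_Mapping.keys p. Poly_Mapping.keys m \<subseteq> {1..n}},
           monoid.mult = (*), one = 1, zero = 0, add = (+)\<rparr>"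

definition uvar :: "nat \<Rightarrow> mpoly" where
  "uvar i = Poly_Mapping.single (Poly_Mapping.single i 1) 1"

definition umon :: "nat set \<Rightarrow> mpoly" where
  "umon S = (\<Prod>i\<in>S. uvar i)"

definition Rideal :: "nat \<Rightarrow> real vec set \<Rightarrow> (nat \<Rightarrow> int) \<Rightarrow> (nat \<Rightarrow> int) \<Rightarrow> mpoly set" where
  "Rideal n eta \<alpha> \<beta> = Idl\<^bsub>Zu n\<^esub> {umon S | S. S \<subseteq> {1..n} \<and>
     region n eta \<alpha> \<inter> region n eta \<beta> \<inter> hyperplanes eta S = {}}"

definition Rtilde ::
  "nat \<Rightarrow> real vec set \<Rightarrow> (nat \<Rightarrow> int) \<Rightarrow> (nat \<Rightarrow> int) \<Rightarrow> mpoly set ring" where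
  "Rtilde n eta \<alpha> \<beta> = Zu n Quot Rideal n eta \<alpha> \<beta>"

definition sep :: "nat \<Rightarrow> (nat \<Rightarrow> int) \<Rightarrow> (nat \<Rightarrow> int) \<Rightarrow> (nat \<Rightarrow> int) \<Rightarrow> nat set" where
  "sep n \<alpha> \<beta> \<gamma> = {i\<in>{1..n}. \<alpha> i = \<gamma> i \<and> \<alpha> i \<noteq> \<beta> i}"

text \<open>The product of \<open>a f\<^sub>\<alpha>\<^sub>\<beta>\<close> and \<open>b f\<^sub>\<beta>\<^sub>\<gamma>\<close>, for classes \<open>A\<close> of \<open>a\<close> and \<open>B\<close> of \<open>b\<close>.
  The union is over all representatives, as in \<^const>\<open>rcoset_mult\<close>; it consists of one coset.\<close>

definition Rtilde_mult ::
  "nat \<Rightarrow> real vec set \<Rightarrow> (nat \<Rightarrow> int) \<Rightarrow> (nat \<Rightarrow> int) \<Rightarrow> (nat \<Rightarrow> int)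
     \<Rightarrow> mpoly set \<Rightarrow> mpoly set \<Rightarrow> mpoly set" where
  "Rtilde_mult n eta \<alpha> \<beta> \<gamma> A B =
     (\<Union>a\<in>A. \<Union>b\<in>B. Rideal n eta \<alpha> \<gamma> +>\<^bsub>Zu n\<^esub> (umon (sep n \<alpha> \<beta> \<gamma>) * a * b))"

text \<open>As \<open>PP\<close> is finite, elements of the direct sum are families indexed by \<open>PP \<times> PP\<close>.\<close>

type_synonym btilde = "(nat \<Rightarrow> int) \<times> (nat \<Rightarrow> int) \<Rightarrow> mpoly set"

definition Btilde ::
  "nat \<Rightarrow> real vec set \<Rightarrow> real vec set \<Rightarrow> real vec set \<Rightarrow> btilde ring" where
  "Btilde n V eta xi = (let P = PP n V eta xi in
     \<lparr>carrier = (\<Pi>\<^sub>E (\<alpha>, \<beta>)\<in>P \<times> P. carrier (Rtilde n eta \<alpha> \<beta>)),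
      monoid.mult = (\<lambda>x y. \<lambda>(\<alpha>, \<gamma>)\<in>P \<times> P.
         \<Oplus>\<^bsub>Rtilde n eta \<alpha> \<gamma>\<^esub>\<beta>\<in>P. Rtilde_mult n eta \<alpha> \<beta> \<gamma> (x (\<alpha>, \<beta>)) (y (\<beta>, \<gamma>))),
      one = (\<lambda>(\<alpha>, \<beta>)\<in>P \<times> P.
         if \<alpha> = \<beta> then \<one>\<^bsub>Rtilde n eta \<alpha> \<beta>\<^esub> else \<zero>\<^bsub>Rtilde n eta \<alpha> \<beta>\<^esub>),
      zero = (\<lambda>(\<alpha>, \<beta>)\<in>P \<times> P. \<zero>\<^bsub>Rtilde n eta \<alpha> \<beta>\<^esub>),
      add = (\<lambda>x y. \<lambda>(\<alpha>, \<beta>)\<in>P \<times> P. x (\<alpha>, \<beta>) \<oplus>\<^bsub>Rtilde n eta \<alpha> \<beta>\<^esub> y (\<alpha>, \<beta>))\<rparr>)"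

text \<open>\<open>Bterm n V eta xi p \<alpha> \<beta>\<close> is \<open>p f\<^sub>\<alpha>\<^sub>\<beta>\<close>, and \<open>Bscalar n V eta xi p\<close> is \<open>p\<close> times the unit.\<close>

definition Bterm ::
  "nat \<Rightarrow> real vec set \<Rightarrow> real vec set \<Rightarrow> real vec set \<Rightarrow> mpoly
     \<Rightarrow> (nat \<Rightarrow> int) \<Rightarrow> (nat \<Rightarrow> int) \<Rightarrow> btilde" where
  "Bterm n V eta xi p \<alpha> \<beta> = (\<lambda>(\<gamma>, \<delta>)\<in>PP n V eta xi \<times> PP n V eta xi.
     if \<gamma> = \<alpha> \<and> \<delta> = \<beta> then Rideal n eta \<gamma> \<delta> +>\<^bsub>Zu n\<^esub> p else \<zero>\<^bsub>Rtilde n eta \<gamma> \<delta>\<^esub>)"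

definition Bscalar ::
  "nat \<Rightarrow> real vec set \<Rightarrow> real vec set \<Rightarrow> real vec set \<Rightarrow> mpoly \<Rightarrow> btilde" where
  "Bscalar n V eta xi p = (\<lambda>(\<gamma>, \<delta>)\<in>PP n V eta xi \<times> PP n V eta xi.
     if \<gamma> = \<delta> then Rideal n eta \<gamma> \<delta> +>\<^bsub>Zu n\<^esub> p else \<zero>\<^bsub>Rtilde n eta \<gamma> \<delta>\<^esub>)"

abbreviation fgen ::
  "nat \<Rightarrow> real vec set \<Rightarrow> real vec set \<Rightarrow> real vec set
     \<Rightarrow> (nat \<Rightarrow> int) \<Rightarrow> (nat \<Rightarrow> int) \<Rightarrow> btilde" where
  "fgen n V eta xi \<equiv> Bterm n V eta xi 1"

text \<open>Multi-degrees lie in the free abelian group on the symbols \<open>e\<^sub>i\<close>,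
  with \<open>e\<^sub>i = single i 1\<close>.\<close>

type_synonym multideg = "nat \<Rightarrow>\<^sub>0 int"

definition monomial_deg :: "(nat \<Rightarrow>\<^sub>0 nat) \<Rightarrow> multideg" where
  "monomial_deg m =
     (\<Sum>i\<in>Poly_Mapping.keys m. Poly_Mapping.single i (2 * int (Poly_Mapping.lookup m i)))"

definition fgen_deg :: "nat \<Rightarrow> (nat \<Rightarrow> int) \<Rightarrow> (nat \<Rightarrow> int) \<Rightarrow> multideg" where
  "fgen_deg n \<alpha> \<beta> = (\<Sum>i\<in>{i\<in>{1..n}. \<alpha> i \<noteq> \<beta> i}. Poly_Mapping.single i 1)"

definition Btilde_component ::
  "nat \<Rightarrow> real vec set \<Rightarrow> real vec set \<Rightarrow> real vec set \<Rightarrow> multideg \<Rightarrow> btilde set" where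
  "Btilde_component n V eta xi d = {x \<in> carrier (Btilde n V eta xi).
     \<forall>\<alpha>\<in>PP n V eta xi. \<forall>\<beta>\<in>PP n V eta xi. \<exists>p\<in>carrier (Zu n).
       x (\<alpha>, \<beta>) = Rideal n eta \<alpha> \<beta> +>\<^bsub>Zu n\<^esub> p \<and>
       (\<forall>m\<in>Poly_Mapping.keys p. monomial_deg m + fgen_deg n \<alpha> \<beta> = d)}"

definition psi_V ::
  "nat \<Rightarrow> real vec set \<Rightarrow> real vec set \<Rightarrow> real vec set \<Rightarrow> btilde \<Rightarrow> btilde" where
  "psi_V n V eta xi x = (\<lambda>(\<alpha>, \<beta>)\<in>PP n V eta xi \<times> PP n V eta xi. x (\<beta>, \<alpha>))"

section \<open>Path algebras over the integers\<close>

type_synonym ('v, 'e) path = "'v \<times> 'e list \<times> 'v"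

definition paths :: "('v, 'e) pre_digraph \<Rightarrow> ('v, 'e) path set" where
  "paths G = {(u, p, v). pre_digraph.awalk G u p v}"

definition path_mult :: "('v, 'e) path \<Rightarrow> ('v, 'e) path \<Rightarrow> ('v, 'e) path \<Rightarrow>\<^sub>0 int" where
  "path_mult = (\<lambda>(u, p, v) (v', q, w). if v = v' then frag_of (u, p @ q, w) else 0)"

text \<open>The quiver is assumed to have finitely many vertices.\<close>

definition path_algebra :: "('v, 'e) pre_digraph \<Rightarrow> (('v, 'e) path \<Rightarrow>\<^sub>0 int) ring" where
  "path_algebra G =
     \<lparr>carrier = {a. Poly_Mapping.keys a \<subseteq> paths G},
      monoid.mult = (\<lambda>a b. frag_extend (\<lambda>p. frag_extend (path_mult p) b) a),
      one = (\<Sum>v\<in>verts G. frag_of (v, [], v)),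
      zero = 0, add = (+)\<rparr>"

section \<open>The Ozsvath--Szabo algebra\<close>

datatype label = Rarr nat | Larr nat | Uarr nat

fun move :: "label \<Rightarrow> nat set \<Rightarrow> nat set" where
  "move (Rarr i) x = insert i (x - {i - 1})"
| "move (Larr i) x = insert (i - 1) (x - {i})"
| "move (Uarr i) x = x"

type_synonym arrow = "nat set \<times> label"
type_synonym osz_free = "(nat set, arrow) path \<Rightarrow>\<^sub>0 int"

definition Vset :: "nat \<Rightarrow> nat \<Rightarrow> nat set set" where
  "Vset n k = {x. x \<subseteq> {0..n} \<and> card x = k}"

text \<open>\<open>Vl n k\<close> consists of subsets of \<open>{0,\<dots>,n-1}\<close>, which is empty for \<open>n = 0\<close>.\<close>

definition Vl :: "nat \<Rightarrow> nat \<Rightarrow> nat set set" where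
  "Vl n k = {x. x \<subseteq> {0..<n} \<and> card x = k}"

definition osz_quiver :: "nat \<Rightarrow> nat \<Rightarrow> (nat set, arrow) pre_digraph" where
  "osz_quiver n k =
     \<lparr>verts = Vset n k,
      arcs = {(x, Rarr i) | x i. x \<in> Vset n k \<and> i \<in> {1..n} \<and> x \<inter> {i - 1, i} = {i - 1}}
           \<union> {(x, Larr i) | x i. x \<in> Vset n k \<and> i \<in> {1..n} \<and> x \<inter> {i - 1, i} = {i}}
           \<union> {(x, Uarr i) | x i. x \<in> Vset n k \<and> i \<in> {1..n}},
      tail = fst,
      head = (\<lambda>(x, l). move l x)\<rparr>"

fun arrows_from :: "nat set \<Rightarrow> label list \<Rightarrow> arrow list" where
  "arrows_from x [] = []"
| "arrows_from x (l # ls) = (x, l) # arrows_from (move l x) ls"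

text \<open>The path starting at \<open>x\<close> with the given labels, provided that it exists, i.e. lies in
  \<open>paths (osz_quiver n k)\<close>.\<close>

definition osz_path :: "nat set \<Rightarrow> label list \<Rightarrow> (nat set, arrow) path" where
  "osz_path x ls = (x, arrows_from x ls, fold move ls x)"

inductive osz_eq :: "label list \<Rightarrow> label list \<Rightarrow> bool" where
  "osz_eq [Rarr i, Uarr j] [Uarr j, Rarr i]"
| "osz_eq [Larr i, Uarr j] [Uarr j, Larr i]"
| "osz_eq [Uarr i, Uarr j] [Uarr j, Uarr i]"
| "osz_eq [Rarr i, Larr i] [Uarr i]"
| "osz_eq [Larr i, Rarr i] [Uarr i]"
| "\<bar>int i - int j\<bar> > 1 \<Longrightarrow> osz_eq [Rarr i, Rarr j] [Rarr j, Rarr i]"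
| "\<bar>int i - int j\<bar> > 1 \<Longrightarrow> osz_eq [Larr i, Larr j] [Larr j, Larr i]"
| "\<bar>int i - int j\<bar> > 1 \<Longrightarrow> osz_eq [Larr i, Rarr j] [Rarr j, Larr i]"

inductive osz_zero :: "nat set \<Rightarrow> label list \<Rightarrow> bool" where
  "osz_zero x [Rarr i, Rarr (Suc i)]"
| "osz_zero x [Larr (Suc i), Larr i]"
| "x \<inter> {i - 1, i} = {} \<Longrightarrow> osz_zero x [Uarr i]"

definition osz_relations :: "nat \<Rightarrow> nat \<Rightarrow> osz_free set" where
  "osz_relations n k =
     {frag_of (osz_path x v) - frag_of (osz_path x w) | x v w. osz_eq v w \<and>
        osz_path x v \<in> paths (osz_quiver n k) \<and> osz_path x w \<in> paths (osz_quiver n k)}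
   \<union> {frag_of (osz_path x w) | x w. osz_zero x w \<and> osz_path x w \<in> paths (osz_quiver n k)}"

definition osz_ideal :: "nat \<Rightarrow> nat \<Rightarrow> osz_free set" where
  "osz_ideal n k = Idl\<^bsub>path_algebra (osz_quiver n k)\<^esub> (osz_relations n k)"

definition osz :: "nat \<Rightarrow> nat \<Rightarrow> osz_free set ring" where
  "osz n k = path_algebra (osz_quiver n k) Quot osz_ideal n k"

definition osz_class :: "nat \<Rightarrow> nat \<Rightarrow> osz_free \<Rightarrow> osz_free set" where
  "osz_class n k a = osz_ideal n k +>\<^bsub>path_algebra (osz_quiver n k)\<^esub> a"

abbreviation osz_word :: "nat \<Rightarrow> nat \<Rightarrow> nat set \<Rightarrow> label list \<Rightarrow> osz_free set" where
  "osz_word n k x ls \<equiv> osz_class n k (frag_of (osz_path x ls))"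

abbreviation osz_idem :: "nat \<Rightarrow> nat \<Rightarrow> nat set \<Rightarrow> osz_free set" where
  "osz_idem n k x \<equiv> osz_word n k x []"

definition osz_l :: "nat \<Rightarrow> nat \<Rightarrow> osz_free set ring" where
  "osz_l n k = (osz n k)
     \<lparr>carrier := {finsum (osz n k)
          (\<lambda>(x, x'). osz_idem n k x \<otimes>\<^bsub>osz n k\<^esub> b x x' \<otimes>\<^bsub>osz n k\<^esub> osz_idem n k x')
          (Vl n k \<times> Vl n k)
        | b. \<forall>x x'. b x x' \<in> carrier (osz n k)},
      one := \<Oplus>\<^bsub>osz n k\<^esub>x\<in>Vl n k. osz_idem n k x\<rparr>"

fun label_deg :: "label \<Rightarrow> multideg" where
  "label_deg (Rarr i) = Poly_Mapping.single i 1"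
| "label_deg (Larr i) = Poly_Mapping.single i 1"
| "label_deg (Uarr i) = Poly_Mapping.single i 2"

definition path_deg :: "(nat set, arrow) path \<Rightarrow> multideg" where
  "path_deg = (\<lambda>(x, p, y). \<Sum>a\<leftarrow>p. label_deg (snd a))"

definition osz_component :: "nat \<Rightarrow> nat \<Rightarrow> multideg \<Rightarrow> osz_free set set" where
  "osz_component n k d = {osz_class n k a | a. a \<in> carrier (path_algebra (osz_quiver n k)) \<and>
     (\<forall>p\<in>Poly_Mapping.keys a. path_deg p = d)}"

definition osz_l_component :: "nat \<Rightarrow> nat \<Rightarrow> multideg \<Rightarrow> osz_free set set" where
  "osz_l_component n k d = carrier (osz_l n k) \<inter> osz_component n k d"

fun flip_label :: "label \<Rightarrow> label" where
  "flip_label (Rarr i) = Larr i"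
| "flip_label (Larr i) = Rarr i"
| "flip_label (Uarr i) = Uarr i"

definition flip_arrow :: "arrow \<Rightarrow> arrow" where
  "flip_arrow = (\<lambda>(x, l). (move l x, flip_label l))"

definition reverse_path :: "(nat set, arrow) path \<Rightarrow> (nat set, arrow) path" where
  "reverse_path = (\<lambda>(x, p, y). (y, rev (map flip_arrow p), x))"

text \<open>Path reversal preserves \<open>osz_ideal n k\<close>, hence maps cosets to cosets.\<close>

definition psi_OSz :: "osz_free set \<Rightarrow> osz_free set" where
  "psi_OSz X = frag_extend (\<lambda>p. frag_of (reverse_path p)) ` X"

section \<open>The maps\<close>

definition x_of :: "nat \<Rightarrow> (nat \<Rightarrow> int) \<Rightarrow> nat set" where
  "x_of n \<alpha> = {i\<in>{0..<n}. \<alpha> i \<noteq> \<alpha> (i + 1)}"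

definition alpha_of ::
  "nat \<Rightarrow> real vec set \<Rightarrow> real vec set \<Rightarrow> real vec set \<Rightarrow> nat set \<Rightarrow> (nat \<Rightarrow> int)" where
  "alpha_of n V eta xi = the_inv_into (PP n V eta xi) (x_of n)"

text \<open>\<open>is_Phi\<close> and \<open>is_Psi\<close> say that a map is a homomorphism of (unital, associative) rings
  with the prescribed values on generators. On the side of \<open>Btilde\<close>, the idempotent
  \<open>e\<^sub>\<alpha>\<close> is \<open>f\<^sub>\<alpha>\<^sub>\<alpha>\<close> and the arrow \<open>p(\<alpha>,\<beta>)\<close> is \<open>f\<^sub>\<alpha>\<^sub>\<beta>\<close>.\<close>

definition is_Phi ::
  "nat \<Rightarrow> nat \<Rightarrow> real vec set \<Rightarrow> real vec set \<Rightarrow> real vec set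
     \<Rightarrow> (osz_free set \<Rightarrow> btilde) \<Rightarrow> bool" where
  "is_Phi n k V eta xi \<Phi> \<longleftrightarrow> (let \<alpha> = alpha_of n V eta xi in
     ring_hom_ring (osz_l n k) (Btilde n V eta xi) \<Phi> \<and>
     (\<forall>x\<in>Vl n k. \<Phi> (osz_idem n k x) = fgen n V eta xi (\<alpha> x) (\<alpha> x)) \<and>
     (\<forall>x\<in>Vl n k. \<forall>y\<in>Vl n k. \<forall>i. \<forall>l\<in>{Rarr i, Larr i}.
        (x, l) \<in> arcs (osz_quiver n k) \<and> head (osz_quiver n k) (x, l) = y \<longrightarrow>
          \<Phi> (osz_word n k x [l]) = fgen n V eta xi (\<alpha> x) (\<alpha> y)) \<and>
     (\<forall>x\<in>Vl n k. \<forall>i\<in>{1..n}.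
        \<Phi> (osz_word n k x [Uarr i]) = Bterm n V eta xi (uvar i) (\<alpha> x) (\<alpha> x)))"

definition is_Psi ::
  "nat \<Rightarrow> nat \<Rightarrow> real vec set \<Rightarrow> real vec set \<Rightarrow> real vec set
     \<Rightarrow> (btilde \<Rightarrow> osz_free set) \<Rightarrow> bool" where
  "is_Psi n k V eta xi \<Psi> \<longleftrightarrow> (let P = PP n V eta xi in
     ring_hom_ring (Btilde n V eta xi) (osz_l n k) \<Psi> \<and>
     (\<forall>\<alpha>\<in>P. \<Psi> (fgen n V eta xi \<alpha> \<alpha>) = osz_idem n k (x_of n \<alpha>)) \<and>
     (\<forall>\<alpha>\<in>P. \<forall>\<beta>\<in>P. \<forall>i\<in>{1..n}. \<beta> = \<alpha>(i := - \<alpha> i) \<longrightarrow>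
        (x_of n \<beta> = (x_of n \<alpha> - {i - 1}) \<union> {i} \<longrightarrow>
           \<Psi> (fgen n V eta xi \<alpha> \<beta>) = osz_word n k (x_of n \<alpha>) [Rarr i]) \<and>
        (x_of n \<beta> = (x_of n \<alpha> - {i}) \<union> {i - 1} \<longrightarrow>
           \<Psi> (fgen n V eta xi \<alpha> \<beta>) = osz_word n k (x_of n \<alpha>) [Larr i])) \<and>
     (\<forall>i\<in>{1..n}. \<Psi> (Bscalar n V eta xi (uvar i)) =
        (\<Oplus>\<^bsub>osz n k\<^esub>x\<in>Vl n k. osz_word n k x [Uarr i])))"

definition graded_ring_iso ::
  "'a ring \<Rightarrow> (multideg \<Rightarrow> 'a set) \<Rightarrow> 'b ring \<Rightarrow> (multideg \<Rightarrow> 'b set) \<Rightarrow> ('a \<Rightarrow> 'b) \<Rightarrow> bool"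
  where
  "graded_ring_iso A cA B cB h \<longleftrightarrow> h \<in> ring_iso A B \<and> (\<forall>d. h ` cA d = cB d)"

end

theory Submission
  imports Defs "Jordan_Normal_Form.DL_Rank"
begin

text \<open>A subset of \<open>{0,\<dots>,n}\<close> is treated as the set of sign changes of a sign vector, so that an arrow
  \<open>R\<^sub>i\<close> or \<open>L\<^sub>i\<close> changes the sign in position \<open>i\<close>. A path from \<open>x\<close> to \<open>y\<close> then has the multi-degree
  \<open>2 m + \<Sum>\<^sub>i\<^sub>\<in>\<^sub>D e\<^sub>i\<close> where \<open>D\<close> is the set of positions in which the signs of \<open>x\<close> and \<open>y\<close> differ, and it is
  mapped to the monomial \<open>u\<^sup>m\<close>. The relations turn the path into the letters \<open>U\<^sub>i\<close> prescribed by \<open>m\<close>, followed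
  by a shortest path from \<open>x\<close> to \<open>y\<close>, and they make it zero if some change of the signs in
  \<open>D \<union> supp m\<close> produces more than \<open>k\<close> sign changes. The other monomials are independent, because
  the combinations of paths whose polynomials involve none of them form an ideal that contains the
  relations.

  On the other side, the positivity of the minors shows that \<open>\<alpha>\<close> is feasible for a left cyclic
  arrangement iff it has at most \<open>k\<close> sign changes, and bounded iff it has at least \<open>k\<close>. By convexity,
  \<open>\<Delta>\<^sub>\<alpha> \<inter> \<Delta>\<^sub>\<beta> \<inter> H\<^sub>S\<close> is empty iff changing signs of \<open>\<alpha>\<close> in \<open>S\<close> and where \<open>\<alpha>\<close> and \<open>\<beta>\<close> differ can
  produce an infeasible sign vector. So both algebras are assembled from the quotients of
  \<open>\<int>[u\<^sub>1,\<dots>,u\<^sub>n]\<close> by the same monomial ideals.\<close>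

section \<open>Sets of sign changes\<close>

text \<open>The algebra \<open>osz\<close> has all k-subsets of {0..n} as vertices and
  \<open>osz_l\<close> is a corner of it, so a path between left vertices may pass through sets that
  contain n. The normal form is therefore established at all vertices; afterwards it shows that left
  paths can be rewritten without leaving the left vertices. Parity reconciles the two settings: the
  sign at n + 1 is the same for all vertices, so a vertex is determined by its signs in {1..n},
  although n itself may be a change. The delicate point of the normal form is a step from a crowded
  vertex to one from which a shortest path exists. Such a word has to vanish, but a zero relation
  appears only after several commutations (\<open>step_geodesic_zero\<close> and the two lemmas on
  blocked arrows before it). The isomorphism is defined by the polynomials of paths and not by
  values on generators, which would require checking relations of the target. Its multiplicativity
  is a rounding identity, and the ring axioms of \<open>Btilde\<close> are transported along
  it.\<close>

text \<open>Let \<open>x\<close> be the set of sign changes of a sign vector that is \<open>+\<close> at 0. Then \<open>pos_at x i\<close> says that the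
  sign at \<open>i\<close> is \<open>+\<close>, \<open>toggle T x\<close> describes the sign vector with the signs in \<open>T\<close> changed, and
  \<open>crowded k E x\<close> says that changing signs in \<open>E\<close> can produce more than \<open>k\<close> sign changes.\<close>

definition pos_at :: "nat set \<Rightarrow> nat \<Rightarrow> bool" where
  "pos_at x i \<longleftrightarrow> even (card (x \<inter> {..<i}))"

definition dset :: "nat \<Rightarrow> nat set \<Rightarrow> nat set \<Rightarrow> nat set" where
  "dset n x y = {i\<in>{1..n}. pos_at x i \<noteq> pos_at y i}"

definition toggle :: "nat set \<Rightarrow> nat set \<Rightarrow> nat set" where
  "toggle T x = {j. (j \<in> x) \<noteq> ((j \<in> T) \<noteq> (Suc j \<in> T))}"

definition crowded :: "nat \<Rightarrow> nat set \<Rightarrow> nat set \<Rightarrow> bool" where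
  "crowded k E x \<longleftrightarrow> (\<exists>T\<subseteq>E. k < card (toggle T x))"

text \<open>Exactly one of i - 1 and i is a change. Changing the sign at i then moves this change
  across i, as \<open>R_i\<close> and \<open>L_i\<close> do, instead of creating or deleting two
  changes.\<close>

definition movable :: "nat set \<Rightarrow> nat \<Rightarrow> bool" where
  "movable x i \<longleftrightarrow> 1 \<le> i \<and> (i - 1 \<in> x) \<noteq> (i \<in> x)"

lemma pos_at_0 [simp]: "pos_at x 0"
  by (simp add: pos_at_def)

lemma pos_at_Suc: "pos_at x (Suc i) \<longleftrightarrow> (pos_at x i \<longleftrightarrow> i \<notin> x)"
proof -
  have "x \<inter> {..<Suc i} = (if i \<in> x then insert i (x \<inter> {..<i}) else x \<inter> {..<i})"
    by (auto simp: less_Suc_eq)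
  then show ?thesis
    by (auto simp: pos_at_def)
qed

text \<open>The fictitious position n + 1 lies beyond all changes, so its sign records the parity of
  the cardinality. All vertices of \<open>Vset n k\<close> share it.\<close>

lemma pos_at_atMost: "x \<subseteq> {0..n} \<Longrightarrow> pos_at x (Suc n) \<longleftrightarrow> even (card x)"
  unfolding pos_at_def by (simp add: Int_absorb2 lessThan_Suc_atMost atMost_atLeast0)

lemma mem_iff_pos_at: "i \<in> x \<longleftrightarrow> pos_at x i \<noteq> pos_at x (Suc i)"
  by (auto simp: pos_at_Suc)

lemma toggle_empty [simp]: "toggle {} x = x"
  by (simp add: toggle_def)

lemma toggle_toggle: "toggle S (toggle T x) = toggle {i. (i \<in> S) \<noteq> (i \<in> T)} x"
  by (auto simp: toggle_def)

lemma toggle_toggle_same [simp]: "toggle T (toggle T x) = x"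
  by (simp add: toggle_toggle)

lemma toggle_subset: "x \<subseteq> {0..n} \<Longrightarrow> T \<subseteq> {1..n} \<Longrightarrow> toggle T x \<subseteq> {0..n}"
  by (force simp: toggle_def)

lemma pos_at_toggle: "0 \<notin> T \<Longrightarrow> pos_at (toggle T x) i \<longleftrightarrow> (pos_at x i \<longleftrightarrow> i \<notin> T)"
proof (induction i)
  case (Suc i)
  then show ?case by (simp add: pos_at_Suc) (auto simp: toggle_def)
qed simp

text \<open>The parity is the sign at n + 1, which is not among the signs changed.\<close>

lemma even_card_toggle:
  assumes "x \<subseteq> {0..n}" "T \<subseteq> {1..n}"
  shows "even (card (toggle T x)) = even (card x)"
proof -
  have "0 \<notin> T" "Suc n \<notin> T" using assms(2) by auto
  then show ?thesis
    using pos_at_atMost[OF assms(1)] pos_at_atMost[OF toggle_subset[OF assms]] pos_at_toggle[of T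
      x "Suc n"] by blast
qed

lemma dset_subset: "dset n x y \<subseteq> {1..n}"
  by (auto simp: dset_def)

lemma finite_dset [simp]: "finite (dset n x y)"
  by (simp add: dset_def)

lemma dset_same [simp]: "dset n x x = {}"
  by (simp add: dset_def)

lemma dset_commute: "dset n x y = dset n y x"
  by (auto simp: dset_def)

lemma dset_toggle:
  assumes "T \<subseteq> {1..n}"
  shows "dset n (toggle T x) y = {i. (i \<in> dset n x y) \<noteq> (i \<in> T)}"
proof -
  have "0 \<notin> T" using assms by auto
  then show ?thesis using assms by (auto simp: dset_def pos_at_toggle)
qed

lemma VsetD: "x \<in> Vset n k \<Longrightarrow> x \<subseteq> {0..n}" "x \<in> Vset n k \<Longrightarrow> card x = k"
  "x \<in> Vset n k \<Longrightarrow> finite x"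
  using finite_subset by (auto simp: Vset_def)

text \<open>The signs in 0..n agree by the definition of \<open>dset\<close>. Whether n is a change
  depends also on the sign at n + 1, and there the common cardinality k is used.\<close>

lemma toggle_dset:
  assumes "x \<in> Vset n k" "y \<in> Vset n k"
  shows "toggle (dset n x y) x = y"
proof -
  let ?D = "dset n x y"
  have *: "pos_at (toggle ?D x) i = pos_at y i" if "i \<le> Suc n" for i
  proof -
    have "i = 0 \<or> i \<in> {1..n} \<or> i = Suc n" using that by auto
    then consider "i = 0" | "i \<in> {1..n}" | "i = Suc n" by blast
    then show ?thesis
    proof cases
      case 3
      then show ?thesis
        using pos_at_atMost[of x n] pos_at_atMost[of y n] pos_at_toggle[of ?D x i] assms
        by (auto simp: Vset_def dset_def)
    next
      case 2
      then show ?thesis by (subst pos_at_toggle) (auto simp: dset_def)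
    qed simp
  qed
  have sub: "toggle ?D x \<subseteq> {0..n}" "y \<subseteq> {0..n}"
    using toggle_subset[OF VsetD(1)[OF assms(1)] dset_subset] VsetD(1)[OF assms(2)] by blast+
  show ?thesis
  proof (rule Set.set_eqI)
    fix j
    show "j \<in> toggle ?D x \<longleftrightarrow> j \<in> y"
    proof (cases "j \<le> n")
      case True
      then show ?thesis by (simp add: mem_iff_pos_at[of j] *)
    next
      case False
      then show ?thesis using sub by auto
    qed
  qed
qed

lemma crowded_mono: "crowded k E x \<Longrightarrow> E \<subseteq> E' \<Longrightarrow> crowded k E' x"
  unfolding crowded_def by blast

text \<open>Symmetric difference with \<open>T\<close> permutes the subsets of \<open>E\<close>. So
  crowding with respect to \<open>E\<close> may be tested at any vertex obtained by changing signs
  in \<open>E\<close>; this is what carries it along a path.\<close>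

lemma crowded_toggle:
  assumes "T \<subseteq> E"
  shows "crowded k E (toggle T x) \<longleftrightarrow> crowded k E x"
proof -
  have *: "crowded k E (toggle T x)" if c: "crowded k E x" for x
  proof -
    obtain S where S: "S \<subseteq> E" "k < card (toggle S x)" using c by (auto simp: crowded_def)
    have "toggle {i. (i \<in> S) \<noteq> (i \<in> T)} (toggle T x) = toggle S x"
      unfolding toggle_toggle by (rule arg_cong[where f="\<lambda>S. toggle S x"]) auto
    with S assms show ?thesis
      unfolding crowded_def by (intro exI[of _ "{i. (i \<in> S) \<noteq> (i \<in> T)}"]) auto
  qed
  show ?thesis using *[of x] *[of "toggle T x"] by auto
qed

lemma toggle_single_movable:
  assumes "movable x i"
  shows "toggle {i} x = (if i \<in> x then insert (i - 1) (x - {i}) else insert i (x - {i - 1}))"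
  using assms by (cases i) (auto simp: movable_def toggle_def)

lemma movable_toggle [simp]: "movable (toggle {i} x) i \<longleftrightarrow> movable x i"
  by (cases i) (auto simp: movable_def toggle_def)

lemma toggle_single_Vset:
  assumes "x \<in> Vset n k" "movable x i" "i \<le> n"
  shows "toggle {i} x \<in> Vset n k"
proof -
  have "finite x" "card x = k" using VsetD[OF assms(1)] by auto
  then have "card (toggle {i} x) = k"
    using assms(2) card_Suc_Diff1[of x i] card_Suc_Diff1[of x "i-1"]
    by (auto simp: toggle_single_movable movable_def card_insert_if)
  moreover have "toggle {i} x \<subseteq> {0..n}"
    using toggle_subset[OF VsetD(1)[OF assms(1)], of "{i}"] assms by (auto simp: movable_def)
  ultimately show ?thesis by (auto simp: Vset_def)
qed

lemma movable_far:
  assumes "movable x i" "\<bar>int i - int j\<bar> > 1"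
  shows "movable (toggle {j} x) i"
  using assms by (cases i; cases j) (auto simp: movable_def toggle_def)

lemma toggle_commute: "toggle {i} (toggle {j} x) = toggle {j} (toggle {i} x)"
  unfolding toggle_toggle by (rule arg_cong[where f="\<lambda>S. toggle S x"]) auto

section \<open>Intervals of signs whose change produces too many sign changes\<close>

lemma crowded_single:
  assumes "finite x" "1 \<le> i" "i - 1 \<notin> x" "i \<notin> x" "i \<in> E"
  shows "crowded (card x) E x"
proof -
  have "toggle {i} x = insert (i - 1) (insert i x)"
    using assms by (cases i) (auto simp: toggle_def)
  then have "card x < card (toggle {i} x)" using assms by simp
  then show ?thesis using assms(5) unfolding crowded_def by blast
qed

text \<open>Changing all signs of an interval affects only the two ends a - 1 and b, and there a
  change appears; inside, the effects cancel.\<close>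

lemma crowded_interval:
  assumes "finite x" "1 \<le> a" "a \<le> b" "{a..b} \<subseteq> E" "a - 1 \<notin> x" "b \<notin> x"
  shows "crowded (card x) E x"
proof -
  have "toggle {a..b} x = insert (a - 1) (insert b x)"
  proof (rule Set.set_eqI)
    fix j
    show "j \<in> toggle {a..b} x \<longleftrightarrow> j \<in> insert (a - 1) (insert b x)"
      using assms by (cases "j = a - 1"; cases "j = b") (auto simp: toggle_def)
  qed
  then have "card x < card (toggle {a..b} x)" using assms by (cases a) simp_all
  then show ?thesis using assms(4) unfolding crowded_def by blast
qed

text \<open>Converse of \<open>crowded_interval\<close>. The last run of consecutive elements of
  \<open>T\<close> affects only its ends a - 1 and b. If one of these is in \<open>x\<close>, the
  run does not raise the number of changes, so the excess persists when it is dropped from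
  \<open>T\<close>.\<close>

lemma interval_if_card_toggle:
  assumes "finite x" "finite T" "0 \<notin> T" "card x < card (toggle T x)"
  shows "\<exists>a b. 1 \<le> a \<and> a \<le> b \<and> {a..b} \<subseteq> T \<and> a - 1 \<notin> x \<and> b \<notin> x"
  using assms(2-)
proof (induction "card T" arbitrary: T rule: less_induct)
  case less
  then have ne: "T \<noteq> {}" by auto
  define b where "b = Max T"
  have b: "b \<in> T" "\<And>i. i \<in> T \<Longrightarrow> i \<le> b" using ne less.prems by (auto simp: b_def)
  \<comment> \<open>\<open>{a..b}\<close> is the last maximal run of consecutive elements of
    \<open>T\<close>.\<close>
  define a where "a = (LEAST a. {a..b} \<subseteq> T)"
  have ab: "{a..b} \<subseteq> T" unfolding a_def by (rule LeastI[of _ b]) (use b in auto)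
  have "a \<le> b" unfolding a_def by (rule Least_le) (use b in auto)
  have a1: "1 \<le> a" using ab \<open>a \<le> b\<close> less.prems(2) by (cases a) auto
  have a2: "a - 1 \<notin> T"
  proof
    assume "a - 1 \<in> T"
    moreover have "{a-1..b} \<subseteq> insert (a - 1) {a..b}" by auto
    ultimately have "{a-1..b} \<subseteq> T" using ab by blast
    then have "a \<le> a - 1" unfolding a_def by (rule Least_le)
    then show False using a1 by auto
  qed
  define T' where "T' = T - {a..b}"
  have T'b: "i < a - 1" if "i \<in> T'" for i
  proof -
    have "i \<in> T" "\<not> (a \<le> i \<and> i \<le> b)" "i \<noteq> a - 1" using that a2 by (auto simp: T'_def)
    then show ?thesis using b(2)[of i] by linarith
  qed
  show ?case
  proof (cases "a - 1 \<in> x \<or> b \<in> x")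
    case False
    with ab \<open>a \<le> b\<close> a1 show ?thesis by blast
  next
    case True
    \<comment> \<open>The other elements of \<open>T\<close> are smaller than a - 1, so the run acts
      independently of them.\<close>
    have eq: "toggle T x = {j. (j \<in> toggle T' x) \<noteq> (j = a - 1 \<or> j = b)}"
    proof (rule Set.set_eqI)
      fix j
      have T: "i \<in> T \<longleftrightarrow> i \<in> T' \<or> (a \<le> i \<and> i \<le> b)" for i using ab by (auto simp: T'_def)
      have "((j \<in> T) \<noteq> (Suc j \<in> T)) = (((j \<in> T') \<noteq> (Suc j \<in> T')) \<noteq> (j = a - 1 \<or> j = b))"
        using T'b[of j] T'b[of "Suc j"] a1 \<open>a \<le> b\<close> unfolding T by linarith
      then show "j \<in> toggle T x \<longleftrightarrow> j \<in> {j. (j \<in> toggle T' x) \<noteq> (j = a - 1 \<or> j = b)}"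
        unfolding toggle_def by blast
    qed
    have mem: "(a - 1 \<in> toggle T' x) = (a - 1 \<in> x)" "(b \<in> toggle T' x) = (b \<in> x)"
    proof -
      have "b \<notin> T'" "Suc b \<notin> T'" "a - 1 \<notin> T'" "Suc (a - 1) \<notin> T'"
        using T'b[of b] T'b[of "Suc b"] T'b[of "Suc (a - 1)"] T'b[of "a - 1"] a1 \<open>a \<le> b\<close>
        by linarith+
      then show "(a - 1 \<in> toggle T' x) = (a - 1 \<in> x)" "(b \<in> toggle T' x) = (b \<in> x)"
        by (simp_all add: toggle_def)
    qed
    have fin: "finite (toggle T' x)"
    proof (rule finite_subset)
      show "toggle T' x \<subseteq> x \<union> T' \<union> (\<lambda>j. j - 1) ` T'" by (force simp: toggle_def image_iff)
      show "finite (x \<union> T' \<union> (\<lambda>j. j - 1) ` T')" using assms(1) less.prems(1)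
        by (auto simp: T'_def)
    qed
    have "card (toggle T x) \<le> card (toggle T' x)"
    proof -
      have "\<exists>c d. c \<in> toggle T' x \<and> toggle T x \<subseteq> insert d (toggle T' x - {c})"
      proof (cases "a - 1 \<in> x")
        case True
        then show ?thesis unfolding eq using mem by (intro exI[of _ "a - 1"] exI[of _ b]) auto
      next
        case False
        then show ?thesis unfolding eq using mem \<open>a - 1 \<in> x \<or> b \<in> x\<close>
          by (intro exI[of _ b] exI[of _ "a - 1"]) auto
      qed
      then obtain c d where cd: "c \<in> toggle T' x" "toggle T x \<subseteq> insert d (toggle T' x - {c})"
        by blast
      then have "card (toggle T x) \<le> card (insert d (toggle T' x - {c}))"
        using fin by (intro card_mono) auto
      also have "\<dots> \<le> Suc (card (toggle T' x - {c}))" by (simp add: fin card_insert_if)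
      also have "\<dots> = card (toggle T' x)" using card_Suc_Diff1[OF fin cd(1)] .
      finally show ?thesis .
    qed
    moreover have "card T' < card T"
    proof (rule psubset_card_mono)
      have "b \<in> T" "b \<notin> T'" using \<open>a \<le> b\<close> ab by (auto simp: T'_def)
      then show "T' \<subset> T" by (auto simp: T'_def)
    qed (fact less.prems(1))
    moreover have "finite T'" "0 \<notin> T'" using less.prems by (simp_all add: T'_def)
    ultimately obtain a' b' where "1 \<le> a' \<and> a' \<le> b' \<and> {a'..b'} \<subseteq> T' \<and> a' - 1 \<notin> x \<and> b' \<notin> x"
      using less.hyps[of T'] less.prems(3) by (meson order.strict_trans2)
    then show ?thesis unfolding T'_def by blast
  qed
qed

text \<open>The interval is cut at the first position that is not a change, so that its interior
  consists of changes. These can be moved out one at a time, which is the form needed when words are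
  shown to vanish.\<close>

lemma crowdedE:
  assumes "crowded k E x" "E \<subseteq> {1..n}" "x \<in> Vset n k"
  obtains a b where "1 \<le> a" "a \<le> b" "{a..b} \<subseteq> E" "a - 1 \<notin> x" "b \<notin> x" "{a..<b} \<subseteq> x"
proof -
  obtain T where T: "T \<subseteq> E" "card x < card (toggle T x)"
    using assms(1) VsetD(2)[OF assms(3)] by (auto simp: crowded_def)
  have "finite T" "0 \<notin> T" using T assms(2) finite_subset[of T "{1..n}"] by auto
  then obtain a b' where ab: "1 \<le> a" "a \<le> b'" "{a..b'} \<subseteq> T" "a - 1 \<notin> x" "b' \<notin> x"
    using interval_if_card_toggle[of x T] T VsetD(3)[OF assms(3)] by blast
  define b where "b = (LEAST b. a \<le> b \<and> b \<notin> x)"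
  have b: "a \<le> b \<and> b \<notin> x" unfolding b_def by (rule LeastI[of _ b']) (use ab in auto)
  have "b \<le> b'" unfolding b_def by (rule Least_le) (use ab in auto)
  moreover have "{a..<b} \<subseteq> x"
  proof
    fix i assume "i \<in> {a..<b}"
    then show "i \<in> x" using not_less_Least[of i "\<lambda>b. a \<le> b \<and> b \<notin> x"] by (simp add: b_def)
  qed
  moreover have "{a..b} \<subseteq> {a..b'}" using \<open>b \<le> b'\<close> by auto
  ultimately show thesis using that[of a b] ab(1,3,4) b T(1) by blast
qed

text \<open>If no position of the difference set is movable, each has a change on both sides or on
  neither. Neither makes \<open>x\<close> crowded. If it is always both, toggling only removes
  changes, so \<open>y\<close> is contained in \<open>x\<close> and the equal cardinalities give
  \<open>y = x\<close>.\<close>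

lemma movable_in_dset:
  assumes "x \<in> Vset n k" "y \<in> Vset n k" "x \<noteq> y" "\<not> crowded k (dset n x y) x"
  obtains i where "i \<in> dset n x y" "movable x i"
proof -
  let ?D = "dset n x y"
  note fin = VsetD(3)[OF assms(1)] and card = VsetD(2)[OF assms(1)]
  have "\<exists>i\<in>?D. movable x i"
  proof (rule ccontr)
    assume *: "\<not> (\<exists>i\<in>?D. movable x i)"
    have both: "i - 1 \<in> x \<and> i \<in> x" if "i \<in> ?D" for i
    proof -
      have "1 \<le> i" using that by (auto simp: dset_def)
      then show ?thesis
        using * that assms(4) crowded_single[OF fin, of i ?D] card by (auto simp: movable_def)
    qed
    have "y \<subseteq> x"
    proof
      fix j assume "j \<in> y"
      then have "j \<in> toggle ?D x" using toggle_dset assms by blast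
      then show "j \<in> x" using both[of j] both[of "Suc j"] by (auto simp: toggle_def)
    qed
    then have "y = x" using fin card VsetD(2)[OF assms(2)] by (simp add: card_subset_eq)
    then show False using assms(3) by simp
  qed
  then show thesis using that by blast
qed

text \<open>If c is a change, changing the signs at c and c + 1 is already too much. Otherwise the
  difference set is cut after c: each of the two partial togglings makes c a change, together they
  have 2k + 2 elements, and one of them exceeds k. Hence two competing first steps of a shortest
  path are never adjacent.\<close>

lemma crowded_if_adjacent:
  assumes "x \<in> Vset n k" "y \<in> Vset n k" "c \<in> dset n x y" "Suc c \<in> dset n x y"
    and "movable x c" "movable x (Suc c)"
  shows "crowded k (dset n x y) x"
proof (cases "c \<in> x")
  case True
  have "{c..Suc c} \<subseteq> dset n x y" using assms(3,4) by (auto simp: atLeastAtMostSuc_conv)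
  moreover have "c - 1 \<notin> x" "Suc c \<notin> x" "1 \<le> c" using assms(5,6) True by (auto simp: movable_def)
  ultimately show ?thesis
    using crowded_interval[of x c "Suc c" "dset n x y"] VsetD[OF assms(1)] by auto
next
  case False
  let ?D = "dset n x y"
  have y: "j \<in> y \<longleftrightarrow> j \<in> toggle ?D x" for j using toggle_dset assms by blast
  have "c \<notin> y" using assms False by (simp add: y) (simp add: toggle_def)
  have T1: "toggle (?D \<inter> {..c}) x = (y \<inter> {..<c}) \<union> {c} \<union> (x \<inter> {c<..})"
  proof (rule Set.set_eqI)
    fix j
    show "j \<in> toggle (?D \<inter> {..c}) x \<longleftrightarrow> j \<in> (y \<inter> {..<c}) \<union> {c} \<union> (x \<inter> {c<..})"
      using assms(3,4) False by (cases j c rule: linorder_cases) (auto simp: y toggle_def)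
  qed
  have T2: "toggle (?D \<inter> {c<..}) x = (x \<inter> {..<c}) \<union> {c} \<union> (y \<inter> {c<..})"
  proof (rule Set.set_eqI)
    fix j
    show "j \<in> toggle (?D \<inter> {c<..}) x \<longleftrightarrow> j \<in> (x \<inter> {..<c}) \<union> {c} \<union> (y \<inter> {c<..})"
      using assms(3,4) False by (cases j c rule: linorder_cases) (auto simp: y toggle_def)
  qed
  have f: "finite x" "finite y" "card x = k" "card y = k" using VsetD assms by auto
  have split: "card z = card (z \<inter> {..<c}) + card (z \<inter> {c<..})" if "finite z" "c \<notin> z" for z
  proof -
    have "z = (z \<inter> {..<c}) \<union> (z \<inter> {c<..})" using that by (auto simp: not_less le_less)
    then have "card z = card ((z \<inter> {..<c}) \<union> (z \<inter> {c<..}))" by simp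
    also have "\<dots> = card (z \<inter> {..<c}) + card (z \<inter> {c<..})"
      using that by (intro card_Un_disjoint) auto
    finally show ?thesis .
  qed
  have c3: "card ((z \<inter> {..<c}) \<union> {c} \<union> (w \<inter> {c<..})) = card (z \<inter> {..<c}) + 1 + card (w \<inter> {c<..})"
    if "finite z" "finite w" for z w
    using that by (subst card_Un_disjoint; auto)+
  have "card (toggle (?D \<inter> {..c}) x) + card (toggle (?D \<inter> {c<..}) x) = 2 * k + 2"
    unfolding T1 T2 c3[OF f(2,1)] c3[OF f(1,2)] using split[of x] split[of y] f False \<open>c \<notin> y\<close>
      by linarith
  then have "k < card (toggle (?D \<inter> {..c}) x) \<or> k < card (toggle (?D \<inter> {c<..}) x)" by linarith
  then show ?thesis unfolding crowded_def by blast
qed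

section \<open>Multiplication of paths\<close>

text \<open>The product of the path algebra on arbitrary combinations, so that bilinearity and
  associativity hold without membership in the carrier.\<close>

definition pmul :: "(('v, 'e) path \<Rightarrow>\<^sub>0 int) \<Rightarrow> (('v, 'e) path \<Rightarrow>\<^sub>0 int) \<Rightarrow> (('v, 'e) path \<Rightarrow>\<^sub>0 int)"
  where
  "pmul a b = frag_extend (\<lambda>p. frag_extend (path_mult p) b) a"

lemma frag_cmul_diff_distrib2: "frag_cmul c (x - y) = frag_cmul c x - frag_cmul c y"
  by (metis add_diff_cancel_right' diff_add_cancel frag_cmul_distrib2)

lemma frag_extend_minus_fun:
  "frag_extend (\<lambda>p. f p - g p) a = frag_extend f a - frag_extend g a"
  by (simp add: frag_extend_def frag_cmul_diff_distrib2 sum_subtractf)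

lemma pmul_of [simp]: "pmul (frag_of p) (frag_of q) = path_mult p q"
  by (simp add: pmul_def)

lemma pmul_0 [simp]: "pmul 0 a = 0" "pmul a 0 = 0"
  by (simp_all add: pmul_def frag_extend_eq_0)

lemma pmul_diff: "pmul (a - b) c = pmul a c - pmul b c" "pmul a (b - c) = pmul a b - pmul a c"
  by (simp_all add: pmul_def frag_extend_diff frag_extend_minus_fun)

lemma pmul_add: "pmul (a + b) c = pmul a c + pmul b c" "pmul a (b + c) = pmul a b + pmul a c"
proof -
  have m: "pmul (- b) c = - pmul b c" "pmul b (- c) = - pmul b c"
    for b c :: "('v, 'e) path \<Rightarrow>\<^sub>0 int"
    using pmul_diff(1)[of 0 b c] pmul_diff(2)[of b 0 c] by auto
  show "pmul (a + b) c = pmul a c + pmul b c" "pmul a (b + c) = pmul a b + pmul a c"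
    using pmul_diff(1)[of a "- b" c] pmul_diff(2)[of a b "- c"] by (simp_all add: m)
qed

lemma pmul_sum: "pmul (\<Sum>i\<in>I. f i) c = (\<Sum>i\<in>I. pmul (f i) c)"
  "pmul c (\<Sum>i\<in>I. f i) = (\<Sum>i\<in>I. pmul c (f i))"
  by (induction I rule: infinite_finite_induct) (simp_all add: pmul_add)

lemma path_mult_assoc: "pmul (path_mult p q) (frag_of r) = pmul (frag_of p) (path_mult q r)"
  by (cases p; cases q; cases r) (simp add: path_mult_def)

lemma pmul_assoc: "pmul (pmul a b) c = pmul a (pmul b c)"
proof (induction a rule: frag_induction[OF subset_UNIV])
  case (2 p)
  show ?case
  proof (induction b rule: frag_induction[OF subset_UNIV])
    case (2 q)
    show ?case
      by (induction c rule: frag_induction[OF subset_UNIV]) (simp_all add: pmul_diff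
        path_mult_assoc)
  qed (simp_all add: pmul_diff)
qed (simp_all add: pmul_diff)

context
  fixes G :: "('v, 'e) pre_digraph" (structure)
  assumes wf: "wf_digraph G" and fin: "finite (verts G)"
begin

lemma paths_ends: "(u, p, v) \<in> paths G \<Longrightarrow> u \<in> verts G \<and> v \<in> verts G"
proof -
  assume "(u, p, v) \<in> paths G"
  then have a: "pre_digraph.awalk G u p v" by (simp add: paths_def)
  show "u \<in> verts G \<and> v \<in> verts G"
    using a wf_digraph.awlast_in_verts[OF wf, of u p] wf_digraph.awalk_conv[OF wf, of u p v]
    by (simp add: pre_digraph.awalk_def)
qed

lemma keys_path_mult:
  assumes "p \<in> paths G" "q \<in> paths G"
  shows "Poly_Mapping.keys (path_mult p q) \<subseteq> paths G"
  using assms wf_digraph.awalk_appendI[OF wf]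
  by (auto simp: path_mult_def paths_def split: prod.splits)

lemma keys_pmul:
  assumes "Poly_Mapping.keys a \<subseteq> paths G" "Poly_Mapping.keys b \<subseteq> paths G"
  shows "Poly_Mapping.keys (pmul a b) \<subseteq> paths G"
proof -
  have *: "Poly_Mapping.keys (frag_extend (path_mult p) b) \<subseteq> paths G" if "p \<in> paths G" for p
    using keys_frag_extend[of "path_mult p" b] keys_path_mult[OF that] assms(2) by blast
  show ?thesis
    unfolding pmul_def using keys_frag_extend[of "\<lambda>p. frag_extend (path_mult p) b" a] * assms(1)
      by blast
qed

definition path_one :: "('v, 'e) path \<Rightarrow>\<^sub>0 int" where
  "path_one = (\<Sum>v\<in>verts G. frag_of (v, [], v))"

lemma keys_path_one: "Poly_Mapping.keys path_one \<subseteq> paths G"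
proof -
  have "Poly_Mapping.keys path_one \<subseteq> (\<Union>v\<in>verts G. {(v, [], v)})"
    unfolding path_one_def using keys_sum[of "\<lambda>v. frag_of (v, [], v)" "verts G"] by simp
  also have "\<dots> \<subseteq> paths G" by (auto simp: paths_def pre_digraph.awalk_def pre_digraph.cas.simps)
  finally show ?thesis .
qed

lemma pmul_path_one:
  assumes "Poly_Mapping.keys a \<subseteq> paths G"
  shows "pmul path_one a = a" "pmul a path_one = a"
proof -
  have 1: "pmul (\<Sum>v\<in>verts G. frag_of (v, [], v)) (frag_of p) = frag_of p"
    and 2: "pmul (frag_of p) (\<Sum>v\<in>verts G. frag_of (v, [], v)) = frag_of p"
    if "p \<in> paths G" for p
  proof -
    obtain u l v where p: "p = (u, l, v)" by (cases p)
    have uv: "u \<in> verts G" "v \<in> verts G" using that paths_ends p by blast+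
    have "pmul (frag_of (w, [], w)) (frag_of p) = (if w = u then frag_of p else 0)"
      "pmul (frag_of p) (frag_of (w, [], w)) = (if w = v then frag_of p else 0)" for w
      by (auto simp: path_mult_def p)
    then show "pmul (\<Sum>v\<in>verts G. frag_of (v, [], v)) (frag_of p) = frag_of p"
      "pmul (frag_of p) (\<Sum>v\<in>verts G. frag_of (v, [], v)) = frag_of p"
      using uv fin by (simp_all add: pmul_sum)
  qed
  show "pmul path_one a = a" unfolding path_one_def
    using assms by (induction a rule: frag_induction) (auto simp: pmul_diff 1 simp del: pmul_of)
  show "pmul a path_one = a" unfolding path_one_def
    using assms by (induction a rule: frag_induction) (auto simp: pmul_diff 2 simp del: pmul_of)
qed

lemma ring_path_algebra: "ring (path_algebra G)"
proof (rule ringI)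
  have c: "carrier (path_algebra G) = {a. Poly_Mapping.keys a \<subseteq> paths G}"
    and m: "monoid.mult (path_algebra G) = pmul" and o: "one (path_algebra G) = path_one"
    and z: "zero (path_algebra G) = 0" and p: "add (path_algebra G) = (+)"
    by (simp_all add: path_algebra_def pmul_def path_one_def fun_eq_iff)
  note s = c m o z p
  show "abelian_group (path_algebra G)"
  proof (rule abelian_groupI)
    fix x y assume "x \<in> carrier (path_algebra G)" "y \<in> carrier (path_algebra G)"
    then show "x \<oplus>\<^bsub>path_algebra G\<^esub> y \<in> carrier (path_algebra G)"
      using keys_add[of x y] by (auto simp: s)
  next
    fix x assume "x \<in> carrier (path_algebra G)"
    then show "\<exists>y\<in>carrier (path_algebra G). y \<oplus>\<^bsub>path_algebra G\<^esub> x = \<zero>\<^bsub>path_algebra G\<^esub>"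
      by (intro bexI[of _ "- x"]) (auto simp: s)
  qed (auto simp: s add_ac)
  show "Group.monoid (path_algebra G)"
    by (rule monoidI) (auto simp: s pmul_assoc pmul_path_one dest: subsetD[OF keys_path_one]
      subsetD[OF keys_pmul])
qed (auto simp: path_algebra_def pmul_def[symmetric] pmul_add)

end

section \<open>Words in the Ozsvath--Szabo algebra\<close>

text \<open>The arrow from \<open>x\<close> that changes the sign at a movable position
  \<open>i\<close>. Whether it is \<open>R_i\<close> or \<open>L_i\<close> is decided by
  \<open>x\<close>, so both are treated as one kind of letter. For other \<open>i\<close> the value
  is a default that is not an arrow from \<open>x\<close>.\<close>

definition step :: "nat set \<Rightarrow> nat \<Rightarrow> label" where
  "step x i = (if i - 1 \<in> x then Rarr i else Larr i)"

text \<open>A start vertex and a list of labels determine a path, because at most one arrow has a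
  given source and label. Paths are therefore handled as words.\<close>

fun valid_word :: "nat \<Rightarrow> nat \<Rightarrow> nat set \<Rightarrow> label list \<Rightarrow> bool" where
  "valid_word n k x [] \<longleftrightarrow> x \<in> Vset n k"
| "valid_word n k x (l # ls) \<longleftrightarrow> (x, l) \<in> arcs (osz_quiver n k) \<and> valid_word n k (move l x) ls"

lemma move_step: "movable x i \<Longrightarrow> move (step x i) x = toggle {i} x"
  by (auto simp: step_def toggle_single_movable movable_def)

lemma arc_iff: "(x, l) \<in> arcs (osz_quiver n k) \<longleftrightarrow>
  x \<in> Vset n k \<and> (\<exists>i\<in>{1..n}. l = Uarr i \<or> (l = step x i \<and> movable x i))"
proof -
  have 1: "x \<inter> {i - 1, i} = {i - 1} \<longleftrightarrow> i - 1 \<in> x \<and> i \<notin> x" if "i \<in> {1..n}" for i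
    using that by (auto simp: Int_insert_right split: if_splits)
  have 2: "x \<inter> {i - 1, i} = {i} \<longleftrightarrow> i - 1 \<notin> x \<and> i \<in> x" if "i \<in> {1..n}" for i
    using that by (auto simp: Int_insert_right split: if_splits)
  have "(x, l) \<in> arcs (osz_quiver n k) \<longleftrightarrow> x \<in> Vset n k \<and> (\<exists>i\<in>{1..n}.
      (l = Rarr i \<and> x \<inter> {i - 1, i} = {i - 1}) \<or> (l = Larr i \<and> x \<inter> {i - 1, i} = {i}) \<or> l = Uarr i)"
    by (cases l) (auto simp: osz_quiver_def)
  also have "\<dots> \<longleftrightarrow> x \<in> Vset n k \<and> (\<exists>i\<in>{1..n}. l = Uarr i \<or> (l = step x i \<and> movable x i))"
  proof (rule conj_cong[OF refl], rule bex_cong[OF refl])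
    fix i assume "i \<in> {1..n}"
    then show "(l = Rarr i \<and> x \<inter> {i - 1, i} = {i - 1} \<or> l = Larr i \<and> x \<inter> {i - 1, i} = {i} \<or> l =
      Uarr i) =
      (l = Uarr i \<or> l = step x i \<and> movable x i)"
      unfolding 1[OF \<open>i \<in> {1..n}\<close>] 2[OF \<open>i \<in> {1..n}\<close>] by (simp add: step_def movable_def) blast
  qed
  finally show ?thesis .
qed

lemma arc_Rarr: "(x, Rarr i) \<in> arcs (osz_quiver n k) \<longleftrightarrow>
    x \<in> Vset n k \<and> i \<in> {1..n} \<and> i - 1 \<in> x \<and> i \<notin> x"
  and arc_Larr: "(x, Larr i) \<in> arcs (osz_quiver n k) \<longleftrightarrow>
    x \<in> Vset n k \<and> i \<in> {1..n} \<and> i - 1 \<notin> x \<and> i \<in> x"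
  and arc_Uarr: "(x, Uarr i) \<in> arcs (osz_quiver n k) \<longleftrightarrow> x \<in> Vset n k \<and> i \<in> {1..n}"
  unfolding arc_iff by (auto simp: step_def movable_def split: if_splits)

lemma arc_cases:
  assumes "(x, l) \<in> arcs (osz_quiver n k)"
  obtains (U) i where "l = Uarr i" "i \<in> {1..n}" "x \<in> Vset n k" "move l x = x"
  | (A) i where "l = step x i" "i \<in> {1..n}" "movable x i" "x \<in> Vset n k" "move l x = toggle {i} x"
    "move l x \<in> Vset n k"
  using assms unfolding arc_iff by (auto simp: move_step toggle_single_Vset)

lemma finite_Vset: "finite (Vset n k)"
  by (rule finite_subset[of _ "Pow {0..n}"]) (auto simp: Vset_def)

lemma wf_osz_quiver: "wf_digraph (osz_quiver n k)"
proof
  fix e assume e: "e \<in> arcs (osz_quiver n k)"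
  obtain x l where xl: "e = (x, l)" by (cases e)
  have "x \<in> Vset n k \<and> move l x \<in> Vset n k"
    using e unfolding xl by (cases rule: arc_cases) auto
  then show "tail (osz_quiver n k) e \<in> verts (osz_quiver n k)"
    and "head (osz_quiver n k) e \<in> verts (osz_quiver n k)"
    by (auto simp: xl osz_quiver_def)
qed

lemma valid_word_Vset: "valid_word n k x ls \<Longrightarrow> x \<in> Vset n k"
  by (cases ls) (auto simp: arc_iff)

lemma valid_word_append: "valid_word n k x (u @ v) \<longleftrightarrow>
  valid_word n k x u \<and> valid_word n k (fold move u x) v"
  by (induction u arbitrary: x) (auto simp: valid_word_Vset)

lemma valid_word_target: "valid_word n k x ls \<Longrightarrow> fold move ls x \<in> Vset n k"
  by (induction ls arbitrary: x) auto

lemma osz_quiver_simps [simp]: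
  "verts (osz_quiver n k) = Vset n k" "tail (osz_quiver n k) e = fst e"
  "head (osz_quiver n k) (x, l) = move l x"
  by (simp_all add: osz_quiver_def)

lemma awalk_arrows_from:
  "pre_digraph.awalk (osz_quiver n k) x (arrows_from x ls) (fold move ls x) \<longleftrightarrow> valid_word n k x ls"
proof -
  have "pre_digraph.cas (osz_quiver n k) x (arrows_from x ls) (fold move ls x)"
    by (induction ls arbitrary: x) (auto simp: pre_digraph.cas.simps)
  moreover have "x \<in> Vset n k \<and> set (arrows_from x ls) \<subseteq> arcs (osz_quiver n k) \<longleftrightarrow>
    valid_word n k x ls"
  proof (induction ls arbitrary: x)
    case (Cons l ls)
    have "move l x \<in> Vset n k" if "(x, l) \<in> arcs (osz_quiver n k)"
      using that by (cases rule: arc_cases) auto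
    then show ?case using Cons[of "move l x"] by (auto simp: arc_iff)
  qed simp
  ultimately show ?thesis by (simp add: pre_digraph.awalk_def)
qed

lemma osz_path_in_paths: "osz_path x ls \<in> paths (osz_quiver n k) \<longleftrightarrow> valid_word n k x ls"
  by (simp add: osz_path_def paths_def awalk_arrows_from)

lemma paths_oszE:
  assumes "p \<in> paths (osz_quiver n k)"
  obtains x ls where "p = osz_path x ls" "valid_word n k x ls"
proof -
  obtain x as y where p: "p = (x, as, y)" by (cases p)
  have w: "pre_digraph.awalk (osz_quiver n k) x as y" using assms by (simp add: p paths_def)
  have "pre_digraph.cas (osz_quiver n k) x as y" using w by (simp add: pre_digraph.awalk_def)
  then have "as = arrows_from x (map snd as) \<and> y = fold move (map snd as) x"
    by (induction as arbitrary: x) (auto simp: pre_digraph.cas.simps)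
  then have "p = osz_path x (map snd as)" by (simp add: p osz_path_def)
  with assms osz_path_in_paths show thesis using that by metis
qed

lemma arrows_from_append:
  "arrows_from x (u @ v) = arrows_from x u @ arrows_from (fold move u x) v"
  by (induction u arbitrary: x) auto

lemma path_mult_osz: "path_mult (osz_path x u) (osz_path y v) =
  (if y = fold move u x then frag_of (osz_path x (u @ v)) else 0)"
  by (auto simp: path_mult_def osz_path_def arrows_from_append)

context
  fixes n k :: nat
begin

abbreviation (input) "Fr \<equiv> path_algebra (osz_quiver n k)"

lemma ring_Fr: "ring Fr"
  by (rule ring_path_algebra) (simp_all add: wf_osz_quiver finite_Vset)

lemma Fr_simps: "carrier Fr = {a. Poly_Mapping.keys a \<subseteq> paths (osz_quiver n k)}"
  "monoid.mult Fr = pmul" "add Fr = (+)" "zero Fr = 0"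
  by (simp_all add: path_algebra_def pmul_def fun_eq_iff)

lemma osz_relations_carrier: "osz_relations n k \<subseteq> carrier Fr"
  unfolding osz_relations_def Fr_simps
  using keys_diff by (fastforce split: if_splits)

lemma ideal_osz: "ideal (osz_ideal n k) Fr"
  unfolding osz_ideal_def by (rule ring.genideal_ideal[OF ring_Fr osz_relations_carrier])

lemma ring_osz: "ring (osz n k)"
  unfolding osz_def by (rule ideal.quotient_is_ring[OF ideal_osz])

lemma osz_class_hom: "osz_class n k \<in> Ring.ring_hom Fr (osz n k)"
proof -
  have "osz_class n k = (+>\<^bsub>Fr\<^esub>) (osz_ideal n k)" by (simp add: osz_class_def fun_eq_iff)
  then show ?thesis unfolding osz_def using ideal.rcos_ring_hom[OF ideal_osz] by simp
qed

lemma osz_class_closed: "a \<in> carrier Fr \<Longrightarrow> osz_class n k a \<in> carrier (osz n k)"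
  using osz_class_hom by (rule ring_hom_closed)

lemma osz_class_mult: "a \<in> carrier Fr \<Longrightarrow> b \<in> carrier Fr \<Longrightarrow>
   osz_class n k (pmul a b) = osz_class n k a \<otimes>\<^bsub>osz n k\<^esub> osz_class n k b"
  using ring_hom_mult[OF osz_class_hom, of a b] by (simp add: Fr_simps)

lemma osz_class_add: "a \<in> carrier Fr \<Longrightarrow> b \<in> carrier Fr \<Longrightarrow>
   osz_class n k (a + b) = osz_class n k a \<oplus>\<^bsub>osz n k\<^esub> osz_class n k b"
  using ring_hom_add[OF osz_class_hom, of a b] by (simp add: Fr_simps)

lemma osz_class_eq_iff:
  assumes "a \<in> carrier Fr" "b \<in> carrier Fr"
  shows "osz_class n k a = osz_class n k b \<longleftrightarrow> a - b \<in> osz_ideal n k"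
proof -
  interpret I: ideal "osz_ideal n k" Fr by (rule ideal_osz)
  have "\<ominus>\<^bsub>Fr\<^esub> b = - b"
    using assms by (intro I.minus_equality) (auto simp: Fr_simps)
  then have "a \<ominus>\<^bsub>Fr\<^esub> b = a - b" by (simp add: a_minus_def Fr_simps)
  then show ?thesis
    using I.quotient_eq_iff_same_a_r_cos[OF ideal_osz assms] by (simp add: osz_class_def)
qed

lemma osz_class_0: "osz_class n k 0 = \<zero>\<^bsub>osz n k\<^esub>"
  using ring_hom_zero[OF osz_class_hom ring_Fr ring_osz] by (simp add: Fr_simps)

lemma frag_of_osz_path: "valid_word n k x ls \<Longrightarrow> frag_of (osz_path x ls) \<in> carrier Fr"
  by (simp add: Fr_simps osz_path_in_paths)

lemma word_closed: "valid_word n k x ls \<Longrightarrow> osz_word n k x ls \<in> carrier (osz n k)"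
  by (intro osz_class_closed frag_of_osz_path)

lemma word_append:
  assumes "valid_word n k x (u @ v)"
  shows "osz_word n k x (u @ v) = osz_word n k x u \<otimes>\<^bsub>osz n k\<^esub> osz_word n k (fold move u x) v"
proof -
  have "valid_word n k x u" "valid_word n k (fold move u x) v" using assms
    by (auto simp: valid_word_append)
  from osz_class_mult[OF this[THEN frag_of_osz_path]] show ?thesis by (simp add: path_mult_osz)
qed

lemma word_Cons:
  assumes "valid_word n k x (l # v)"
  shows "osz_word n k x (l # v) = osz_word n k x [l] \<otimes>\<^bsub>osz n k\<^esub> osz_word n k (move l x) v"
  using word_append[of x "[l]" v] assms by simp

lemma relation_in_ideal: "a \<in> osz_relations n k \<Longrightarrow> a \<in> osz_ideal n k"
  unfolding osz_ideal_def using ring.genideal_self[OF ring_Fr osz_relations_carrier] by blast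

lemma word_eq:
  assumes "osz_eq v w" "valid_word n k x v" "valid_word n k x w"
  shows "osz_word n k x v = osz_word n k x w"
proof -
  have "frag_of (osz_path x v) - frag_of (osz_path x w) \<in> osz_relations n k"
    unfolding osz_relations_def using assms by (auto simp: osz_path_in_paths)
  then show ?thesis
    using relation_in_ideal osz_class_eq_iff frag_of_osz_path assms(2,3) by blast
qed

lemma word_zero:
  assumes "osz_zero x w" "valid_word n k x w"
  shows "osz_word n k x w = \<zero>\<^bsub>osz n k\<^esub>"
proof -
  have "frag_of (osz_path x w) - 0 \<in> osz_relations n k"
    unfolding osz_relations_def using assms by (auto simp: osz_path_in_paths)
  then have "osz_word n k x w = osz_class n k 0"
    using relation_in_ideal osz_class_eq_iff[of "frag_of (osz_path x w)" 0] frag_of_osz_path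
      assms(2)
    by (simp add: Fr_simps)
  then show ?thesis by (simp add: osz_class_0)
qed

lemma word_cong_Cons:
  assumes "valid_word n k x (l # v)" "valid_word n k (move l x) v'"
    "osz_word n k (move l x) v = osz_word n k (move l x) v'"
  shows "osz_word n k x (l # v) = osz_word n k x (l # v')"
  using word_Cons[of x l v] word_Cons[of x l v'] assms by simp

lemma word_cong_prefix:
  assumes "valid_word n k x (u @ v)" "valid_word n k x u'" "osz_word n k x u = osz_word n k x u'"
    "fold move u' x = fold move u x"
  shows "osz_word n k x (u @ v) = osz_word n k x (u' @ v)"
  using word_append[of x u v] word_append[of x u' v] assms by (simp add: valid_word_append)

lemma word_cong_suffix:
  assumes "valid_word n k x (u @ v)" "valid_word n k (fold move u x) v'"
    "osz_word n k (fold move u x) v = osz_word n k (fold move u x) v'"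
  shows "osz_word n k x (u @ v) = osz_word n k x (u @ v')"
  using word_append[of x u v] word_append[of x u v'] assms by (simp add: valid_word_append)

lemma word_zero_suffix:
  assumes "valid_word n k x (u @ v)" "osz_word n k (fold move u x) v = \<zero>\<^bsub>osz n k\<^esub>"
  shows "osz_word n k x (u @ v) = \<zero>\<^bsub>osz n k\<^esub>"
proof -
  interpret R: ring "osz n k" by (rule ring_osz)
  show ?thesis using word_append[of x u v] assms word_closed[of x u]
    by (simp add: valid_word_append)
qed

lemma word_zero_prefix:
  assumes "valid_word n k x (u @ v)" "osz_word n k x u = \<zero>\<^bsub>osz n k\<^esub>"
  shows "osz_word n k x (u @ v) = \<zero>\<^bsub>osz n k\<^esub>"
proof -
  interpret R: ring "osz n k" by (rule ring_osz)
  show ?thesis using word_append[of x u v] assms word_closed[of "fold move u x" v]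
    by (simp add: valid_word_append)
qed

declare valid_word.simps(2) [simp del]

lemma valid_word_step: "x \<in> Vset n k \<Longrightarrow> movable x i \<Longrightarrow> i \<le> n \<Longrightarrow>
  valid_word n k x (step x i # ls) \<longleftrightarrow> valid_word n k (toggle {i} x) ls"
  by (auto simp: arc_iff move_step movable_def valid_word.simps(2))

lemma valid_word_U: "x \<in> Vset n k \<Longrightarrow> valid_word n k x (Uarr i # ls) \<longleftrightarrow>
  i \<in> {1..n} \<and> valid_word n k x ls"
  by (auto simp: arc_iff valid_word.simps(2) step_def split: if_splits)

lemma valid_word_Us: "valid_word n k x (map Uarr us @ ls) \<longleftrightarrow> set us \<subseteq> {1..n} \<and> valid_word n k x ls"
proof (induction us)
  case (Cons i us)
  show ?case
  proof (cases "x \<in> Vset n k")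
    case True
    then show ?thesis using Cons by (auto simp: valid_word_U)
  next
    case False
    then show ?thesis using valid_word_Vset by blast
  qed
qed simp

lemma fold_Us [simp]: "fold move (map Uarr us) x = x"
  by (induction us) auto

section \<open>Commuting the letters of a word\<close>

lemma swap_step_U:
  assumes "x \<in> Vset n k" "movable x i" "i \<le> n" "valid_word n k (toggle {i} x) (Uarr j # ls)"
  shows "osz_word n k x (step x i # Uarr j # ls) = osz_word n k x (Uarr j # step x i # ls)"
proof -
  have x': "toggle {i} x \<in> Vset n k" using assms toggle_single_Vset by blast
  have "osz_word n k x ([step x i, Uarr j] @ ls) = osz_word n k x ([Uarr j, step x i] @ ls)"
  proof (rule word_cong_prefix)
    have "osz_eq [step x i, Uarr j] [Uarr j, step x i]" by (simp add: step_def osz_eq.intros)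
    then show "osz_word n k x [step x i, Uarr j] = osz_word n k x [Uarr j, step x i]"
      by (rule word_eq) (use assms x' in \<open>simp_all add: valid_word_step valid_word_U\<close>)
  qed (use assms x' in \<open>simp_all add: valid_word_step valid_word_U move_step\<close>)
  then show ?thesis by simp
qed

lemma step_step:
  assumes "x \<in> Vset n k" "movable x i" "i \<le> n" "valid_word n k x ls"
  shows "osz_word n k x (step x i # step (toggle {i} x) i # ls) = osz_word n k x (Uarr i # ls)"
proof -
  have x': "toggle {i} x \<in> Vset n k" using assms toggle_single_Vset by blast
  have i: "i \<in> {1..n}" using assms by (auto simp: movable_def)
  have "osz_word n k x ([step x i, step (toggle {i} x) i] @ ls) = osz_word n k x ([Uarr i] @ ls)"
  proof (rule word_cong_prefix)
    have "osz_eq [step x i, step (toggle {i} x) i] [Uarr i]"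
      using assms(2) i by (auto simp: step_def movable_def toggle_def intro: osz_eq.intros)
    then show "osz_word n k x [step x i, step (toggle {i} x) i] = osz_word n k x [Uarr i]"
      by (rule word_eq)
        (use assms x' i in \<open>simp_all add: valid_word_step valid_word_U\<close>)
  qed (use assms x' i in \<open>simp_all add: valid_word_step valid_word_U move_step\<close>)
  then show ?thesis by simp
qed

lemma swap_step:
  assumes "x \<in> Vset n k" "movable x i" "i \<le> n" "movable x j" "j \<le> n" "\<bar>int i - int j\<bar> > 1"
    "valid_word n k (toggle {j} (toggle {i} x)) ls"
  shows "osz_word n k x (step x i # step (toggle {i} x) j # ls) =
    osz_word n k x (step x j # step (toggle {j} x) i # ls)"
proof -
  have x': "toggle {i} x \<in> Vset n k" "toggle {j} x \<in> Vset n k" using assms toggle_single_Vset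
    by blast+
  have m: "movable (toggle {i} x) j" "movable (toggle {j} x) i"
    using assms by (auto intro!: movable_far)
  have ij: "i \<noteq> j" "i \<noteq> Suc j" "j \<noteq> Suc i" "1 \<le> i" "1 \<le> j" using assms by (auto simp: movable_def)
  have a: "step (toggle {i} x) j = step x j" "step (toggle {j} x) i = step x i"
    using ij by (auto simp: step_def toggle_def)
  have z: "toggle {j} (toggle {i} x) \<in> Vset n k" using assms valid_word_Vset by blast
  have "osz_word n k x ([step x i, step (toggle {i} x) j] @ ls) =
    osz_word n k x ([step x j, step (toggle {j} x) i] @ ls)"
  proof (rule word_cong_prefix)
    have ok: "valid_word n k x [step x i, step (toggle {i} x) j]"
      "valid_word n k x [step x j, step (toggle {j} x) i]"
      using assms x' m z toggle_commute[of i j x] by (simp_all add: valid_word_step)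
    \<comment> \<open>The commutation of an \<open>L\<close> with an \<open>R\<close> is listed in
      one order only, so the relation may have to be read from right to left.\<close>
    have "osz_eq [step x i, step x j] [step x j, step x i] \<or>
      osz_eq [step x j, step x i] [step x i, step x j]"
      using assms(6) by (auto simp: step_def intro: osz_eq.intros)
    then show "osz_word n k x [step x i, step (toggle {i} x) j] =
      osz_word n k x [step x j, step (toggle {j} x) i]"
      using word_eq ok unfolding a by metis
    show "valid_word n k x [step x j, step (toggle {j} x) i]" by (rule ok)
    show "valid_word n k x ([step x i, step (toggle {i} x) j] @ ls)"
      using assms x' m by (simp add: valid_word_step)
    show "fold move [step x j, step (toggle {j} x) i] x =
      fold move [step x i, step (toggle {i} x) j] x"
      using assms m by (simp add: move_step toggle_commute[of i j])
  qed
  then show ?thesis by simp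
qed

lemma U_front:
  assumes "i \<in> set us" "valid_word n k x (map Uarr us @ g)"
  shows "osz_word n k x (map Uarr us @ g) = osz_word n k x (Uarr i # map Uarr (remove1 i us) @ g)"
  using assms
proof (induction us)
  case (Cons j us)
  note x = valid_word_Vset[OF Cons.prems(2)]
  show ?case
  proof (cases "i = j")
    case False
    then have i: "i \<in> set us" using Cons.prems by simp
    have ok: "valid_word n k x (map Uarr us @ g)" "j \<in> {1..n}"
      using Cons.prems(2) x by (auto simp: valid_word_U)
    have ok': "valid_word n k x (Uarr i # map Uarr (remove1 i us) @ g)"
      using ok(1) i x set_remove1_subset[of i us] by (auto simp: valid_word_U valid_word_Us)
    have "osz_word n k x (Uarr j # map Uarr us @ g) =
      osz_word n k x (Uarr j # Uarr i # map Uarr (remove1 i us) @ g)"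
      using Cons.IH[OF i ok(1)] ok ok' x by (intro word_cong_Cons) (simp_all add: valid_word_U)
    also have "\<dots> = osz_word n k x (Uarr i # Uarr j # map Uarr (remove1 i us) @ g)"
    proof -
      have "osz_word n k x ([Uarr j, Uarr i] @ (map Uarr (remove1 i us) @ g)) =
        osz_word n k x ([Uarr i, Uarr j] @ (map Uarr (remove1 i us) @ g))"
      proof (rule word_cong_prefix)
        show "osz_word n k x [Uarr j, Uarr i] = osz_word n k x [Uarr i, Uarr j]"
          using ok ok' x by (intro word_eq osz_eq.intros) (simp_all add: valid_word_U)
      qed (use ok ok' x in \<open>simp_all add: valid_word_U\<close>)
      then show ?thesis by simp
    qed
    finally show ?thesis using False by simp
  qed simp
qed simp

lemma Us_perm:
  assumes "mset us = mset vs" "valid_word n k x (map Uarr us @ g)"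
  shows "osz_word n k x (map Uarr us @ g) = osz_word n k x (map Uarr vs @ g)"
  using assms
proof (induction us arbitrary: vs)
  case (Cons j us)
  note x = valid_word_Vset[OF Cons.prems(2)]
  have j: "j \<in> set vs" using Cons.prems(1) by (metis list.set_intros(1) set_mset_mset)
  have m: "mset us = mset (remove1 j vs)" using Cons.prems(1)
    by (metis mset_remove1 mset.simps(2) add_mset_remove_trivial)
  have ok: "valid_word n k x (map Uarr us @ g)" "j \<in> {1..n}"
    using Cons.prems(2) x by (auto simp: valid_word_U)
  have "set vs = set (j # us)" using Cons.prems(1) by (metis set_mset_mset)
  then have okv: "valid_word n k x (map Uarr vs @ g)" using Cons.prems(2) by (metis valid_word_Us)
  have "osz_word n k x (map Uarr (j # us) @ g) =
    osz_word n k x (Uarr j # map Uarr (remove1 j vs) @ g)"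
    using Cons.IH[OF m ok(1)] ok x okv set_remove1_subset[of j vs]
    by (simp, intro word_cong_Cons) (auto simp: valid_word_U valid_word_Us)
  also have "\<dots> = osz_word n k x (map Uarr vs @ g)" using U_front[OF j okv] by simp
  finally show ?case .
qed simp

lemma step_Us:
  assumes "x \<in> Vset n k" "movable x i" "i \<le> n" "valid_word n k (toggle {i} x) (map Uarr us @ g)"
  shows "osz_word n k x (step x i # map Uarr us @ g) =
    osz_word n k x (map Uarr us @ step x i # g)"
  using assms(4)
proof (induction us)
  case (Cons j us)
  have x': "toggle {i} x \<in> Vset n k" using assms toggle_single_Vset by blast
  have ok: "valid_word n k (toggle {i} x) (map Uarr us @ g)" "j \<in> {1..n}"
    using Cons.prems x' by (auto simp: valid_word_U)
  have "osz_word n k x (step x i # map Uarr (j # us) @ g) =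
    osz_word n k x (Uarr j # step x i # map Uarr us @ g)"
    using swap_step_U[OF assms(1-3)] Cons.prems by simp
  also have "\<dots> = osz_word n k x (Uarr j # map Uarr us @ step x i # g)"
    using Cons.IH[OF ok(1)] ok assms(1-3)
    by (intro word_cong_Cons) (auto simp: valid_word_U valid_word_step valid_word_Us)
  finally show ?case by simp
qed simp

end

section \<open>Geodesic words\<close>

text \<open>Each letter changes a sign in which the current vertex still differs from
  \<open>y\<close>. So no sign is changed twice and the length is the size of the difference
  set.\<close>

inductive geodesic :: "nat \<Rightarrow> nat \<Rightarrow> nat set \<Rightarrow> nat set \<Rightarrow> label list \<Rightarrow> bool" for n k y where
  Nil: "y \<in> Vset n k \<Longrightarrow> geodesic n k y y []"
| Cons: "x \<in> Vset n k \<Longrightarrow> i \<in> dset n x y \<Longrightarrow> movable x i \<Longrightarrow> geodesic n k y (toggle {i} x) ls \<Longrightarrow>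
    geodesic n k y x (step x i # ls)"

context
  fixes n k :: nat and y :: "nat set"
begin

abbreviation (input) "free x \<equiv> \<not> crowded k (dset n x y) x"

lemma dset_step: "i \<in> dset n x y \<Longrightarrow> dset n (toggle {i} x) y = dset n x y - {i}"
  using dset_toggle[of "{i}" n x y] by (auto simp: dset_def)

lemma dset_step': "i \<notin> dset n x y \<Longrightarrow> i \<in> {1..n} \<Longrightarrow> dset n (toggle {i} x) y = insert i (dset n x y)"
  using dset_toggle[of "{i}" n x y] by auto

text \<open>Toggling inside the difference set does not affect crowding, and the set to be tested
  afterwards is smaller.\<close>

lemma free_step:
  assumes "i \<in> dset n x y" "free x"
  shows "free (toggle {i} x)"
  using assms crowded_mono[of k "dset n x y - {i}" "toggle {i} x" "dset n x y"] crowded_toggle[of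
    "{i}" "dset n x y" k x]
  by (auto simp: dset_step)

lemma dset_le: "i \<in> dset n x y \<Longrightarrow> 1 \<le> i \<and> i \<le> n"
  by (auto simp: dset_def)

lemma geodesicD:
  assumes "geodesic n k y x g"
  shows "valid_word n k x g" "fold move g x = y" "x \<in> Vset n k" "y \<in> Vset n k"
  using assms
  by (induction rule: geodesic.induct) (auto simp: valid_word_step move_step dset_le)

lemma geodesic_exists:
  assumes "x \<in> Vset n k" "y \<in> Vset n k" "free x"
  shows "\<exists>g. geodesic n k y x g"
  using assms(1,3)
proof (induction "card (dset n x y)" arbitrary: x rule: less_induct)
  case less
  show ?case
  proof (cases "x = y")
    case True
    then show ?thesis using geodesic.Nil assms(2) by blast
  next
    case False
    then obtain i where i: "i \<in> dset n x y" "movable x i"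
      using movable_in_dset less.prems assms(2) by metis
    have "card (dset n (toggle {i} x) y) < card (dset n x y)"
      using i card_Diff1_less[OF finite_dset i(1)] by (simp only: dset_step)
    then obtain g where "geodesic n k y (toggle {i} x) g"
      using less i free_step toggle_single_Vset dset_le by metis
    then show ?thesis using geodesic.Cons i less.prems by blast
  qed
qed

text \<open>A diamond argument. Two different first steps i and j are not adjacent, because the
  vertex is not crowded, so they commute. By induction each word may be continued by the other's
  first step and a common geodesic.\<close>

lemma geodesic_unique:
  assumes "geodesic n k y x g" "geodesic n k y x g'" "free x"
  shows "osz_word n k x g = osz_word n k x g'"
  using assms
proof (induction "card (dset n x y)" arbitrary: x g g' rule: less_induct)
  case less
  note x = geodesicD(3,4)[OF less.prems(1)]
  show ?case
  proof (cases "x = y")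
    case True
    have "h = []" if "geodesic n k y x h" for h
      using that True by (cases rule: geodesic.cases) auto
    from this[OF less.prems(1)] this[OF less.prems(2)] show ?thesis by simp
  next
    case False
    obtain i h where i: "g = step x i # h" "i \<in> dset n x y" "movable x i"
      "geodesic n k y (toggle {i} x) h"
      using less.prems(1) False by (cases rule: geodesic.cases) auto
    obtain j h' where j: "g' = step x j # h'" "j \<in> dset n x y" "movable x j"
      "geodesic n k y (toggle {j} x) h'"
      using less.prems(2) False by (cases rule: geodesic.cases) auto
    have smaller: "card (dset n (toggle {i} x) y) < card (dset n x y)" if "i \<in> dset n x y" for i
      using card_Diff1_less[OF finite_dset that] that by (simp only: dset_step)
    have via: "osz_word n k x (step x i # h) = osz_word n k x (step x i # h'')"
      if "i \<in> dset n x y" "movable x i" "geodesic n k y (toggle {i} x) h"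
        "geodesic n k y (toggle {i} x) h''" for i h h''
    proof (rule word_cong_Cons)
      show "osz_word n k (move (step x i) x) h = osz_word n k (move (step x i) x) h''"
        using less.hyps[OF smaller[OF that(1)] that(3,4) free_step] that less.prems(3)
          by (simp add: move_step)
    qed (use that x geodesicD(1)[OF that(3)] geodesicD(1)[OF that(4)] dset_le[OF that(1)] in
          \<open>simp_all add: valid_word_step move_step\<close>)
    show ?thesis
    proof (cases "i = j")
      case True
      then show ?thesis using via i j by metis
    next
      case False
      have "\<bar>int i - int j\<bar> > 1"
      proof (rule ccontr)
        assume "\<not> \<bar>int i - int j\<bar> > 1"
        then have "i = Suc j \<or> j = Suc i" using False by linarith
        then show False using crowded_if_adjacent[OF x] i j less.prems(3) by blast
      qed
      then have far: "\<bar>int i - int j\<bar> > 1" "\<bar>int j - int i\<bar> > 1" by linarith+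
      have m: "movable (toggle {i} x) j" "movable (toggle {j} x) i" using movable_far far i j
        by blast+
      have d: "j \<in> dset n (toggle {i} x) y" "i \<in> dset n (toggle {j} x) y" using i j False
        by (auto simp: dset_step)
      have V: "toggle {i} x \<in> Vset n k" "toggle {j} x \<in> Vset n k" using geodesicD(3) i j by blast+
      have Vij: "toggle {j} (toggle {i} x) \<in> Vset n k"
        using toggle_single_Vset[OF V(1) m(1)] d(1) dset_le by blast
      obtain g0 where g0: "geodesic n k y (toggle {j} (toggle {i} x)) g0"
        using geodesic_exists[OF Vij x(2)] free_step[OF d(1) free_step[OF i(2) less.prems(3)]]
          by blast
      have "geodesic n k y (toggle {i} x) (step (toggle {i} x) j # g0)"
        "geodesic n k y (toggle {j} x) (step (toggle {j} x) i # g0)"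
        using geodesic.Cons[OF V(1) d(1) m(1) g0] geodesic.Cons[OF V(2) d(2) m(2)] g0
          by (simp_all add: toggle_commute[of j i])
      then have "osz_word n k x g = osz_word n k x (step x i # step (toggle {i} x) j # g0)"
        "osz_word n k x g' = osz_word n k x (step x j # step (toggle {j} x) i # g0)"
        using via i j by metis+
      moreover have "osz_word n k x (step x i # step (toggle {i} x) j # g0) =
        osz_word n k x (step x j # step (toggle {j} x) i # g0)"
        using swap_step[OF x(1) i(3) _ j(3) _ far(1) geodesicD(1)[OF g0]] dset_le[OF i(2)]
          dset_le[OF j(2)] by blast
      ultimately show ?thesis by simp
    qed
  qed
qed

section \<open>A step in front of a geodesic\<close>

lemma step_geodesic_cong:
  assumes "x \<in> Vset n k" "movable x i" "i \<le> n" "geodesic n k y (toggle {i} x) g"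
    "geodesic n k y (toggle {i} x) h"
    "free (toggle {i} x)"
  shows "osz_word n k x (step x i # g) = osz_word n k x (step x i # h)"
  using geodesic_unique[OF assms(4,5,6)] geodesicD(1)[OF assms(4)] geodesicD(1)[OF assms(5)]
    assms(1-3)
  by (intro word_cong_Cons) (simp_all add: valid_word_step move_step)

text \<open>The arrow is \<open>L\<^sub>b\<^sub>+\<^sub>1\<close>. It commutes with the arrows \<open>L\<^sub>a, L\<^sub>a\<^sub>+\<^sub>1, \<dots>\<close> of the geodesic until it meets
  \<open>L\<^sub>b\<close>, and \<open>L\<^sub>b\<^sub>+\<^sub>1 L\<^sub>b = 0\<close>.\<close>

lemma left_blocked:
  assumes "x \<in> Vset n k" "1 \<le> a" "a \<le> b" "Suc b \<le> n" "a - 1 \<notin> x" "{a..<b} \<subseteq> x" "b \<notin> x" "Suc b \<in> x"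
    "{a..b} \<subseteq> dset n (toggle {Suc b} x) y" "geodesic n k y (toggle {Suc b} x) g"
      "free (toggle {Suc b} x)"
  shows "osz_word n k x (step x (Suc b) # g) = \<zero>\<^bsub>osz n k\<^esub>"
  using assms
proof (induction "b - a" arbitrary: x a g)
  case 0
  let ?x' = "toggle {Suc b} x"
  have ab: "a = b" using 0 by simp
  have m: "movable x (Suc b)" using 0 by (simp add: movable_def)
  have m': "movable ?x' b" using 0 ab by (auto simp: movable_def toggle_def)
  have d: "b \<in> dset n ?x' y" using 0 ab by auto
  have V: "?x' \<in> Vset n k" "y \<in> Vset n k" using geodesicD(3,4) 0 by blast+
  obtain g1 where g1: "geodesic n k y (toggle {b} ?x') g1"
    using geodesic_exists[OF toggle_single_Vset[OF V(1) m'] V(2) free_step[OF d]] 0 by auto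
  \<comment> \<open>By uniqueness the tail may be taken to start with \<open>L_b\<close>, which
    brings the zero relation to the front.\<close>
  have "osz_word n k x (step x (Suc b) # g) = osz_word n k x (step x (Suc b) # step ?x' b # g1)"
    using step_geodesic_cong[OF 0(2) m 0(5) 0(11) geodesic.Cons[OF V(1) d m' g1]] 0 by blast
  moreover have a1: "step x (Suc b) = Larr (Suc b)" using 0 by (simp add: step_def)
  moreover have a2: "step ?x' b = Larr b" using 0 ab by (auto simp: step_def toggle_def)
  ultimately have eq: "osz_word n k x (step x (Suc b) # g) =
    osz_word n k x ([Larr (Suc b), Larr b] @ g1)" by simp
  have ok: "valid_word n k x (step x (Suc b) # step ?x' b # g1)"
    using 0 m m' V geodesicD(1)[OF g1] by (simp add: valid_word_step)
  then have ok: "valid_word n k x ([Larr (Suc b), Larr b] @ g1)"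
    unfolding a1 a2 by simp
  then have "osz_word n k x [Larr (Suc b), Larr b] = \<zero>\<^bsub>osz n k\<^esub>"
    using word_zero[of x "[Larr (Suc b), Larr b]"] osz_zero.intros valid_word_append by blast
  then show ?case using word_zero_prefix[OF ok] eq by simp
next
  case (Suc d)
  note IH = Suc.hyps(1) and P = Suc.prems
  let ?x' = "toggle {Suc b} x"
  have ab: "a < b" using Suc.hyps(2) by simp
  have m: "movable x (Suc b)" using P by (simp add: movable_def)
  have ax: "a \<in> x" using P(6) ab by auto
  have ma: "movable x a" using ax P by (simp add: movable_def)
  have far: "\<bar>int a - int (Suc b)\<bar> > 1" "\<bar>int (Suc b) - int a\<bar> > 1" using ab by linarith+
  have m': "movable ?x' a" "movable (toggle {a} x) (Suc b)" using movable_far ma m far by blast+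
  have d: "a \<in> dset n ?x' y" using P ab by auto
  have V: "?x' \<in> Vset n k" "y \<in> Vset n k" using geodesicD(3,4) P by blast+
  have an: "a \<le> n" using ab P by simp
  have Va: "toggle {a} x \<in> Vset n k" using toggle_single_Vset[OF P(1) ma an] .
  obtain g1 where g1: "geodesic n k y (toggle {a} ?x') g1"
    using geodesic_exists[OF toggle_single_Vset[OF V(1) m'(1) an] V(2) free_step[OF d P(11)]]
      by auto
  have g1': "geodesic n k y (toggle {Suc b} (toggle {a} x)) g1" using g1
    by (simp add: toggle_commute[of a])
  have "osz_word n k x (step x (Suc b) # g) = osz_word n k x (step x (Suc b) # step ?x' a # g1)"
    using step_geodesic_cong[OF P(1) m P(4) P(10) geodesic.Cons[OF V(1) d m'(1) g1] P(11)] .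
  also have "\<dots> = osz_word n k x (step x a # step (toggle {a} x) (Suc b) # g1)"
    using swap_step[OF P(1) m P(4) ma an far(2) geodesicD(1)[OF g1]] .
  also have "\<dots> = \<zero>\<^bsub>osz n k\<^esub>"
  proof -
    \<comment> \<open>The change a has been moved to a - 1, so the interval now starts at a +
      1.\<close>
    have "osz_word n k (toggle {a} x) (step (toggle {a} x) (Suc b) # g1) = \<zero>\<^bsub>osz n k\<^esub>"
    proof (rule IH[of "Suc a"])
      show "d = b - Suc a" using Suc.hyps(2) by simp
      show "{Suc a..b} \<subseteq> dset n (toggle {Suc b} (toggle {a} x)) y"
        using P(9) d unfolding toggle_commute[of "Suc b"] by (auto simp: dset_step)
      show "free (toggle {Suc b} (toggle {a} x))"
        using free_step[OF d P(11)] by (simp add: toggle_commute[of "Suc b"])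
      show "geodesic n k y (toggle {Suc b} (toggle {a} x)) g1" by (rule g1')
    qed (use P Va ab ax in \<open>auto simp: toggle_def\<close>)
    then show ?thesis
      using word_zero_suffix[of n k x "[step x a]" "step (toggle {a} x) (Suc b) # g1"] P ma an Va
        m' geodesicD(1)[OF g1']
      by (simp add: valid_word_step move_step)
  qed
  finally show ?case .
qed

text \<open>Here \<open>R\<^sub>c\<close> commutes with \<open>R\<^sub>b, R\<^sub>b\<^sub>-\<^sub>1, \<dots>\<close> until it meets \<open>R\<^sub>c\<^sub>+\<^sub>1\<close>.\<close>

lemma right_blocked:
  assumes "x \<in> Vset n k" "1 \<le> c" "c < b" "b \<le> n" "c - 1 \<in> x" "c \<notin> x" "{c<..<b} \<subseteq> x" "b \<notin> x"
    "{c<..b} \<subseteq> dset n (toggle {c} x) y" "geodesic n k y (toggle {c} x) g" "free (toggle {c} x)"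
  shows "osz_word n k x (step x c # g) = \<zero>\<^bsub>osz n k\<^esub>"
  using assms
proof (induction b arbitrary: x g)
  case (Suc b x g)
  note IH = Suc.IH and P = Suc.prems
  let ?x' = "toggle {c} x"
  have m: "movable x c" using P by (simp add: movable_def)
  have cn: "c \<le> n" using P by simp
  have V: "?x' \<in> Vset n k" "y \<in> Vset n k" using geodesicD(3,4) P by blast+
  have d: "Suc b \<in> dset n ?x' y" using P by auto
  show ?case
  proof (cases "b = c")
    case True
    have m': "movable ?x' (Suc c)" using P True by (auto simp: movable_def toggle_def)
    have d': "Suc c \<in> dset n ?x' y" "Suc c \<le> n" using d P True by simp_all
    obtain g1 where g1: "geodesic n k y (toggle {Suc c} ?x') g1"
      using geodesic_exists[OF toggle_single_Vset[OF V(1) m' d'(2)] V(2)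
        free_step[OF d'(1) P(11)]] by blast
    have "osz_word n k x (step x c # g) = osz_word n k x (step x c # step ?x' (Suc c) # g1)"
      using step_geodesic_cong[OF P(1) m cn P(10) geodesic.Cons[OF V(1) d'(1) m' g1] P(11)] .
    moreover have a1: "step x c = Rarr c" using P by (simp add: step_def)
    moreover have a2: "step ?x' (Suc c) = Rarr (Suc c)" using P
      by (auto simp: step_def toggle_def)
    ultimately have eq: "osz_word n k x (step x c # g) =
      osz_word n k x ([Rarr c, Rarr (Suc c)] @ g1)" by simp
    have "valid_word n k x (step x c # step ?x' (Suc c) # g1)"
      using P m m' V cn True geodesicD(1)[OF g1] by (simp add: valid_word_step)
    then have ok: "valid_word n k x ([Rarr c, Rarr (Suc c)] @ g1)"
      unfolding a1 a2 by simp
    then have "osz_word n k x [Rarr c, Rarr (Suc c)] = \<zero>\<^bsub>osz n k\<^esub>"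
      using word_zero[of x "[Rarr c, Rarr (Suc c)]"] osz_zero.intros valid_word_append by blast
    then show ?thesis using word_zero_prefix[OF ok] eq by simp
  next
    case False
    then have cb: "c < b" using P by simp
    have bx: "b \<in> x" using P(7) cb by auto
    have mb: "movable x (Suc b)" using bx P by (simp add: movable_def)
    have far: "\<bar>int c - int (Suc b)\<bar> > 1" "\<bar>int (Suc b) - int c\<bar> > 1" using cb by linarith+
    have m': "movable ?x' (Suc b)" "movable (toggle {Suc b} x) c" using movable_far mb m far
      by blast+
    have Vb: "toggle {Suc b} x \<in> Vset n k" using toggle_single_Vset[OF P(1) mb P(4)] .
    obtain g1 where g1: "geodesic n k y (toggle {Suc b} ?x') g1"
      using geodesic_exists[OF toggle_single_Vset[OF V(1) m'(1) P(4)] V(2) free_step[OF d P(11)]]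
        by auto
    have g1': "geodesic n k y (toggle {c} (toggle {Suc b} x)) g1" using g1
      by (simp add: toggle_commute[of c])
    have "osz_word n k x (step x c # g) = osz_word n k x (step x c # step ?x' (Suc b) # g1)"
      using step_geodesic_cong[OF P(1) m cn P(10) geodesic.Cons[OF V(1) d m'(1) g1] P(11)] .
    also have "\<dots> = osz_word n k x (step x (Suc b) # step (toggle {Suc b} x) c # g1)"
      using swap_step[OF P(1) m cn mb P(4) far(1) geodesicD(1)[OF g1]] .
    also have "\<dots> = \<zero>\<^bsub>osz n k\<^esub>"
    proof -
      \<comment> \<open>The change b has been moved to b + 1, so the interval now ends at b.\<close>
      have "osz_word n k (toggle {Suc b} x) (step (toggle {Suc b} x) c # g1) = \<zero>\<^bsub>osz n k\<^esub>"
      proof (rule IH)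
        show "{c<..b} \<subseteq> dset n (toggle {c} (toggle {Suc b} x)) y"
          using P(9) d unfolding toggle_commute[of c] by (auto simp: dset_step)
        show "free (toggle {c} (toggle {Suc b} x))"
          using free_step[OF d P(11)] by (simp add: toggle_commute[of c])
        show "geodesic n k y (toggle {c} (toggle {Suc b} x)) g1" by (rule g1')
        show "{c<..<b} \<subseteq> toggle {Suc b} x" using P(7) by (auto simp: toggle_def)
      qed (use P Vb cb bx in \<open>auto simp: toggle_def\<close>)
      then show ?thesis
        using word_zero_suffix[of n k x "[step x (Suc b)]" "step (toggle {Suc b} x) c # g1"] P mb
          cn Vb m' geodesicD(1)[OF g1']
        by (simp add: valid_word_step move_step)
    qed
    finally show ?thesis .
  qed
qed simp

text \<open>Some interval \<open>{a..b}\<close> crowds \<open>x\<close>, but nothing crowds the next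
  vertex. The position i is not in the interval, since otherwise its remaining signs would crowd the
  next vertex. So i only touches an end, as b + 1 or a - 1, and fills the gap there; these are the
  two blocked situations.\<close>

lemma step_geodesic_zero:
  assumes "x \<in> Vset n k" "movable x i" "i \<le> n" "geodesic n k y (toggle {i} x) g"
    "free (toggle {i} x)"
    "i \<notin> dset n (toggle {i} x) y" "crowded k (dset n x y) x"
  shows "osz_word n k x (step x i # g) = \<zero>\<^bsub>osz n k\<^esub>"
proof -
  let ?x' = "toggle {i} x"
  have i: "i \<in> {1..n}" using assms by (auto simp: movable_def)
  have D: "dset n x y = insert i (dset n ?x' y)" "i \<in> dset n x y"
    using dset_step'[OF assms(6) i] by auto
  obtain a b where ab: "1 \<le> a" "a \<le> b" "{a..b} \<subseteq> dset n x y" "a - 1 \<notin> x" "b \<notin> x" "{a..<b} \<subseteq> x"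
    using crowdedE[OF assms(7) dset_subset assms(1)] by blast
  have V': "?x' \<in> Vset n k" using geodesicD(3)[OF assms(4)] .
  have bn: "b \<le> n" using ab dset_le[of b x] by auto
  have ni: "i \<notin> {a..b}"
  proof
    assume ii: "i \<in> {a..b}"
    obtain T where T: "T \<subseteq> dset n x y" "i \<in> T" "k < card (toggle T x)"
      using ii ab crowded_interval[OF VsetD(3)[OF assms(1)] ab(1,2) _ ab(4,5), of "{a..b}"]
        VsetD(2)[OF assms(1)]
    proof -
      have "toggle {a..b} x = insert (a - 1) (insert b x)"
      proof (rule Set.set_eqI)
        fix j
        show "j \<in> toggle {a..b} x \<longleftrightarrow> j \<in> insert (a - 1) (insert b x)"
          using ab by (cases "j = a - 1"; cases "j = b") (auto simp: toggle_def)
      qed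
      then have "k < card (toggle {a..b} x)"
        using ab VsetD(2,3)[OF assms(1)] by (cases a) simp_all
      then show thesis using that[of "{a..b}"] ab(3) ii by blast
    qed
    have "toggle (T - {i}) ?x' = toggle T x"
      unfolding toggle_toggle using T(2) by (intro arg_cong[where f="\<lambda>S. toggle S x"]) auto
    then have "crowded k (dset n ?x' y) ?x'"
      unfolding crowded_def using T D(1) by (intro exI[of _ "T - {i}"]) auto
    then show False using assms(5) by simp
  qed
  then have sub: "{a..b} \<subseteq> dset n ?x' y" using ab(3) unfolding D(1) by blast
  have not: "\<not> (a - 1 \<notin> ?x' \<and> b \<notin> ?x')"
    using crowded_interval[OF VsetD(3)[OF V'] ab(1,2) sub] assms(5) VsetD(2)[OF V'] by blast
  consider "i = Suc b" | "i = a - 1" "1 \<le> i"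
    using not ab ni i by (auto simp: toggle_def split: if_splits)
  then show ?thesis
  proof cases
    case 1
    have "Suc b \<in> x" using assms(2) ab(5) 1 by (simp add: movable_def)
    then show ?thesis
      using left_blocked[OF assms(1) ab(1,2) _ ab(4,6,5)] assms(3-5) sub unfolding 1 by blast
  next
    case 2
    have "{i<..<b} = {a..<b}" "{i<..b} = {a..b}" using 2 by auto
    then show ?thesis
      using right_blocked[OF assms(1) 2(2), of b g] 2 ab assms sub bn by (auto simp: movable_def)
  qed
qed

text \<open>The step leads away from \<open>y\<close>, so the geodesic behind it may be taken to
  start by undoing it; the two letters make \<open>U_i\<close>.\<close>

lemma step_geodesic_U:
  assumes "x \<in> Vset n k" "movable x i" "i \<le> n" "geodesic n k y (toggle {i} x) g"
    "free (toggle {i} x)"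
    "i \<in> dset n (toggle {i} x) y" "geodesic n k y x g0"
  shows "osz_word n k x (step x i # g) = osz_word n k x (Uarr i # g0)" "free x"
proof -
  let ?x' = "toggle {i} x"
  have V': "?x' \<in> Vset n k" using geodesicD(3)[OF assms(4)] .
  have m: "movable ?x' i" using assms(2) by simp
  show "free x" using free_step[OF assms(6,5)] by simp
  have "geodesic n k y ?x' (step ?x' i # g0)" using geodesic.Cons[OF V' assms(6) m] assms(7)
    by simp
  then have "osz_word n k x (step x i # g) = osz_word n k x (step x i # step ?x' i # g0)"
    using step_geodesic_cong[OF assms(1-4) _ assms(5)] by blast
  also have "\<dots> = osz_word n k x (Uarr i # g0)"
    using step_step[OF assms(1-3) geodesicD(1)[OF assms(7)]] .
  finally show "osz_word n k x (step x i # g) = osz_word n k x (Uarr i # g0)" .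
qed

text \<open>Moving the element \<open>a\<close> of \<open>x\<close> to \<open>a - 1\<close>, along the geodesic or by \<open>U\<^sub>a = L\<^sub>a R\<^sub>a\<close>, shortens the interval
  until some \<open>U\<^sub>b\<close> is applied to a set that contains neither \<open>b - 1\<close> nor \<open>b\<close>.\<close>

lemma Us_geodesic_zero_aux:
  assumes "geodesic n k y x g" "free x" "set us \<subseteq> {1..n}" "1 \<le> a" "a \<le> b"
    "{a..b} \<subseteq> set us \<union> dset n x y" "a - 1 \<notin> x" "b \<notin> x" "{a..<b} \<subseteq> x"
  shows "osz_word n k x (map Uarr us @ g) = \<zero>\<^bsub>osz n k\<^esub>"
  using assms
proof (induction "b - a" arbitrary: x g us a)
  case 0
  note P = 0(2-)
  have ab: "a = b" using 0 by simp
  note V = geodesicD(3)[OF P(1)]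
  have "a \<notin> dset n x y"
    using crowded_single[OF VsetD(3)[OF V] P(4,7)] ab P VsetD(2)[OF V] by auto
  then have a: "a \<in> set us" using P ab by auto
  have ok: "valid_word n k x (map Uarr us @ g)" using geodesicD(1)[OF P(1)] P(3)
    by (simp add: valid_word_Us)
  have eq: "osz_word n k x (map Uarr us @ g) =
    osz_word n k x ([Uarr a] @ map Uarr (remove1 a us) @ g)"
    using U_front[OF a ok] by simp
  have ok': "valid_word n k x ([Uarr a] @ map Uarr (remove1 a us) @ g)"
    using geodesicD(1)[OF P(1)] P(3) a V set_remove1_subset[of a us]
    by (auto simp: valid_word_U valid_word_Us)
  have "osz_word n k x [Uarr a] = \<zero>\<^bsub>osz n k\<^esub>"
    using ok' P ab by (intro word_zero osz_zero.intros) (auto simp: valid_word_U V)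
  then show ?case using word_zero_prefix[OF ok'] eq by simp
next
  case (Suc d)
  note IH = Suc.hyps(1) and P = Suc.prems
  note V = geodesicD(3)[OF P(1)]
  note Vy = geodesicD(4)[OF P(1)]
  have ab: "a < b" using Suc.hyps(2) by simp
  have ax: "a \<in> x" using P(9) ab by auto
  have m: "movable x a" using ax P by (simp add: movable_def)
  let ?x = "toggle {a} x"
  have "a \<in> {a..b}" using ab by simp
  then have "a \<in> set us \<union> dset n x y" using P(6) by blast
  then have an: "a \<in> {1..n}" using P(3) dset_subset by blast
  then have an': "a \<le> n" by simp
  have V': "?x \<in> Vset n k" using toggle_single_Vset[OF V m an'] .
  have m': "movable ?x a" using m by simp
  have step: "osz_word n k ?x (map Uarr vs @ h) = \<zero>\<^bsub>osz n k\<^esub>"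
    if "geodesic n k y ?x h" "free ?x" "set vs \<subseteq> {1..n}" "{Suc a..b} \<subseteq> set vs \<union> dset n ?x y"
      for vs h
  proof (rule IH[of "Suc a"])
    show "d = b - Suc a" using Suc.hyps(2) by simp
  qed (use that P ab ax in \<open>auto simp: toggle_def\<close>)
  show ?case
  proof (cases "a \<in> set us")
    case True
    define vs where "vs = remove1 a us"
    have vs: "set vs \<subseteq> {1..n}" "set us \<subseteq> insert a (set vs)"
      using P(3) set_remove1_subset[of a us] by (auto simp: vs_def) (metis in_set_remove1)
    have ok: "valid_word n k x (map Uarr us @ g)" using geodesicD(1)[OF P(1)] P(3)
      by (simp add: valid_word_Us)
    have okv: "valid_word n k x (map Uarr vs @ g)" using geodesicD(1)[OF P(1)] vs
      by (simp add: valid_word_Us)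
    have okv': "valid_word n k ?x (map Uarr vs @ step ?x a # g)"
      using geodesicD(1)[OF P(1)] vs V' m' an' by (simp add: valid_word_Us valid_word_step)
    have "osz_word n k x (map Uarr us @ g) = osz_word n k x (Uarr a # map Uarr vs @ g)"
      using U_front[OF True ok] by (simp add: vs_def)
    \<comment> \<open>One letter \<open>U_a\<close> is traded for moving the change a to a - 1 and
      back. The way back is pushed behind the other letters \<open>U\<close>; in front of the
      geodesic it yields a new \<open>U_a\<close>, or a longer geodesic, or zero.\<close>
    also have "\<dots> = osz_word n k x (step x a # step ?x a # map Uarr vs @ g)"
      using step_step[OF V m an' okv] by simp
    also have "\<dots> = osz_word n k x ([step x a] @ map Uarr vs @ step ?x a # g)"
      using step_Us[OF V' m' an', of vs g] okv okv' V V' m m' an'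
      by (simp, intro word_cong_Cons) (simp_all add: valid_word_step move_step)
    also have "\<dots> = \<zero>\<^bsub>osz n k\<^esub>"
    proof (rule word_zero_suffix)
      show "valid_word n k x ([step x a] @ map Uarr vs @ step ?x a # g)"
        using okv' V m an' by (simp add: valid_word_step)
      have g: "geodesic n k y (toggle {a} ?x) g" "free (toggle {a} ?x)" using P by simp_all
      have "osz_word n k ?x (map Uarr vs @ step ?x a # g) = \<zero>\<^bsub>osz n k\<^esub>"
      proof (cases "a \<in> dset n x y")
        case True
        obtain g1 where g1: "geodesic n k y ?x g1"
          using geodesic_exists[OF V' Vy free_step[OF True P(2)]] by blast
        have w: "osz_word n k ?x (step ?x a # g) = osz_word n k ?x (Uarr a # g1)"
          using step_geodesic_U(1)[OF V' m' an' g _ g1] True by simp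
        have "osz_word n k ?x (map Uarr vs @ step ?x a # g) =
          osz_word n k ?x (map Uarr vs @ Uarr a # g1)"
          using w okv' geodesicD(1)[OF g1] V' an
            by (intro word_cong_suffix) (simp_all add: valid_word_U)
        also have "\<dots> = osz_word n k ?x (map Uarr (vs @ [a]) @ g1)" by simp
        also have "\<dots> = \<zero>\<^bsub>osz n k\<^esub>"
        proof (rule step[OF g1 free_step[OF True P(2)]])
          have "{Suc a..b} \<subseteq> {a..b} - {a}" by auto
          then show "{Suc a..b} \<subseteq> set (vs @ [a]) \<union> dset n ?x y"
            using P(6) vs(2) unfolding dset_step[OF True] by auto
        qed (use vs an in auto)
        finally show ?thesis .
      next
        case False
        have D: "dset n ?x y = insert a (dset n x y)" using dset_step'[OF False an] .
        show ?thesis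
        proof (cases "free ?x")
          case True
          obtain g1 where g1: "geodesic n k y ?x g1" using geodesic_exists[OF V' Vy True] by blast
          have "geodesic n k y ?x (step ?x a # g)" using geodesic.Cons[OF V' _ m' g(1)] D by blast
          then have "osz_word n k ?x (step ?x a # g) = osz_word n k ?x g1"
            using geodesic_unique g1 True by blast
          then have "osz_word n k ?x (map Uarr vs @ step ?x a # g) =
            osz_word n k ?x (map Uarr vs @ g1)"
            using okv' geodesicD(1)[OF g1] by (intro word_cong_suffix) simp_all
          also have "\<dots> = \<zero>\<^bsub>osz n k\<^esub>"
          proof (rule step[OF g1 True vs(1)])
            have "{Suc a..b} \<subseteq> {a..b} - {a}" by auto
            then show "{Suc a..b} \<subseteq> set vs \<union> dset n ?x y" using P(6) vs(2) unfolding D by blast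
          qed
          finally show ?thesis .
        next
          case nf: False
          then show ?thesis
            using step_geodesic_zero[OF V' m' an' g] False okv'
              by (intro word_zero_suffix) simp_all
        qed
      qed
      then show "osz_word n k (fold move [step x a] x) (map Uarr vs @ step ?x a # g) = \<zero>\<^bsub>osz n k\<^esub>"
        using m by (simp add: move_step)
    qed
    finally show ?thesis .
  next
    case False
    then have d: "a \<in> dset n x y" using \<open>a \<in> set us \<union> dset n x y\<close> by blast
    have fr: "free ?x" using free_step[OF d P(2)] .
    obtain g1 where g1: "geodesic n k y ?x g1" using geodesic_exists[OF V' Vy fr] by blast
    have g: "geodesic n k y x (step x a # g1)" using geodesic.Cons[OF V d m g1] .
    have "osz_word n k x g = osz_word n k x (step x a # g1)"
      using geodesic_unique[OF P(1) g P(2)] .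
    then have "osz_word n k x (map Uarr us @ g) = osz_word n k x (map Uarr us @ step x a # g1)"
      using geodesicD(1)[OF P(1)] geodesicD(1)[OF g] P(3)
        by (intro word_cong_suffix) (simp_all add: valid_word_Us)
    also have "\<dots> = osz_word n k x ([step x a] @ map Uarr us @ g1)"
      using step_Us[OF V m an', of us g1] geodesicD(1)[OF g1] P(3) by (simp add: valid_word_Us)
    also have "\<dots> = \<zero>\<^bsub>osz n k\<^esub>"
    proof (rule word_zero_suffix)
      show "valid_word n k x ([step x a] @ map Uarr us @ g1)"
        using V m an' P(3) geodesicD(1)[OF g1] by (simp add: valid_word_step valid_word_Us)
      show "osz_word n k (fold move [step x a] x) (map Uarr us @ g1) = \<zero>\<^bsub>osz n k\<^esub>"
      proof -
        have "{Suc a..b} \<subseteq> {a..b} - {a}" by auto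
        then have "{Suc a..b} \<subseteq> set us \<union> dset n ?x y" using P(6) unfolding dset_step[OF d]
          by blast
        then show ?thesis using step[OF g1 fr P(3)] m by (simp add: move_step)
      qed
    qed
    finally show ?thesis .
  qed
qed

lemma Us_geodesic_zero:
  assumes "geodesic n k y x g" "free x" "set us \<subseteq> {1..n}" "crowded k (set us \<union> dset n x y) x"
  shows "osz_word n k x (map Uarr us @ g) = \<zero>\<^bsub>osz n k\<^esub>"
proof -
  have "set us \<union> dset n x y \<subseteq> {1..n}" using assms(3) dset_subset by blast
  from crowdedE[OF assms(4) this geodesicD(3)[OF assms(1)]] show ?thesis
    using Us_geodesic_zero_aux[OF assms(1-3)] by metis
qed

end

section \<open>Normal form of words\<close>

fun label_wt :: "label \<Rightarrow> nat \<Rightarrow> nat" where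
  "label_wt (Rarr j) i = of_bool (i = j)"
| "label_wt (Larr j) i = of_bool (i = j)"
| "label_wt (Uarr j) i = 2 * of_bool (i = j)"

text \<open>The exponent of \<open>e_i\<close> in the multi-degree, as a natural number.\<close>

definition wt :: "label list \<Rightarrow> nat \<Rightarrow> nat" where
  "wt ls i = (\<Sum>l\<leftarrow>ls. label_wt l i)"

lemma wt_simps [simp]: "wt [] i = 0" "wt (l # ls) i = label_wt l i + wt ls i"
  "wt (u @ v) i = wt u i + wt v i"
  by (simp_all add: wt_def)

lemma label_wt_step [simp]: "label_wt (step x j) i = of_bool (i = j)"
  by (simp add: step_def)

lemma wt_Us [simp]: "wt (map Uarr us) i = 2 * count (mset us) i"
  by (induction us) auto

lemma arrows_from_labels: "map (\<lambda>a. label_deg (snd a)) (arrows_from x ls) = map label_deg ls"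
  by (induction ls arbitrary: x) auto

lemma path_deg_osz_path: "Poly_Mapping.lookup (path_deg (osz_path x ls)) i = int (wt ls i)"
proof -
  have "path_deg (osz_path x ls) = (\<Sum>l\<leftarrow>ls. label_deg l)"
    unfolding path_deg_def osz_path_def by (simp add: arrows_from_labels)
  moreover have "Poly_Mapping.lookup (\<Sum>l\<leftarrow>ls. label_deg l) i = int (wt ls i)"
  proof (induction ls)
    case (Cons l ls)
    then show ?case by (cases l) (auto simp: lookup_add lookup_single when_def)
  qed simp
  ultimately show ?thesis by simp
qed

lemma dset_toggle_single:
  assumes "movable x j" "j \<le> n"
  shows "i \<in> dset n (toggle {j} x) y \<longleftrightarrow> (i \<in> dset n x y) \<noteq> (i = j)"
proof -
  have "{j} \<subseteq> {1..n}" using assms by (auto simp: movable_def)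
  from dset_toggle[OF this, of x y] show ?thesis by auto
qed

text \<open>Only \<open>R_i\<close> and \<open>L_i\<close> change the sign at i and have weight 1
  there, while \<open>U_i\<close> has weight 2.\<close>

lemma odd_wt:
  assumes "valid_word n k x ls"
  shows "i \<in> dset n x (fold move ls x) \<longleftrightarrow> odd (wt ls i)"
  using assms
proof (induction ls arbitrary: x)
  case (Cons l ls)
  then have "(x, l) \<in> arcs (osz_quiver n k)" "valid_word n k (move l x) ls"
    by (simp_all add: valid_word.simps(2))
  then show ?case
  proof (cases rule: arc_cases)
    case (U j)
    then show ?thesis using Cons.IH[OF \<open>valid_word n k (move l x) ls\<close>] by simp
  next
    case (A j)
    have "i \<in> dset n x (fold move ls (move l x)) \<longleftrightarrow>
      (i \<in> dset n (move l x) (fold move ls (move l x))) \<noteq> (i = j)"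
      using dset_toggle_single[of x j n i] A by auto
    then show ?thesis using Cons.IH[OF \<open>valid_word n k (move l x) ls\<close>] A by auto
  qed
qed simp

lemma wt_range: "valid_word n k x ls \<Longrightarrow> wt ls i \<noteq> 0 \<Longrightarrow> i \<in> {1..n}"
proof (induction ls arbitrary: x)
  case (Cons l ls)
  then have a: "(x, l) \<in> arcs (osz_quiver n k)" "valid_word n k (move l x) ls"
    by (simp_all add: valid_word.simps(2))
  from a(1) show ?case
    by (cases rule: arc_cases) (use Cons.IH[OF a(2)] Cons.prems(2) in \<open>auto split: if_splits\<close>)
qed simp

lemma ex_count: "finite {i. f i \<noteq> (0::nat)} \<Longrightarrow> \<exists>us. \<forall>i. count (mset us) i = f i"
proof -
  assume "finite {i. f i \<noteq> 0}"
  then have "count (Abs_multiset f) = f" by (intro count_Abs_multiset) simp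
  then show ?thesis using ex_mset[of "Abs_multiset f"] by metis
qed

lemma finite_wt: "finite {i. wt ls i \<noteq> 0}"
proof (induction ls)
  case (Cons l ls)
  have "{i. label_wt l i \<noteq> 0} \<subseteq> {case l of Rarr i \<Rightarrow> i | Larr i \<Rightarrow> i | Uarr i \<Rightarrow> i}"
    by (cases l) auto
  then have "finite {i. label_wt l i \<noteq> 0}" by (rule finite_subset) simp
  then have "finite ({i. label_wt l i \<noteq> 0} \<union> {i. wt ls i \<noteq> 0})" using Cons by simp
  then show ?case by (rule rev_finite_subset) auto
qed simp

lemma ex_mset_half: "\<exists>us. \<forall>i. count (mset us) i = wt ls i div 2"
proof (rule ex_count)
  show "finite {i. wt ls i div 2 \<noteq> 0}"
    by (rule finite_subset[OF _ finite_wt[of ls]]) auto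
qed

text \<open>Letters are prepended one at a time. If the tail is crowded, it vanishes and so does the
  word, and crowding is inherited. Otherwise the letter is absorbed by the reduced tail:
  \<open>U\<close> joins the letters \<open>U\<close>, and a step is moved past them to the
  geodesic, where it extends it, turns into a \<open>U\<close>, or gives zero.\<close>

lemma word_normal_form:
  assumes "valid_word n k x ls" "fold move ls x = y"
  shows "crowded k ({i. wt ls i div 2 \<noteq> 0} \<union> dset n x y) x \<Longrightarrow>
           osz_word n k x ls = \<zero>\<^bsub>osz n k\<^esub>"
    and "\<not> crowded k ({i. wt ls i div 2 \<noteq> 0} \<union> dset n x y) x \<Longrightarrow> geodesic n k y x g \<Longrightarrow>
           (\<forall>i. count (mset us) i = wt ls i div 2) \<Longrightarrow>
           osz_word n k x ls = osz_word n k x (map Uarr us @ g)"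
proof -
  let ?E = "\<lambda>ls x. {i. wt ls i div 2 \<noteq> 0} \<union> dset n x y"
  have *: "(crowded k (?E ls x) x \<longrightarrow> osz_word n k x ls = \<zero>\<^bsub>osz n k\<^esub>) \<and>
    (\<not> crowded k (?E ls x) x \<longrightarrow>
      (\<forall>us g. geodesic n k y x g \<and> (\<forall>i. count (mset us) i = wt ls i div 2) \<longrightarrow>
           osz_word n k x ls = osz_word n k x (map Uarr us @ g)))"
    using assms
  proof (induction ls arbitrary: x)
    case Nil
    have y: "y \<in> Vset n k" "x = y" using Nil by auto
    have "\<not> crowded k {} y" using VsetD[OF y(1)] by (auto simp: crowded_def)
    moreover have "g = []" if "geodesic n k y y g" for g using that
      by (cases rule: geodesic.cases) auto
    moreover have "us = []" if "\<forall>i. count (mset us) i = 0" for us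
      using that by (metis count_empty mset_zero_iff multiset_eqI)
    ultimately show ?case using y by auto
  next
    case (Cons l ls)
    let ?x = "move l x"
    have a: "(x, l) \<in> arcs (osz_quiver n k)" and ok: "valid_word n k ?x ls"
      using Cons.prems(1) by (simp_all add: valid_word.simps(2))
    have x: "x \<in> Vset n k" using Cons.prems(1) valid_word_Vset by blast
    have y: "y \<in> Vset n k" using valid_word_target[OF Cons.prems(1)] Cons.prems(2) by simp
    have y': "fold move ls ?x = y" using Cons.prems(2) by simp
    note IH = Cons.IH[OF ok y']
    \<comment> \<open>The sign j changed by the first letter lies in the larger set: it is in the
      difference set, unless it is changed again later, and then its weight is at least 2.\<close>
    have E: "?E ls ?x \<subseteq> ?E (l # ls) x \<and> (crowded k (?E (l # ls) x) ?x \<longleftrightarrow>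
      crowded k (?E (l # ls) x) x)"
      using a
    proof (cases rule: arc_cases)
      case (U j)
      then show ?thesis by auto
    next
      case (A j)
      have odd: "i \<in> dset n (toggle {j} x) y \<longleftrightarrow> odd (wt ls i)" for i
        using odd_wt[OF ok, of i] y' A by simp
      have d: "i \<in> dset n x y \<longleftrightarrow> odd (wt ls i) \<noteq> (i = j)" for i
        using dset_toggle_single[OF A(3), of n i y] A(2) odd[of i] by auto
      have "j \<in> ?E (l # ls) x" using A by (auto simp: d)
      then have "crowded k (?E (l # ls) x) ?x \<longleftrightarrow> crowded k (?E (l # ls) x) x"
        using crowded_toggle[of "{j}"] A by simp
      moreover have "?E ls ?x \<subseteq> ?E (l # ls) x" using A by (auto simp: d odd)
      ultimately show ?thesis by blast
    qed
    show ?case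
    proof (cases "crowded k (?E ls ?x) ?x")
      case True
      then have z: "osz_word n k ?x ls = \<zero>\<^bsub>osz n k\<^esub>" using IH by blast
      have "osz_word n k x (l # ls) = \<zero>\<^bsub>osz n k\<^esub>"
        using word_zero_suffix[of n k x "[l]" ls] Cons.prems(1) z by simp
      moreover have "crowded k (?E (l # ls) x) x" using True E crowded_mono by blast
      ultimately show ?thesis by blast
    next
      case False
      obtain us where us: "\<forall>i. count (mset us) i = wt ls i div 2" using ex_mset_half by blast
      have free': "\<not> crowded k (dset n ?x y) ?x" using False crowded_mono by blast
      have x': "?x \<in> Vset n k" using ok valid_word_Vset by blast
      obtain g where g: "geodesic n k y ?x g" using geodesic_exists[OF x' y free'] by blast
      have eq: "osz_word n k ?x ls = osz_word n k ?x (map Uarr us @ g)" using IH False g us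
        by blast
      have usn: "set us \<subseteq> {1..n}"
      proof
        fix i assume "i \<in> set us"
        then have "wt ls i \<noteq> 0" using us by (metis count_mset_0_iff div_0)
        then show "i \<in> {1..n}" using wt_range[OF ok] by blast
      qed
      have okg: "valid_word n k ?x (map Uarr us @ g)" using geodesicD(1)[OF g] usn
        by (simp add: valid_word_Us)
      have W: "osz_word n k x (l # ls) = osz_word n k x (l # map Uarr us @ g)"
        using word_cong_Cons[OF Cons.prems(1) okg eq] .
      \<comment> \<open>Both claims follow once the word has the normal shape with some geodesic and
        some order of the letters \<open>U\<close>, since neither choice matters.\<close>
      have fin: "(crowded k (?E (l # ls) x) x \<longrightarrow> osz_word n k x (l # ls) = \<zero>\<^bsub>osz n k\<^esub>) \<and>
        (\<not> crowded k (?E (l # ls) x) x \<longrightarrow>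
          (\<forall>us g. geodesic n k y x g \<and> (\<forall>i. count (mset us) i = wt (l # ls) i div 2) \<longrightarrow>
           osz_word n k x (l # ls) = osz_word n k x (map Uarr us @ g)))"
        if w: "osz_word n k x (l # ls) = osz_word n k x (map Uarr vs @ h)"
          and h: "geodesic n k y x h"
          and vs: "\<forall>i. count (mset vs) i = wt (l # ls) i div 2"
            and free: "\<not> crowded k (dset n x y) x" for vs h
      proof (intro conjI impI allI)
        have S: "set vs = {i. wt (l # ls) i div 2 \<noteq> 0}" using vs
          by (metis (mono_tags, lifting) Collect_cong count_mset_0_iff Collect_mem_eq)
        have vsn: "set vs \<subseteq> {1..n}" unfolding S using wt_range[OF Cons.prems(1)]
          by (metis (mono_tags, lifting) div_0 mem_Collect_eq subsetI)
        {
          assume "crowded k (?E (l # ls) x) x"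
          then show "osz_word n k x (l # ls) = \<zero>\<^bsub>osz n k\<^esub>"
            using Us_geodesic_zero[OF h free vsn] w S by simp
        next
          fix us g assume ug: "geodesic n k y x g \<and> (\<forall>i. count (mset us) i = wt (l # ls) i div 2)"
          have "mset us = mset vs" using ug vs by (metis multiset_eqI)
          moreover have "osz_word n k x (map Uarr vs @ h) = osz_word n k x (map Uarr vs @ g)"
            using geodesic_unique[OF h _ free, of g] ug geodesicD(1) h vsn
            by (intro word_cong_suffix) (auto simp: valid_word_Us)
          moreover have "osz_word n k x (map Uarr vs @ g) = osz_word n k x (map Uarr us @ g)"
            using \<open>mset us = mset vs\<close> ug vsn geodesicD(1)[of n k y x g]
              by (intro Us_perm) (auto simp: valid_word_Us)
          ultimately show "osz_word n k x (l # ls) = osz_word n k x (map Uarr us @ g)" using w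
            by simp
        }
      qed
      from a show ?thesis
      proof (cases rule: arc_cases)
        case (U j)
        show ?thesis
        proof (rule fin)
          show "osz_word n k x (l # ls) = osz_word n k x (map Uarr (j # us) @ g)" using W U
            by simp
          show "geodesic n k y x g" using g U by simp
          show "\<forall>i. count (mset (j # us)) i = wt (l # ls) i div 2" using us U by auto
          show "\<not> crowded k (dset n x y) x" using free' U by simp
        qed
      next
        case (A j)
        have jn: "j \<le> n" using A(2) by simp
        have x1: "?x = toggle {j} x" using A by simp
        have odd: "i \<in> dset n (toggle {j} x) y \<longleftrightarrow> odd (wt ls i)" for i
          using odd_wt[OF ok, of i] y' A by simp
        have okj: "valid_word n k x (map Uarr us @ step x j # g)"
          using okg usn x A(3) jn unfolding x1 by (simp add: valid_word_Us valid_word_step)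
        have W2: "osz_word n k x (l # ls) = osz_word n k x (map Uarr us @ step x j # g)"
          using W step_Us[OF x A(3) jn okg[unfolded x1]] unfolding A(1) by simp
        note g' = g[unfolded x1] and free'' = free'[unfolded x1]
        show ?thesis
        proof (cases "j \<in> dset n (toggle {j} x) y")
          case True
          have fr: "\<not> crowded k (dset n x y) x" using free_step[OF True free''] by simp
          obtain h where h: "geodesic n k y x h" using geodesic_exists[OF x y fr] by blast
          have "osz_word n k x (step x j # g) = osz_word n k x (Uarr j # h)"
            using step_geodesic_U(1)[OF x A(3) jn g' free'' True h] .
          then have "osz_word n k x (map Uarr us @ step x j # g) =
            osz_word n k x (map Uarr us @ Uarr j # h)"
            using okj geodesicD(1)[OF h] x A(2)
              by (intro word_cong_suffix) (simp_all add: valid_word_U)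
          then have "osz_word n k x (l # ls) = osz_word n k x (map Uarr (us @ [j]) @ h)" using W2
            by simp
          moreover have "\<forall>i. count (mset (us @ [j])) i = wt (l # ls) i div 2"
            using us A(1) True odd[of j] by (auto elim!: oddE)
          ultimately show ?thesis using fin h fr by blast
        next
          case nd: False
          show ?thesis
          proof (cases "crowded k (dset n x y) x")
            case True
            have "osz_word n k x (step x j # g) = \<zero>\<^bsub>osz n k\<^esub>"
              using step_geodesic_zero[OF x A(3) jn g' free'' nd True] .
            then have "osz_word n k x (l # ls) = \<zero>\<^bsub>osz n k\<^esub>"
              using W2 okj word_zero_suffix[of n k x "map Uarr us" "step x j # g"] by simp
            moreover have "crowded k (?E (l # ls) x) x" using True crowded_mono by blast
            ultimately show ?thesis by blast
          next
            case fr: False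
            have jd: "j \<in> dset n x y" using nd dset_toggle_single[OF A(3) jn, of j y] by simp
            have h: "geodesic n k y x (step x j # g)" using geodesic.Cons[OF x jd A(3) g'] .
            have "\<forall>i. count (mset us) i = wt (l # ls) i div 2"
              using us A(1) nd odd[of j] by auto
            then show ?thesis using fin[OF W2 h _ fr] by blast
          qed
        qed
      qed
    qed
  qed
  show "crowded k (?E ls x) x \<Longrightarrow> osz_word n k x ls = \<zero>\<^bsub>osz n k\<^esub>" using * by blast
  show "\<not> crowded k (?E ls x) x \<Longrightarrow> geodesic n k y x g \<Longrightarrow> (\<forall>i. count (mset us) i = wt ls i div 2) \<Longrightarrow>
    osz_word n k x ls = osz_word n k x (map Uarr us @ g)" using * by blast
qed

section \<open>The polynomial of a path\<close>

text \<open>Rounding down discards the summands \<open>e_i\<close> for the signs in which the ends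
  differ; these are the positions of odd weight.\<close>

definition path_mon :: "(nat set, arrow) path \<Rightarrow> nat \<Rightarrow>\<^sub>0 nat" where
  "path_mon p = Poly_Mapping.map (\<lambda>z. nat (z div 2)) (path_deg p)"

definition crowded_mon :: "nat \<Rightarrow> nat \<Rightarrow> nat set \<Rightarrow> nat set \<Rightarrow> (nat \<Rightarrow>\<^sub>0 nat) \<Rightarrow> bool" where
  "crowded_mon n k x y m \<longleftrightarrow> crowded k (Poly_Mapping.keys m \<union> dset n x y) x"

definition path_poly :: "nat set \<Rightarrow> nat set \<Rightarrow> osz_free \<Rightarrow> mpoly" where
  "path_poly x y = frag_extend (\<lambda>p. if fst p = x \<and> snd (snd p) =
    y then frag_of (path_mon p) else 0)"

definition crowded_poly :: "nat \<Rightarrow> nat \<Rightarrow> nat set \<Rightarrow> nat set \<Rightarrow> mpoly set" where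
  "crowded_poly n k x y = {p \<in> carrier (Zu n). \<forall>m\<in>Poly_Mapping.keys p. crowded_mon n k x y m}"

definition normal_word :: "nat \<Rightarrow> nat \<Rightarrow> nat set \<Rightarrow> nat set \<Rightarrow> (nat \<Rightarrow>\<^sub>0 nat) \<Rightarrow> label list" where
  "normal_word n k x y m = map Uarr (SOME us. \<forall>i. count (mset us) i =
    Poly_Mapping.lookup m i) @ (SOME g. geodesic n k y x g)"

text \<open>A section of \<open>path_poly x y\<close> modulo crowded monomials. These are sent to 0,
  as no geodesic need exist for them.\<close>

definition lift :: "nat \<Rightarrow> nat \<Rightarrow> nat set \<Rightarrow> nat set \<Rightarrow> mpoly \<Rightarrow> osz_free" where
  "lift n k x y = frag_extend (\<lambda>m. if crowded_mon n k x y m then 0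
    else frag_of (osz_path x (normal_word n k x y m)))"

lemma lookup_path_mon: "Poly_Mapping.lookup (path_mon (osz_path x ls)) i = wt ls i div 2"
  by (simp add: path_mon_def Poly_Mapping.map.rep_eq path_deg_osz_path when_def nat_div_distrib)

lemma keys_path_mon: "Poly_Mapping.keys (path_mon (osz_path x ls)) = {i. wt ls i div 2 \<noteq> 0}"
  by (auto simp: in_keys_iff lookup_path_mon)

lemma osz_path_ends [simp]: "fst (osz_path x ls) = x" "snd (snd (osz_path x ls)) = fold move ls x"
  by (simp_all add: osz_path_def)

lemma Zu_simps: "carrier (Zu n) = {p. \<forall>m\<in>Poly_Mapping.keys p. Poly_Mapping.keys m \<subseteq> {1..n}}"
  "monoid.mult (Zu n) = (*)" "one (Zu n) = 1" "zero (Zu n) = 0" "add (Zu n) = (+)"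
  by (simp_all add: Zu_def)

lemma keys_path_mon_range:
  "valid_word n k x ls \<Longrightarrow> Poly_Mapping.keys (path_mon (osz_path x ls)) \<subseteq> {1..n}"
  unfolding keys_path_mon using wt_range
    by (metis (mono_tags, lifting) div_0 mem_Collect_eq subsetI)

definition indicator_exp :: "nat set \<Rightarrow> nat \<Rightarrow>\<^sub>0 nat" where
  "indicator_exp S = (\<Sum>i\<in>S. Poly_Mapping.single i 1)"

lemma umon_indicator_exp:
  assumes "finite S"
  shows "umon S = frag_of (indicator_exp S)"
  unfolding umon_def indicator_exp_def using assms
  by (induction S rule: finite_induct) (auto simp: uvar_def mult_single)

lemma lookup_indicator_exp:
  "finite S \<Longrightarrow> Poly_Mapping.lookup (indicator_exp S) i = (if i \<in> S then 1 else 0)"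
  by (simp add: indicator_exp_def lookup_sum lookup_single when_def)

lemma keys_indicator_exp: "finite S \<Longrightarrow> Poly_Mapping.keys (indicator_exp S) = S"
  by (auto simp: in_keys_iff lookup_indicator_exp split: if_splits)

lemma keys_add_nat: "Poly_Mapping.keys (a + b :: nat \<Rightarrow>\<^sub>0 nat) =
  Poly_Mapping.keys a \<union> Poly_Mapping.keys b"
  by (auto simp: in_keys_iff lookup_add)

lemma umon_Zu: "S \<subseteq> {1..n} \<Longrightarrow> umon S \<in> carrier (Zu n)"
  using finite_subset[of S "{1..n}"] by (simp add: umon_indicator_exp Zu_simps keys_indicator_exp)

lemma Zu_mult: "p \<in> carrier (Zu n) \<Longrightarrow> q \<in> carrier (Zu n) \<Longrightarrow> p * q \<in> carrier (Zu n)"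
proof -
  assume p: "p \<in> carrier (Zu n)" and q: "q \<in> carrier (Zu n)"
  show "p * q \<in> carrier (Zu n)"
    unfolding Zu_simps
  proof safe
    fix m i assume m: "m \<in> Poly_Mapping.keys (p * q)" and i: "i \<in> Poly_Mapping.keys m"
    obtain a b where ab: "m = a + b" "a \<in> Poly_Mapping.keys p" "b \<in> Poly_Mapping.keys q"
      using m keys_mult[of p q] by blast
    have "Poly_Mapping.keys a \<subseteq> {1..n}" "Poly_Mapping.keys b \<subseteq> {1..n}"
      using p q ab unfolding Zu_simps by blast+
    then show "i \<in> {1..n}" using i unfolding ab(1) keys_add_nat by blast
  qed
qed

lemma Zu_diff: "p \<in> carrier (Zu n) \<Longrightarrow> q \<in> carrier (Zu n) \<Longrightarrow> p - q \<in> carrier (Zu n)"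
  using keys_diff[of p q] by (auto simp: Zu_simps)

lemma Zu_add: "p \<in> carrier (Zu n) \<Longrightarrow> q \<in> carrier (Zu n) \<Longrightarrow> p + q \<in> carrier (Zu n)"
  using keys_add[of p q] by (auto simp: Zu_simps)

lemma crowded_poly_diff: "p \<in> crowded_poly n k x y \<Longrightarrow> q \<in> crowded_poly n k x y \<Longrightarrow>
  p - q \<in> crowded_poly n k x y"
  using keys_diff[of p q] Zu_diff[of p n q] by (auto simp: crowded_poly_def)

lemma crowded_poly_add: "p \<in> crowded_poly n k x y \<Longrightarrow> q \<in> crowded_poly n k x y \<Longrightarrow>
  p + q \<in> crowded_poly n k x y"
  using keys_add[of p q] Zu_add[of p n q] by (auto simp: crowded_poly_def)

lemma crowded_poly_0 [simp]: "0 \<in> crowded_poly n k x y"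
  by (simp add: crowded_poly_def Zu_simps)

lemma crowded_poly_sum: "(\<And>i. i \<in> I \<Longrightarrow> f i \<in> crowded_poly n k x y) \<Longrightarrow>
  (\<Sum>i\<in>I. f i) \<in> crowded_poly n k x y"
  by (induction I rule: infinite_finite_induct) (auto intro: crowded_poly_add)

text \<open>\<open>y\<close> arises from \<open>x\<close> by toggling the difference set, which is
  part of the set tested.\<close>

lemma crowded_mon_commute:
  assumes "x \<in> Vset n k" "y \<in> Vset n k"
  shows "crowded_mon n k x y m \<longleftrightarrow> crowded_mon n k y x m"
  using crowded_toggle[of "dset n x y" "Poly_Mapping.keys m \<union> dset n x y" k x] toggle_dset[OF
    assms]
  by (simp add: crowded_mon_def dset_commute[of n y x])

text \<open>The set tested for the product contains both difference sets: a sign changed once is in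
  \<open>dset n x z\<close>, and one changed twice is in the support of \<open>l\<close>. So
  crowding may be tested at \<open>x\<close> or at \<open>y\<close> and is inherited from either
  factor.\<close>

lemma crowded_mon_mult:
  assumes "x \<in> Vset n k" "y \<in> Vset n k" "z \<in> Vset n k"
    "crowded_mon n k x y m \<or> crowded_mon n k y z m'"
    and "Poly_Mapping.keys l = dset n x y \<inter> dset n y z"
  shows "crowded_mon n k x z (l + m + m')"
proof -
  let ?E = "Poly_Mapping.keys (l + m + m') \<union> dset n x z"
  have sub: "dset n x y \<subseteq> ?E" "dset n y z \<subseteq> ?E"
    using assms(5) unfolding keys_add_nat by (auto simp: dset_def)
  have "crowded k ?E y \<longleftrightarrow> crowded k ?E x"
    using crowded_toggle[OF sub(1), of k x] toggle_dset[OF assms(1,2)] by simp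
  moreover have "Poly_Mapping.keys m \<union> dset n x y \<subseteq> ?E" "Poly_Mapping.keys m' \<union> dset n y z \<subseteq> ?E"
    using sub unfolding keys_add_nat by auto
  ultimately show ?thesis
    using assms(4) crowded_mono unfolding crowded_mon_def by blast
qed

lemma crowded_poly_mult:
  assumes "x \<in> Vset n k" "y \<in> Vset n k" "z \<in> Vset n k" "p \<in> carrier (Zu n)" "q \<in> carrier (Zu n)"
    "p \<in> crowded_poly n k x y \<or> q \<in> crowded_poly n k y z"
  shows "umon (dset n x y \<inter> dset n y z) * p * q \<in> crowded_poly n k x z"
proof -
  let ?S = "dset n x y \<inter> dset n y z"
  have S: "umon ?S \<in> carrier (Zu n)" by (rule umon_Zu) (auto simp: dset_def)
  have "crowded_mon n k x z m" if m: "m \<in> Poly_Mapping.keys (umon ?S * p * q)" for m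
  proof -
    obtain a c where 1: "m = a + c" "a \<in> Poly_Mapping.keys (umon ?S * p)"
      "c \<in> Poly_Mapping.keys q"
      using m keys_mult[of "umon ?S * p" q] by blast
    obtain l b where 2: "a = l + b" "l \<in> Poly_Mapping.keys (umon ?S)" "b \<in> Poly_Mapping.keys p"
      using 1(2) keys_mult[of "umon ?S" p] by blast
    have "Poly_Mapping.keys l = ?S" using 2(2)
      by (simp add: umon_indicator_exp keys_indicator_exp)
    then show ?thesis
      using crowded_mon_mult[OF assms(1-3), of b c l] assms(6) 1 2
        by (auto simp: crowded_poly_def)
  qed
  then show ?thesis using Zu_mult[OF Zu_mult[OF S assms(4)] assms(5)]
    by (simp add: crowded_poly_def)
qed

lemma path_poly_0 [simp]: "path_poly x y 0 = 0"
  by (simp add: path_poly_def)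

lemma path_poly_diff: "path_poly x y (a - b) = path_poly x y a - path_poly x y b"
  by (simp add: path_poly_def frag_extend_diff)

lemma path_poly_add: "path_poly x y (a + b) = path_poly x y a + path_poly x y b"
  by (simp add: path_poly_def frag_extend_add)

lemma path_poly_sum: "path_poly x y (\<Sum>i\<in>I. f i) = (\<Sum>i\<in>I. path_poly x y (f i))"
  by (induction I rule: infinite_finite_induct) (auto simp: path_poly_add)

lemma path_poly_osz_path: "path_poly x y (frag_of (osz_path z ls)) =
  (if z = x \<and> fold move ls z = y then frag_of (path_mon (osz_path z ls)) else 0)"
  by (simp add: path_poly_def)

lemma osz_free_induct [consumes 1, case_names zero path diff]:
  assumes "a \<in> carrier (path_algebra (osz_quiver n k))"
    and "P 0" "\<And>x ls. valid_word n k x ls \<Longrightarrow> P (frag_of (osz_path x ls))"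
    and "\<And>a b. P a \<Longrightarrow> P b \<Longrightarrow> P (a - b)"
  shows "P a"
proof -
  have "Poly_Mapping.keys a \<subseteq> paths (osz_quiver n k)" using assms(1) by (simp add: Fr_simps)
  then show ?thesis
    by (induction a rule: frag_induction) (use assms(2-4) in \<open>auto elim!: paths_oszE\<close>)
qed

lemma path_poly_Zu:
  assumes "a \<in> carrier (path_algebra (osz_quiver n k))"
  shows "path_poly x y a \<in> carrier (Zu n)"
  using assms
proof (induction rule: osz_free_induct)
  case (path x' ls)
  then show ?case using keys_path_mon_range[OF path] by (auto simp: path_poly_osz_path Zu_simps)
qed (simp_all add: path_poly_diff Zu_diff, simp add: Zu_simps)

text \<open>This is the multiplication rule of the convolution algebra. For two paths it says that
  half the sum of two weights, rounded down, exceeds the sum of the rounded halves by 1 exactly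
  where both weights are odd, that is where the sign changes and changes back.\<close>

lemma path_poly_mult:
  assumes "a \<in> carrier (path_algebra (osz_quiver n k))"
    "b \<in> carrier (path_algebra (osz_quiver n k))"
    "x \<in> Vset n k" "z \<in> Vset n k"
  shows "path_poly x z (pmul a b) =
    (\<Sum>y\<in>Vset n k. umon (dset n x y \<inter> dset n y z) * path_poly x y a * path_poly y z b)"
  using assms(1)
proof (induction rule: osz_free_induct)
  case (path x' u)
  have u: "valid_word n k x' u" by fact
  let ?y = "fold move u x'"
  show ?case using assms(2)
  proof (induction rule: osz_free_induct)
    case (path y' v)
    have v: "valid_word n k y' v" by fact
    have yV: "?y \<in> Vset n k" using valid_word_target[OF u] .
    let ?t = "\<lambda>y. umon (dset n x y \<inter> dset n y z) * path_poly x y (frag_of (osz_path x' u)) *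
      path_poly y z (frag_of (osz_path y' v))"
    have "(\<Sum>y\<in>Vset n k. ?t y) = ?t ?y"
    proof -
      have "?t y = 0" if "y \<noteq> ?y" for y using that by (simp add: path_poly_osz_path)
      then have "(\<Sum>y\<in>Vset n k. ?t y) = (\<Sum>y\<in>{?y}. ?t y)"
        using yV by (intro sum.mono_neutral_right) (auto simp: finite_Vset)
      then show ?thesis by simp
    qed
    also have "\<dots> = path_poly x z (pmul (frag_of (osz_path x' u)) (frag_of (osz_path y' v)))"
    proof (cases "x' = x \<and> y' = ?y \<and> fold move v ?y = z")
      case False
      then show ?thesis by (auto simp: path_poly_osz_path path_mult_osz)
    next
      case True
      then have x': "x' = x" and y': "y' = ?y" and z: "fold move v ?y = z" by blast+
      have z': "fold move v (fold move u x) = z" using x' z by simp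
      let ?S = "dset n x ?y \<inter> dset n ?y z"
      have "indicator_exp ?S + path_mon (osz_path x u) + path_mon (osz_path ?y v) =
        path_mon (osz_path x (u @ v))"
      proof (rule poly_mapping_eqI)
        fix i
        have 1: "i \<in> dset n x ?y \<longleftrightarrow> odd (wt u i)" using odd_wt[OF u, of i] x' by simp
        have 2: "i \<in> dset n ?y z \<longleftrightarrow> odd (wt v i)" using odd_wt[OF v, of i] y' z by simp
        have "Poly_Mapping.lookup (indicator_exp ?S) i = (if i \<in> ?S then 1 else 0)"
          by (simp add: lookup_indicator_exp)
        moreover have "(if odd a \<and> odd b then 1 else 0) + a div 2 + b div 2 = (a + b) div 2"
          for a b :: nat
          by (auto elim!: oddE evenE)
        ultimately show "Poly_Mapping.lookup (indicator_exp ?S + path_mon (osz_path x u) +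
          path_mon (osz_path ?y v)) i
           = Poly_Mapping.lookup (path_mon (osz_path x (u @ v))) i"
          by (simp add: lookup_add lookup_path_mon 1 2)
      qed
      moreover have "?t ?y = frag_of (indicator_exp ?S + path_mon (osz_path x u) +
        path_mon (osz_path ?y v))"
        using x' y' z' by (simp add: path_poly_osz_path umon_indicator_exp mult_single)
      moreover have "path_poly x z (pmul (frag_of (osz_path x' u)) (frag_of (osz_path y' v))) =
        frag_of (path_mon (osz_path x (u @ v)))"
        using x' y' z' by (simp add: path_mult_osz path_poly_osz_path)
      ultimately show ?thesis by simp
    qed
    finally show ?case by simp
  qed (simp_all add: pmul_diff path_poly_diff right_diff_distrib sum_subtractf)
qed (simp_all add: pmul_diff path_poly_diff right_diff_distrib left_diff_distrib sum_subtractf)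

context
  fixes n k :: nat
begin

lemma count_normal_word:
  "count (mset (SOME us. \<forall>i. count (mset us) i = Poly_Mapping.lookup m i)) i =
    Poly_Mapping.lookup m i"
proof -
  have "finite {i. Poly_Mapping.lookup m i \<noteq> 0}" by simp
  then have "\<exists>us. \<forall>i. count (mset us) i = Poly_Mapping.lookup m i" by (rule ex_count)
  from someI_ex[OF this] show ?thesis by blast
qed

lemma normal_word:
  assumes "x \<in> Vset n k" "y \<in> Vset n k" "\<not> crowded_mon n k x y m" "Poly_Mapping.keys m \<subseteq> {1..n}"
  shows "valid_word n k x (normal_word n k x y m)" "fold move (normal_word n k x y m) x = y"
    "path_mon (osz_path x (normal_word n k x y m)) = m"
proof -
  have free: "\<not> crowded k (dset n x y) x" using assms(3) crowded_mono unfolding crowded_mon_def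
    by blast
  define g where "g = (SOME g. geodesic n k y x g)"
  define us where "us = (SOME us. \<forall>i. count (mset us) i = Poly_Mapping.lookup m i)"
  have g: "geodesic n k y x g" unfolding g_def
    using someI_ex[OF geodesic_exists[OF assms(1,2) free]] .
  have us: "count (mset us) i = Poly_Mapping.lookup m i" for i unfolding us_def
    by (rule count_normal_word)
  have nf: "normal_word n k x y m = map Uarr us @ g" by (simp add: normal_word_def g_def us_def)
  have "set us = Poly_Mapping.keys m"
    by (rule Set.set_eqI) (simp add: in_keys_iff flip: us)
  then show "valid_word n k x (normal_word n k x y m)" "fold move (normal_word n k x y m) x = y"
    using geodesicD[OF g] assms(4) by (simp_all add: nf valid_word_Us)
  have cg: "wt g i = (if i \<in> dset n x y then 1 else 0)" for i
    using g
  proof (induction rule: geodesic.induct)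
    case (Cons x i' ls)
    then show ?case by (simp add: dset_step)
  qed simp
  show "path_mon (osz_path x (normal_word n k x y m)) = m"
    by (rule poly_mapping_eqI) (simp add: lookup_path_mon nf us cg)
qed

lemma word_normal_word:
  assumes "valid_word n k x ls" "fold move ls x = y"
  shows "osz_word n k x ls = osz_class n k (lift n k x y (frag_of (path_mon (osz_path x ls))))"
proof (cases "crowded_mon n k x y (path_mon (osz_path x ls))")
  case True
  then show ?thesis
    using word_normal_form(1)[OF assms]
      by (simp add: lift_def osz_class_0 crowded_mon_def keys_path_mon)
next
  case False
  define m where "m = path_mon (osz_path x ls)"
  have V: "x \<in> Vset n k" "y \<in> Vset n k" using assms valid_word_Vset valid_word_target by blast+
  have free: "\<not> crowded k (dset n x y) x" using False crowded_mono unfolding crowded_mon_def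
    by blast
  have g: "geodesic n k y x (SOME g. geodesic n k y x g)"
    using someI_ex[OF geodesic_exists[OF V free]] .
  have "osz_word n k x ls = osz_word n k x (normal_word n k x y m)"
    unfolding normal_word_def
    using word_normal_form(2)[OF assms _ g] False count_normal_word[of m]
    by (simp add: crowded_mon_def keys_path_mon m_def lookup_path_mon)
  then show ?thesis using False by (simp add: lift_def m_def)
qed

lemma lift_diff: "lift n k x y (p - q) = lift n k x y p - lift n k x y q"
  by (simp add: lift_def frag_extend_diff)

lemma lift_0 [simp]: "lift n k x y 0 = 0"
  by (simp add: lift_def)

lemma lift_crowded_poly: "p \<in> crowded_poly n k x y \<Longrightarrow> lift n k x y p = 0"
  unfolding lift_def by (rule frag_extend_eq_0) (auto simp: crowded_poly_def)

lemma keys_lift: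
  assumes "x \<in> Vset n k" "y \<in> Vset n k" "p \<in> carrier (Zu n)"
    "q \<in> Poly_Mapping.keys (lift n k x y p)"
  obtains m where "m \<in> Poly_Mapping.keys p" "\<not> crowded_mon n k x y m"
    "q = osz_path x (normal_word n k x y m)"
    "Poly_Mapping.keys m \<subseteq> {1..n}"
proof -
  obtain m where m: "m \<in> Poly_Mapping.keys p"
    "q \<in> Poly_Mapping.keys (if crowded_mon n k x y m then 0
      else frag_of (osz_path x (normal_word n k x y m)))"
    using subsetD[OF keys_frag_extend assms(4)[unfolded lift_def]] by blast
  have "Poly_Mapping.keys m \<subseteq> {1..n}" using assms(3) m(1) unfolding Zu_simps by blast
  moreover have "\<not> crowded_mon n k x y m" "q = osz_path x (normal_word n k x y m)"
    using m(2) by (auto split: if_splits)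
  ultimately show thesis using that[of m] m(1) by blast
qed

lemma lift_closed:
  assumes "x \<in> Vset n k" "y \<in> Vset n k" "p \<in> carrier (Zu n)"
  shows "lift n k x y p \<in> carrier (Fr n k)"
proof -
  have "q \<in> paths (osz_quiver n k)" if "q \<in> Poly_Mapping.keys (lift n k x y p)" for q
    using keys_lift[OF assms that] normal_word(1)[OF assms(1,2)] osz_path_in_paths by metis
  then show ?thesis by (auto simp: Fr_simps)
qed

lemma Fr_diff: "a \<in> carrier (Fr n k) \<Longrightarrow> b \<in> carrier (Fr n k) \<Longrightarrow> a - b \<in> carrier (Fr n k)"
  using keys_diff[of a b] by (auto simp: Fr_simps)

lemma Fr_add: "a \<in> carrier (Fr n k) \<Longrightarrow> b \<in> carrier (Fr n k) \<Longrightarrow> a + b \<in> carrier (Fr n k)"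
  using keys_add[of a b] by (auto simp: Fr_simps)

lemma Fr_0 [simp]: "0 \<in> carrier (Fr n k)"
  by (simp add: Fr_simps)

lemma Fr_sum: "(\<And>i. i \<in> I \<Longrightarrow> f i \<in> carrier (Fr n k)) \<Longrightarrow> (\<Sum>i\<in>I. f i) \<in> carrier (Fr n k)"
  by (induction I rule: infinite_finite_induct) (auto intro: Fr_add)

lemma osz_ideal_diff: "a \<in> osz_ideal n k \<Longrightarrow> b \<in> osz_ideal n k \<Longrightarrow> a - b \<in> osz_ideal n k"
proof -
  assume a: "a \<in> osz_ideal n k" and b: "b \<in> osz_ideal n k"
  interpret I: ideal "osz_ideal n k" "path_algebra (osz_quiver n k)" by (rule ideal_osz)
  have "a \<in> carrier (Fr n k)" "b \<in> carrier (Fr n k)" using a b I.Icarr by blast+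
  have "osz_class n k b = osz_class n k 0"
    using b osz_class_eq_iff[of b n k 0] \<open>b \<in> carrier (Fr n k)\<close> by simp
  moreover have "osz_class n k a = osz_class n k 0"
    using a osz_class_eq_iff[of a n k 0] \<open>a \<in> carrier (Fr n k)\<close> by simp
  ultimately show "a - b \<in> osz_ideal n k"
    using osz_class_eq_iff[of a n k b] \<open>a \<in> carrier (Fr n k)\<close> \<open>b \<in> carrier (Fr n k)\<close> by simp
qed

text \<open>The spanning half of the comparison: modulo the relations, an element can be rebuilt
  from its polynomials by normal words.\<close>

lemma osz_class_expansion:
  assumes "a \<in> carrier (Fr n k)"
  shows "a - (\<Sum>x\<in>Vset n k. \<Sum>y\<in>Vset n k. lift n k x y (path_poly x y a)) \<in> osz_ideal n k"
  using assms
proof (induction rule: osz_free_induct)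
  case zero
  show ?case
    using additive_subgroup.zero_closed[OF ideal.axioms(1)[OF ideal_osz[of n k]]]
      by (simp add: Fr_simps)
next
  case (path x ls)
  let ?y = "fold move ls x" and ?p = "frag_of (osz_path x ls)"
  have V: "x \<in> Vset n k" "?y \<in> Vset n k" using path valid_word_Vset valid_word_target by blast+
  have "(\<Sum>x'\<in>Vset n k. \<Sum>y'\<in>Vset n k. lift n k x' y' (path_poly x' y' ?p)) =
    (\<Sum>x'\<in>Vset n k. \<Sum>y'\<in>Vset n k. if x' = x \<and> y' = ?y then lift n k x ?y (path_poly x ?y ?p) else
      0)"
    by (intro sum.cong refl) (auto simp: path_poly_osz_path)
  also have "\<dots> = (\<Sum>x'\<in>Vset n k. if x' = x then lift n k x ?y (path_poly x ?y ?p) else 0)"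
    using V finite_Vset by (intro sum.cong refl) (simp cong: if_cong)
  also have "\<dots> = lift n k x ?y (path_poly x ?y ?p)" using V finite_Vset by simp
  also have "\<dots> = lift n k x ?y (frag_of (path_mon (osz_path x ls)))"
    by (simp add: path_poly_osz_path)
  finally have eq: "(\<Sum>x'\<in>Vset n k. \<Sum>y'\<in>Vset n k. lift n k x' y' (path_poly x' y' ?p)) =
    lift n k x ?y (frag_of (path_mon (osz_path x ls)))" .
  have "frag_of (path_mon (osz_path x ls)) \<in> carrier (Zu n)"
    using keys_path_mon_range[OF path] by (simp add: Zu_simps)
  then show ?case
    unfolding eq using word_normal_word[OF path refl] osz_class_eq_iff frag_of_osz_path[OF path]
      lift_closed[OF V] by blast
next
  case (diff a b)
  have eq: "a - b - (\<Sum>x\<in>Vset n k. \<Sum>y\<in>Vset n k. lift n k x y (path_poly x y (a - b))) =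
     (a - (\<Sum>x\<in>Vset n k. \<Sum>y\<in>Vset n k. lift n k x y (path_poly x y a))) -
     (b - (\<Sum>x\<in>Vset n k. \<Sum>y\<in>Vset n k. lift n k x y (path_poly x y b)))"
    by (simp add: path_poly_diff lift_diff sum_subtractf)
  show ?case unfolding eq using osz_ideal_diff[OF diff] .
qed

section \<open>The ideal of relations in terms of polynomials\<close>

definition "path_poly_kernel =
  {a \<in> carrier (Fr n k). \<forall>x\<in>Vset n k. \<forall>y\<in>Vset n k. path_poly x y a \<in> crowded_poly n k x y}"

lemma ideal_path_poly_kernel: "ideal path_poly_kernel (Fr n k)"
proof (rule idealI[OF ring_Fr])
  interpret F: ring "path_algebra (osz_quiver n k)" by (rule ring_Fr)
  show "subgroup path_poly_kernel (add_monoid (Fr n k))"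
  proof (rule F.add.subgroupI)
    show "path_poly_kernel \<subseteq> carrier (Fr n k)" by (auto simp: path_poly_kernel_def)
    have "0 \<in> path_poly_kernel" by (simp add: path_poly_kernel_def)
    then show "path_poly_kernel \<noteq> {}" by blast
  next
    fix a assume a: "a \<in> path_poly_kernel"
    have "- a \<in> path_poly_kernel"
      using a crowded_poly_diff[OF crowded_poly_0, of "path_poly _ _ a"] Fr_diff[OF Fr_0, of a]
      by (auto simp: path_poly_kernel_def path_poly_diff[of _ _ 0 a, simplified])
    moreover have "\<ominus>\<^bsub>Fr n k\<^esub> a = - a" using a \<open>- a \<in> path_poly_kernel\<close>
      by (intro F.minus_equality) (auto simp: path_poly_kernel_def Fr_simps)
    ultimately show "\<ominus>\<^bsub>Fr n k\<^esub> a \<in> path_poly_kernel" by simp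
  next
    fix a b assume "a \<in> path_poly_kernel" "b \<in> path_poly_kernel"
    then show "a \<oplus>\<^bsub>Fr n k\<^esub> b \<in> path_poly_kernel"
      using Fr_add[of a b] by (auto simp: path_poly_kernel_def path_poly_add crowded_poly_add
        Fr_simps(3))
  qed
next
  fix a b assume a: "a \<in> path_poly_kernel" and b: "b \<in> carrier (Fr n k)"
  have aF: "a \<in> carrier (Fr n k)" using a by (simp add: path_poly_kernel_def)
  show "b \<otimes>\<^bsub>Fr n k\<^esub> a \<in> path_poly_kernel" "a \<otimes>\<^bsub>Fr n k\<^esub> b \<in> path_poly_kernel"
    using ring.ring_simprules(5)[OF ring_Fr, of b n k a] ring.ring_simprules(5)[OF ring_Fr, of a n
      k b] a b aF path_poly_Zu[OF b] path_poly_Zu[OF aF]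
    unfolding path_poly_kernel_def Fr_simps(2)
    by (auto simp: path_poly_mult[OF b aF] path_poly_mult[OF aF b] intro!: crowded_poly_sum
      crowded_poly_mult)
qed

text \<open>The two sides of an equality have the same weights. The parities of the weights and the
  start determine the end of a path, so the polynomials agree. A word declared zero involves a
  position i with neither i - 1 nor i in \<open>x\<close>, so its monomial is crowded.\<close>

lemma relations_path_poly_kernel: "osz_relations n k \<subseteq> path_poly_kernel"
proof
  fix r assume "r \<in> osz_relations n k"
  then consider (eq) x v w where "r = frag_of (osz_path x v) - frag_of (osz_path x w)"
    "osz_eq v w"
      "valid_word n k x v" "valid_word n k x w"
    | (zero) x w where "r = frag_of (osz_path x w)" "osz_zero x w" "valid_word n k x w"
    unfolding osz_relations_def by (auto simp: osz_path_in_paths)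
  then show "r \<in> path_poly_kernel"
  proof cases
    case eq
    have c: "wt v i = wt w i" for i using eq(2) by cases auto
    then have m: "path_mon (osz_path x v) = path_mon (osz_path x w)"
      by (intro poly_mapping_eqI) (simp add: lookup_path_mon)
    have d: "dset n x (fold move v x) = dset n x (fold move w x)"
      using odd_wt[OF eq(3)] odd_wt[OF eq(4)] c by auto
    have "fold move v x = toggle (dset n x (fold move v x)) x"
      by (rule sym[OF toggle_dset[OF valid_word_Vset[OF eq(3)] valid_word_target[OF eq(3)]]])
    also have "\<dots> = toggle (dset n x (fold move w x)) x" by (simp only: d)
    also have "\<dots> = fold move w x"
      by (rule toggle_dset[OF valid_word_Vset[OF eq(4)] valid_word_target[OF eq(4)]])
    finally have t: "fold move v x = fold move w x" .
    have "path_poly x' y' r = 0" for x' y' unfolding eq(1) path_poly_diff path_poly_osz_path m t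
      by simp
    then show ?thesis using Fr_diff frag_of_osz_path eq(3,4)
      by (simp add: path_poly_kernel_def eq(1))
  next
    case zero
    have V: "x \<in> Vset n k" using zero valid_word_Vset by blast
    have "crowded_mon n k x (fold move w x) (path_mon (osz_path x w))"
    proof -
      have *: "crowded k ({i. wt w i div 2 \<noteq> 0} \<union> dset n x (fold move w x)) x"
        if "i - 1 \<notin> x" "i \<notin> x" "i \<in> {1..n}" "wt w i \<noteq> 0" for i
      proof -
        have "i \<in> {i. wt w i div 2 \<noteq> 0} \<union> dset n x (fold move w x)"
          using that odd_wt[OF zero(3), of i] by (auto elim: oddE) 
        then show ?thesis
          using crowded_single[OF VsetD(3)[OF V] _ that(1,2)] that(3) VsetD(2)[OF V] by auto
      qed
      from zero(2) show ?thesis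
      proof cases
        case (1 i)
        then have a: "(x, Rarr i) \<in> arcs (osz_quiver n k)"
          "(move (Rarr i) x, Rarr (Suc i)) \<in> arcs (osz_quiver n k)"
          using zero(3) by (simp_all add: valid_word.simps(2))
        \<comment> \<open>The position is i + 1: \<open>R_i\<close> requires i not to be in
          \<open>x\<close>, and the following \<open>R_{i+1}\<close> requires the same of i +
          1.\<close>
        have "i \<notin> x" "Suc i \<notin> x" "Suc i \<in> {1..n}"
          using a by (auto simp: arc_Rarr)
        then show ?thesis using *[of "Suc i"] 1 by (simp add: crowded_mon_def keys_path_mon)
      next
        case (2 i)
        then have a: "(x, Larr (Suc i)) \<in> arcs (osz_quiver n k)"
          "(move (Larr (Suc i)) x, Larr i) \<in> arcs (osz_quiver n k)"
          using zero(3) by (simp_all add: valid_word.simps(2))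
        have "i - 1 \<notin> x" "i \<notin> x" "i \<in> {1..n}"
          using a by (auto simp: arc_Larr)
        then show ?thesis using *[of i] 2 by (simp add: crowded_mon_def keys_path_mon)
      next
        case (3 i)
        then have a: "(x, Uarr i) \<in> arcs (osz_quiver n k)"
          using zero(3) by (simp add: valid_word.simps(2))
        then have "i \<in> {1..n}" by (simp add: arc_Uarr)
        then show ?thesis using *[of i] 3 by (auto simp: crowded_mon_def keys_path_mon)
      qed
    qed
    then have "path_poly x' y' r \<in> crowded_poly n k x' y'" for x' y'
      using keys_path_mon_range[OF zero(3)]
        by (auto simp: zero(1) path_poly_osz_path crowded_poly_def Zu_simps)
    then show ?thesis using frag_of_osz_path[OF zero(3)]
      by (simp add: path_poly_kernel_def zero(1))
  qed
qed

text \<open>The kernel is an ideal containing the relations; conversely an element of it has the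
  expansion 0 in normal words. Membership in the ideal becomes a condition on monomials, from which
  injectivity of the comparison map and compatibility with path reversal are read off.\<close>

lemma osz_ideal_eq: "osz_ideal n k =
  {a \<in> carrier (Fr n k). \<forall>x\<in>Vset n k. \<forall>y\<in>Vset n k. path_poly x y a \<in> crowded_poly n k x y}"
proof -
  have "osz_ideal n k \<subseteq> path_poly_kernel"
    unfolding osz_ideal_def using ring.genideal_minimal[OF ring_Fr ideal_path_poly_kernel
      relations_path_poly_kernel] .
  moreover have "path_poly_kernel \<subseteq> osz_ideal n k"
  proof
    fix a assume a: "a \<in> path_poly_kernel"
    then have "(\<Sum>x\<in>Vset n k. \<Sum>y\<in>Vset n k. lift n k x y (path_poly x y a)) = 0"
      by (intro sum.neutral ballI) (auto simp: path_poly_kernel_def lift_crowded_poly)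
    moreover have "a \<in> carrier (Fr n k)" using a by (simp add: path_poly_kernel_def)
    ultimately show "a \<in> osz_ideal n k" using osz_class_expansion[of a] by simp
  qed
  ultimately show ?thesis by (auto simp: path_poly_kernel_def)
qed

lemma path_poly_lift:
  assumes "x \<in> Vset n k" "y \<in> Vset n k" "p \<in> carrier (Zu n)"
  shows "path_poly x y (lift n k x y p) - p \<in> crowded_poly n k x y"
    and "(x', y') \<noteq> (x, y) \<Longrightarrow> path_poly x' y' (lift n k x y p) = 0"
proof -
  have "Poly_Mapping.keys p \<subseteq> {m. Poly_Mapping.keys m \<subseteq> {1..n}}" using assms(3)
    by (auto simp: Zu_simps)
  then have "path_poly x y (lift n k x y p) - p \<in> crowded_poly n k x y \<and> ((x', y') \<noteq> (x, y) \<longrightarrow>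
    path_poly x' y' (lift n k x y p) = 0)"
  proof (induction p rule: frag_induction)
    case (one m)
    then have m: "Poly_Mapping.keys m \<subseteq> {1..n}" by simp
    show ?case
    proof (cases "crowded_mon n k x y m")
      case True
      then have "frag_of m \<in> crowded_poly n k x y" using m
        by (simp add: crowded_poly_def Zu_simps)
      then show ?thesis using True crowded_poly_diff[OF crowded_poly_0] by (auto simp: lift_def)
    next
      case False
      have "lift n k x y (frag_of m) = frag_of (osz_path x (normal_word n k x y m))" using False
        by (simp add: lift_def)
      then show ?thesis using normal_word[OF assms(1,2) False m]
        by (auto simp: path_poly_osz_path)
    qed
  next
    case (diff a b)
    have "path_poly x y (lift n k x y (a - b)) - (a - b) =
      (path_poly x y (lift n k x y a) - a) - (path_poly x y (lift n k x y b) - b)"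
      by (simp add: lift_diff path_poly_diff)
    moreover have "path_poly x' y' (lift n k x y (a - b)) =
      path_poly x' y' (lift n k x y a) - path_poly x' y' (lift n k x y b)"
      by (simp add: lift_diff path_poly_diff)
    ultimately show ?case using diff crowded_poly_diff by (metis diff_zero)
  qed simp
  then show "path_poly x y (lift n k x y p) - p \<in> crowded_poly n k x y"
    and "(x', y') \<noteq> (x, y) \<Longrightarrow> path_poly x' y' (lift n k x y p) = 0" by blast+
qed

end

section \<open>Sign patterns in subspaces with positive minors\<close>

definition minor :: "real mat \<Rightarrow> nat set \<Rightarrow> real" where
  "minor A J = det (submatrix A UNIV J)"

text \<open>The Laplace expansion of the minor with columns \<open>J\<close> of the matrix
  \<open>A\<close> with the row \<open>y\<close> put on top; \<open>J\<close> is meant to have one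
  element more than \<open>A\<close> has rows.\<close>

definition bordered :: "real mat \<Rightarrow> (nat \<Rightarrow> real) \<Rightarrow> nat set \<Rightarrow> real" where
  "bordered A y J = (\<Sum>i\<in>J. (-1) ^ card (J \<inter> {..<i}) * y i * minor A (J - {i}))"

lemma card_pick_less: "c < card J \<Longrightarrow> card (J \<inter> {..<pick J c}) = c"
  using card_pick[of c J] by (simp add: Int_def lessThan_def)

lemma pick_card_less: "i \<in> J \<Longrightarrow> pick J (card (J \<inter> {..<i})) = i"
  using pick_card_in_set[of i J] by (simp add: Int_def lessThan_def)

lemma card_less_card: "finite J \<Longrightarrow> (i :: nat) \<in> J \<Longrightarrow> card (J \<inter> {..<i}) < card J"
proof (rule psubset_card_mono)
  assume "i \<in> J"
  moreover have "i \<notin> J \<inter> {..<i}" by simp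
  ultimately show "J \<inter> {..<i} \<subset> J" by blast
qed

lemma bij_betw_pick:
  assumes "finite J" "card J = m"
  shows "bij_betw (pick J) {..<m} J"
  by (rule bij_betw_byWitness[where f' = "\<lambda>i. card (J \<inter> {..<i})"])
    (use assms in \<open>auto simp: card_pick_less pick_card_less card_less_card pick_in_set_le\<close>)

lemma pick_remove:
  assumes "finite J" "c < card J" "d < card J - 1"
  shows "pick (J - {pick J c}) d = pick J (if d < c then d else Suc d)"
proof -
  let ?e = "if d < c then d else Suc d"
  have e: "?e < card J" "?e \<noteq> c" using assms by auto
  have inj: "inj_on (pick J) {..<card J}" using bij_betw_pick[OF assms(1) refl]
    by (simp add: bij_betw_def)
  have ne: "pick J ?e \<noteq> pick J c" using inj_onD[OF inj, of ?e c] e assms(2) by auto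
  have mem: "pick J ?e \<in> J - {pick J c}" using ne pick_in_set_le[OF e(1)] by blast
  have "card ((J - {pick J c}) \<inter> {..<pick J ?e}) = d"
  proof (cases "d < c")
    case True
    then have "pick J d < pick J c" using pick_mono_le[OF assms(2)] by blast
    then have "(J - {pick J c}) \<inter> {..<pick J d} = J \<inter> {..<pick J d}" by auto
    then show ?thesis using True card_pick_less[of d J] e by simp
  next
    case False
    then have "pick J c < pick J (Suc d)" using pick_mono_le[of "Suc d" J c] assms by auto
    then have "pick J c \<in> J \<inter> {..<pick J (Suc d)}" using pick_in_set_le[OF assms(2)] by simp
    moreover have "(J - {pick J c}) \<inter> {..<pick J (Suc d)} = J \<inter> {..<pick J (Suc d)} - {pick J c}"
      by auto
    ultimately show ?thesis using False card_pick_less[of "Suc d" J] e assms(1) by simp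
  qed
  then show ?thesis using pick_card_less[OF mem] by simp
qed

lemma submatrix_UNIV_cols:
  assumes "A \<in> carrier_mat m N" "J \<subseteq> {0..<N}"
  shows "submatrix A UNIV J = mat m (card J) (\<lambda>(r, c). A $$ (r, pick J c))"
proof -
  have "{j. j < dim_col A \<and> j \<in> J} = J" using assms by auto
  then show ?thesis using assms(1) by (simp add: submatrix_def pick_UNIV)
qed

lemma bordered_det:
  assumes "A \<in> carrier_mat m N" "J \<subseteq> {0..<N}" "card J = Suc m"
  shows "bordered A y J = det (mat (Suc m) (Suc m)
     (\<lambda>(r, c). if r = 0 then y (pick J c) else A $$ (r - 1, pick J c)))"
proof -
  let ?M = "mat (Suc m) (Suc m) (\<lambda>(r, c). if r = 0 then y (pick J c) else A $$ (r - 1, pick J c))"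
  have fin: "finite J" using assms(2) finite_subset by blast
  have "det ?M = (\<Sum>c<Suc m. ?M $$ (0, c) * cofactor ?M 0 c)"
    by (rule laplace_expansion_row) simp_all
  also have "\<dots> = (\<Sum>c<Suc m. (-1) ^ card (J \<inter> {..<pick J c}) * y (pick J c) * minor A (J -
    {pick J c}))"
  proof (rule sum.cong[OF refl])
    fix c assume "c \<in> {..<Suc m}"
    then have c: "c < Suc m" by simp
    have card: "card (J - {pick J c}) = m"
      using pick_in_set_le[of c J] assms(3) c fin by simp
    have "mat_delete ?M 0 c = submatrix A UNIV (J - {pick J c})"
    proof (rule eq_matI)
      have s: "submatrix A UNIV (J - {pick J c}) =
        mat m m (\<lambda>(r, c'). A $$ (r, pick (J - {pick J c}) c'))"
        using submatrix_UNIV_cols[OF assms(1), of "J - {pick J c}"] assms(2) card by auto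
      show "dim_row (mat_delete ?M 0 c) = dim_row (submatrix A UNIV (J - {pick J c}))"
        "dim_col (mat_delete ?M 0 c) = dim_col (submatrix A UNIV (J - {pick J c}))"
        by (simp_all add: s mat_delete_def)
      fix r d assume "r < dim_row (submatrix A UNIV (J - {pick J c}))"
        "d < dim_col (submatrix A UNIV (J - {pick J c}))"
      then have rd: "r < m" "d < m" by (simp_all add: s)
      show "mat_delete ?M 0 c $$ (r, d) = submatrix A UNIV (J - {pick J c}) $$ (r, d)"
        using rd c pick_remove[OF fin, of c d] assms(3) by (simp add: s mat_delete_def)
    qed
    then show "?M $$ (0, c) * cofactor ?M 0 c =
      (-1) ^ card (J \<inter> {..<pick J c}) * y (pick J c) * minor A (J - {pick J c})"
      using c assms(3) by (simp add: cofactor_def minor_def card_pick_less)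
  qed
  also have "\<dots> = bordered A y J"
    unfolding bordered_def by (rule sum.reindex_bij_betw[OF bij_betw_pick[OF fin assms(3)]])
  finally show ?thesis by simp
qed

lemma bordered_cong: "(\<And>i. i \<in> J \<Longrightarrow> y i = z i) \<Longrightarrow> bordered A y J = bordered A z J"
  by (simp add: bordered_def)

lemma bordered_add: "bordered A (\<lambda>i. y i + z i) J = bordered A y J + bordered A z J"
  by (simp add: bordered_def algebra_simps sum.distrib)

lemma bordered_smult: "bordered A (\<lambda>i. c * y i) J = c * bordered A y J"
  by (simp add: bordered_def algebra_simps sum_distrib_left)

lemma bordered_sum: "bordered A (\<lambda>i. \<Sum>r\<in>R. y r i) J = (\<Sum>r\<in>R. bordered A (y r) J)"
proof -
  have "bordered A (\<lambda>i. 0) J = 0" by (simp add: bordered_def)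
  then show ?thesis by (induction R rule: infinite_finite_induct) (auto simp: bordered_add)
qed

text \<open>By linearity the bordering row may be taken to be a row of \<open>A\<close>, and then
  two rows coincide.\<close>

lemma bordered_row_space:
  assumes "A \<in> carrier_mat m N" "J \<subseteq> {0..<N}" "card J = Suc m"
    and "\<And>i. i \<in> J \<Longrightarrow> v i = (\<Sum>r<m. c r * A $$ (r, i))"
  shows "bordered A v J = 0"
proof -
  have row: "bordered A (\<lambda>i. A $$ (r, i)) J = 0" if r: "r < m" for r
  proof -
    let ?M = "mat (Suc m) (Suc m) (\<lambda>(r', c). if r' =
      0 then A $$ (r, pick J c) else A $$ (r' - 1, pick J c))"
    have "row ?M 0 = row ?M (Suc r)" using r by (intro eq_vecI) simp_all
    then have "det ?M = 0" using det_identical_rows[of ?M "Suc m" 0 "Suc r"] r by simp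
    then show ?thesis using bordered_det[OF assms(1-3), of "\<lambda>i. A $$ (r, i)"] by simp
  qed
  have "bordered A v J = bordered A (\<lambda>i. \<Sum>r<m. c r * A $$ (r, i)) J"
    by (rule bordered_cong) (rule assms(4))
  also have "\<dots> = 0" by (simp add: bordered_sum bordered_smult row)
  finally show ?thesis .
qed

lemma minor_mult:
  assumes "G \<in> carrier_mat m m" "A \<in> carrier_mat m N" "J \<subseteq> {0..<N}" "card J = m"
  shows "minor (G * A) J = det G * minor A J"
proof -
  have GA: "G * A \<in> carrier_mat m N" using assms by simp
  have "submatrix (G * A) UNIV J = G * submatrix A UNIV J"
  proof (rule eq_matI)
    fix i j assume "i < dim_row (G * submatrix A UNIV J)" "j < dim_col (G * submatrix A UNIV J)"
    then have ij: "i < m" "j < m"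
      using assms by (simp_all add: submatrix_UNIV_cols[OF assms(2,3)])
    have p: "pick J j < N" using pick_in_set_le[of j J] ij assms(3,4) by auto
    have "submatrix (G * A) UNIV J $$ (i, j) = row G i \<bullet> col A (pick J j)"
      using ij p assms by (simp add: submatrix_UNIV_cols[OF GA assms(3)])
    also have "col A (pick J j) = col (submatrix A UNIV J) j"
      using ij p assms by (intro eq_vecI) (simp_all add: submatrix_UNIV_cols[OF assms(2,3)])
    finally show "submatrix (G * A) UNIV J $$ (i, j) = (G * submatrix A UNIV J) $$ (i, j)"
      using ij assms by (simp add: submatrix_UNIV_cols[OF assms(2,3)])
  qed (use assms in \<open>simp_all add: submatrix_UNIV_cols[OF assms(2,3)] submatrix_UNIV_cols[OF GA
    assms(3)]\<close>)
  then show ?thesis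
    unfolding minor_def using assms
    by (simp add: det_mult[of G m] submatrix_UNIV_cols[OF assms(2,3)])
qed

text \<open>Carries the sign of one entry over to another through a relation with two terms whose
  minors have equal signs.\<close>

lemma opposite_terms_sign:
  fixes v v' d d' :: real
  assumes "(-1) ^ a * v * d' + (-1) ^ Suc b * v' * d = 0" "d > 0 \<and> d' > 0 \<or> d < 0 \<and> d' < 0"
    "(-1) ^ a * v > 0"
  shows "(-1) ^ b * v' > 0"
proof -
  have e: "(-1) ^ a * v * d' = (-1) ^ b * v' * d" using assms(1) by simp
  show ?thesis
  proof (cases "d > 0")
    case True
    then have "(-1) ^ b * v' * d > 0" using e assms(2,3)
      by (metis mult_pos_pos not_less_iff_gr_or_eq)
    then show ?thesis using True by (simp add: zero_less_mult_iff)
  next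
    case False
    then have "d < 0" "d' < 0" using assms(2) by auto
    then have "(-1) ^ b * v' * d < 0" using e assms(3) by (metis mult_pos_neg)
    then show ?thesis using \<open>d < 0\<close> by (simp add: mult_less_0_iff)
  qed
qed

definition same_sign_minors :: "real mat \<Rightarrow> nat \<Rightarrow> nat \<Rightarrow> bool" where
  "same_sign_minors A m N \<longleftrightarrow> A \<in> carrier_mat m N \<and>
    ((\<forall>J. J \<subseteq> {0..<N} \<and> card J = m \<longrightarrow> minor A J > 0) \<or>
     (\<forall>J. J \<subseteq> {0..<N} \<and> card J = m \<longrightarrow> minor A J < 0))"

text \<open>By Cramer's rule, the entry \<open>l\<close> of the vector is a maximal minor with column \<open>j\<close> replaced by \<open>l\<close>.\<close>

lemma vanishing_vector:
  assumes "same_sign_minors A m N" "I \<subseteq> {0..<N}" "card I + 1 = m" "j < N" "j \<notin> I"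
    "s = 1 \<or> s = (-1 :: real)"
  shows "\<exists>c. (\<forall>i\<in>I. (\<Sum>r<m. c r * A $$ (r, i)) = 0) \<and>
    (\<forall>l<N. l \<notin> I \<longrightarrow> s * (-1) ^ card (I \<inter> {..<l}) * (\<Sum>r<m. c r * A $$ (r, l)) > 0)"
proof -
  have A: "A \<in> carrier_mat m N" using assms(1) by (simp add: same_sign_minors_def)
  have fin: "finite I" using assms(2) finite_subset by blast
  let ?J = "insert j I"
  have J: "?J \<subseteq> {0..<N}" "card ?J = m" "finite ?J" using assms fin by auto
  define B where "B = submatrix A UNIV ?J"
  have B: "B = mat m m (\<lambda>(r, c). A $$ (r, pick ?J c))"
    unfolding B_def using submatrix_UNIV_cols[OF A J(1)] J(2) by simp
  have Bc: "B \<in> carrier_mat m m" by (simp add: B)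
  have dB: "det B \<noteq> 0" using assms(1) J(1,2)
    unfolding B_def minor_def[symmetric] same_sign_minors_def by (metis less_irrefl)
  define q where "q = card (?J \<inter> {..<j})"
  have q: "q < m" "pick ?J q = j"
    using card_less_card[OF J(3), of j] J(2) pick_card_less[of j ?J] by (auto simp: q_def)
  \<comment> \<open>The factor makes the entry at \<open>j\<close> equal to the prescribed
    sign.\<close>
  define t where "t = s * (-1) ^ card (I \<inter> {..<j}) / det B"
  define c where "c r = t * adj_mat B $$ (q, r)" for r
  define v where "v i = (\<Sum>r<m. c r * A $$ (r, i))" for i
  have val: "v (pick ?J d) = (if d = q then s * (-1) ^ card (I \<inter> {..<j}) else 0)" if d: "d < m"
    for d
  proof -
    have "(adj_mat B * B) $$ (q, d) = (\<Sum>r<m. adj_mat B $$ (q, r) * B $$ (r, d))"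
      using adj_mat(1)[OF Bc] Bc q d
      by (auto simp: scalar_prod_def atLeast0LessThan intro!: sum.cong)
    also have "adj_mat B * B = det B \<cdot>\<^sub>m 1\<^sub>m m" by (rule adj_mat(3)[OF Bc])
    finally have e: "(\<Sum>r<m. adj_mat B $$ (q, r) * B $$ (r, d)) = (if d = q then det B else 0)"
      using q d by auto
    have "v (pick ?J d) = t * (\<Sum>r<m. adj_mat B $$ (q, r) * B $$ (r, d))"
      unfolding v_def c_def sum_distrib_left using d by (intro sum.cong) (auto simp: B)
    then show ?thesis using e dB by (simp add: t_def)
  qed
  have vI: "v i = 0" if "i \<in> I" for i
  proof -
    have "i \<in> ?J" using that by simp
    then obtain d where d: "d < m" "i = pick ?J d"
      using pick_card_less[of i ?J] card_less_card[OF J(3), of i] J(2) by metis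
    then show ?thesis using val[of d] q that assms(5) by auto
  qed
  have vj: "v j = s * (-1) ^ card (I \<inter> {..<j})" using val[OF q(1)] q by simp
  have key: "s * (-1) ^ card (I \<inter> {..<l}) * v l > 0" if l: "l < N" "l \<notin> I" for l
  proof (cases "l = j")
    case True
    have "s * s = 1" using assms(6) by auto
    then show ?thesis unfolding True vj
      by (simp add: power_mult_distrib[symmetric] algebra_simps flip: power_add mult_2)
  next
    case False
    \<comment> \<open>On the columns I, j and l the vanishing expansion keeps only the terms of j
      and l, so the sign at j decides the sign at l.\<close>
    let ?K = "insert l (insert j I)"
    have K: "?K \<subseteq> {0..<N}" "card ?K = Suc m" "finite ?K" using J l False assms by auto
    have z: "bordered A v ?K = 0"
      by (rule bordered_row_space[OF A K(1,2), of v c]) (simp add: v_def)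
    let ?g = "\<lambda>i. (-1) ^ card (?K \<inter> {..<i}) * v i * minor A (?K - {i})"
    have "bordered A v ?K = ?g l + (?g j + (\<Sum>i\<in>I. ?g i))"
      unfolding bordered_def using fin l False assms(5) by simp
    then have two: "?g l + ?g j = 0" using z vI by simp
    have Kl: "?K - {l} = insert j I" "?K - {j} = insert l I" using l False assms(5) by auto
    have cards: "card (insert l I) = m" "insert l I \<subseteq> {0..<N}" using l assms(2,3) fin by auto
    have sgn: "minor A (insert j I) > 0 \<and> minor A (insert l I) > 0 \<or> minor A (insert j I) < 0 \<and>
      minor A (insert l I) < 0"
      using assms(1) unfolding same_sign_minors_def
    proof (elim conjE disjE)
      assume "\<forall>J. J \<subseteq> {0..<N} \<and> card J = m \<longrightarrow> minor A J > 0"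
      then show ?thesis using J(1,2) cards by blast
    next
      assume "\<forall>J. J \<subseteq> {0..<N} \<and> card J = m \<longrightarrow> minor A J < 0"
      then show ?thesis using J(1,2) cards by blast
    qed
    define ss where "ss = s"
    have ssj: "(-1) ^ card (I \<inter> {..<j}) * (s * v j) > 0"
    proof -
      have "s * s = 1" using assms(6) by auto
      then show ?thesis unfolding vj by (simp add: algebra_simps flip: power_add mult_2)
    qed
    have two': "?g l * s + ?g j * s = 0" using two by (metis distrib_right mult_zero_left)
    show ?thesis
    proof (cases "l < j")
      case True
      have c1: "card (?K \<inter> {..<l}) = card (I \<inter> {..<l})"
        using True by (intro arg_cong[where f=card]) auto
      have "?K \<inter> {..<j} = insert l (I \<inter> {..<j})" using True by auto
      then have c2: "card (?K \<inter> {..<j}) = Suc (card (I \<inter> {..<j}))" using l fin by simp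
      have "(-1) ^ card (I \<inter> {..<j}) * (s * v j) * minor A (insert l I) +
        (-1) ^ Suc (card (I \<inter> {..<l})) * (s * v l) * minor A (insert j I) = 0"
        using two' unfolding Kl c1 c2 by (simp only: power_Suc) argo
      from opposite_terms_sign[OF this _ ssj] sgn show ?thesis by (simp add: algebra_simps)
    next
      case nl: False
      then have jl: "j < l" using False by simp
      have c1: "card (?K \<inter> {..<j}) = card (I \<inter> {..<j})"
        using jl by (intro arg_cong[where f=card]) auto
      have "?K \<inter> {..<l} = insert j (I \<inter> {..<l})" using jl by auto
      then have c2: "card (?K \<inter> {..<l}) = Suc (card (I \<inter> {..<l}))" using assms(5) fin by simp
      have "(-1) ^ card (I \<inter> {..<j}) * (s * v j) * minor A (insert l I) +
        (-1) ^ Suc (card (I \<inter> {..<l})) * (s * v l) * minor A (insert j I) = 0"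
        using two' unfolding Kl c1 c2 by (simp only: power_Suc) argo
      from opposite_terms_sign[OF this _ ssj] sgn show ?thesis by (simp add: algebra_simps)
    qed
  qed
  show ?thesis using vI key unfolding v_def by blast
qed

section \<open>Realizing a sign sequence with few changes\<close>

definition changes :: "(nat \<Rightarrow> real) \<Rightarrow> nat \<Rightarrow> nat set" where
  "changes g N = {i. Suc i < N \<and> g i \<noteq> g (Suc i)}"

lemma sign_alternation:
  assumes "\<And>i. i < N \<Longrightarrow> g i = 1 \<or> g i = (-1 :: real)" "l < N"
  shows "g l = g 0 * (-1) ^ card (changes g N \<inter> {..<l})"
  using assms(2)
proof (induction l)
  case (Suc l)
  have "changes g N \<inter> {..<Suc l} =
    (if g l \<noteq> g (Suc l) then insert l (changes g N \<inter> {..<l}) else changes g N \<inter> {..<l})"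
    using Suc.prems by (auto simp: changes_def less_Suc_eq)
  moreover have "g (Suc l) = (if g l \<noteq> g (Suc l) then - g l else g l)"
    using assms(1)[of l] assms(1)[of "Suc l"] Suc.prems by auto
  moreover have "g l = g 0 * (-1) ^ card (changes g N \<inter> {..<l})" using Suc by simp
  ultimately show ?case by (cases "g l = g (Suc l)") simp_all
qed simp

text \<open>Off the positions that follow a change, the sequence has the sign given by the number of
  such positions below. If j is among them, it is replaced by the nearest smaller position outside.
  The set is then enlarged to m - 1 elements by the first or the last position outside it; the first
  reverses the sign \<open>s\<close>, the last keeps it.\<close>

lemma compatible_set:
  assumes g: "\<And>i. i < N \<Longrightarrow> g i = 1 \<or> g i = (-1 :: real)"
    and "card (changes g N) < m" "m \<le> N" "j < N"
  shows "\<exists>I s. I \<subseteq> {0..<N} - {j} \<and> card I + 1 = m \<and> (s = 1 \<or> s = -1) \<and>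
    (\<forall>l<N. l \<notin> I \<longrightarrow> g l = s * (-1) ^ card (I \<inter> {..<l}))"
proof -
  define P where "P I \<longleftrightarrow> I \<subseteq> {0..<N} - {j} \<and> (\<exists>s. (s = 1 \<or> s = -1) \<and>
    (\<forall>l<N. l \<notin> I \<longrightarrow> g l = s * (-1) ^ card (I \<inter> {..<l})))" for I
  have base: "\<exists>I. P I \<and> card I = card (changes g N)"
  proof -
    define I0 where "I0 = Suc ` changes g N"
    have I0: "I0 \<subseteq> {1..<N}" "finite I0" "card I0 = card (changes g N)"
    proof -
      show "I0 \<subseteq> {1..<N}" by (auto simp: I0_def changes_def)
      then show "finite I0" by (rule finite_subset) simp
      show "card I0 = card (changes g N)" unfolding I0_def by (rule card_image) simp
    qed
    have wt: "card (changes g N \<inter> {..<l}) = card (I0 \<inter> {..l})" for l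
    proof -
      have "I0 \<inter> {..l} = Suc ` (changes g N \<inter> {..<l})" by (auto simp: I0_def)
      then show ?thesis by (simp add: card_image)
    qed
    have g0: "g l = g 0 * (-1) ^ card (I0 \<inter> {..l})" if "l < N" for l
      using sign_alternation[of N g l] g that by (simp add: wt)
    have s0: "g 0 = 1 \<or> g 0 = -1" using g[of 0] assms(4) by auto
    show ?thesis
    proof (cases "j \<in> I0")
      case False
      have "I0 \<inter> {..l} = I0 \<inter> {..<l}" if "l \<notin> I0" for l using that by (auto simp: le_less)
      then have "\<forall>l<N. l \<notin> I0 \<longrightarrow> g l = g 0 * (-1) ^ card (I0 \<inter> {..<l})" using g0 by metis
      moreover have "I0 \<subseteq> {0..<N} - {j}" using False I0(1) by auto
      ultimately have "P I0" unfolding P_def using s0 by blast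
      then show ?thesis using I0(3) by blast
    next
      case True
      \<comment> \<open>The set \<open>I0\<close> does not contain 0, so some position below j lies
        outside it.\<close>
      define F where "F = {..<j} - I0"
      have F: "finite F" "0 \<in> F" using True I0(1) by (auto simp: F_def)
      define a where "a = Max F"
      have "a \<in> F" "\<And>i. i \<in> F \<Longrightarrow> i \<le> a"
        unfolding a_def using F Max_in[of F] Max_ge[of F] by blast+
      then have a: "a \<in> {..<j} - I0" "\<And>i. i \<in> {..<j} - I0 \<Longrightarrow> i \<le> a"
        unfolding F_def by blast+
      define I where "I = insert a (I0 - {j})"
      have "card I = card I0" unfolding I_def using a card_Suc_Diff1[OF I0(2) True] I0(2) by simp
      moreover have "P I"
        unfolding P_def
      proof (intro conjI exI[of _ "g 0"] allI impI)
        show "I \<subseteq> {0..<N} - {j}" using a I0(1) assms(4) by (auto simp: I_def)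
        show "g 0 = 1 \<or> g 0 = -1" by (rule s0)
        fix l assume l: "l < N" "l \<notin> I"
        have "even (card (I \<inter> {..<l})) = even (card (I0 \<inter> {..l}))"
        proof -
          consider "l = j" | "l < a" "l \<notin> I0" | "j < l" "l \<notin> I0"
            using l(2) a(1) a(2)[of l] unfolding I_def
              by (metis DiffI insertI1 insertI2 insert_Diff_single insert_iff lessThan_iff
              linorder_neqE_nat not_le singletonD)
          then show ?thesis
          proof cases
            case 1
            have "I \<inter> {..<l} = insert a (I0 \<inter> {..<j})" using a 1 by (auto simp: I_def)
            moreover have "I0 \<inter> {..l} = insert j (I0 \<inter> {..<j})" using True 1 by auto
            ultimately show ?thesis using a I0(2) by simp
          next
            case 2
            have "I \<inter> {..<l} = I0 \<inter> {..l}" using 2 a by (auto simp: I_def le_less)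
            then show ?thesis by simp
          next
            case 3
            have "I \<inter> {..<l} = insert a (I0 \<inter> {..l} - {j})" using 3 a
              by (auto simp: I_def le_less)
            moreover have "j \<in> I0 \<inter> {..l}" using 3 True by simp
            ultimately have "card (I \<inter> {..<l}) = card (I0 \<inter> {..l})"
              using a I0(2) card.remove[of "I0 \<inter> {..l}" j] by simp
            then show ?thesis by simp
          qed
        qed
        then show "g l = g 0 * (-1) ^ card (I \<inter> {..<l})" using g0[OF l(1)]
          by (simp add: minus_one_power_iff)
      qed
      ultimately show ?thesis using I0(3) by auto
    qed
  qed
  have step: "\<exists>I'. P I' \<and> card I' = Suc (card I)" if "P I" "card I + 1 < N" for I
  proof -
    obtain s where s: "s = 1 \<or> s = -1" "\<And>l. l < N \<Longrightarrow> l \<notin> I \<Longrightarrow> g l = s * (-1) ^ card (I \<inter> {..<l})"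
      and I: "I \<subseteq> {0..<N} - {j}" using \<open>P I\<close> unfolding P_def by auto
    have fin: "finite I" using I finite_subset by blast
    let ?C = "{0..<N} - I"
    have "card ?C = N - card I" using I by (subst card_Diff_subset[OF fin]) auto
    then have c2: "card ?C > 1" using that(2) by simp
    have ne: "?C \<noteq> {}" using c2 by (metis card.empty not_one_less_zero)
    \<comment> \<open>At least two positions lie outside \<open>I\<close>, so the first or the last
      of them differs from j and may be added.\<close>
    have "\<exists>b\<in>?C. b \<noteq> j"
    proof (rule ccontr)
      assume "\<not> (\<exists>b\<in>?C. b \<noteq> j)"
      then have "?C \<subseteq> {j}" by blast
      then have "card ?C \<le> 1" using card_mono[of "{j}" ?C] by simp
      then show False using c2 by simp
    qed
    then obtain b where b: "b \<in> ?C" "b \<noteq> j" by blast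
    show ?thesis
    proof (cases "b < j")
      case True
      define a where "a = Min ?C"
      have a: "a \<in> ?C" "\<And>i. i \<in> ?C \<Longrightarrow> a \<le> i" using Min_in[of ?C] ne by (auto simp: a_def)
      have aj: "a \<noteq> j" using a(2)[OF b(1)] True by auto
      have "P (insert a I)"
        unfolding P_def
      proof (intro conjI exI[of _ "- s"] allI impI)
        show "insert a I \<subseteq> {0..<N} - {j}" using I a aj by auto
        show "- s = 1 \<or> - s = -1" using s(1) by auto
        fix l assume l: "l < N" "l \<notin> insert a I"
        have "a < l" using a(2)[of l] l by auto
        then have "insert a I \<inter> {..<l} = insert a (I \<inter> {..<l})" by auto
        then have "card (insert a I \<inter> {..<l}) = Suc (card (I \<inter> {..<l}))" using a(1) fin by simp
        then show "g l = - s * (-1) ^ card (insert a I \<inter> {..<l})" using s(2)[of l] l by simp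
      qed
      moreover have "card (insert a I) = Suc (card I)" using a(1) fin by simp
      ultimately show ?thesis by blast
    next
      case False
      define a where "a = Max ?C"
      have a: "a \<in> ?C" "\<And>i. i \<in> ?C \<Longrightarrow> i \<le> a" using Max_in[of ?C] ne by (auto simp: a_def)
      have aj: "a \<noteq> j" using a(2)[OF b(1)] False b(2) by auto
      have "P (insert a I)"
        unfolding P_def
      proof (intro conjI exI[of _ s] allI impI)
        show "insert a I \<subseteq> {0..<N} - {j}" using I a aj by auto
        show "s = 1 \<or> s = -1" using s(1) by auto
        fix l assume l: "l < N" "l \<notin> insert a I"
        have "l < a" using a(2)[of l] l by (auto simp: le_less)
        then have "insert a I \<inter> {..<l} = I \<inter> {..<l}" by auto
        then show "g l = s * (-1) ^ card (insert a I \<inter> {..<l})" using s(2)[of l] l by simp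
      qed
      moreover have "card (insert a I) = Suc (card I)" using a(1) fin by simp
      ultimately show ?thesis by blast
    qed
  qed
  have "card (changes g N) \<le> d \<Longrightarrow> d < N \<Longrightarrow> \<exists>I. P I \<and> card I = d" for d
  proof (induction d)
    case 0
    then show ?case using base by simp
  next
    case (Suc d)
    show ?case
    proof (cases "card (changes g N) = Suc d")
      case True
      then show ?thesis using base by simp
    next
      case False
      then obtain I where "P I" "card I = d" using Suc by auto
      then show ?thesis using step[of I] Suc.prems by auto
    qed
  qed
  moreover have "card (changes g N) \<le> m - 1" "m - 1 < N" using assms(2-4) by linarith+
  ultimately have "\<exists>I. P I \<and> card I = m - 1" by blast
  then obtain I where I: "P I" "card I = m - 1" by blast
  then have "card I + 1 = m" using assms(2) by simp
  then show ?thesis using I(1) unfolding P_def by blast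
qed

text \<open>Sum the vectors of \<open>vanishing_vector\<close> over sets \<open>I\<close> avoiding each of the coordinates.\<close>

lemma realize_signs:
  assumes A: "same_sign_minors A m N" and g: "\<And>i. i < N \<Longrightarrow> g i = 1 \<or> g i = (-1 :: real)"
    and m: "card (changes g N) < m" "m \<le> N"
  shows "\<exists>c. \<forall>i<N. g i * (\<Sum>r<m. c r * A $$ (r, i)) > 0"
proof -
  have "\<exists>c. (\<forall>i<N. g i * (\<Sum>r<m. c r * A $$ (r, i)) \<ge> 0) \<and> g j * (\<Sum>r<m. c r * A $$ (r, j)) > 0"
    if j: "j < N" for j
  proof -
    obtain I s where I: "I \<subseteq> {0..<N} - {j}" "card I + 1 = m" "s = 1 \<or> s = -1"
      "\<And>l. l < N \<Longrightarrow> l \<notin> I \<Longrightarrow> g l = s * (-1) ^ card (I \<inter> {..<l})"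
      using compatible_set[OF g m j] by metis
    obtain c where c: "\<And>i. i \<in> I \<Longrightarrow> (\<Sum>r<m. c r * A $$ (r, i)) = 0"
      "\<And>l. l < N \<Longrightarrow> l \<notin> I \<Longrightarrow> s * (-1) ^ card (I \<inter> {..<l}) * (\<Sum>r<m. c r * A $$ (r, l)) > 0"
      using vanishing_vector[OF A, of I j s] I(1-3) j by blast
    have "g i * (\<Sum>r<m. c r * A $$ (r, i)) \<ge> 0" if "i < N" for i
      using c I(4)[OF that] that by (cases "i \<in> I") (auto intro: less_imp_le)
    moreover have "j \<notin> I" using I(1) by blast
    ultimately show ?thesis using c(2)[OF j] I(4)[OF j] by (intro exI[of _ c]) auto
  qed
  then have "\<forall>j. \<exists>c. j < N \<longrightarrow> (\<forall>i<N. g i * (\<Sum>r<m. c r * A $$ (r, i)) \<ge> 0) \<and>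
    g j * (\<Sum>r<m. c r * A $$ (r, j)) > 0"
    by blast
  from choice[OF this] obtain c
    where c: "\<And>j i. j < N \<Longrightarrow> i < N \<Longrightarrow> g i * (\<Sum>r<m. c j r * A $$ (r, i)) \<ge> 0"
    "\<And>j. j < N \<Longrightarrow> g j * (\<Sum>r<m. c j r * A $$ (r, j)) > 0" by blast
  have "g i * (\<Sum>r<m. (\<Sum>j<N. c j r) * A $$ (r, i)) > 0" if i: "i < N" for i
  proof -
    have "(\<Sum>r<m. (\<Sum>j<N. c j r) * A $$ (r, i)) = (\<Sum>j<N. \<Sum>r<m. c j r * A $$ (r, i))"
      unfolding sum_distrib_right by (rule sum.swap)
    then have "g i * (\<Sum>r<m. (\<Sum>j<N. c j r) * A $$ (r, i)) =
      (\<Sum>j<N. g i * (\<Sum>r<m. c j r * A $$ (r, i)))"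
      by (simp add: sum_distrib_left)
    also have "\<dots> > 0" using i c by (intro sum_pos2[of _ i]) auto
    finally show ?thesis .
  qed
  then show ?thesis by (intro exI[of _ "\<lambda>r. \<Sum>j<N. c j r"]) simp
qed

section \<open>Linear subspaces of coordinate space\<close>

lemma linear_subspaceD:
  assumes "linear_subspace n k V"
  shows "V \<subseteq> carrier_vec n" "0\<^sub>v n \<in> V" "u \<in> V \<Longrightarrow> v \<in> V \<Longrightarrow> u + v \<in> V" "v \<in> V \<Longrightarrow> c \<cdot>\<^sub>v v \<in> V"
proof -
  have "LinearCombinations.submodule class_ring V (module_vec TYPE(real) n)"
    using assms by (simp add: linear_subspace_def VectorSpace.subspace_def)
  then show "V \<subseteq> carrier_vec n" "0\<^sub>v n \<in> V" "u \<in> V \<Longrightarrow> v \<in> V \<Longrightarrow> u + v \<in> V" "v \<in> V \<Longrightarrow> c \<cdot>\<^sub>v v \<in> V"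
    by (auto simp: submodule_def module_vec_def class_ring_simps)
qed

text \<open>For the span of V and \<eta>, of dimension k + 1, this gives k < n, so that column sets
  of the sizes k and k + 1 exist.\<close>

lemma row_space_dim_le:
  assumes "A \<in> carrier_mat m N" "linear_subspace N k (vec_space.row_space N A)"
  shows "k \<le> N"
proof -
  interpret v: vec_space "TYPE(real)" N .
  have s: "VectorSpace.subspace class_ring (v.row_space A) v.V"
    using assms(2) by (simp add: linear_subspace_def)
  have "v.row_space A = v.span (set (cols A\<^sup>T))" by (simp add: v.row_space_def)
  moreover have "vectorspace.fin_dim class_ring (v.span_vs (set (cols A\<^sup>T)))"
    using assms(1) by (intro v.fin_dim_span_cols[of _ m]) simp
  ultimately have "vectorspace.fin_dim class_ring (v.vs (v.row_space A))" by simp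
  from v.subspace_dim[OF s v.fin_dim this] show ?thesis
    using assms(2) v.dim_is_n by (simp add: linear_subspace_def)
qed

lemma coset_vec:
  assumes "C \<in> a_rcosets\<^bsub>module_vec TYPE(real) n\<^esub> W"
  obtains y where "y \<in> carrier_vec n" "C = (\<lambda>v. v + y) ` W"
proof -
  obtain y where "y \<in> carrier_vec n" "C = (\<Union>h\<in>W. {h + y})"
    using assms unfolding A_RCOSETS_def' a_r_coset_def' by (auto simp: module_vec_def)
  then show thesis using that[of y] by auto
qed

lemma row_space_iff:
  fixes A :: "real mat"
  assumes A: "A \<in> carrier_mat m N"
  shows "w \<in> vec_space.row_space N A \<longleftrightarrow>
    w \<in> carrier_vec N \<and> (\<exists>c. \<forall>i<N. w $ i = (\<Sum>r<m. c r * A $$ (r, i)))"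
proof -
  have e: "(A\<^sup>T *\<^sub>v y) $ i = (\<Sum>r<m. y $ r * A $$ (r, i))" if "i < N" "y \<in> carrier_vec m" for y i
    using A that by (auto simp: scalar_prod_def atLeast0LessThan mult.commute intro!: sum.cong)
  have d: "dim_vec (A\<^sup>T *\<^sub>v y) = N" for y using A by simp
  show ?thesis
  proof
    assume "w \<in> vec_space.row_space N A"
    then obtain y where "w \<in> carrier_vec N" "y \<in> carrier_vec m" "A\<^sup>T *\<^sub>v y = w"
      unfolding vec_space.row_space_eq[OF A] using A by auto
    then show "w \<in> carrier_vec N \<and> (\<exists>c. \<forall>i<N. w $ i = (\<Sum>r<m. c r * A $$ (r, i)))"
      using e[of _ y] by (auto intro!: exI[of _ "\<lambda>r. y $ r"])
  next
    assume "w \<in> carrier_vec N \<and> (\<exists>c. \<forall>i<N. w $ i = (\<Sum>r<m. c r * A $$ (r, i)))"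
    then obtain c where c: "w \<in> carrier_vec N" "\<And>i. i < N \<Longrightarrow> w $ i = (\<Sum>r<m. c r * A $$ (r, i))"
      by blast
    have "A\<^sup>T *\<^sub>v vec m c = w"
      using c d by (intro eq_vecI) (auto simp: e simp del: index_mult_mat_vec)
    then show "w \<in> vec_space.row_space N A"
      unfolding vec_space.row_space_eq[OF A] using A c(1) by (auto intro!: bexI[of _ "vec m c"])
  qed
qed

lemma Gr_posE:
  assumes "W \<in> Gr_pos m N"
  obtains A where "same_sign_minors A m N" "vec_space.row_space N A = W" "linear_subspace N m W"
  using assms unfolding Gr_pos_def same_sign_minors_def minor_def by blast

text \<open>The m smallest elements. They keep their rank, and the rank of a change decides the sign
  after it.\<close>

lemma ex_initial_segment:
  fixes C :: "nat set"
  assumes "finite C" "m \<le> card C"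
  shows "\<exists>C'\<subseteq>C. card C' = m \<and> (\<forall>i\<in>C'. C \<inter> {..<i} = C' \<inter> {..<i})"
  using assms
proof (induction "card C - m" arbitrary: C)
  case 0
  then show ?case by (intro exI[of _ C]) auto
next
  case (Suc d)
  then have ne: "C \<noteq> {}" by auto
  let ?D = "C - {Max C}"
  have M: "Max C \<in> C" "\<And>i. i \<in> C \<Longrightarrow> i \<le> Max C" using ne Suc.prems(1) by auto
  have c: "card ?D = card C - 1" using M(1) Suc.prems(1) by simp
  have "d = card ?D - m" "m \<le> card ?D" using Suc c by linarith+
  then obtain C' where C': "C' \<subseteq> ?D" "card C' = m" "\<forall>i\<in>C'. ?D \<inter> {..<i} = C' \<inter> {..<i}"
    using Suc.hyps(1)[of ?D] Suc.prems(1) by auto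
  have "C \<inter> {..<i} = ?D \<inter> {..<i}" if "i \<in> C'" for i
  proof -
    have "i \<le> Max C" using that C'(1) M(2) by blast
    then have "Max C \<notin> {..<i}" by simp
    then show ?thesis by blast
  qed
  then have "\<forall>i\<in>C'. C \<inter> {..<i} = C' \<inter> {..<i}" using C'(3) by simp
  moreover have "C' \<subseteq> C" using C'(1) by blast
  ultimately show ?case using C'(2) by metis
qed

text \<open>Deleting column 0, which holds the values of \<xi>, turns a matrix for the vectors
  (\<xi>(v), v) into one for V; its minors are among the given ones and so share their sign.\<close>

lemma minor_shift:
  assumes "A \<in> carrier_mat m (Suc N)" "J \<subseteq> {0..<N}"
  shows "minor (mat m N (\<lambda>(r, i). A $$ (r, Suc i))) J = minor A (Suc ` J)"
proof -
  have p: "pick (Suc ` J) c = Suc (pick J c)" if c: "c < card J" for c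
  proof -
    have m: "Suc (pick J c) \<in> Suc ` J" using pick_in_set_le[OF c] by blast
    have "Suc ` J \<inter> {..<Suc (pick J c)} = Suc ` (J \<inter> {..<pick J c})" by auto
    then have "card (Suc ` J \<inter> {..<Suc (pick J c)}) = c"
      using card_pick_less[OF c] by (simp add: card_image)
    then show ?thesis using pick_card_less[OF m] by simp
  qed
  have pl: "pick J c < N" if "c < card J" for c using pick_in_set_le[OF that] assms(2) by auto
  have S: "Suc ` J \<subseteq> {0..<Suc N}" using assms(2) by auto
  have "submatrix (mat m N (\<lambda>(r, i). A $$ (r, Suc i))) UNIV J = submatrix A UNIV (Suc ` J)"
    unfolding submatrix_UNIV_cols[OF assms(1) S] submatrix_UNIV_cols[OF mat_carrier assms(2)]
    using pl by (intro eq_matI) (auto simp: card_image p)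
  then show ?thesis by (simp add: minor_def)
qed

text \<open>The candidate qualifies because V is contained in its double orthogonal complement.
  Uniqueness holds because the difference of two candidates is orthogonal to itself.\<close>

lemma orth_proj_eqI:
  assumes "linear_subspace n k V" "y \<in> carrier_vec n" "p \<in> orth n V" "y - p \<in> V"
  shows "orth_proj n (orth n V) y = p"
  unfolding orth_proj_def
proof (rule the_equality)
  note V = linear_subspaceD(1)[OF assms(1)]
  have p: "p \<in> carrier_vec n" "\<And>v. v \<in> V \<Longrightarrow> p \<bullet> v = 0"
    using assms(3) by (auto simp: vec_module.orthogonal_complement_def)
  have "(y - p) \<bullet> q = 0" if q: "q \<in> orth n V" for q
  proof -
    have "q \<in> carrier_vec n" "q \<bullet> (y - p) = 0" using q assms(4)
      by (auto simp: vec_module.orthogonal_complement_def)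
    then show ?thesis using assms(4) V by (metis comm_scalar_prod subsetD)
  qed
  then show "p \<in> orth n V \<and> y - p \<in> orth n (orth n V)"
    using assms p V by (auto simp: vec_module.orthogonal_complement_def)
  fix q assume q: "q \<in> orth n V \<and> y - q \<in> orth n (orth n V)"
  have qc: "q \<in> carrier_vec n" "\<And>v. v \<in> V \<Longrightarrow> q \<bullet> v = 0"
    using q by (auto simp: vec_module.orthogonal_complement_def)
  define d where "d = p - q"
  have d: "d \<in> carrier_vec n" using p qc by (simp add: d_def)
  have dO: "d \<in> orth n V"
    using p qc V d unfolding vec_module.orthogonal_complement_def d_def
    by (auto simp: minus_scalar_prod_distrib[of _ n])
  have "(y - p) \<bullet> d = 0"
    using dO assms(4) V d by (auto simp: vec_module.orthogonal_complement_def intro: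
      comm_scalar_prod[THEN trans])
  moreover have "(y - q) \<bullet> d = 0" using q dO by (auto simp: vec_module.orthogonal_complement_def)
  ultimately have "(y - q) \<bullet> d - (y - p) \<bullet> d = 0" by simp
  moreover have "(y - q) \<bullet> d - (y - p) \<bullet> d = d \<bullet> d"
  proof -
    have "d = (y - q) - (y - p)" using assms(2) p qc unfolding d_def by (intro eq_vecI) auto
    then have "d \<bullet> d = ((y - q) - (y - p)) \<bullet> d" by simp
    also have "\<dots> = (y - q) \<bullet> d - (y - p) \<bullet> d"
      using assms(2) p qc d by (intro minus_scalar_prod_distrib[of _ n]) auto
    finally show ?thesis by simp
  qed
  ultimately have "d \<bullet> d = 0" by simp
  then have "(\<Sum>i<n. d $ i * d $ i) = 0" using d by (simp add: scalar_prod_def atLeast0LessThan)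
  then have "\<forall>i<n. d $ i = 0" by (subst (asm) sum_nonneg_eq_0_iff) auto
  then show "q = p" using p qc unfolding d_def by (intro eq_vecI) auto
qed

section \<open>Sign vectors and monomials\<close>

lemma real_sgn: "\<gamma> \<in> sign_vectors n \<Longrightarrow> real_of_int (\<gamma> i) = 1 \<or> real_of_int (\<gamma> i) = -1"
  unfolding sign_vectors_def by (metis (mono_tags, lifting) mem_Collect_eq of_int_1 of_int_minus)

lemma sign_vectors_0: "\<gamma> \<in> sign_vectors n \<Longrightarrow> \<gamma> 0 = 1"
  by (simp add: sign_vectors_def)

lemma changes_x_of: "changes (\<lambda>i. real_of_int (\<gamma> i)) (Suc n) = x_of n \<gamma>"
  by (auto simp: changes_def x_of_def)

lemma finite_x_of [simp]: "finite (x_of n \<gamma>)"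
  by (simp add: x_of_def)

lemma sign_x_of:
  assumes "\<gamma> \<in> sign_vectors n" "l \<le> n"
  shows "real_of_int (\<gamma> l) = (-1) ^ card (x_of n \<gamma> \<inter> {..<l})"
  using sign_alternation[of "Suc n" "\<lambda>i. real_of_int (\<gamma> i)" l] real_sgn[OF assms(1)] assms
  by (simp add: changes_x_of sign_vectors_0)

lemma pos_at_x_of:
  assumes "\<alpha> \<in> sign_vectors n" "l \<le> n"
  shows "pos_at (x_of n \<alpha>) l \<longleftrightarrow> \<alpha> l = 1"
proof -
  have "real_of_int (\<alpha> l) = (-1) ^ card (x_of n \<alpha> \<inter> {..<l})" using sign_x_of[OF assms] .
  then show ?thesis by (auto simp: pos_at_def minus_one_power_iff split: if_splits)
qed

lemma sign_cases: "\<alpha> \<in> sign_vectors n \<Longrightarrow> \<alpha> i = 1 \<or> \<alpha> i = -1"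
  by (simp add: sign_vectors_def)

lemma sign_outside: "\<alpha> \<in> sign_vectors n \<Longrightarrow> i \<notin> {1..n} \<Longrightarrow> \<alpha> i = 1"
  unfolding sign_vectors_def by blast

lemma dset_x_of:
  assumes "\<alpha> \<in> sign_vectors n" "\<beta> \<in> sign_vectors n"
  shows "dset n (x_of n \<alpha>) (x_of n \<beta>) = {i. \<alpha> i \<noteq> \<beta> i}"
proof (rule Set.set_eqI)
  fix i
  show "i \<in> dset n (x_of n \<alpha>) (x_of n \<beta>) \<longleftrightarrow> i \<in> {i. \<alpha> i \<noteq> \<beta> i}"
  proof (cases "i \<in> {1..n}")
    case True
    then show ?thesis
      using pos_at_x_of[OF assms(1), of i] pos_at_x_of[OF assms(2), of i] sign_cases[OF assms(1),
        of i] sign_cases[OF assms(2), of i]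
      by (auto simp: dset_def)
  next
    case False
    then show ?thesis using sign_outside[OF assms(1) False] sign_outside[OF assms(2) False]
      by (auto simp: dset_def)
  qed
qed

lemma Vl_Vset: "Vl n k \<subseteq> Vset n k"
  by (auto simp: Vl_def Vset_def)

lemma finite_Vl: "finite (Vl n k)"
  using finite_subset[OF Vl_Vset finite_Vset] .

lemma bij_x_of: "bij_betw (x_of n) {\<alpha> \<in> sign_vectors n. card (x_of n \<alpha>) = k} (Vl n k)"
proof (rule bij_betwI')
  fix \<alpha> \<beta> assume a: "\<alpha> \<in> {\<alpha> \<in> sign_vectors n. card (x_of n \<alpha>) = k}"
    "\<beta> \<in> {\<alpha> \<in> sign_vectors n. card (x_of n \<alpha>) = k}"
  show "x_of n \<alpha> = x_of n \<beta> \<longleftrightarrow> \<alpha> = \<beta>"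
  proof
    assume "x_of n \<alpha> = x_of n \<beta>"
    then have "{i. \<alpha> i \<noteq> \<beta> i} = {}" using dset_x_of[of \<alpha> n \<beta>] a by simp
    then show "\<alpha> = \<beta>" by (simp add: fun_eq_iff)
  qed simp
next
  fix \<alpha> assume "\<alpha> \<in> {\<alpha> \<in> sign_vectors n. card (x_of n \<alpha>) = k}"
  then show "x_of n \<alpha> \<in> Vl n k" by (auto simp: Vl_def x_of_def)
next
  fix x assume x: "x \<in> Vl n k"
  define \<alpha> :: "nat \<Rightarrow> int" where "\<alpha> i = (if i \<in> {1..n} \<and> \<not> pos_at x i then -1 else 1)" for i
  have "\<alpha> \<in> sign_vectors n" by (auto simp: sign_vectors_def \<alpha>_def)
  moreover have "x_of n \<alpha> = x"
  proof (rule Set.set_eqI)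
    fix i
    have s: "\<alpha> i = (if pos_at x i then 1 else -1)" if "i \<le> n" for i
      using that by (cases "i = 0") (auto simp: \<alpha>_def)
    show "i \<in> x_of n \<alpha> \<longleftrightarrow> i \<in> x"
    proof (cases "i < n")
      case True
      then have "i \<in> x_of n \<alpha> \<longleftrightarrow> \<alpha> i \<noteq> \<alpha> (Suc i)" by (simp add: x_of_def)
      also have "\<dots> \<longleftrightarrow> pos_at x i \<noteq> pos_at x (Suc i)" using s[of i] s[of "Suc i"] True by auto
      finally show ?thesis using mem_iff_pos_at[of i x] by simp
    next
      case False
      then show ?thesis using x by (auto simp: x_of_def Vl_def)
    qed
  qed
  moreover have "card x = k" using x by (simp add: Vl_def)
  ultimately show "\<exists>\<alpha>\<in>{\<alpha> \<in> sign_vectors n. card (x_of n \<alpha>) = k}. x = x_of n \<alpha>" by auto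
qed

text \<open>\<open>crowded\<close> also counts a change at n, which a sign vector does not have.
  Toggling preserves the parity of the cardinality, so an excess over k is an excess by at least 2
  and survives the removal of n.\<close>

lemma crowded_x_of:
  assumes a: "\<alpha> \<in> sign_vectors n" "card (x_of n \<alpha>) = k" and b: "\<beta> \<in> sign_vectors n"
    and S: "S \<subseteq> {1..n}"
  shows "crowded k (S \<union> dset n (x_of n \<alpha>) (x_of n \<beta>)) (x_of n \<alpha>) \<longleftrightarrow>
    (\<exists>\<gamma>\<in>sign_vectors n. (\<forall>i. i \<notin> S \<and> \<alpha> i = \<beta> i \<longrightarrow> \<gamma> i = \<alpha> i) \<and> k < card (x_of n \<gamma>))"
proof -
  let ?x = "x_of n \<alpha>"
  let ?E = "S \<union> dset n ?x (x_of n \<beta>)"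
  have E: "?E \<subseteq> {1..n}" using S dset_subset by blast
  have x: "?x \<subseteq> {0..n}" by (auto simp: x_of_def)
  have xf: "x_of n \<gamma> = toggle T ?x - {n}"
    if T: "T = {i. \<gamma> i \<noteq> \<alpha> i}" "T \<subseteq> {1..n}" and g: "\<gamma> \<in> sign_vectors n" for \<gamma> T
  proof (rule Set.set_eqI)
    fix i
    have n: "i \<in> toggle T ?x \<Longrightarrow> i \<le> n" using toggle_subset[OF x T(2)] by auto
    show "i \<in> x_of n \<gamma> \<longleftrightarrow> i \<in> toggle T ?x - {n}"
    proof (cases "i < n")
      case True
      have "\<gamma> i \<noteq> \<gamma> (Suc i) \<longleftrightarrow> (\<alpha> i \<noteq> \<alpha> (Suc i)) \<noteq> ((\<gamma> i \<noteq> \<alpha> i) \<noteq> (\<gamma> (Suc i) \<noteq> \<alpha> (Suc i)))"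
        using sign_cases[OF a(1), of i] sign_cases[OF a(1), of "Suc i"] sign_cases[OF g, of i]
          sign_cases[OF g, of "Suc i"]
        by auto
      then show ?thesis using True by (simp add: x_of_def toggle_def T(1))
    next
      case False
      then show ?thesis using n by (auto simp: x_of_def)
    qed
  qed
  show ?thesis
  proof
    assume "crowded k ?E ?x"
    then obtain T where T: "T \<subseteq> ?E" "k < card (toggle T ?x)" by (auto simp: crowded_def)
    have Tn: "T \<subseteq> {1..n}" using T(1) E by blast
    define \<gamma> where "\<gamma> i = (if i \<in> T then - \<alpha> i else \<alpha> i)" for i
    have nz: "\<alpha> i \<noteq> 0" for i using sign_cases[OF a(1), of i] by auto
    have g: "\<gamma> \<in> sign_vectors n"
      using a(1) Tn unfolding sign_vectors_def \<gamma>_def by auto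
    have "T = {i. \<gamma> i \<noteq> \<alpha> i}" using nz by (auto simp: \<gamma>_def)
    then have xg: "x_of n \<gamma> = toggle T ?x - {n}" using xf Tn g by blast
    have "even (card (toggle T ?x)) = even k" using even_card_toggle[OF x Tn] a(2) by simp
    then have "card (toggle T ?x) \<noteq> Suc k" by auto
    then have "Suc k < card (toggle T ?x)" using T(2) by linarith
    moreover have "card (toggle T ?x) \<le> Suc (card (toggle T ?x - {n}))"
      by (metis card_Diff1_le card_Suc_Diff1 card.infinite le_SucI order_refl Diff_insert0
        Diff_empty zero_le)
    ultimately have "k < card (x_of n \<gamma>)" unfolding xg by linarith
    moreover have "\<gamma> i = \<alpha> i" if "i \<notin> S" "\<alpha> i = \<beta> i" for i
      using that T(1) by (auto simp: \<gamma>_def dset_x_of[OF a(1) b])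
    ultimately show "\<exists>\<gamma>\<in>sign_vectors n. (\<forall>i. i \<notin> S \<and> \<alpha> i = \<beta> i \<longrightarrow> \<gamma> i = \<alpha> i) \<and> k < card (x_of n \<gamma>)"
      using g by blast
  next
    assume "\<exists>\<gamma>\<in>sign_vectors n. (\<forall>i. i \<notin> S \<and> \<alpha> i = \<beta> i \<longrightarrow> \<gamma> i = \<alpha> i) \<and> k < card (x_of n \<gamma>)"
    then obtain \<gamma> where g: "\<gamma> \<in> sign_vectors n" "\<And>i. i \<notin> S \<Longrightarrow> \<alpha> i = \<beta> i \<Longrightarrow> \<gamma> i = \<alpha> i"
      "k < card (x_of n \<gamma>)" by blast
    define T where "T = {i. \<gamma> i \<noteq> \<alpha> i}"
    have TE: "T \<subseteq> ?E" using g(2) by (auto simp: T_def dset_x_of[OF a(1) b])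
    then have Tn: "T \<subseteq> {1..n}" using E by blast
    have "x_of n \<gamma> = toggle T ?x - {n}" using xf[OF T_def Tn g(1)] .
    moreover have "finite (toggle T ?x)" using toggle_subset[OF x Tn] finite_subset by blast
    ultimately have "card (x_of n \<gamma>) \<le> card (toggle T ?x)" by (metis card_mono Diff_subset)
    then show "crowded k ?E ?x" using g(3) TE unfolding crowded_def by (intro exI[of _ T]) auto
  qed
qed

section \<open>The polynomial ring and the ideals of crowded monomials\<close>

lemma cring_Zu: "cring (Zu n)"
proof (rule cringI)
  show "abelian_group (Zu n)"
  proof (rule abelian_groupI)
    fix x assume "x \<in> carrier (Zu n)"
    then show "\<exists>y\<in>carrier (Zu n). y \<oplus>\<^bsub>Zu n\<^esub> x = \<zero>\<^bsub>Zu n\<^esub>"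
      by (intro bexI[of _ "- x"]) (auto simp: Zu_simps)
  qed (auto simp: Zu_simps(2-5) Zu_add add_ac, auto simp: Zu_simps)
  show "comm_monoid (Zu n)"
    by (rule comm_monoidI) (auto simp: Zu_simps(2-5) Zu_mult mult_ac, auto simp: Zu_simps)
qed (simp add: Zu_simps algebra_simps)

lemma ring_Zu: "ring (Zu n)"
  using cring_Zu cring.axioms(1) by blast

lemma Zu_uminus: "p \<in> carrier (Zu n) \<Longrightarrow> \<ominus>\<^bsub>Zu n\<^esub> p = - p"
proof -
  assume p: "p \<in> carrier (Zu n)"
  interpret Z: ring "Zu n" by (rule ring_Zu)
  show ?thesis using p by (intro Z.minus_equality) (auto simp: Zu_simps)
qed

lemma Zu_minus: "p \<in> carrier (Zu n) \<Longrightarrow> q \<in> carrier (Zu n) \<Longrightarrow> p \<ominus>\<^bsub>Zu n\<^esub> q = p - q"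
  by (simp add: a_minus_def Zu_uminus Zu_simps(5))

lemma Zu_0 [simp]: "0 \<in> carrier (Zu n)" and Zu_1 [simp]: "1 \<in> carrier (Zu n)"
  by (simp_all add: Zu_simps)

lemma Zu_sum: "(\<And>i. i \<in> I \<Longrightarrow> f i \<in> carrier (Zu n)) \<Longrightarrow> (\<Sum>i\<in>I. f i) \<in> carrier (Zu n)"
  by (induction I rule: infinite_finite_induct) (auto intro: Zu_add)

lemma ideal_crowded_poly: "ideal (crowded_poly n k x y) (Zu n)"
proof (rule idealI[OF ring_Zu])
  interpret Z: ring "Zu n" by (rule ring_Zu)
  show "subgroup (crowded_poly n k x y) (add_monoid (Zu n))"
  proof (rule Z.add.subgroupI)
    show "crowded_poly n k x y \<subseteq> carrier (Zu n)" by (auto simp: crowded_poly_def)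
    show "crowded_poly n k x y \<noteq> {}" using crowded_poly_0 by blast
    fix a assume a: "a \<in> crowded_poly n k x y"
    then have "- a \<in> crowded_poly n k x y" using crowded_poly_diff[OF crowded_poly_0 a] by simp
    then show "\<ominus>\<^bsub>Zu n\<^esub> a \<in> crowded_poly n k x y" using Zu_uminus a by (simp add: crowded_poly_def)
  qed (simp add: Zu_simps(5) crowded_poly_add)
next
  fix a p assume a: "a \<in> crowded_poly n k x y" and p: "p \<in> carrier (Zu n)"
  have "crowded_mon n k x y m" if m: "m \<in> Poly_Mapping.keys (p * a)" for m
  proof -
    obtain b c where bc: "m = b + c" "b \<in> Poly_Mapping.keys p" "c \<in> Poly_Mapping.keys a"
      using m keys_mult[of p a] by blast
    then have "crowded_mon n k x y c" using a by (simp add: crowded_poly_def)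
    then show ?thesis unfolding crowded_mon_def bc(1) keys_add_nat by (rule crowded_mono) blast
  qed
  then have "p * a \<in> crowded_poly n k x y" using Zu_mult p a by (simp add: crowded_poly_def)
  then show "p \<otimes>\<^bsub>Zu n\<^esub> a \<in> crowded_poly n k x y" "a \<otimes>\<^bsub>Zu n\<^esub> p \<in> crowded_poly n k x y"
    by (simp_all add: Zu_simps(2) mult.commute)
qed

definition Rclass :: "nat \<Rightarrow> real vec set \<Rightarrow> (nat \<Rightarrow> int) \<Rightarrow> (nat \<Rightarrow> int) \<Rightarrow> mpoly \<Rightarrow> mpoly set" where
  "Rclass n eta \<alpha> \<beta> p = Rideal n eta \<alpha> \<beta> +>\<^bsub>Zu n\<^esub> p"

section \<open>The algebra of paths between left vertices\<close>

text \<open>The corner eRe of an idempotent e, with unit e. It is applied to the sum of the trivial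
  paths at left vertices.\<close>

lemma ring_corner:
  fixes R (structure)
  assumes "ring R" and e: "e \<in> carrier R" "e \<otimes> e = e"
  shows "ring (R\<lparr>carrier := {a \<in> carrier R. e \<otimes> a = a \<and> a \<otimes> e = a}, one := e\<rparr>)"
proof -
  interpret ring R by fact
  show ?thesis
  proof (rule ringI)
    show "abelian_group (R\<lparr>carrier := {a \<in> carrier R. e \<otimes> a = a \<and> a \<otimes> e = a}, one := e\<rparr>)"
    proof (rule abelian_groupI)
      fix x assume "x \<in> carrier (R\<lparr>carrier := {a \<in> carrier R. e \<otimes> a = a \<and> a \<otimes> e = a}, one := e\<rparr>)"
      then show "\<exists>y\<in>carrier (R\<lparr>carrier := {a \<in> carrier R. e \<otimes> a = a \<and> a \<otimes> e = a}, one := e\<rparr>).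
        y \<oplus>\<^bsub>R\<lparr>carrier := {a \<in> carrier R. e \<otimes> a = a \<and> a \<otimes> e = a}, one := e\<rparr>\<^esub> x =
        \<zero>\<^bsub>R\<lparr>carrier := {a \<in> carrier R. e \<otimes> a = a \<and> a \<otimes> e = a}, one := e\<rparr>\<^esub>"
        by (intro bexI[of _ "\<ominus> x"]) (auto simp: l_neg r_minus l_minus e)
    qed (auto simp: a_ac l_distr r_distr e)
    show "Group.monoid (R\<lparr>carrier := {a \<in> carrier R. e \<otimes> a = a \<and> a \<otimes> e = a}, one := e\<rparr>)"
    proof (rule monoidI)
      fix x y assume "x \<in> carrier (R\<lparr>carrier := {a \<in> carrier R. e \<otimes> a = a \<and> a \<otimes> e =
        a}, one := e\<rparr>)"
        "y \<in> carrier (R\<lparr>carrier := {a \<in> carrier R. e \<otimes> a = a \<and> a \<otimes> e = a}, one := e\<rparr>)"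
      then show "x \<otimes>\<^bsub>R\<lparr>carrier := {a \<in> carrier R. e \<otimes> a = a \<and> a \<otimes> e = a}, one := e\<rparr>\<^esub> y
        \<in> carrier (R\<lparr>carrier := {a \<in> carrier R. e \<otimes> a = a \<and> a \<otimes> e = a}, one := e\<rparr>)"
        using m_assoc[of e x y] m_assoc[of x y e] e by auto
    qed (auto simp: m_assoc e)
  qed (auto simp: l_distr r_distr)
qed

text \<open>Only the ends are restricted; a path may pass through sets that contain n.\<close>

definition left_paths :: "nat \<Rightarrow> nat \<Rightarrow> osz_free set" where
  "left_paths n k = {a \<in> carrier (Fr n k). \<forall>p\<in>Poly_Mapping.keys a. fst p \<in> Vl n k \<and>
    snd (snd p) \<in> Vl n k}"

definition restrict_ends :: "nat set \<Rightarrow> nat set \<Rightarrow> osz_free \<Rightarrow> osz_free" where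
  "restrict_ends x y = frag_extend (\<lambda>p. if fst p = x \<and> snd (snd p) = y then frag_of p else 0)"

lemma restrict_ends_pmul: "pmul (pmul (frag_of (x, [], x)) a) (frag_of (y, [], y)) =
  restrict_ends x y a"
proof (induction a rule: frag_induction[OF subset_UNIV])
  case (2 p)
  obtain u l v where p: "p = (u, l, v)" by (rule prod_cases3)
  show ?case unfolding p by (simp add: path_mult_def restrict_ends_def)
qed (simp_all add: pmul_diff restrict_ends_def frag_extend_diff)

lemma idem_path: "osz_path x [] = (x, [], x)"
  by (simp add: osz_path_def)

lemma valid_word_Nil_Vl: "x \<in> Vl n k \<Longrightarrow> valid_word n k x []"
  using Vl_Vset by auto

lemma keys_restrict_ends: "Poly_Mapping.keys (restrict_ends x y a) \<subseteq> {p \<in> Poly_Mapping.keys a.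
  fst p = x \<and> snd (snd p) = y}"
proof
  fix q assume "q \<in> Poly_Mapping.keys (restrict_ends x y a)"
  then obtain p where "p \<in> Poly_Mapping.keys a"
    "q \<in> Poly_Mapping.keys (if fst p = x \<and> snd (snd p) = y then frag_of p else 0)"
    using subsetD[OF keys_frag_extend, of q] unfolding restrict_ends_def by blast
  then show "q \<in> {p \<in> Poly_Mapping.keys a. fst p = x \<and> snd (snd p) = y}"
    by (auto split: if_splits)
qed

lemma restrict_ends_sum:
  assumes "a \<in> left_paths n k"
  shows "(\<Sum>(x, y)\<in>Vl n k \<times> Vl n k. restrict_ends x y a) = a"
proof -
  have fin: "finite (Vl n k \<times> Vl n k)" using finite_Vl by blast
  have "Poly_Mapping.keys a \<subseteq> {p. fst p \<in> Vl n k \<and> snd (snd p) \<in> Vl n k}" using assms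
    by (auto simp: left_paths_def)
  then show ?thesis
  proof (induction a rule: frag_induction)
    case (one p)
    have "(\<Sum>(x, y)\<in>Vl n k \<times> Vl n k. restrict_ends x y (frag_of p)) =
      (\<Sum>z\<in>Vl n k \<times> Vl n k. if z = (fst p, snd (snd p)) then frag_of p else 0)"
    proof (rule sum.cong[OF refl])
      fix z
      show "(case z of (x, y) \<Rightarrow> restrict_ends x y (frag_of p)) =
        (if z = (fst p, snd (snd p)) then frag_of p else 0)"
        by (cases "fst z = fst p"; cases "snd z = snd (snd p)") (simp_all add: restrict_ends_def
          case_prod_beta prod_eq_iff)
    qed
    then show ?case using one fin by simp
  qed (simp_all add: restrict_ends_def frag_extend_diff sum_subtractf case_prod_beta)
qed

context
  fixes n k :: nat
begin

definition left_one :: osz_free where "left_one = (\<Sum>x\<in>Vl n k. frag_of (osz_path x []))"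

lemma finsum_osz_class:
  assumes "finite I" "\<And>i. i \<in> I \<Longrightarrow> f i \<in> carrier (Fr n k)"
  shows "finsum (osz n k) (\<lambda>i. osz_class n k (f i)) I = osz_class n k (\<Sum>i\<in>I. f i)"
  using assms
proof (induction I rule: finite_induct)
  interpret R: ring "osz n k" by (rule ring_osz)
  case empty
  show ?case by (simp add: osz_class_0)
next
  interpret R: ring "osz n k" by (rule ring_osz)
  case (insert i I)
  have "(\<Sum>i\<in>I. f i) \<in> carrier (Fr n k)" using insert.prems by (intro Fr_sum) simp
  then show ?case
    using insert by (simp add: R.finsum_insert osz_class_closed osz_class_add Pi_iff)
qed

lemma left_one_carrier: "left_one \<in> carrier (Fr n k)"
  unfolding left_one_def by (intro Fr_sum frag_of_osz_path valid_word_Nil_Vl)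

lemma one_osz_l: "one (osz_l n k) = osz_class n k left_one"
  using finsum_osz_class[of "Vl n k" "\<lambda>x. frag_of (osz_path x [])"] finite_Vl frag_of_osz_path
    valid_word_Nil_Vl
  by (simp add: osz_l_def left_one_def)

lemma osz_l_simps: "monoid.mult (osz_l n k) = monoid.mult (osz n k)"
  "add (osz_l n k) = add (osz n k)"
  "zero (osz_l n k) = zero (osz n k)"
  by (simp_all add: osz_l_def)

lemma left_paths_Fr: "a \<in> left_paths n k \<Longrightarrow> a \<in> carrier (Fr n k)"
  by (simp add: left_paths_def)

lemma left_paths_add: "a \<in> left_paths n k \<Longrightarrow> b \<in> left_paths n k \<Longrightarrow> a + b \<in> left_paths n k"
  using keys_add[of a b] Fr_add[of a n k b] by (auto simp: left_paths_def)

lemma left_paths_diff: "a \<in> left_paths n k \<Longrightarrow> b \<in> left_paths n k \<Longrightarrow> a - b \<in> left_paths n k"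
  using keys_diff[of a b] Fr_diff[of a n k b] by (auto simp: left_paths_def)

lemma left_paths_0: "0 \<in> left_paths n k"
  by (simp add: left_paths_def)

lemma left_paths_sum: "(\<And>i. i \<in> I \<Longrightarrow> f i \<in> left_paths n k) \<Longrightarrow> (\<Sum>i\<in>I. f i) \<in> left_paths n k"
  by (induction I rule: infinite_finite_induct) (auto intro: left_paths_add left_paths_0)

lemma restrict_ends_left_paths:
  assumes "a \<in> carrier (Fr n k)" "x \<in> Vl n k" "y \<in> Vl n k"
  shows "restrict_ends x y a \<in> left_paths n k"
  using keys_restrict_ends[of x y a] assms by (auto simp: left_paths_def Fr_simps)

lemma osz_word_left_paths: "valid_word n k x ls \<Longrightarrow> x \<in> Vl n k \<Longrightarrow> fold move ls x \<in> Vl n k \<Longrightarrow>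
  frag_of (osz_path x ls) \<in> left_paths n k"
  using frag_of_osz_path by (simp add: left_paths_def)

lemma left_one_left_paths: "left_one \<in> left_paths n k"
  unfolding left_one_def by (intro left_paths_sum osz_word_left_paths) (auto intro:
    valid_word_Nil_Vl[unfolded valid_word.simps])

lemma left_one_mult:
  assumes "a \<in> left_paths n k"
  shows "pmul left_one a = a" "pmul a left_one = a"
proof -
  have 1: "pmul left_one (frag_of p) = frag_of p" "pmul (frag_of p) left_one = frag_of p"
    if p: "fst p \<in> Vl n k \<and> snd (snd p) \<in> Vl n k" for p
  proof -
    have "pmul (frag_of (osz_path x [])) (frag_of p) = (if x = fst p then frag_of p else 0)"
      "pmul (frag_of p) (frag_of (osz_path x [])) = (if x = snd (snd p) then frag_of p else 0)"
        for x
      by (cases p; auto simp: path_mult_def idem_path)+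
    then show "pmul left_one (frag_of p) = frag_of p" "pmul (frag_of p) left_one = frag_of p"
      unfolding left_one_def pmul_sum using p finite_Vl by (simp_all del: pmul_of)
  qed
  have k: "Poly_Mapping.keys a \<subseteq> {p. fst p \<in> Vl n k \<and> snd (snd p) \<in> Vl n k}" using assms
    by (auto simp: left_paths_def)
  show "pmul left_one a = a" using k
    by (induction a rule: frag_induction) (auto simp: pmul_diff 1 simp del: pmul_of)
  show "pmul a left_one = a" using k
    by (induction a rule: frag_induction) (auto simp: pmul_diff 1 simp del: pmul_of)
qed

lemma Fr_pmul: "a \<in> carrier (Fr n k) \<Longrightarrow> b \<in> carrier (Fr n k) \<Longrightarrow> pmul a b \<in> carrier (Fr n k)"
  using ring.ring_simprules(5)[OF ring_Fr, of a n k b] by (simp add: Fr_simps(2))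

lemma carrier_osz: "carrier (osz n k) = osz_class n k ` carrier (Fr n k)"
  unfolding osz_def FactRing_def A_RCOSETS_def' osz_class_def by auto

text \<open>Multiplication by trivial paths on both sides selects the paths with these ends, so the
  sums defining \<open>osz_l\<close> are the classes of combinations of left paths.\<close>

lemma carrier_osz_l: "carrier (osz_l n k) = osz_class n k ` left_paths n k"
proof -
  interpret R: ring "osz n k" by (rule ring_osz)
  have fin: "finite (Vl n k \<times> Vl n k)" using finite_Vl by blast
  have key: "osz_idem n k x \<otimes>\<^bsub>osz n k\<^esub> osz_class n k c \<otimes>\<^bsub>osz n k\<^esub> osz_idem n k y =
    osz_class n k (restrict_ends x y c)"
    if "x \<in> Vl n k" "y \<in> Vl n k" "c \<in> carrier (Fr n k)" for x y c
  proof -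
    note F = frag_of_osz_path[OF valid_word_Nil_Vl[OF that(1)]] frag_of_osz_path[OF
      valid_word_Nil_Vl[OF that(2)]]
    have "osz_idem n k x \<otimes>\<^bsub>osz n k\<^esub> osz_class n k c =
      osz_class n k (pmul (frag_of (osz_path x [])) c)"
      using osz_class_mult F that by simp
    then show ?thesis
      using osz_class_mult[of "pmul (frag_of (osz_path x [])) c" n k "frag_of (osz_path y [])"] F
        that Fr_pmul
      by (simp add: idem_path restrict_ends_pmul)
  qed
  have sum: "finsum (osz n k) (\<lambda>(x, x'). osz_idem n k x \<otimes>\<^bsub>osz n k\<^esub> osz_class n k (c x x') \<otimes>\<^bsub>osz n k\<^esub>
    osz_idem n k x') (Vl n k \<times> Vl n k)
    = osz_class n k (\<Sum>(x, y)\<in>Vl n k \<times> Vl n k. restrict_ends x y (c x y))" if c: "\<And>x y. c x y \<in>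
      carrier (Fr n k)" for c
  proof -
    have "finsum (osz n k) (\<lambda>(x, x'). osz_idem n k x \<otimes>\<^bsub>osz n k\<^esub> osz_class n k (c x x') \<otimes>\<^bsub>osz n k\<^esub>
      osz_idem n k x') (Vl n k \<times> Vl n k)
      = finsum (osz n k) (\<lambda>z. osz_class n k (case z of (x, y) \<Rightarrow> restrict_ends x y (c x y))) (Vl n
        k \<times> Vl n k)"
      by (intro R.finsum_cong') (use c key restrict_ends_left_paths left_paths_Fr osz_class_closed
        in auto)
    also have "\<dots> = osz_class n k (\<Sum>z\<in>Vl n k \<times> Vl n k. case z of (x, y) \<Rightarrow> restrict_ends x y (c x
      y))"
      by (rule finsum_osz_class[OF fin]) (use c restrict_ends_left_paths left_paths_Fr in auto)
    finally show ?thesis by (simp add: case_prod_beta)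
  qed
  show ?thesis
  proof (rule Set.set_eqI)
    fix A
    show "A \<in> carrier (osz_l n k) \<longleftrightarrow> A \<in> osz_class n k ` left_paths n k"
    proof
      assume "A \<in> carrier (osz_l n k)"
      then obtain b where b: "\<And>x x'. b x x' \<in> carrier (osz n k)"
        "A = finsum (osz n k) (\<lambda>(x, x'). osz_idem n k x \<otimes>\<^bsub>osz n k\<^esub> b x x' \<otimes>\<^bsub>osz n k\<^esub> osz_idem n k x')
          (Vl n k \<times> Vl n k)"
        by (auto simp: osz_l_def)
      have "\<forall>x x'. \<exists>c. c \<in> carrier (Fr n k) \<and> b x x' = osz_class n k c" using b(1)
        unfolding carrier_osz by blast
      then obtain c where c: "\<And>x x'. c x x' \<in> carrier (Fr n k)"
        "\<And>x x'. b x x' = osz_class n k (c x x')" by metis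
      have "A = osz_class n k (\<Sum>(x, y)\<in>Vl n k \<times> Vl n k. restrict_ends x y (c x y))"
        unfolding b(2) c(2) by (rule sum[OF c(1)])
      moreover have "(\<Sum>(x, y)\<in>Vl n k \<times> Vl n k. restrict_ends x y (c x y)) \<in> left_paths n k"
        by (intro left_paths_sum) (use c restrict_ends_left_paths in auto)
      ultimately show "A \<in> osz_class n k ` left_paths n k" by blast
    next
      assume "A \<in> osz_class n k ` left_paths n k"
      then obtain a where a: "a \<in> left_paths n k" "A = osz_class n k a" by blast
      have "A = finsum (osz n k) (\<lambda>(x, x'). osz_idem n k x \<otimes>\<^bsub>osz n k\<^esub> osz_class n k a \<otimes>\<^bsub>osz n k\<^esub>
        osz_idem n k x') (Vl n k \<times> Vl n k)"
        using sum[of "\<lambda>x y. a"] restrict_ends_sum[OF a(1)] left_paths_Fr[OF a(1)] a(2) by simp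
      then show "A \<in> carrier (osz_l n k)"
        using osz_class_closed[OF left_paths_Fr[OF a(1)]]
        by (auto simp: osz_l_def intro!: exI[of _ "\<lambda>x y. osz_class n k a"])
    qed
  qed
qed

lemma ring_osz_l: "ring (osz_l n k)"
proof -
  interpret R: ring "osz n k" by (rule ring_osz)
  let ?e = "osz_class n k left_one"
  have e: "?e \<in> carrier (osz n k)" "?e \<otimes>\<^bsub>osz n k\<^esub> ?e = ?e"
    using osz_class_closed[OF left_one_carrier] osz_class_mult[OF left_one_carrier
      left_one_carrier] left_one_mult[OF left_one_left_paths] by simp_all
  have "osz_class n k ` left_paths n k =
    {a \<in> carrier (osz n k). ?e \<otimes>\<^bsub>osz n k\<^esub> a = a \<and> a \<otimes>\<^bsub>osz n k\<^esub> ?e = a}"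
  proof (rule Set.set_eqI)
    fix A
    show "A \<in> osz_class n k ` left_paths n k \<longleftrightarrow>
      A \<in> {a \<in> carrier (osz n k). ?e \<otimes>\<^bsub>osz n k\<^esub> a = a \<and> a \<otimes>\<^bsub>osz n k\<^esub> ?e = a}"
    proof
      assume "A \<in> osz_class n k ` left_paths n k"
      then obtain a where a: "a \<in> left_paths n k" "A = osz_class n k a" by blast
      then show "A \<in> {a \<in> carrier (osz n k). ?e \<otimes>\<^bsub>osz n k\<^esub> a = a \<and> a \<otimes>\<^bsub>osz n k\<^esub> ?e = a}"
        using osz_class_closed[OF left_paths_Fr] osz_class_mult[OF left_one_carrier
          left_paths_Fr[OF a(1)]] osz_class_mult[OF left_paths_Fr[OF a(1)] left_one_carrier]
        by (simp add: left_one_mult)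
    next
      assume A: "A \<in> {a \<in> carrier (osz n k). ?e \<otimes>\<^bsub>osz n k\<^esub> a = a \<and> a \<otimes>\<^bsub>osz n k\<^esub> ?e = a}"
      then obtain a where a: "a \<in> carrier (Fr n k)" "A = osz_class n k a" unfolding carrier_osz
        by blast
      have "osz_class n k (pmul (pmul left_one a) left_one) = A"
        using A a left_one_carrier Fr_pmul by (simp add: osz_class_mult)
      moreover have "pmul (pmul left_one a) left_one =
        (\<Sum>x\<in>Vl n k. \<Sum>y\<in>Vl n k. restrict_ends x y a)"
        unfolding left_one_def pmul_sum idem_path
          by (subst sum.swap) (simp add: restrict_ends_pmul)
      moreover have "(\<Sum>x\<in>Vl n k. \<Sum>y\<in>Vl n k. restrict_ends x y a) \<in> left_paths n k"
        by (intro left_paths_sum restrict_ends_left_paths a)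
      ultimately show "A \<in> osz_class n k ` left_paths n k" by (metis imageI)
    qed
  qed
  then have "osz_l n k = (osz n k)\<lparr>carrier := {a \<in> carrier (osz n k). ?e \<otimes>\<^bsub>osz n k\<^esub> a =
    a \<and> a \<otimes>\<^bsub>osz n k\<^esub> ?e = a}, one := ?e\<rparr>"
    using carrier_osz_l one_osz_l by (simp add: osz_l_def)
  then show ?thesis using ring_corner[OF ring_osz e] by simp
qed

lemma path_poly_left_paths_0:
  assumes "a \<in> left_paths n k" "x \<notin> Vl n k \<or> y \<notin> Vl n k"
  shows "path_poly x y a = 0"
  unfolding path_poly_def by (rule frag_extend_eq_0) (use assms in \<open>auto simp: left_paths_def\<close>)

end

text \<open>All k changes of a left vertex lie below n, so left vertices have the same sign at
  n.\<close>

lemma dset_Vl: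
  assumes "x \<in> Vl n k" "y \<in> Vl n k" "i \<in> dset n x y"
  shows "i < n"
proof -
  have "x \<inter> {..<n} = x" "y \<inter> {..<n} = y" using assms(1,2) by (auto simp: Vl_def)
  then have "pos_at x n = pos_at y n" using assms(1,2) by (simp add: pos_at_def Vl_def)
  then have "i \<noteq> n" "i \<le> n" using assms(3) by (auto simp: dset_def)
  then show ?thesis by simp
qed

lemma toggle_Vl:
  assumes "x \<in> Vl n k" "1 \<le> i" "i < n" "toggle {i} x \<in> Vset n k"
  shows "toggle {i} x \<in> Vl n k"
proof -
  have "toggle {i} x \<subseteq> {0..<n}" using assms(1-3) by (auto simp: Vl_def toggle_def)
  then show ?thesis using assms(4) by (simp add: Vl_def Vset_def)
qed

lemma osz_word_osz_l: "valid_word n k x ls \<Longrightarrow> x \<in> Vl n k \<Longrightarrow> fold move ls x \<in> Vl n k \<Longrightarrow>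
  osz_word n k x ls \<in> carrier (osz_l n k)"
  unfolding carrier_osz_l using osz_word_left_paths by blast

text \<open>The arrows between left vertices generate, although a path may leave the left vertices:
  its normal form does not. A geodesic between left vertices never uses the position n, and letters
  \<open>U\<close> do not move the vertex.\<close>

lemma osz_l_hom_unique:
  assumes R: "ring R" and h: "h \<in> Ring.ring_hom (osz_l n k) R" "h' \<in> Ring.ring_hom (osz_l n k) R"
    and idem: "\<And>x. x \<in> Vl n k \<Longrightarrow> h (osz_idem n k x) = h' (osz_idem n k x)"
    and arr: "\<And>x l. x \<in> Vl n k \<Longrightarrow> move l x \<in> Vl n k \<Longrightarrow> (x, l) \<in> arcs (osz_quiver n k) \<Longrightarrow>
      h (osz_word n k x [l]) = h' (osz_word n k x [l])"
    and A: "A \<in> carrier (osz_l n k)"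
  shows "h A = h' A"
proof -
  interpret R: ring R by fact
  note hc = ring_hom_closed[OF h(1)] ring_hom_closed[OF h(2)]
  have step: "h (osz_word n k x (l # v)) = h' (osz_word n k x (l # v))"
    if "valid_word n k x (l # v)" "x \<in> Vl n k" "move l x \<in> Vl n k"
      "fold move v (move l x) \<in> Vl n k"
      "h (osz_word n k (move l x) v) = h' (osz_word n k (move l x) v)" for x l v
  proof -
    have ok: "valid_word n k x [l]" "valid_word n k (move l x) v" "(x, l) \<in> arcs (osz_quiver n k)"
      using that(1) by (auto simp: valid_word.simps(2) dest: valid_word_Vset)
    have "osz_word n k x (l # v) = osz_word n k x [l] \<otimes>\<^bsub>osz_l n k\<^esub> osz_word n k (move l x) v"
      using word_Cons[OF that(1)] by (simp add: osz_l_simps)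
    moreover have "osz_word n k x [l] \<in> carrier (osz_l n k)"
      "osz_word n k (move l x) v \<in> carrier (osz_l n k)"
      using ok that by (simp_all add: osz_word_osz_l)
    ultimately show ?thesis
      using ring_hom_mult[OF h(1)] ring_hom_mult[OF h(2)] arr[OF that(2,3) ok(3)] that(5) by simp
  qed
  have geo: "h (osz_word n k x g) = h' (osz_word n k x g)"
    if "geodesic n k y x g" "x \<in> Vl n k" "y \<in> Vl n k" for x y g
    using that
  proof (induction rule: geodesic.induct)
    case Nil
    then show ?case using idem by simp
  next
    case (Cons x i ls)
    have i: "1 \<le> i" "i \<le> n" using dset_le Cons.hyps(2) by auto
    have fV: "toggle {i} x \<in> Vl n k"
      using toggle_Vl[OF Cons.prems(1) i(1) dset_Vl[OF Cons.prems Cons.hyps(2)]] geodesicD(3)[OF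
        Cons.hyps(4)] by simp
    have ok: "valid_word n k x (step x i # ls)"
      using geodesicD(1)[OF Cons.hyps(4)] valid_word_step[OF Cons.hyps(1,3) i(2)] by simp
    show ?case
      by (rule step) (use ok fV Cons.IH[OF fV Cons.prems(2)] Cons.prems
        geodesicD(2)[OF Cons.hyps(4)] in \<open>simp_all add: move_step Cons.hyps(3)\<close>)
  qed
  have nf: "h (osz_word n k x (map Uarr us @ g)) = h' (osz_word n k x (map Uarr us @ g))"
    if "geodesic n k y x g" "x \<in> Vl n k" "y \<in> Vl n k" "valid_word n k x (map Uarr us @ g)"
      for x y us g
    using that(4)
  proof (induction us)
    case Nil
    then show ?case using geo[OF that(1-3)] by simp
  next
    case (Cons u us)
    have ok: "valid_word n k x (Uarr u # (map Uarr us @ g))" "valid_word n k x (map Uarr us @ g)"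
      using Cons.prems by (simp_all add: valid_word.simps(2))
    have "h (osz_word n k x (Uarr u # (map Uarr us @ g))) =
      h' (osz_word n k x (Uarr u # (map Uarr us @ g)))"
      by (rule step) (use ok(1) that(2,3) Cons.IH[OF ok(2)] geodesicD(2)[OF that(1)] in
        \<open>simp_all add: fold_append\<close>)
    then show ?case by simp
  qed
  have h_zero: "h (zero (osz_l n k)) = h' (zero (osz_l n k))"
    using ring_hom_zero[OF h(1) ring_osz_l R] ring_hom_zero[OF h(2) ring_osz_l R] by simp
  have word: "h (osz_word n k x ls) = h' (osz_word n k x ls)"
    if ok: "valid_word n k x ls" and xy: "x \<in> Vl n k" "fold move ls x \<in> Vl n k" for x ls
  proof -
    let ?y = "fold move ls x" and ?m = "path_mon (osz_path x ls)"
    show ?thesis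
    proof (cases "crowded_mon n k x ?y ?m")
      case True
      then show ?thesis using word_normal_word[OF ok refl] h_zero
        by (simp add: lift_def osz_class_0 osz_l_simps)
    next
      case False
      have V: "x \<in> Vset n k" "?y \<in> Vset n k" using xy Vl_Vset by blast+
      have "\<not> crowded k (dset n x ?y) x" using False crowded_mono unfolding crowded_mon_def
        by blast
      then have g: "geodesic n k ?y x (SOME g. geodesic n k ?y x g)"
        using someI_ex[OF geodesic_exists[OF V]] by blast
      have "h (osz_word n k x (normal_word n k x ?y ?m)) =
        h' (osz_word n k x (normal_word n k x ?y ?m))"
        using nf[OF g xy] normal_word(1)[OF V False keys_path_mon_range[OF ok]]
          unfolding normal_word_def by blast
      then show ?thesis using word_normal_word[OF ok refl] False by (simp add: lift_def)
    qed
  qed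
  obtain a where a: "a \<in> left_paths n k" "A = osz_class n k a" using A unfolding carrier_osz_l
    by blast
  have "Poly_Mapping.keys a \<subseteq> {p \<in> paths (osz_quiver n k). fst p \<in> Vl n k \<and> snd (snd p) \<in> Vl n k}"
    using a(1) by (auto simp: left_paths_def Fr_simps)
  then have "a \<in> left_paths n k \<and> h (osz_class n k a) = h' (osz_class n k a)"
  proof (induction a rule: frag_induction)
    case zero
    show ?case using h_zero left_paths_0 by (simp add: osz_class_0 osz_l_simps)
  next
    case (one p)
    then obtain x ls where p: "p = osz_path x ls" "valid_word n k x ls" using paths_oszE by blast
    then show ?case using one word osz_word_left_paths by simp
  next
    case (diff a b)
    then have ab: "a \<in> left_paths n k" "b \<in> left_paths n k" "a - b \<in> left_paths n k"
      using left_paths_diff by blast+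
    then have mem: "osz_class n k (a - b) \<in> carrier (osz_l n k)"
      "osz_class n k b \<in> carrier (osz_l n k)"
      unfolding carrier_osz_l by blast+
    have "osz_class n k a = osz_class n k (a - b) \<oplus>\<^bsub>osz_l n k\<^esub> osz_class n k b"
      using osz_class_add[OF left_paths_Fr[OF ab(3)] left_paths_Fr[OF ab(2)]]
        by (simp add: osz_l_simps)
    then have "h (osz_class n k (a - b)) \<oplus>\<^bsub>R\<^esub> h' (osz_class n k b) =
      h' (osz_class n k (a - b)) \<oplus>\<^bsub>R\<^esub> h' (osz_class n k b)"
      using diff ring_hom_add[OF h(1) mem] ring_hom_add[OF h(2) mem] by simp
    then have "h (osz_class n k (a - b)) = h' (osz_class n k (a - b))"
      using hc mem by simp
    then show ?case using ab by simp
  qed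
  then show ?thesis using a by simp
qed

section \<open>Reversal of paths\<close>

abbreviation (input) path_rev :: "osz_free \<Rightarrow> osz_free" where
  "path_rev \<equiv> frag_extend (\<lambda>p. frag_of (reverse_path p))"

lemma flip_arc:
  assumes "(x, l) \<in> arcs (osz_quiver n k)"
  shows "(move l x, flip_label l) \<in> arcs (osz_quiver n k)" "move (flip_label l) (move l x) = x"
proof -
  have "valid_word n k x [l]"
    using assms valid_word_target[of n k x "[]"] wf_digraph.head_in_verts[OF wf_osz_quiver assms]
    by (simp add: valid_word.simps(2))
  then have V: "move l x \<in> Vset n k" using valid_word_target by force
  show "(move l x, flip_label l) \<in> arcs (osz_quiver n k)" "move (flip_label l) (move l x) = x"
    using assms V by (cases l; auto simp: arc_Rarr arc_Larr arc_Uarr)+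
qed

lemma valid_word_reverse:
  assumes "valid_word n k x ls"
  shows "valid_word n k (fold move ls x) (rev (map flip_label ls))"
    and "fold move (rev (map flip_label ls)) (fold move ls x) = x"
    and "reverse_path (osz_path x ls) = osz_path (fold move ls x) (rev (map flip_label ls))"
proof -
  have *: "valid_word n k (fold move ls x) (rev (map flip_label ls)) \<and>
    fold move (rev (map flip_label ls)) (fold move ls x) = x \<and>
    rev (map flip_arrow (arrows_from x ls)) = arrows_from (fold move ls x) (rev
      (map flip_label ls))"
    using assms
  proof (induction ls arbitrary: x)
    case (Cons l ls)
    have a: "(x, l) \<in> arcs (osz_quiver n k)" "valid_word n k (move l x) ls" using Cons.prems
      by (simp_all add: valid_word.simps(2))
    note IH = Cons.IH[OF a(2)]
    have "x \<in> Vset n k" using valid_word_Vset[OF Cons.prems] .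
    then show ?case using IH flip_arc[OF a(1)]
      by (simp add: valid_word_append valid_word.simps(2) arrows_from_append flip_arrow_def)
  qed simp
  then show "valid_word n k (fold move ls x) (rev (map flip_label ls))"
    "fold move (rev (map flip_label ls)) (fold move ls x) = x"
    "reverse_path (osz_path x ls) = osz_path (fold move ls x) (rev (map flip_label ls))"
    by (simp_all add: osz_path_def reverse_path_def)
qed

lemma wt_reverse: "wt (rev (map flip_label ls)) i = wt ls i"
proof (induction ls)
  case (Cons l ls)
  then show ?case by (cases l) simp_all
qed simp

lemma path_rev_diff: "path_rev (a - b) = path_rev a - path_rev b"
  by (rule frag_extend_diff)

lemma path_rev_add: "path_rev (a + b) = path_rev a + path_rev b"
  by (rule frag_extend_add)

lemma flip_flip_label: "flip_label (flip_label l) = l"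
  by (cases l) simp_all

lemma path_rev_path:
  assumes "valid_word n k x ls"
  shows "path_rev (frag_of (osz_path x ls)) =
    frag_of (osz_path (fold move ls x) (rev (map flip_label ls)))"
  by (simp add: valid_word_reverse(3)[OF assms])

lemma path_rev_Fr:
  assumes "a \<in> carrier (Fr n k)"
  shows "path_rev a \<in> carrier (Fr n k)" "path_rev (path_rev a) = a"
    "path_poly x y (path_rev a) = path_poly y x a"
proof -
  have "path_rev a \<in> carrier (Fr n k) \<and> path_rev (path_rev a) = a \<and> path_poly x y (path_rev a) =
    path_poly y x a"
    using assms
  proof (induction rule: osz_free_induct)
    case (path z ls)
    note r = valid_word_reverse[OF path]
    have "path_mon (osz_path (fold move ls z) (rev (map flip_label ls))) =
      path_mon (osz_path z ls)"
      by (rule poly_mapping_eqI) (simp only: lookup_path_mon wt_reverse)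
    moreover have "path_rev (path_rev (frag_of (osz_path z ls))) = frag_of (osz_path z ls)"
      by (simp only: path_rev_path[OF path] path_rev_path[OF r(1)] r(2))
        (simp add: rev_map flip_flip_label comp_def)
    ultimately show ?case
      unfolding path_rev_path[OF path] using frag_of_osz_path[OF r(1)] r(2)
        by (auto simp: path_poly_osz_path)
  next
    case (diff a b)
    then show ?case by (simp add: path_rev_diff path_poly_diff Fr_diff)
  qed simp
  then show "path_rev a \<in> carrier (Fr n k)" "path_rev (path_rev a) = a"
    "path_poly x y (path_rev a) = path_poly y x a" by blast+
qed

lemma path_rev_left_paths:
  assumes "a \<in> left_paths n k"
  shows "path_rev a \<in> left_paths n k"
proof -
  have "fst q \<in> Vl n k \<and> snd (snd q) \<in> Vl n k" if q: "q \<in> Poly_Mapping.keys (path_rev a)" for q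
  proof -
    obtain p where "p \<in> Poly_Mapping.keys a" "q = reverse_path p"
      using q keys_frag_extend[of "\<lambda>p. frag_of (reverse_path p)" a] by fastforce
    then show ?thesis using assms by (auto simp: left_paths_def reverse_path_def case_prod_beta)
  qed
  then show ?thesis using path_rev_Fr(1)[OF left_paths_Fr[OF assms]] by (simp add: left_paths_def)
qed

lemma crowded_poly_commute:
  "x \<in> Vset n k \<Longrightarrow> y \<in> Vset n k \<Longrightarrow> crowded_poly n k x y = crowded_poly n k y x"
  using crowded_mon_commute by (simp add: crowded_poly_def)

text \<open>Reversal swaps the two ends in the polynomials, and crowding is symmetric in the ends,
  so the description of the ideal by polynomials is invariant.\<close>

lemma path_rev_ideal: "path_rev ` osz_ideal n k = osz_ideal n k"
proof -
  have *: "path_rev a \<in> osz_ideal n k" if "a \<in> osz_ideal n k" for a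
  proof -
    have a: "a \<in> carrier (Fr n k)"
      "\<And>x y. x \<in> Vset n k \<Longrightarrow> y \<in> Vset n k \<Longrightarrow> path_poly x y a \<in> crowded_poly n k x y"
      using that unfolding osz_ideal_eq by blast+
    have "path_poly y x a \<in> crowded_poly n k x y" if "x \<in> Vset n k" "y \<in> Vset n k" for x y
      using a(2)[OF that(2,1)] crowded_poly_commute[OF that] by simp
    then show ?thesis using path_rev_Fr[OF a(1)] unfolding osz_ideal_eq by simp
  qed
  then have "a \<in> path_rev ` osz_ideal n k" if "a \<in> osz_ideal n k" for a
    using path_rev_Fr(2)[of a n k] that *[OF that] unfolding osz_ideal_eq
      by (metis (no_types, lifting) image_eqI mem_Collect_eq)
  with * show ?thesis by blast
qed

lemma psi_OSz_class:
  assumes "a \<in> carrier (Fr n k)"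
  shows "psi_OSz (osz_class n k a) = osz_class n k (path_rev a)"
proof -
  have coset: "osz_class n k b = (\<lambda>i. i + b) ` osz_ideal n k" for b
    by (auto simp: osz_class_def a_r_coset_def' Fr_simps)
  have "psi_OSz (osz_class n k a) = (\<lambda>i. i + path_rev a) ` (path_rev ` osz_ideal n k)"
    unfolding coset psi_OSz_def by (simp add: image_image path_rev_add)
  then show ?thesis unfolding path_rev_ideal coset .
qed

context
  fixes n k :: nat and V eta xi :: "real vec set"
  assumes pol: "polarized_arrangement n k V eta xi" and lc: "left_cyclic n k V eta xi"
begin

section \<open>Regions of a left cyclic arrangement\<close>

lemma subspace_V: "linear_subspace n k V"
  using pol by (simp add: polarized_arrangement_def arrangement_def)

lemmas V_carrier = linear_subspaceD(1)[OF subspace_V] and V_0 = linear_subspaceD(2)[OF subspace_V]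
  and V_add = linear_subspaceD(3)[OF subspace_V] and V_smult = linear_subspaceD(4)[OF subspace_V]

lemma V_diff: "u \<in> V \<Longrightarrow> v \<in> V \<Longrightarrow> u - v \<in> V"
proof -
  assume uv: "u \<in> V" "v \<in> V"
  then have "u + (-1) \<cdot>\<^sub>v v \<in> V" using V_add V_smult by blast
  moreover have "u + (-1) \<cdot>\<^sub>v v = u - v" using uv V_carrier by (intro eq_vecI) auto
  ultimately show ?thesis by simp
qed

lemma eta_coset: "\<exists>y\<in>carrier_vec n. eta = (\<lambda>v. v + y) ` V"
proof -
  have "eta \<in> a_rcosets\<^bsub>module_vec TYPE(real) n\<^esub> V"
    using pol by (simp add: polarized_arrangement_def arrangement_def)
  from coset_vec[OF this] show ?thesis by blast
qed

lemma eta_carrier: "eta \<subseteq> carrier_vec n"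
  using eta_coset V_carrier by auto

lemma eta_ex: "\<exists>y. y \<in> eta"
  using eta_coset V_0 by auto

lemma eta_add: "x \<in> eta \<Longrightarrow> v \<in> V \<Longrightarrow> x + v \<in> eta"
proof -
  assume x: "x \<in> eta" and v: "v \<in> V"
  obtain y u where y: "y \<in> carrier_vec n" "eta = (\<lambda>v. v + y) ` V" "u \<in> V" "x = u + y"
    using eta_coset x by auto
  have "x + v = (u + v) + y" using y v V_carrier by (intro eq_vecI) auto
  then show ?thesis using y V_add v by auto
qed

lemma eta_diff: "x \<in> eta \<Longrightarrow> x' \<in> eta \<Longrightarrow> x - x' \<in> V"
proof -
  assume x: "x \<in> eta" "x' \<in> eta"
  obtain y u u' where y: "y \<in> carrier_vec n" "u \<in> V" "x = u + y" "u' \<in> V" "x' = u' + y"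
    using eta_coset x by auto
  have "x - x' = u - u'" using y V_carrier by (intro eq_vecI) auto
  then show ?thesis using V_diff y by simp
qed

lemma functional_eq: "\<exists>w\<in>carrier_vec n. \<forall>v\<in>V. functional xi v = w \<bullet> v"
proof -
  obtain w where w: "w \<in> carrier_vec n" "xi = (\<lambda>u. u + w) ` (orth n V)"
    using pol coset_vec[of xi n "orth n V"] by (auto simp: polarized_arrangement_def)
  have "functional xi v = w \<bullet> v" if v: "v \<in> V" for v
    unfolding functional_def
  proof (rule the_equality)
    have "(u + w) \<bullet> v = w \<bullet> v" if "u \<in> orth n V" for u
      using that v w V_carrier by (auto simp: vec_module.orthogonal_complement_def
        add_scalar_prod_distrib[of _ n])
    then show *: "\<forall>w'\<in>xi. w' \<bullet> v = w \<bullet> v" using w by auto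
    have "0\<^sub>v n \<in> orth n V" using V_carrier by (auto simp: vec_module.orthogonal_complement_def)
    then have "xi \<noteq> {}" using w by auto
    then show "c = w \<bullet> v" if "\<forall>w'\<in>xi. w' \<bullet> v = c" for c using * that by auto
  qed
  then show ?thesis using w by blast
qed

lemma functional_add: "u \<in> V \<Longrightarrow> v \<in> V \<Longrightarrow> functional xi (u + v) = functional xi u + functional xi v"
proof -
  assume uv: "u \<in> V" "v \<in> V"
  obtain w where w: "w \<in> carrier_vec n" "\<And>v. v \<in> V \<Longrightarrow> functional xi v = w \<bullet> v" using functional_eq
    by blast
  have "w \<bullet> (u + v) = w \<bullet> u + w \<bullet> v"
    using w(1) uv V_carrier by (intro scalar_prod_add_distrib[of _ n]) auto
  then show ?thesis using w(2) uv V_add by simp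
qed

lemma functional_smult: "v \<in> V \<Longrightarrow> functional xi (c \<cdot>\<^sub>v v) = c * functional xi v"
proof -
  assume v: "v \<in> V"
  obtain w where w: "w \<in> carrier_vec n" "\<And>v. v \<in> V \<Longrightarrow> functional xi v = w \<bullet> v" using functional_eq
    by blast
  show ?thesis using w v V_smult V_carrier by (auto simp: scalar_prod_smult_right)
qed

text \<open>A matrix whose rows span the vectors (\<xi>(v), v). Column 0 holds the values of \<xi>
  and column i + 1 the coordinate with index i; the description of the row space is spelled out in
  coordinates.\<close>

definition "cyclic_matrix A' \<longleftrightarrow> same_sign_minors A' k (Suc n) \<and>
  (\<forall>v\<in>V. \<exists>c. functional xi v = (\<Sum>r<k. c r * A' $$ (r, 0)) \<and>
    (\<forall>i<n. v $ i = (\<Sum>r<k. c r * A' $$ (r, Suc i)))) \<and>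
  (\<forall>c. \<exists>v\<in>V. functional xi v = (\<Sum>r<k. c r * A' $$ (r, 0)) \<and>
    (\<forall>i<n. v $ i = (\<Sum>r<k. c r * A' $$ (r, Suc i))))"

lemma ex_cyclic_matrix: "\<exists>A'. cyclic_matrix A'"
proof -
  have "(\<lambda>v. vCons (functional xi v) v) ` V \<in> Gr_pos k (Suc n)"
    using lc by (simp add: left_cyclic_def)
  then obtain A where A: "same_sign_minors A k (Suc n)"
    "vec_space.row_space (Suc n) A = (\<lambda>v. vCons (functional xi v) v) ` V" by (rule Gr_posE)
  have Ac: "A \<in> carrier_mat k (Suc n)" using A by (simp add: same_sign_minors_def)
  note iff = row_space_iff[OF Ac, unfolded A(2)]
  show ?thesis
    unfolding cyclic_matrix_def
  proof (intro exI[of _ A] conjI ballI allI)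
    fix v assume "v \<in> V"
    then obtain c where c: "\<And>i. i < Suc n \<Longrightarrow> vCons (functional xi v) v $ i =
      (\<Sum>r<k. c r * A $$ (r, i))"
      using iff[of "vCons (functional xi v) v"] by blast
    show "\<exists>c. functional xi v =
      (\<Sum>r<k. c r * A $$ (r, 0)) \<and> (\<forall>i<n. v $ i = (\<Sum>r<k. c r * A $$ (r, Suc i)))"
      using c[of 0] c[of "Suc _"] by (intro exI[of _ c]) auto
  next
    fix c :: "nat \<Rightarrow> real"
    have "vec (Suc n) (\<lambda>i. \<Sum>r<k. c r * A $$ (r, i)) \<in> (\<lambda>v. vCons (functional xi v) v) ` V"
      unfolding iff by (auto intro: exI[of _ c])
    then obtain v where v: "v \<in> V"
      "vec (Suc n) (\<lambda>i. \<Sum>r<k. c r * A $$ (r, i)) = vCons (functional xi v) v"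
      by blast
    have "vCons (functional xi v) v $ i = (\<Sum>r<k. c r * A $$ (r, i))" if "i < Suc n" for i
      using that by (simp flip: v(2))
    from this[of 0] this[of "Suc _"]
    show "\<exists>v\<in>V. functional xi v =
      (\<Sum>r<k. c r * A $$ (r, 0)) \<and> (\<forall>i<n. v $ i = (\<Sum>r<k. c r * A $$ (r, Suc i)))"
      using v(1) by (intro bexI[of _ v]) auto
  qed (rule A(1))
qed

lemma ex_basis_W:
  "\<exists>A. same_sign_minors A (Suc k) n \<and> vec_space.row_space n A =
    {v + c \<cdot>\<^sub>v y | v c y. v \<in> V \<and> y \<in> eta}"
  and k_less_n: "k < n"
proof -
  have "{v + c \<cdot>\<^sub>v y | v c y. v \<in> V \<and> y \<in> eta} \<in> Gr_pos (Suc k) n"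
    using lc by (simp add: left_cyclic_def)
  then obtain A where A: "same_sign_minors A (Suc k) n"
    "vec_space.row_space n A = {v + c \<cdot>\<^sub>v y | v c y. v \<in> V \<and> y \<in> eta}"
    "linear_subspace n (Suc k) {v + c \<cdot>\<^sub>v y | v c y. v \<in> V \<and> y \<in> eta}" by (rule Gr_posE)
  show "k < n"
    using row_space_dim_le[of A "Suc k" n "Suc k"] A by (simp add: same_sign_minors_def)
  show "\<exists>A. same_sign_minors A (Suc k) n \<and> vec_space.row_space n A =
    {v + c \<cdot>\<^sub>v y | v c y. v \<in> V \<and> y \<in> eta}"
    using A by blast
qed

lemma realize_in_V:
  assumes "\<And>i. i < Suc n \<Longrightarrow> g i = 1 \<or> g i = (-1 :: real)" "card (changes g (Suc n)) < k"
  obtains v where "v \<in> V" "g 0 * functional xi v > 0" "\<And>i. i < n \<Longrightarrow> g (Suc i) * v $ i > 0"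
proof -
  obtain A' where A': "cyclic_matrix A'" using ex_cyclic_matrix by blast
  then have S: "same_sign_minors A' k (Suc n)" by (simp add: cyclic_matrix_def)
  obtain c where c: "\<And>i. i < Suc n \<Longrightarrow> g i * (\<Sum>r<k. c r * A' $$ (r, i)) > 0"
    using realize_signs[OF S assms] k_less_n by auto
  obtain v where "v \<in> V" "functional xi v = (\<Sum>r<k. c r * A' $$ (r, 0))"
    "\<And>i. i < n \<Longrightarrow> v $ i = (\<Sum>r<k. c r * A' $$ (r, Suc i))"
    using A' unfolding cyclic_matrix_def by blast
  then show thesis using that[of v] c[of 0] c[of "Suc _"] by simp
qed

text \<open>The projection of \<open>\<eta>\<close> to the orthogonal complement of \<open>V\<close> exists because the Gram matrix of a
  basis of \<open>V\<close> is invertible.\<close>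

lemma proj_ex: "\<exists>p\<in>eta. p \<in> orth n V \<and> p $ 0 > 0"
proof -
  obtain y where y: "y \<in> eta" using eta_ex by blast
  have yc: "y \<in> carrier_vec n" using y eta_carrier by blast
  obtain A' where A': "cyclic_matrix A'" using ex_cyclic_matrix by blast
  define A where "A = mat k n (\<lambda>(r, i). A' $$ (r, Suc i))"
  have A: "A \<in> carrier_mat k n" by (simp add: A_def)
  have inV: "A\<^sup>T *\<^sub>v c \<in> V" if c: "c \<in> carrier_vec k" for c
  proof -
    obtain v where v: "v \<in> V" "\<And>i. i < n \<Longrightarrow> v $ i = (\<Sum>r<k. c $ r * A' $$ (r, Suc i))"
      using A' unfolding cyclic_matrix_def by meson
    have "A\<^sup>T *\<^sub>v c = v"
      using v V_carrier c by (intro eq_vecI) (auto simp: A_def scalar_prod_def atLeast0LessThan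
        mult.commute intro!: sum.cong)
    then show ?thesis using v by simp
  qed
  have ofV: "\<exists>c\<in>carrier_vec k. v = A\<^sup>T *\<^sub>v c" if v: "v \<in> V" for v
  proof -
    obtain c where "\<And>i. i < n \<Longrightarrow> v $ i = (\<Sum>r<k. c r * A' $$ (r, Suc i))"
      using A' v unfolding cyclic_matrix_def by meson
    then have "v = A\<^sup>T *\<^sub>v vec k c"
      using v V_carrier by (intro eq_vecI) (auto simp: A_def scalar_prod_def atLeast0LessThan
        mult.commute intro!: sum.cong)
    then show ?thesis by (intro bexI[of _ "vec k c"]) auto
  qed
  let ?M = "A * A\<^sup>T"
  have M: "?M \<in> carrier_mat k k" using A by simp
  \<comment> \<open>The minor on the first k columns of \<open>A\<close> is nonzero, so the
    transpose of \<open>A\<close> is injective.\<close>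
  have inj: "c = 0\<^sub>v k" if c: "c \<in> carrier_vec k" "A\<^sup>T *\<^sub>v c = 0\<^sub>v n" for c
  proof -
    have S: "same_sign_minors A' k (Suc n)" using A' by (simp add: cyclic_matrix_def)
    have kn: "k \<le> n" using k_less_n by simp
    define J where "J = {0..<k}"
    have J: "J \<subseteq> {0..<n}" "card J = k" using kn by (auto simp: J_def)
    have pk: "pick J j = j" if "j < k" for j
    proof -
      have "j \<in> J" "J \<inter> {..<j} = {..<j}" using that by (auto simp: J_def)
      then show ?thesis using pick_card_less[of j J] by simp
    qed
    have "minor A J = minor A' (Suc ` J)"
      unfolding A_def using minor_shift[of A' k n J] S J by (simp add: same_sign_minors_def)
    moreover have "minor A' (Suc ` J) \<noteq> 0"
    proof -
      have "Suc ` J \<subseteq> {0..<Suc n}" "card (Suc ` J) = k" using J by (auto simp: card_image)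
      then show ?thesis using S unfolding same_sign_minors_def by (metis less_irrefl)
    qed
    ultimately have nz: "det (submatrix A UNIV J) \<noteq> 0" by (simp add: minor_def)
    have sm: "submatrix A UNIV J = mat k k (\<lambda>(r, j). A $$ (r, j))"
      using submatrix_UNIV_cols[OF A J(1)] J(2) pk by (auto intro!: eq_matI)
    have "(submatrix A UNIV J)\<^sup>T *\<^sub>v c = 0\<^sub>v k"
    proof (rule eq_vecI)
      fix j assume "j < dim_vec (0\<^sub>v k :: real vec)"
      then have j: "j < k" by simp
      have "((submatrix A UNIV J)\<^sup>T *\<^sub>v c) $ j = (A\<^sup>T *\<^sub>v c) $ j"
        using j kn A c(1) by (auto simp: sm scalar_prod_def intro!: sum.cong)
      then show "((submatrix A UNIV J)\<^sup>T *\<^sub>v c) $ j = 0\<^sub>v k $ j" using c(2) j kn by simp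
    qed (simp add: sm)
    moreover have "det ((submatrix A UNIV J)\<^sup>T) \<noteq> 0"
      using nz det_transpose[of "submatrix A UNIV J" k] by (simp add: sm)
    moreover have "(submatrix A UNIV J)\<^sup>T \<in> carrier_mat k k" by (simp add: sm)
    ultimately show ?thesis using det_0_iff_vec_prod_zero[of "(submatrix A UNIV J)\<^sup>T" k] c(1)
      by blast
  qed
  \<comment> \<open>If the Gram matrix kills c, the vector d obtained by applying the transpose of
    \<open>A\<close> to c has d . d = 0.\<close>
  have "det ?M \<noteq> 0"
  proof
    assume "det ?M = 0"
    then obtain c where c: "c \<in> carrier_vec k" "c \<noteq> 0\<^sub>v k" "?M *\<^sub>v c = 0\<^sub>v k"
      using det_0_iff_vec_prod_zero[OF M] by blast
    define d where "d = A\<^sup>T *\<^sub>v c"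
    have d: "d \<in> carrier_vec n" using A c by (simp add: d_def)
    have "A *\<^sub>v d = ?M *\<^sub>v c"
      unfolding d_def by (rule assoc_mult_mat_vec[symmetric, of A k n "A\<^sup>T" k]) (use A c
        in simp_all)
    then have "A *\<^sub>v d = 0\<^sub>v k" using c by simp
    have "d \<bullet> d = c \<bullet> (A *\<^sub>v d)"
    proof -
      have "d \<bullet> d = (A\<^sup>T *\<^sub>v c) \<bullet> d" by (simp add: d_def)
      also have "\<dots> = c \<bullet> (A *\<^sub>v d)"
        using transpose_vec_mult_scalar[OF A d c(1)] A c d
          by (simp add: comm_scalar_prod[of "A\<^sup>T *\<^sub>v c" n])
      finally show ?thesis .
    qed
    also have "\<dots> = 0" using \<open>A *\<^sub>v d = 0\<^sub>v k\<close> c(1) by simp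
    finally have "(\<Sum>i<n. d $ i * d $ i) = 0" using d
      by (simp add: scalar_prod_def atLeast0LessThan)
    then have "\<forall>i<n. d $ i = 0" by (subst (asm) sum_nonneg_eq_0_iff) auto
    then have "d = 0\<^sub>v n" using d by (intro eq_vecI) auto
    then show False using inj[OF c(1)] c(2) by (simp add: d_def)
  qed
  \<comment> \<open>The coefficients of the part of y in V: they solve the normal equations, with
    the inverse of the Gram matrix written by the adjugate.\<close>
  define c where "c = (1 / det ?M) \<cdot>\<^sub>v (adj_mat ?M *\<^sub>v (A *\<^sub>v y))"
  have adj: "adj_mat ?M \<in> carrier_mat k k" using adj_mat(1)[OF M] .
  have cc: "c \<in> carrier_vec k" using adj A yc by (simp add: c_def)
  have Ay: "A *\<^sub>v y \<in> carrier_vec k" using A yc by simp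
  have "?M *\<^sub>v c = (1 / det ?M) \<cdot>\<^sub>v (?M *\<^sub>v (adj_mat ?M *\<^sub>v (A *\<^sub>v y)))"
    unfolding c_def by (rule mult_mat_vec[OF M]) (use adj Ay in simp)
  also have "?M *\<^sub>v (adj_mat ?M *\<^sub>v (A *\<^sub>v y)) = (?M * adj_mat ?M) *\<^sub>v (A *\<^sub>v y)"
    by (rule assoc_mult_mat_vec[OF M adj Ay, symmetric])
  also have "?M * adj_mat ?M = det ?M \<cdot>\<^sub>m 1\<^sub>m k" by (rule adj_mat(2)[OF M])
  also have "(1 / det ?M) \<cdot>\<^sub>v ((det ?M \<cdot>\<^sub>m 1\<^sub>m k) *\<^sub>v (A *\<^sub>v y)) = A *\<^sub>v y"
    using \<open>det ?M \<noteq> 0\<close> A yc by (intro eq_vecI) auto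
  finally have Mc: "?M *\<^sub>v c = A *\<^sub>v y" .
  define v where "v = A\<^sup>T *\<^sub>v c"
  define p where "p = y - v"
  have v: "v \<in> V" using inV[OF cc] by (simp add: v_def)
  have vc: "v \<in> carrier_vec n" using v V_carrier by blast
  have pc: "p \<in> carrier_vec n" using yc vc by (simp add: p_def)
  have "A *\<^sub>v v = A *\<^sub>v y" using Mc cc A by (simp add: v_def assoc_mult_mat_vec[of A k n "A\<^sup>T" k])
  then have Ap: "A *\<^sub>v p = 0\<^sub>v k" unfolding p_def using A yc vc
    by (simp add: mult_minus_distrib_mat_vec)
  have "p \<bullet> u = 0" if "u \<in> V" for u
  proof -
    obtain b where b: "b \<in> carrier_vec k" "u = A\<^sup>T *\<^sub>v b" using ofV[OF \<open>u \<in> V\<close>] by blast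
    have "p \<bullet> u = (A\<^sup>T *\<^sub>v b) \<bullet> p" using b A pc by (simp add: comm_scalar_prod[of p n])
    also have "\<dots> = b \<bullet> (A *\<^sub>v p)"
      using transpose_vec_mult_scalar[OF A pc b(1)] A b pc
        by (simp add: comm_scalar_prod[of "A\<^sup>T *\<^sub>v b" n])
    finally show ?thesis using Ap b(1) by simp
  qed
  then have po: "p \<in> orth n V" using pc by (auto simp: vec_module.orthogonal_complement_def)
  have yp: "y - p = v" using yc vc unfolding p_def by (intro eq_vecI) auto
  have "orth_proj n (orth n V) y = p"
    using orth_proj_eqI[OF subspace_V yc po] yp v by simp
  moreover have "orth_proj n (orth n V) y $ 0 > 0" using lc y by (simp add: left_cyclic_def)
  moreover have "p \<in> eta"
  proof -
    have "y + (-1) \<cdot>\<^sub>v v \<in> eta" using eta_add[OF y V_smult[OF v]] .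
    moreover have "y + (-1) \<cdot>\<^sub>v v = p" using yc vc unfolding p_def by (intro eq_vecI) auto
    ultimately show ?thesis by simp
  qed
  ultimately show ?thesis using po by auto
qed


lemma eta_combo_in_W:
  assumes "y \<in> eta" "w \<in> {v + c \<cdot>\<^sub>v y | v c y. v \<in> V \<and> y \<in> eta}"
  obtains v c where "v \<in> V" "w = v + c \<cdot>\<^sub>v y"
proof -
  obtain v c y' where w: "w = v + c \<cdot>\<^sub>v y'" "v \<in> V" "y' \<in> eta" using assms(2) by blast
  have "w = (v + c \<cdot>\<^sub>v (y' - y)) + c \<cdot>\<^sub>v y"
  proof -
    have "v \<in> carrier_vec n" "y \<in> carrier_vec n" "y' \<in> carrier_vec n"
      using w assms(1) V_carrier eta_carrier by blast+
    then show ?thesis unfolding w(1) by (intro eq_vecI) (auto simp: algebra_simps)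
  qed
  moreover have "v + c \<cdot>\<^sub>v (y' - y) \<in> V" using V_add V_smult eta_diff w assms(1) by blast
  ultimately show thesis using that by blast
qed

text \<open>\<Delta> stands for the maximal minors of a basis of V, scaled to be positive. The sums
  are the expansions of the minors of size k + 1 after a vector is put on top of the basis. That
  they are positive on \<open>eta\<close>, and not merely of one sign, is what the third condition
  of left cyclicity provides.\<close>

definition oriented :: "(nat set \<Rightarrow> real) \<Rightarrow> bool" where
  "oriented \<Delta> \<longleftrightarrow> (\<forall>J. J \<subseteq> {0..<n} \<and> card J = k \<longrightarrow> \<Delta> J > 0) \<and>
    (\<forall>v\<in>V. \<forall>J. J \<subseteq> {0..<n} \<and> card J = Suc k \<longrightarrow>
      (\<Sum>i\<in>J. (-1) ^ card (J \<inter> {..<i}) * v $ i * \<Delta> (J - {i})) = 0) \<and>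
    (\<forall>y\<in>eta. \<forall>J. J \<subseteq> {0..<n} \<and> card J = Suc k \<longrightarrow>
      (\<Sum>i\<in>J. (-1) ^ card (J \<inter> {..<i}) * y $ i * \<Delta> (J - {i})) > 0)"

lemma orientedD:
  assumes "oriented \<Delta>"
  shows "J \<subseteq> {0..<n} \<Longrightarrow> card J = k \<Longrightarrow> \<Delta> J > 0"
    and "v \<in> V \<Longrightarrow> J \<subseteq> {0..<n} \<Longrightarrow> card J = Suc k \<Longrightarrow>
      (\<Sum>i\<in>J. (-1) ^ card (J \<inter> {..<i}) * v $ i * \<Delta> (J - {i})) = 0"
    and "y \<in> eta \<Longrightarrow> J \<subseteq> {0..<n} \<Longrightarrow> card J = Suc k \<Longrightarrow>
      (\<Sum>i\<in>J. (-1) ^ card (J \<inter> {..<i}) * y $ i * \<Delta> (J - {i})) > 0"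
  using assms unfolding oriented_def by simp_all

text \<open>The minors of a basis of \<open>V\<close> extended by a representative of \<open>\<eta>\<close> all have the same sign. The
  sign is positive because of the sign condition on the projection \<open>p\<close> of \<open>\<eta>\<close>: being orthogonal to \<open>V\<close>,
  \<open>p\<close> has at least \<open>k\<close> sign changes.\<close>

lemma orientation: "\<exists>\<Delta>. oriented \<Delta>"
proof -
  obtain A' where A': "cyclic_matrix A'" using ex_cyclic_matrix by blast
  have S: "same_sign_minors A' k (Suc n)" using A' by (simp add: cyclic_matrix_def)
  have A'c: "A' \<in> carrier_mat k (Suc n)" using S by (simp add: same_sign_minors_def)
  define A where "A = mat k n (\<lambda>(r, i). A' $$ (r, Suc i))"
  have A: "A \<in> carrier_mat k n" by (simp add: A_def)
  have shift: "minor A J = minor A' (Suc ` J)" if "J \<subseteq> {0..<n}" for J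
    unfolding A_def using minor_shift[OF A'c that] .
  have inV: "\<exists>v\<in>V. \<forall>i<n. v $ i = (\<Sum>r<k. c r * A $$ (r, i))" for c
  proof -
    obtain v where "v \<in> V" "\<forall>i<n. v $ i = (\<Sum>r<k. c r * A' $$ (r, Suc i))"
      using A' unfolding cyclic_matrix_def by meson
    then show ?thesis by (intro bexI[of _ v]) (auto simp: A_def)
  qed
  have ofV: "\<exists>c. \<forall>i<n. v $ i = (\<Sum>r<k. c r * A $$ (r, i))" if v: "v \<in> V" for v
  proof -
    obtain c where "\<forall>i<n. v $ i = (\<Sum>r<k. c r * A' $$ (r, Suc i))"
      using A' v unfolding cyclic_matrix_def by meson
    then show ?thesis by (intro exI[of _ c]) (auto simp: A_def)
  qed
  have "\<exists>s. (s = 1 \<or> s = (-1 :: real)) \<and> (\<forall>J. J \<subseteq> {0..<n} \<and> card J = k \<longrightarrow> s * minor A J > 0)"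
  proof -
    have J: "Suc ` J \<subseteq> {0..<Suc n} \<and> card (Suc ` J) = k" if "J \<subseteq> {0..<n} \<and> card J = k" for J
      using that by (auto simp: card_image)
    from S have "(\<forall>J. J \<subseteq> {0..<n} \<and> card J = k \<longrightarrow> minor A J > 0) \<or> (\<forall>J. J \<subseteq> {0..<n} \<and> card J = k \<longrightarrow>
      minor A J < 0)"
      unfolding same_sign_minors_def using J shift by metis
    then show ?thesis
    proof
      assume "\<forall>J. J \<subseteq> {0..<n} \<and> card J = k \<longrightarrow> minor A J > 0"
      then show ?thesis by (intro exI[of _ 1]) auto
    next
      assume "\<forall>J. J \<subseteq> {0..<n} \<and> card J = k \<longrightarrow> minor A J < 0"
      then show ?thesis by (intro exI[of _ "-1"]) auto
    qed
  qed
  then obtain s where s: "s = 1 \<or> s = (-1 :: real)"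
    "\<And>J. J \<subseteq> {0..<n} \<Longrightarrow> card J = k \<Longrightarrow> s * minor A J > 0" by blast
  define D where "D y J = (\<Sum>i\<in>J. (-1) ^ card (J \<inter> {..<i}) * y $ i * (s * minor A (J - {i})))"
    for y :: "real vec" and J
  have Db: "D y J = s * bordered A (\<lambda>i. y $ i) J" for y J
    unfolding D_def bordered_def sum_distrib_left by (intro sum.cong) auto
  have DV: "D v J = 0" if "v \<in> V" "J \<subseteq> {0..<n}" "card J = Suc k" for v J
  proof -
    obtain c where "\<forall>i<n. v $ i = (\<Sum>r<k. c r * A $$ (r, i))" using ofV \<open>v \<in> V\<close> by blast
    then have "bordered A (\<lambda>i. v $ i) J = 0"
      using that by (intro bordered_row_space[OF A that(2,3), of _ c]) auto
    then show ?thesis by (simp add: Db)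
  qed
  obtain p where p: "p \<in> eta" "p \<in> orth n V" "p $ 0 > 0" using proj_ex by blast
  have pc: "p \<in> carrier_vec n" using p eta_carrier by blast
  have Dp: "D y J = D p J" if "y \<in> eta" "J \<subseteq> {0..<n}" "card J = Suc k" for y J
  proof -
    have yc: "y \<in> carrier_vec n" using that eta_carrier by blast
    have "bordered A (\<lambda>i. y $ i) J = bordered A (\<lambda>i. (y - p) $ i + p $ i) J"
      using that(2) pc yc by (intro bordered_cong) auto
    then have "D y J = D (y - p) J + D p J" by (simp add: Db bordered_add algebra_simps)
    then show ?thesis using DV[OF eta_diff[OF that(1) p(1)] that(2,3)] by simp
  qed
  \<comment> \<open>The projection p on top of a matrix for V. It spans the same space as the given
    matrix \<open>AW\<close>, and its minors are those of \<open>AW\<close> up to one common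
    factor.\<close>
  define B where "B = mat (Suc k) n (\<lambda>(r, i). if r = 0 then p $ i else A $$ (r - 1, i))"
  have B: "B \<in> carrier_mat (Suc k) n" by (simp add: B_def)
  have mB: "minor B J = bordered A (\<lambda>i. p $ i) J" if J: "J \<subseteq> {0..<n}" "card J = Suc k" for J
  proof -
    have "pick J c < n" if "c < Suc k" for c using pick_in_set_le[of c J] J that by auto
    then have "submatrix B UNIV J =
      mat (Suc k) (Suc k) (\<lambda>(r, c). if r = 0 then p $ pick J c else A $$ (r - 1, pick J c))"
      unfolding submatrix_UNIV_cols[OF B J(1)] J(2) by (intro eq_matI) (auto simp: B_def)
    then show ?thesis using bordered_det[OF A J] by (simp add: minor_def)
  qed
  obtain AW where AW: "same_sign_minors AW (Suc k) n"
    "vec_space.row_space n AW = {v + c \<cdot>\<^sub>v y | v c y. v \<in> V \<and> y \<in> eta}" using ex_basis_W by blast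
  have AWc: "AW \<in> carrier_mat (Suc k) n" using AW by (simp add: same_sign_minors_def)
  note iff = row_space_iff[OF AWc, unfolded AW(2)]
  have "\<exists>G\<in>carrier_mat (Suc k) (Suc k). B = G * AW"
  proof -
    have "\<exists>c. \<forall>i<n. B $$ (r, i) = (\<Sum>t<Suc k. c t * AW $$ (t, i))" if r: "r < Suc k" for r
    proof (cases "r = 0")
      case True
      have "p = 0\<^sub>v n + 1 \<cdot>\<^sub>v p" using pc by (intro eq_vecI) auto
      then have "p \<in> {v + c \<cdot>\<^sub>v y | v c y. v \<in> V \<and> y \<in> eta}" using V_0 p(1) by blast
      then obtain c where "\<forall>i<n. p $ i = (\<Sum>t<Suc k. c t * AW $$ (t, i))" unfolding iff by blast
      then show ?thesis using True by (auto simp: B_def)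
    next
      case False
      obtain v where v: "v \<in> V" "\<forall>i<n. v $ i = (\<Sum>q<k. (if q = r - 1 then 1 else 0) * A $$ (q, i))"
        using inV[of "\<lambda>q. if q = r - 1 then 1 else 0"] by blast
      have va: "v $ i = A $$ (r - 1, i)" if "i < n" for i
      proof -
        have "(\<Sum>q<k. (if q = r - 1 then 1 else 0) * A $$ (q, i)) =
          (\<Sum>q<k. if q = r - 1 then A $$ (q, i) else 0)"
          by (intro sum.cong) auto
        also have "\<dots> = A $$ (r - 1, i)" using r False by simp
        finally show ?thesis using v(2) that by simp
      qed
      have "v = v + 0 \<cdot>\<^sub>v p" using pc v(1) V_carrier by (intro eq_vecI) auto
      then have "v \<in> {v + c \<cdot>\<^sub>v y | v c y. v \<in> V \<and> y \<in> eta}" using v(1) p(1) by blast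
      then obtain c where "\<forall>i<n. v $ i = (\<Sum>t<Suc k. c t * AW $$ (t, i))" unfolding iff by blast
      then show ?thesis using False r va by (intro exI[of _ c]) (auto simp: B_def)
    qed
    then obtain c where c: "\<And>r i. r < Suc k \<Longrightarrow> i < n \<Longrightarrow> B $$ (r, i) =
      (\<Sum>t<Suc k. c r t * AW $$ (t, i))"
      by metis
    have "B = mat (Suc k) (Suc k) (\<lambda>(r, t). c r t) * AW"
      using AWc B c by (intro eq_matI) (auto simp: scalar_prod_def atLeast0LessThan intro!:
        sum.cong)
    then show ?thesis by (intro bexI[of _ "mat (Suc k) (Suc k) (\<lambda>(r, t). c r t)"]) auto
  qed
  then obtain G where G: "G \<in> carrier_mat (Suc k) (Suc k)" "B = G * AW" by blast
  have "\<exists>H\<in>carrier_mat (Suc k) (Suc k). AW = H * B"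
  proof -
    have "\<exists>c. \<forall>i<n. AW $$ (r, i) = (\<Sum>t<Suc k. c t * B $$ (t, i))" if r: "r < Suc k" for r
    proof -
      have "row AW r \<in> {v + c \<cdot>\<^sub>v y | v c y. v \<in> V \<and> y \<in> eta}"
        unfolding iff
      proof (intro conjI exI[of _ "\<lambda>q. if q = r then 1 else 0"] allI impI)
        show "row AW r \<in> carrier_vec n" using AWc r by auto
        fix i assume i: "i < n"
        have "(\<Sum>q<Suc k. (if q = r then 1 else 0) * AW $$ (q, i)) =
          (\<Sum>q<Suc k. if q = r then AW $$ (q, i) else 0)"
          by (intro sum.cong) auto
        also have "\<dots> = AW $$ (r, i)" using r by simp
        finally show "row AW r $ i = (\<Sum>q<Suc k. (if q = r then 1 else 0) * AW $$ (q, i))"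
          using AWc r i by simp
      qed
      then obtain v c where w: "v \<in> V" "row AW r = v + c \<cdot>\<^sub>v p" using eta_combo_in_W[OF p(1)]
        by blast
      obtain d where d: "\<forall>i<n. v $ i = (\<Sum>q<k. d q * A $$ (q, i))" using ofV w(1) by blast
      have "AW $$ (r, i) = (\<Sum>t<Suc k. (if t = 0 then c else d (t - 1)) * B $$ (t, i))"
        if i: "i < n" for i
      proof -
        have "AW $$ (r, i) = row AW r $ i" using AWc r i by simp
        also have "\<dots> = c * p $ i + (\<Sum>q<k. d q * A $$ (q, i))" using w d i pc V_carrier by auto
        also have "\<dots> = (\<Sum>t<Suc k. (if t = 0 then c else d (t - 1)) * B $$ (t, i))"
          using i unfolding sum.lessThan_Suc_shift by (simp add: B_def)
        finally show ?thesis .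
      qed
      then show ?thesis by (intro exI[of _ "\<lambda>t. if t = 0 then c else d (t - 1)"]) simp
    qed
    then obtain c where c: "\<And>r i. r < Suc k \<Longrightarrow> i < n \<Longrightarrow> AW $$ (r, i) =
      (\<Sum>t<Suc k. c r t * B $$ (t, i))"
      by metis
    have "AW = mat (Suc k) (Suc k) (\<lambda>(r, t). c r t) * B"
      using AWc B c by (intro eq_matI) (auto simp: scalar_prod_def atLeast0LessThan intro!:
        sum.cong)
    then show ?thesis by (intro bexI[of _ "mat (Suc k) (Suc k) (\<lambda>(r, t). c r t)"]) auto
  qed
  then obtain H where H: "H \<in> carrier_mat (Suc k) (Suc k)" "AW = H * B" by blast
  have gm: "minor B J = det G * minor AW J" "minor AW J = det H * minor B J"
    if J: "J \<subseteq> {0..<n}" "card J = Suc k" for J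
    using minor_mult[OF G(1) AWc J, folded G(2)] minor_mult[OF H(1) B J, folded H(2)] .
  \<comment> \<open>Hence a single column set with a positive expansion decides the sign for
    all.\<close>
  have consistent: "D p J > 0" if J: "J \<subseteq> {0..<n}" "card J = Suc k"
    and J0: "J0 \<subseteq> {0..<n}" "card J0 = Suc k" "D p J0 > 0" for J J0
  proof -
    have a: "D p J = s * det G * minor AW J" "D p J0 = s * det G * minor AW J0"
      using gm(1)[OF J] gm(1)[OF J0(1,2)] mB[OF J] mB[OF J0(1,2)] by (simp_all add: Db)
    have "minor AW J > 0 \<and> minor AW J0 > 0 \<or> minor AW J < 0 \<and> minor AW J0 < 0"
      using AW(1) J J0 unfolding same_sign_minors_def by metis
    then show ?thesis using J0(3) unfolding a by (auto simp: zero_less_mult_iff)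
  qed
  have n0: "0 < n" using k_less_n by simp
  \<comment> \<open>The signs of p, where a zero entry repeats the preceding sign. The initial value
    1 is the sign of the first entry.\<close>
  define g where "g = rec_nat (1 :: real) (\<lambda>i x. if p $ Suc i > 0 then 1 else if p $ Suc i < 0
    then -1 else x)"
  have g0: "g 0 = 1" and gS:
    "g (Suc i) = (if p $ Suc i > 0 then 1 else if p $ Suc i < 0 then -1 else g i)" for i
    by (simp_all add: g_def)
  have g1: "g i = 1 \<or> g i = -1" for i by (induction i) (auto simp: g0 gS)
  have gp: "p $ i * g i = \<bar>p $ i\<bar>" for i using p(3) by (cases i) (auto simp: g0 gS)
  have "\<not> card (changes g n) < k"
  proof
    assume few: "card (changes g n) < k"
    \<comment> \<open>The sign asked of \<xi> is a copy of the first sign, so putting it in front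
      adds no change.\<close>
    define h where "h i = (case i of 0 \<Rightarrow> g 0 | Suc i \<Rightarrow> g i)" for i
    have "changes h (Suc n) = Suc ` changes g n"
    proof (rule Set.set_eqI)
      fix i show "i \<in> changes h (Suc n) \<longleftrightarrow> i \<in> Suc ` changes g n"
        by (cases i) (auto simp: changes_def h_def)
    qed
    then have "card (changes h (Suc n)) < k" using few by (simp add: card_image)
    moreover have "h i = 1 \<or> h i = -1" for i using g1 by (cases i) (auto simp: h_def)
    ultimately obtain v where v: "v \<in> V" "\<And>i. i < n \<Longrightarrow> h (Suc i) * v $ i > 0"
      using realize_in_V[of h] by blast
    have vg: "g i * v $ i > 0" if "i < n" for i using v(2)[OF that] by (simp add: h_def)
    \<comment> \<open>All products of entries of p and v are nonnegative and the first is positive,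
      against the orthogonality of p to V.\<close>
    have "p $ i * v $ i = \<bar>p $ i\<bar> * (g i * v $ i)" for i
    proof -
      have "g i * g i = 1" using g1[of i] by auto
      then have "p $ i * v $ i = p $ i * (g i * g i) * v $ i" by simp
      also have "\<dots> = (p $ i * g i) * (g i * v $ i)" by (simp only: mult.assoc)
      finally show ?thesis by (simp only: gp)
    qed
    moreover have "p \<bullet> v = (\<Sum>i<n. p $ i * v $ i)"
      using v(1) V_carrier by (auto simp: scalar_prod_def atLeast0LessThan)
    ultimately have "p \<bullet> v = (\<Sum>i<n. \<bar>p $ i\<bar> * (g i * v $ i))" by (simp only:)
    also have "\<dots> > 0"
    proof (rule sum_pos2[of _ 0])
      show "0 < \<bar>p $ 0\<bar> * (g 0 * v $ 0)" using vg[OF n0] p(3) by (simp add: zero_less_mult_iff)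
      show "0 \<le> \<bar>p $ i\<bar> * (g i * v $ i)" if "i \<in> {..<n}" for i
        using vg[of i] that by (simp add: less_imp_le)
    qed (use n0 in auto)
    finally show False using p(2) v(1) by (auto simp: vec_module.orthogonal_complement_def)
  qed
  then have "k \<le> card (changes g n)" by simp
  moreover have fc: "finite (changes g n)"
    by (rule finite_subset[of _ "{..<n}"]) (auto simp: changes_def)
  ultimately obtain C where C: "C \<subseteq> changes g n" "card C = k"
    "\<forall>i\<in>C. changes g n \<inter> {..<i} = C \<inter> {..<i}"
    using ex_initial_segment by blast
  have finC: "finite C" using C(1) fc finite_subset by blast
  \<comment> \<open>The first entry and the entries right after the first k changes. There p is
    nonzero and alternates in sign, starting with +, so all terms of the expansion are
    positive.\<close>
  define J0 where "J0 = insert 0 (Suc ` C)"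
  have J0: "J0 \<subseteq> {0..<n}" "card J0 = Suc k" "finite J0"
    using C finC n0 by (auto simp: J0_def changes_def card_image)
  have "D p J0 > 0"
    unfolding D_def
  proof (rule sum_pos)
    fix i assume i: "i \<in> J0"
    have "J0 - {i} \<subseteq> {0..<n}" "card (J0 - {i}) = k" using J0 i by auto
    from s(2)[OF this] have sm: "s * minor A (J0 - {i}) > 0" .
    have "(-1) ^ card (J0 \<inter> {..<i}) * p $ i > 0"
    proof (cases i)
      case 0
      then show ?thesis using p(3) by simp
    next
      case (Suc j)
      then have j: "j \<in> C" using i by (auto simp: J0_def)
      then have jn: "Suc j < n" "g j \<noteq> g (Suc j)" using C(1) by (auto simp: changes_def)
      have "J0 \<inter> {..<i} = insert 0 (Suc ` (C \<inter> {..<j}))" unfolding J0_def Suc by auto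
      then have c1: "card (J0 \<inter> {..<i}) = Suc (card (C \<inter> {..<j}))"
        using finC by (simp add: card_image)
      have "changes g n \<inter> {..<Suc j} = insert j (changes g n \<inter> {..<j})"
        using C(1) j by (auto simp: less_Suc_eq)
      also have "changes g n \<inter> {..<j} = C \<inter> {..<j}" using C(3) j by blast
      finally have "changes g n \<inter> {..<Suc j} = insert j (C \<inter> {..<j})" .
      then have "card (changes g n \<inter> {..<Suc j}) = Suc (card (C \<inter> {..<j}))" using finC by simp
      then have gi: "g i = (-1) ^ card (J0 \<inter> {..<i})"
        using sign_alternation[of n g "Suc j"] g1 jn g0 c1 Suc by simp
      have "p $ i \<noteq> 0" using jn(2) gS[of j] Suc by auto
      then show ?thesis using gp[of i] unfolding gi by (metis mult.commute zero_less_abs_iff)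
    qed
    then show "0 < (-1) ^ card (J0 \<inter> {..<i}) * p $ i * (s * minor A (J0 - {i}))" using sm by simp
  qed (use J0 in \<open>auto simp: J0_def\<close>)
  then have pos: "D y J > 0" if "y \<in> eta" "J \<subseteq> {0..<n}" "card J = Suc k" for y J
    using Dp[OF that] consistent[OF that(2,3) J0(1,2)] by simp
  show ?thesis
    unfolding oriented_def
    by (intro exI[of _ "\<lambda>J. s * minor A J"]) (use s(2) DV pos in \<open>auto simp: D_def\<close>)
qed


section \<open>Feasible and bounded sign vectors\<close>

lemma region_iff: "x \<in> region n eta \<gamma> \<longleftrightarrow> x \<in> eta \<and> (\<forall>i<n. of_int (\<gamma> (Suc i)) * x $ i \<ge> 0)"
proof -
  have "(\<forall>i\<in>{1..n}. P i) \<longleftrightarrow> (\<forall>i<n. P (Suc i))" for P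
  proof safe
    fix i assume "\<forall>i<n. P (Suc i)" "i \<in> {1..n}"
    then show "P i" by (cases i) auto
  qed simp
  from this[of "\<lambda>i. of_int (\<gamma> i) * x $ (i - 1) \<ge> 0"]
  have "(\<forall>i\<in>{1..n}. of_int (\<gamma> i) * x $ (i - 1) \<ge> 0) \<longleftrightarrow> (\<forall>i<n. of_int (\<gamma> (Suc i)) * x $ i \<ge> 0)"
    by simp
  then show ?thesis by (simp add: region_def)
qed

lemma eventually_in_region:
  assumes "y \<in> eta" "v \<in> V" "\<And>i. i < n \<Longrightarrow> of_int (\<gamma> (Suc i)) * v $ i > 0" "\<gamma> \<in> sign_vectors n"
  shows "\<exists>t>0. y + t \<cdot>\<^sub>v v \<in> region n eta \<gamma>"
proof -
  have yc: "y \<in> carrier_vec n" and vc: "v \<in> carrier_vec n" using assms(1,2) eta_carrier V_carrier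
    by blast+
  \<comment> \<open>The sum dominates every quotient |y_i| / |v_i|; the summand 1 makes t
    positive.\<close>
  define t where "t = 1 + (\<Sum>i<n. \<bar>y $ i\<bar> / \<bar>v $ i\<bar>)"
  have t: "t > 0" unfolding t_def by (intro add_pos_nonneg sum_nonneg) auto
  have "of_int (\<gamma> (Suc i)) * (y + t \<cdot>\<^sub>v v) $ i \<ge> 0" if i: "i < n" for i
  proof -
    have v0: "\<bar>v $ i\<bar> > 0" using assms(3)[OF i] by auto
    have sv: "of_int (\<gamma> (Suc i)) * v $ i = \<bar>v $ i\<bar>"
      using assms(3)[OF i] real_sgn[OF assms(4), of "Suc i"] by (auto simp: abs_if)
    have "\<bar>y $ i\<bar> / \<bar>v $ i\<bar> \<le> (\<Sum>i<n. \<bar>y $ i\<bar> / \<bar>v $ i\<bar>)"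
      using i by (intro member_le_sum) auto
    then have "\<bar>y $ i\<bar> / \<bar>v $ i\<bar> \<le> t" by (simp add: t_def)
    then have "\<bar>y $ i\<bar> \<le> t * \<bar>v $ i\<bar>" using v0 by (simp add: pos_divide_le_eq)
    moreover have "of_int (\<gamma> (Suc i)) * y $ i \<ge> - \<bar>y $ i\<bar>"
      using real_sgn[OF assms(4), of "Suc i"] by (auto simp: abs_if)
    moreover have "of_int (\<gamma> (Suc i)) * (y + t \<cdot>\<^sub>v v) $ i =
      of_int (\<gamma> (Suc i)) * y $ i + t * \<bar>v $ i\<bar>"
      using i yc vc sv by (simp add: algebra_simps)
    ultimately show ?thesis by linarith
  qed
  then show ?thesis using t eta_add[OF assms(1) V_smult[OF assms(2)]] by (auto simp: region_iff)
qed

text \<open>With more than k changes, a point of the region has entries of weak signs -, +, -, ...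
  right after the first k + 1 changes. On these columns the expansion consists of nonpositive terms,
  whereas it is positive on \<open>eta\<close>.\<close>

lemma card_x_of_if_feasible:
  assumes "\<gamma> \<in> sign_vectors n" "x \<in> region n eta \<gamma>"
  shows "card (x_of n \<gamma>) \<le> k"
proof (rule ccontr)
  assume "\<not> card (x_of n \<gamma>) \<le> k"
  then have "Suc k \<le> card (x_of n \<gamma>)" by simp
  then obtain J where J: "J \<subseteq> x_of n \<gamma>" "card J = Suc k" "\<forall>i\<in>J. x_of n \<gamma> \<inter> {..<i} = J \<inter> {..<i}"
    using ex_initial_segment[OF finite_x_of \<open>Suc k \<le> card (x_of n \<gamma>)\<close>] by blast
  have Jn: "J \<subseteq> {0..<n}" using J(1) by (auto simp: x_of_def)
  obtain \<Delta> where D0: "oriented \<Delta>" using orientation by blast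
  note D = orientedD(1,3)[OF D0]
  have xe: "x \<in> eta" using assms(2) by (simp add: region_iff)
  have "(\<Sum>i\<in>J. (-1) ^ card (J \<inter> {..<i}) * x $ i * \<Delta> (J - {i})) \<le> 0"
  proof (rule sum_nonpos)
    fix i assume i: "i \<in> J"
    have ix: "i \<in> x_of n \<gamma>" "i < n" using i J(1) Jn by auto
    have "x_of n \<gamma> \<inter> {..<Suc i} = insert i (x_of n \<gamma> \<inter> {..<i})" using ix
      by (auto simp: less_Suc_eq)
    also have "x_of n \<gamma> \<inter> {..<i} = J \<inter> {..<i}" using J(3) i by blast
    finally have "x_of n \<gamma> \<inter> {..<Suc i} = insert i (J \<inter> {..<i})" .
    moreover have "card (insert i (J \<inter> {..<i})) = Suc (card (J \<inter> {..<i}))"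
      using finite_subset[OF Jn] by simp
    ultimately have "real_of_int (\<gamma> (Suc i)) = - ((-1) ^ card (J \<inter> {..<i}))"
      using sign_x_of[OF assms(1), of "Suc i"] ix by simp
    then have "(-1) ^ card (J \<inter> {..<i}) * x $ i \<le> 0"
      using assms(2) ix(2) by (auto simp: region_iff)
    moreover have "\<Delta> (J - {i}) > 0" using D(1)[of "J - {i}"] Jn J(2) i finite_subset[OF Jn]
      by auto
    ultimately show "(-1) ^ card (J \<inter> {..<i}) * x $ i * \<Delta> (J - {i}) \<le> 0"
      by (simp add: mult_nonpos_nonneg)
  qed
  then show False using D(2)[OF xe Jn J(2)] by simp
qed

text \<open>If the signs in positions 1 to n have fewer than k changes, V contains a vector with
  these signs, and \<open>eta\<close> meets the region far out in its direction. Otherwise they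
  start with + and have exactly k changes. The span of V and \<eta> contains v + d y with these
  signs; the expansion shows d > 0, and division by d gives a point of \<open>eta\<close>.\<close>

lemma feasible_if_card_x_of:
  assumes g: "\<gamma> \<in> sign_vectors n" and c: "card (x_of n \<gamma>) \<le> k"
  shows "feasible n eta \<gamma>"
proof -
  define f where "f i = real_of_int (\<gamma> (Suc i))" for i
  have f1: "f i = 1 \<or> f i = -1" for i using real_sgn[OF g] by (simp add: f_def)
  have ch: "Suc ` changes f n = x_of n \<gamma> - {0}"
  proof (rule Set.set_eqI)
    fix i show "i \<in> Suc ` changes f n \<longleftrightarrow> i \<in> x_of n \<gamma> - {0}"
      by (cases i) (auto simp: changes_def x_of_def f_def)
  qed
  have cc: "card (changes f n) = card (x_of n \<gamma> - {0})" using card_image[of Suc "changes f n"] ch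
    by simp
  obtain y where y: "y \<in> eta" using eta_ex by blast
  show ?thesis
  proof (cases "card (changes f n) < k")
    case True
    define h where "h i = (case i of 0 \<Rightarrow> f 0 | Suc i \<Rightarrow> f i)" for i
    have "changes h (Suc n) = Suc ` changes f n"
    proof (rule Set.set_eqI)
      fix i show "i \<in> changes h (Suc n) \<longleftrightarrow> i \<in> Suc ` changes f n"
        by (cases i) (auto simp: changes_def h_def)
    qed
    then have "card (changes h (Suc n)) < k" using True by (simp add: card_image)
    moreover have "h i = 1 \<or> h i = -1" for i using f1 by (cases i) (auto simp: h_def)
    ultimately obtain v where v: "v \<in> V" "\<And>i. i < n \<Longrightarrow> h (Suc i) * v $ i > 0"
      using realize_in_V[of h] by blast
    then show ?thesis
      using eventually_in_region[OF y v(1) _ g] by (auto simp: h_def f_def feasible_def)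
  next
    case False
    have "card (x_of n \<gamma> - {0}) \<le> card (x_of n \<gamma>)" by (intro card_mono) auto
    then have ck: "card (changes f n) = k" "card (x_of n \<gamma> - {0}) = card (x_of n \<gamma>)"
      using False c cc by linarith+
    have x0: "0 \<notin> x_of n \<gamma>"
      using ck(2) card_Diff1_less[OF finite_x_of, of 0 n \<gamma>] by auto
    obtain A where A: "same_sign_minors A (Suc k) n"
      "vec_space.row_space n A = {v + c \<cdot>\<^sub>v y | v c y. v \<in> V \<and> y \<in> eta}" using ex_basis_W by blast
    have Ac: "A \<in> carrier_mat (Suc k) n" using A by (simp add: same_sign_minors_def)
    obtain c where c: "\<And>i. i < n \<Longrightarrow> f i * (\<Sum>r<Suc k. c r * A $$ (r, i)) > 0"
      using realize_signs[OF A(1), of f] f1 ck(1) k_less_n by auto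
    define w where "w = vec n (\<lambda>i. \<Sum>r<Suc k. c r * A $$ (r, i))"
    have "w \<in> vec_space.row_space n A" unfolding row_space_iff[OF Ac]
      by (auto simp: w_def intro: exI[of _ c])
    then obtain v d where w: "v \<in> V" "w = v + d \<cdot>\<^sub>v y" using eta_combo_in_W[OF y] A(2) by metis
    have wf: "f i * w $ i > 0" if "i < n" for i using c[OF that] that by (simp add: w_def)
    have yc: "y \<in> carrier_vec n" and vc: "v \<in> carrier_vec n" using y w eta_carrier V_carrier
      by blast+
    obtain \<Delta> where D0: "oriented \<Delta>" using orientation by blast
    note D = orientedD[OF D0]
    \<comment> \<open>Index 0 belongs to the first coordinate, whose sign is + because 0 is not a
      change; index i belongs to the coordinate right after the change i. So the signs alternate
      along \<open>J\<close>.\<close>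
    define J where "J = insert 0 (x_of n \<gamma>)"
    have J: "J \<subseteq> {0..<n}" "card J = Suc k" "finite J"
      using k_less_n x0 ck cc by (auto simp: J_def x_of_def)
    let ?S = "\<lambda>u. \<Sum>i\<in>J. (-1) ^ card (J \<inter> {..<i}) * u $ i * \<Delta> (J - {i})"
    have "?S w > 0"
    proof (rule sum_pos)
      fix i assume i: "i \<in> J"
      have inn: "i < n" using i J by auto
      have "even (card (J \<inter> {..<i})) = even (card (x_of n \<gamma> \<inter> {..<Suc i}))"
      proof (cases "i = 0")
        case True
        have "x_of n \<gamma> \<inter> {..<Suc 0} = {}" using x0 by auto
        then show ?thesis using True by simp
      next
        case False
        then have "i \<in> x_of n \<gamma>" using i by (simp add: J_def)
        then have "x_of n \<gamma> \<inter> {..<Suc i} = insert i (x_of n \<gamma> \<inter> {..<i})"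
          by (auto simp: less_Suc_eq)
        moreover have "J \<inter> {..<i} = insert 0 (x_of n \<gamma> \<inter> {..<i})" using False
          by (auto simp: J_def)
        ultimately show ?thesis using x0 by simp
      qed
      then have "f i = (-1) ^ card (J \<inter> {..<i})"
        using sign_x_of[OF g, of "Suc i"] inn by (simp add: f_def minus_one_power_iff)
      then have "(-1) ^ card (J \<inter> {..<i}) * w $ i > 0" using wf[OF inn] by simp
      moreover have "\<Delta> (J - {i}) > 0" using D(1)[of "J - {i}"] J i by auto
      ultimately show "(-1) ^ card (J \<inter> {..<i}) * w $ i * \<Delta> (J - {i}) > 0" by simp
    qed (use J in \<open>auto simp: J_def\<close>)
    moreover have "?S w = ?S v + d * ?S y"
    proof -
      have "?S w = (\<Sum>i\<in>J. (-1) ^ card (J \<inter> {..<i}) * v $ i * \<Delta> (J - {i}) + d *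
        ((-1) ^ card (J \<inter> {..<i}) * y $ i * \<Delta> (J - {i})))"
        using J(1) yc vc by (intro sum.cong refl) (auto simp: w(2) algebra_simps)
      then show ?thesis by (simp add: sum.distrib sum_distrib_left)
    qed
    ultimately have "d * ?S y > 0" using D(2)[OF w(1) J(1,2)] by simp
    then have d: "d > 0" using D(3)[OF y J(1,2)] by (simp add: zero_less_mult_iff)
    define x where "x = y + (1 / d) \<cdot>\<^sub>v v"
    have "x \<in> region n eta \<gamma>"
      unfolding region_iff
    proof (intro conjI allI impI)
      show "x \<in> eta" unfolding x_def using eta_add[OF y V_smult[OF w(1)]] .
      fix i assume i: "i < n"
      have "x $ i = w $ i / d" using i yc vc d by (simp add: x_def w(2) field_simps)
      then show "of_int (\<gamma> (Suc i)) * x $ i \<ge> 0" using wf[OF i] d by (simp add: f_def)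
    qed
    then show ?thesis by (auto simp: feasible_def)
  qed
qed

lemma feasible_iff: "\<gamma> \<in> sign_vectors n \<Longrightarrow> feasible n eta \<gamma> \<longleftrightarrow> card (x_of n \<gamma>) \<le> k"
  using card_x_of_if_feasible feasible_if_card_x_of by (auto simp: feasible_def)

text \<open>A row of the matrix of \<open>{(\<xi>(v), v)}\<close> bordering that matrix gives a vanishing minor. Its expansion
  expresses \<open>\<xi>(v)\<close> by the entries of \<open>v\<close> in the \<open>k\<close> positions after a sign change, with coefficients of
  signs opposite to \<open>\<gamma>\<close>.\<close>

lemma bounded_if_card_x_of:
  assumes g: "\<gamma> \<in> sign_vectors n" and c: "card (x_of n \<gamma>) = k"
  shows "bounded_sign n V eta xi \<gamma>"
proof -
  obtain A where A: "cyclic_matrix A" using ex_cyclic_matrix by blast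
  have S: "same_sign_minors A k (Suc n)" using A by (simp add: cyclic_matrix_def)
  have Ac: "A \<in> carrier_mat k (Suc n)" using S by (simp add: same_sign_minors_def)
  \<comment> \<open>Column 0 belongs to \<xi>; for a change i, column i + 1 holds the entry
    \<open>v $ i\<close>, the one right after the change.\<close>
  define J where "J = insert 0 (Suc ` x_of n \<gamma>)"
  have J: "J \<subseteq> {0..<Suc n}" "card J = Suc k" "finite J"
    using c by (auto simp: J_def x_of_def card_image)
  have "\<exists>s. (s = 1 \<or> s = (-1 :: real)) \<and> (\<forall>J. J \<subseteq> {0..<Suc n} \<and> card J = k \<longrightarrow> s * minor A J > 0)"
    using S unfolding same_sign_minors_def
  proof (elim conjE disjE)
    assume "\<forall>J. J \<subseteq> {0..<Suc n} \<and> card J = k \<longrightarrow> minor A J > 0"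
    then show ?thesis by (intro exI[of _ 1]) auto
  next
    assume "\<forall>J. J \<subseteq> {0..<Suc n} \<and> card J = k \<longrightarrow> minor A J < 0"
    then show ?thesis by (intro exI[of _ "-1"]) auto
  qed
  then obtain s where s: "\<And>J. J \<subseteq> {0..<Suc n} \<Longrightarrow> card J = k \<Longrightarrow> s * minor A J > (0 :: real)" by blast
  define a where "a i = s * minor A (J - {Suc i})" for i
  define a0 where "a0 = s * minor A (J - {0})"
  have a: "a i > 0" if "i \<in> x_of n \<gamma>" for i
    unfolding a_def using J that by (intro s) (auto simp: J_def)
  have a0: "a0 > 0" unfolding a0_def using J by (intro s) (auto simp: J_def)
  have rel: "a0 * functional xi v = - (\<Sum>i\<in>x_of n \<gamma>. a i * (of_int (\<gamma> (Suc i)) * v $ i))"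
    if v: "v \<in> V" for v
  proof -
    obtain b where b: "functional xi v = (\<Sum>r<k. b r * A $$ (r, 0))"
      "\<forall>i<n. v $ i = (\<Sum>r<k. b r * A $$ (r, Suc i))"
      using A v unfolding cyclic_matrix_def by blast
    define u where "u i = (case i of 0 \<Rightarrow> functional xi v | Suc i \<Rightarrow> v $ i)" for i
    have b0: "bordered A u J = 0"
    proof (rule bordered_row_space[OF Ac J(1,2)])
      fix i assume "i \<in> J"
      then have "i < Suc n" using J by auto
      then show "u i = (\<Sum>r<k. b r * A $$ (r, i))" using b by (cases i) (auto simp: u_def)
    qed
    have b1: "bordered A u J = functional xi v * minor A (J - {0}) +
      (\<Sum>i\<in>x_of n \<gamma>. (-1) ^ Suc (card (x_of n \<gamma> \<inter> {..<i})) * v $ i * minor A (J - {Suc i}))"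
    proof -
      have "bordered A u J = (\<Sum>i\<in>insert 0 (Suc ` x_of n \<gamma>). (-1) ^ card (J \<inter> {..<i}) * u i *
        minor A (J - {i}))"
        by (simp add: bordered_def J_def)
      also have "\<dots> = u 0 * minor A (J - {0}) + (\<Sum>i\<in>Suc ` x_of n \<gamma>. (-1) ^ card (J \<inter> {..<i}) *
        u i * minor A (J - {i}))"
        by (subst sum.insert) auto
      also have "(\<Sum>i\<in>Suc ` x_of n \<gamma>. (-1) ^ card (J \<inter> {..<i}) * u i * minor A (J - {i})) =
         (\<Sum>i\<in>x_of n \<gamma>. (-1) ^ card (J \<inter> {..<Suc i}) * u (Suc i) * minor A (J - {Suc i}))"
        by (subst sum.reindex) auto
      also have "\<dots> = (\<Sum>i\<in>x_of n \<gamma>. (-1) ^ Suc (card (x_of n \<gamma> \<inter> {..<i})) * v $ i * minor A (J -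
        {Suc i}))"
      proof (rule sum.cong[OF refl])
        fix i assume "i \<in> x_of n \<gamma>"
        have "J \<inter> {..<Suc i} = insert 0 (Suc ` (x_of n \<gamma> \<inter> {..<i}))" by (auto simp: J_def)
        then have "card (J \<inter> {..<Suc i}) = Suc (card (x_of n \<gamma> \<inter> {..<i}))"
          by (simp add: card_image)
        then show "(-1) ^ card (J \<inter> {..<Suc i}) * u (Suc i) * minor A (J - {Suc i}) =
          (-1) ^ Suc (card (x_of n \<gamma> \<inter> {..<i})) * v $ i * minor A (J -
            {Suc i})" by (simp add: u_def)
      qed
      also have "u 0 = functional xi v" by (simp add: u_def)
      finally show ?thesis .
    qed
    have b2: "(-1) ^ Suc (card (x_of n \<gamma> \<inter> {..<i})) = real_of_int (\<gamma> (Suc i))"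
      if i: "i \<in> x_of n \<gamma>" for i
    proof -
      have "x_of n \<gamma> \<inter> {..<Suc i} = insert i (x_of n \<gamma> \<inter> {..<i})" using i
        by (auto simp: less_Suc_eq)
      moreover have "i < n" using i by (simp add: x_of_def)
      ultimately show ?thesis using sign_x_of[OF g, of "Suc i"] by simp
    qed
    have "(\<Sum>i\<in>x_of n \<gamma>. (-1) ^ Suc (card (x_of n \<gamma> \<inter> {..<i})) * v $ i * minor A (J - {Suc i})) =
      (\<Sum>i\<in>x_of n \<gamma>. real_of_int (\<gamma> (Suc i)) * v $ i * minor A (J - {Suc i}))"
      by (intro sum.cong refl) (simp only: b2)
    then have "functional xi v * minor A (J - {0}) +
      (\<Sum>i\<in>x_of n \<gamma>. real_of_int (\<gamma> (Suc i)) * v $ i * minor A (J - {Suc i})) = 0"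
      using b0 b1 by linarith
    then have "0 = s * (functional xi v * minor A (J - {0}) +
      (\<Sum>i\<in>x_of n \<gamma>. real_of_int (\<gamma> (Suc i)) * v $ i * minor A (J - {Suc i})))" by simp
    also have "\<dots> = a0 * functional xi v + (\<Sum>i\<in>x_of n \<gamma>. a i * (of_int (\<gamma> (Suc i)) * v $ i))"
      by (simp add: a_def a0_def distrib_left sum_distrib_left algebra_simps)
    finally show ?thesis by simp
  qed
  obtain y where y: "y \<in> eta" using eta_ex by blast
  have yc: "y \<in> carrier_vec n" using y eta_carrier by blast
  define M where "M = (\<Sum>i\<in>x_of n \<gamma>. a i * (of_int (\<gamma> (Suc i)) * y $ i)) / a0"
  show ?thesis
    unfolding bounded_sign_def
  proof (intro exI[of _ "\<lambda>x. functional xi (x - y)"] conjI exI[of _ M] ballI)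
    fix x v assume xv: "x \<in> eta" "v \<in> V"
    have "x + v - y = (x - y) + v"
      using xv yc eta_carrier V_carrier by (intro eq_vecI) auto
    then show "functional xi (x + v - y) = functional xi (x - y) + functional xi v"
      using functional_add[OF eta_diff[OF xv(1) y] xv(2)] by simp
  next
    fix x assume x: "x \<in> region n eta \<gamma>"
    then have xe: "x \<in> eta" by (simp add: region_iff)
    have xc: "x \<in> carrier_vec n" using xe eta_carrier by blast
    have "a0 * functional xi (x - y) = (\<Sum>i\<in>x_of n \<gamma>. a i * (of_int (\<gamma> (Suc i)) * y $ i)) -
       (\<Sum>i\<in>x_of n \<gamma>. a i * (of_int (\<gamma> (Suc i)) * x $ i))"
      unfolding rel[OF eta_diff[OF xe y]] sum_subtractf[symmetric] sum_negf[symmetric]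
      using xc yc by (intro sum.cong) (auto simp: x_of_def algebra_simps)
    also have "\<dots> \<le> (\<Sum>i\<in>x_of n \<gamma>. a i * (of_int (\<gamma> (Suc i)) * y $ i))"
    proof -
      have "(\<Sum>i\<in>x_of n \<gamma>. a i * (of_int (\<gamma> (Suc i)) * x $ i)) \<ge> 0"
      proof (rule sum_nonneg)
        fix i assume i: "i \<in> x_of n \<gamma>"
        then have "i < n" by (simp add: x_of_def)
        then show "0 \<le> a i * (of_int (\<gamma> (Suc i)) * x $ i)" using a[OF i] x
          by (simp add: region_iff)
      qed
      then show ?thesis by simp
    qed
    finally show "functional xi (x - y) \<le> M" using a0
      by (simp add: M_def pos_le_divide_eq mult.commute)
  qed
qed

text \<open>With fewer than k changes, V contains a vector with the signs of \<gamma> on which \<xi>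
  is positive, the sign + at position 0 being the one asked of \<xi>. The nonempty region contains a
  ray in this direction.\<close>

lemma unbounded_if_card_x_of:
  assumes g: "\<gamma> \<in> sign_vectors n" and c: "card (x_of n \<gamma>) < k"
  shows "\<not> bounded_sign n V eta xi \<gamma>"
proof
  assume "bounded_sign n V eta xi \<gamma>"
  then obtain h M where h: "\<And>x v. x \<in> eta \<Longrightarrow> v \<in> V \<Longrightarrow> h (x + v) = h x + functional xi v"
    "\<And>x. x \<in> region n eta \<gamma> \<Longrightarrow> h x \<le> M" unfolding bounded_sign_def by blast
  obtain v where v: "v \<in> V" "functional xi v > 0"
    "\<And>i. i < n \<Longrightarrow> real_of_int (\<gamma> (Suc i)) * v $ i > 0"
    using realize_in_V[of "\<lambda>i. real_of_int (\<gamma> i)"] real_sgn[OF g] c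
    unfolding changes_x_of by (auto simp: sign_vectors_0[OF g])
  have vc: "v \<in> carrier_vec n" using v V_carrier by blast
  obtain x where x: "x \<in> region n eta \<gamma>"
    using feasible_if_card_x_of[OF g] c by (auto simp: feasible_def)
  then have xe: "x \<in> eta" by (simp add: region_iff)
  have xc: "x \<in> carrier_vec n" using xe eta_carrier by blast
  define t where "t = (\<bar>M - h x\<bar> + 1) / functional xi v"
  have t: "t > 0" using v(2) by (simp add: t_def)
  have "x + t \<cdot>\<^sub>v v \<in> region n eta \<gamma>"
    unfolding region_iff
  proof (intro conjI allI impI)
    show "x + t \<cdot>\<^sub>v v \<in> eta" using eta_add[OF xe V_smult[OF v(1)]] .
    fix i assume i: "i < n"
    have "of_int (\<gamma> (Suc i)) * (x + t \<cdot>\<^sub>v v) $ i =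
      of_int (\<gamma> (Suc i)) * x $ i + t * (of_int (\<gamma> (Suc i)) * v $ i)"
      using i xc vc by (simp add: algebra_simps)
    moreover have "of_int (\<gamma> (Suc i)) * x $ i \<ge> 0" using x i by (simp add: region_iff)
    moreover have "t * (of_int (\<gamma> (Suc i)) * v $ i) > 0" using t v(3)[OF i] by simp
    ultimately show "of_int (\<gamma> (Suc i)) * (x + t \<cdot>\<^sub>v v) $ i \<ge> 0" by linarith
  qed
  from h(2)[OF this] have "h x + t * functional xi v \<le> M"
    using h(1)[OF xe V_smult[OF v(1)]] functional_smult[OF v(1)] by simp
  moreover have "t * functional xi v = \<bar>M - h x\<bar> + 1" using v(2) by (simp add: t_def)
  ultimately show False by linarith
qed

lemma PP_eq: "PP n V eta xi = {\<alpha> \<in> sign_vectors n. card (x_of n \<alpha>) = k}"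
  unfolding PP_def
  using feasible_iff bounded_if_card_x_of unbounded_if_card_x_of
  by (auto simp: le_less)

text \<open>Adding \<open>t\<close> to \<open>T\<close>, a segment joins a point of \<open>\<Delta>\<^sub>\<alpha>\<close> to a point of the region on the other side of \<open>H\<^sub>t\<close>,
  and it meets \<open>H\<^sub>t\<close>.\<close>

lemma region_common_point:
  assumes "finite T" "\<alpha> \<in> sign_vectors n" "T \<subseteq> {1..n}"
    "\<And>\<gamma>. \<gamma> \<in> sign_vectors n \<Longrightarrow> (\<forall>i. i \<notin> T \<longrightarrow> \<gamma> i = \<alpha> i) \<Longrightarrow> feasible n eta \<gamma>"
  shows "\<exists>x\<in>region n eta \<alpha>. \<forall>i\<in>T. x $ (i - 1) = 0"
  using assms
proof (induction T arbitrary: \<alpha> rule: finite_induct)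
  case empty
  then show ?case by (auto simp: feasible_def)
next
  case (insert t T)
  define \<beta> where "\<beta> = \<alpha>(t := - \<alpha> t)"
  have t: "t \<in> {1..n}" using insert.prems by simp
  have \<beta>: "\<beta> \<in> sign_vectors n"
    using insert.prems(1) t unfolding sign_vectors_def \<beta>_def by (auto split: if_splits)
  obtain x where x: "x \<in> region n eta \<alpha>" "\<forall>i\<in>T. x $ (i - 1) = 0"
    using insert.IH[OF insert.prems(1)] insert.prems by auto
  have "\<exists>z\<in>region n eta \<beta>. \<forall>i\<in>T. z $ (i - 1) = 0"
    by (rule insert.IH[OF \<beta>]) (use insert.prems(2,3) in \<open>auto simp: \<beta>_def\<close>)
  then obtain z where z: "z \<in> region n eta \<beta>" "\<forall>i\<in>T. z $ (i - 1) = 0" by blast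
  have e: "x \<in> eta" "z \<in> eta" using x z by (simp_all add: region_iff)
  have c: "x \<in> carrier_vec n" "z \<in> carrier_vec n" using e eta_carrier by auto
  define a where "a = of_int (\<alpha> t) * x $ (t - 1)"
  define b where "b = - (of_int (\<alpha> t) * z $ (t - 1))"
  have tt: "t - 1 < n" "Suc (t - 1) = t" using t by auto
  have a: "a \<ge> 0" using x(1) tt unfolding a_def region_iff by metis
  have "of_int (\<beta> t) * z $ (t - 1) \<ge> 0" using z(1) tt unfolding region_iff by metis
  then have b: "b \<ge> 0" by (simp add: b_def \<beta>_def)
  have a1: "real_of_int (\<alpha> t) \<noteq> 0" using real_sgn[OF insert.prems(1), of t] by auto
  show ?case
  proof (cases "a = 0")
    case True
    then show ?thesis using x a1 by (auto simp: a_def)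
  next
    case False
    then have ab: "a + b > 0" using a b by simp
    \<comment> \<open>The parameter at which the segment from x to z crosses the hyperplane of t; a
      and b measure the distances of its ends from it.\<close>
    define r where "r = a / (a + b)"
    have r: "0 \<le> r" "r \<le> 1" using a b ab by (simp_all add: r_def)
    define w where "w = x + r \<cdot>\<^sub>v (z - x)"
    have wi: "w $ i = (1 - r) * x $ i + r * z $ i" if "i < n" for i
      using that c by (simp add: w_def algebra_simps)
    have w0: "w $ (t - 1) = 0"
    proof -
      have "of_int (\<alpha> t) * w $ (t - 1) = (1 - r) * a - r * b"
        unfolding wi[OF tt(1)] a_def b_def by (simp add: algebra_simps)
      also have "\<dots> = 0" using ab by (simp add: r_def field_simps)
      finally show ?thesis using a1 by simp
    qed
    have "w \<in> region n eta \<alpha>"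
      unfolding region_iff
    proof (intro conjI allI impI)
      show "w \<in> eta" unfolding w_def using eta_add[OF e(1) V_smult[OF eta_diff[OF e(2,1)]]] .
      fix i assume i: "i < n"
      show "of_int (\<alpha> (Suc i)) * w $ i \<ge> 0"
      proof (cases "Suc i = t")
        case True
        then show ?thesis using w0 by auto
      next
        case False
        have "of_int (\<alpha> (Suc i)) * x $ i \<ge> 0" "of_int (\<beta> (Suc i)) * z $ i \<ge> 0"
          using x(1) z(1) i by (auto simp: region_iff)
        then have "(1 - r) * (of_int (\<alpha> (Suc i)) * x $ i) + r * (of_int (\<alpha> (Suc i)) * z $ i) \<ge> 0"
          using r False by (simp add: \<beta>_def)
        then show ?thesis unfolding wi[OF i] by (simp add: algebra_simps)
      qed
    qed
    moreover have "\<forall>i\<in>insert t T. w $ (i - 1) = 0"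
    proof
      fix i assume i: "i \<in> insert t T"
      then have "i \<in> {1..n}" using insert.prems(2) by blast
      then have "i - 1 < n" by auto
      then show "w $ (i - 1) = 0" using i w0 wi x(2) z(2) by auto
    qed
    ultimately show ?thesis by blast
  qed
qed

text \<open>At a common point the entries in S and those where \<alpha> and \<beta> differ vanish,
  so the point lies in the region of every such \<gamma> and bounds its number of changes.
  Conversely, if all these \<gamma> are feasible, \<open>region_common_point\<close> gives a common
  point.\<close>

lemma region_empty_iff:
  assumes "\<alpha> \<in> sign_vectors n" "\<beta> \<in> sign_vectors n" "S \<subseteq> {1..n}"
  shows "region n eta \<alpha> \<inter> region n eta \<beta> \<inter> hyperplanes eta S = {} \<longleftrightarrow>
    (\<exists>\<gamma>\<in>sign_vectors n. (\<forall>i. i \<notin> S \<and> \<alpha> i = \<beta> i \<longrightarrow> \<gamma> i = \<alpha> i) \<and> k < card (x_of n \<gamma>))"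
proof
  define T where "T = S \<union> {i. \<alpha> i \<noteq> \<beta> i}"
  have T: "T \<subseteq> {1..n}" using assms unfolding T_def sign_vectors_def by (auto; metis)
  assume empty: "region n eta \<alpha> \<inter> region n eta \<beta> \<inter> hyperplanes eta S = {}"
  show "\<exists>\<gamma>\<in>sign_vectors n. (\<forall>i. i \<notin> S \<and> \<alpha> i = \<beta> i \<longrightarrow> \<gamma> i = \<alpha> i) \<and> k < card (x_of n \<gamma>)"
  proof (rule ccontr)
    assume "\<not> ?thesis"
    then have "feasible n eta \<gamma>" if "\<gamma> \<in> sign_vectors n" "\<forall>i. i \<notin> T \<longrightarrow> \<gamma> i = \<alpha> i" for \<gamma>
      using that feasible_iff[OF that(1)] by (auto simp: T_def not_less)
    then obtain x where x: "x \<in> region n eta \<alpha>" "\<forall>i\<in>T. x $ (i - 1) = 0"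
      using region_common_point[OF finite_subset[OF T] assms(1) T] by auto
    have "x \<in> region n eta \<beta>"
      using x unfolding region_iff T_def
        by (metis (mono_tags, lifting) UnI2 diff_Suc_1 mem_Collect_eq mult_zero_right order_refl)
    moreover have "x \<in> hyperplanes eta S" using x by (auto simp: hyperplanes_def region_iff T_def)
    ultimately show False using x(1) empty by blast
  qed
next
  assume "\<exists>\<gamma>\<in>sign_vectors n. (\<forall>i. i \<notin> S \<and> \<alpha> i = \<beta> i \<longrightarrow> \<gamma> i = \<alpha> i) \<and> k < card (x_of n \<gamma>)"
  then obtain \<gamma> where g: "\<gamma> \<in> sign_vectors n" "\<And>i. i \<notin> S \<Longrightarrow> \<alpha> i = \<beta> i \<Longrightarrow> \<gamma> i = \<alpha> i"
    "k < card (x_of n \<gamma>)" by blast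
  show "region n eta \<alpha> \<inter> region n eta \<beta> \<inter> hyperplanes eta S = {}"
  proof (rule ccontr)
    assume "\<not> ?thesis"
    then obtain x where x: "x \<in> region n eta \<alpha>" "x \<in> region n eta \<beta>" "x \<in> hyperplanes eta S"
      by blast
    have "x \<in> region n eta \<gamma>"
      unfolding region_iff
    proof (intro conjI allI impI)
      show "x \<in> eta" using x by (simp add: region_iff)
      fix i assume i: "i < n"
      have ab: "of_int (\<alpha> (Suc i)) * x $ i \<ge> 0" "of_int (\<beta> (Suc i)) * x $ i \<ge> 0" using x i
        by (auto simp: region_iff)
      consider "Suc i \<in> S" | "Suc i \<notin> S" "\<alpha> (Suc i) = \<beta> (Suc i)" | "\<alpha> (Suc i) \<noteq> \<beta> (Suc i)"
        by blast
      then show "of_int (\<gamma> (Suc i)) * x $ i \<ge> 0"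
      proof cases
        case 1
        then have "x $ i = 0" using x(3) by (force simp: hyperplanes_def)
        then show ?thesis by simp
      next
        case 2
        then show ?thesis using g(2) ab by simp
      next
        case 3
        then have "real_of_int (\<beta> (Suc i)) = - real_of_int (\<alpha> (Suc i))"
          using real_sgn[OF assms(1), of "Suc i"] real_sgn[OF assms(2), of "Suc i"] by auto
        then have "of_int (\<alpha> (Suc i)) * x $ i = 0" using ab by simp
        then have "x $ i = 0" using real_sgn[OF assms(1), of "Suc i"] by auto
        then show ?thesis by simp
      qed
    qed
    then show False using card_x_of_if_feasible[OF g(1)] g(3) by auto
  qed
qed

section \<open>The convolution algebra\<close>

abbreviation (input) "P \<equiv> PP n V eta xi"
abbreviation (input) "cs \<equiv> Rclass n eta"

lemma PP_D: "\<alpha> \<in> P \<Longrightarrow> \<alpha> \<in> sign_vectors n" "\<alpha> \<in> P \<Longrightarrow> card (x_of n \<alpha>) = k"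
  unfolding PP_eq by auto

lemma bij_PP: "bij_betw (x_of n) P (Vl n k)"
  unfolding PP_eq by (rule bij_x_of)

lemma finite_PP: "finite P"
  using bij_betw_finite[OF bij_PP] finite_Vl by blast

lemma x_of_Vl: "\<alpha> \<in> P \<Longrightarrow> x_of n \<alpha> \<in> Vl n k"
  using bij_PP by (auto simp: bij_betw_def)

lemma x_of_Vset: "\<alpha> \<in> P \<Longrightarrow> x_of n \<alpha> \<in> Vset n k"
  using x_of_Vl Vl_Vset by blast

lemma crowded_mon_iff_region:
  assumes "\<alpha> \<in> P" "\<beta> \<in> P" "Poly_Mapping.keys m \<subseteq> {1..n}"
  shows "crowded_mon n k (x_of n \<alpha>) (x_of n \<beta>) m \<longleftrightarrow>
    region n eta \<alpha> \<inter> region n eta \<beta> \<inter> hyperplanes eta (Poly_Mapping.keys m) = {}"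
  using crowded_x_of[OF PP_D[OF assms(1)] PP_D(1)[OF assms(2)] assms(3)]
    region_empty_iff[OF PP_D(1)[OF assms(1)] PP_D(1)[OF assms(2)] assms(3)]
  by (simp add: crowded_mon_def)

text \<open>Whether a monomial is crowded depends only on its support. A crowded monomial is thus a
  multiple of the square-free monomial on its support, which is a generator.\<close>

lemma Rideal_eq:
  assumes "\<alpha> \<in> P" "\<beta> \<in> P"
  shows "Rideal n eta \<alpha> \<beta> = crowded_poly n k (x_of n \<alpha>) (x_of n \<beta>)"
proof -
  interpret Z: ring "Zu n" by (rule ring_Zu)
  let ?G = "{umon S | S. S \<subseteq> {1..n} \<and> region n eta \<alpha> \<inter> region n eta \<beta> \<inter> hyperplanes eta S = {}}"
  let ?J = "crowded_poly n k (x_of n \<alpha>) (x_of n \<beta>)"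
  have G: "?G \<subseteq> carrier (Zu n)" using umon_Zu by auto
  have sub: "?G \<subseteq> ?J"
  proof safe
    fix S assume S: "S \<subseteq> {1..n}" "region n eta \<alpha> \<inter> region n eta \<beta> \<inter> hyperplanes eta S = {}"
    have fin: "finite S" using S(1) finite_subset by blast
    have "crowded_mon n k (x_of n \<alpha>) (x_of n \<beta>) (indicator_exp S)"
      using crowded_mon_iff_region[OF assms, of "indicator_exp S"] S keys_indicator_exp[OF fin]
        by simp
    then show "umon S \<in> ?J" using umon_Zu[OF S(1)]
      by (simp add: crowded_poly_def umon_indicator_exp[OF fin])
  qed
  have "Rideal n eta \<alpha> \<beta> \<subseteq> ?J"
    unfolding Rideal_def by (rule Z.genideal_minimal[OF ideal_crowded_poly sub])
  moreover have "?J \<subseteq> Rideal n eta \<alpha> \<beta>"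
  proof
    have I: "ideal (Rideal n eta \<alpha> \<beta>) (Zu n)" unfolding Rideal_def
      by (rule Z.genideal_ideal[OF G])
    interpret I: ideal "Rideal n eta \<alpha> \<beta>" "Zu n" by (rule I)
    fix p assume "p \<in> ?J"
    then have "Poly_Mapping.keys p \<subseteq> {m. Poly_Mapping.keys m \<subseteq> {1..n} \<and>
      crowded_mon n k (x_of n \<alpha>) (x_of n \<beta>) m}"
      by (auto simp: crowded_poly_def Zu_simps)
    then show "p \<in> Rideal n eta \<alpha> \<beta>"
    proof (induction p rule: frag_induction)
      case zero
      show ?case using additive_subgroup.zero_closed[OF ideal.axioms(1)[OF I]]
        by (simp add: Zu_simps)
    next
      case (one m)
      let ?S = "Poly_Mapping.keys m"
      have m: "?S \<subseteq> {1..n}" "region n eta \<alpha> \<inter> region n eta \<beta> \<inter> hyperplanes eta ?S = {}"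
        using one crowded_mon_iff_region[OF assms] by auto
      have mem: "umon ?S \<in> Rideal n eta \<alpha> \<beta>"
        unfolding Rideal_def using Z.genideal_self[OF G] m by blast
      have "m = indicator_exp ?S + (m - indicator_exp ?S)"
        by (rule poly_mapping_eqI) (auto simp: lookup_add lookup_minus lookup_indicator_exp
          in_keys_iff)
      then have e: "frag_of m = umon ?S * frag_of (m - indicator_exp ?S)"
        by (simp add: umon_indicator_exp mult_single)
      have "Poly_Mapping.keys (m - indicator_exp ?S) \<subseteq> ?S"
        by (auto simp: in_keys_iff lookup_minus)
      then have "frag_of (m - indicator_exp ?S) \<in> carrier (Zu n)" using m(1)
        by (auto simp: Zu_simps)
      from I.I_r_closed[OF mem this] show ?case unfolding e by (simp add: Zu_simps)
    next
      case (diff a b)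
      have "a \<in> carrier (Zu n)" "b \<in> carrier (Zu n)" using diff I.a_subset by blast+
      moreover have "a \<ominus>\<^bsub>Zu n\<^esub> b \<in> Rideal n eta \<alpha> \<beta>"
        unfolding a_minus_def using diff additive_subgroup.a_closed[OF ideal.axioms(1)[OF I]]
          additive_subgroup.a_inv_closed[OF ideal.axioms(1)[OF I]] by blast
      ultimately show ?case by (simp add: Zu_minus)
    qed
  qed
  ultimately show ?thesis by blast
qed

lemma ideal_Rideal: "\<alpha> \<in> P \<Longrightarrow> \<beta> \<in> P \<Longrightarrow> ideal (Rideal n eta \<alpha> \<beta>) (Zu n)"
  by (simp add: Rideal_eq ideal_crowded_poly)

lemma Rclass_hom: "\<alpha> \<in> P \<Longrightarrow> \<beta> \<in> P \<Longrightarrow> cs \<alpha> \<beta> \<in> Ring.ring_hom (Zu n) (Rtilde n eta \<alpha> \<beta>)"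
proof -
  assume "\<alpha> \<in> P" "\<beta> \<in> P"
  moreover have "cs \<alpha> \<beta> = (+>\<^bsub>Zu n\<^esub>) (Rideal n eta \<alpha> \<beta>)" by (simp add: Rclass_def fun_eq_iff)
  ultimately show ?thesis unfolding Rtilde_def using ideal.rcos_ring_hom[OF ideal_Rideal] by simp
qed

lemma ring_Rtilde: "\<alpha> \<in> P \<Longrightarrow> \<beta> \<in> P \<Longrightarrow> ring (Rtilde n eta \<alpha> \<beta>)"
  unfolding Rtilde_def by (rule ideal.quotient_is_ring[OF ideal_Rideal])

lemma Rclass_eq_iff:
  assumes "\<alpha> \<in> P" "\<beta> \<in> P" "p \<in> carrier (Zu n)" "q \<in> carrier (Zu n)"
  shows "cs \<alpha> \<beta> p = cs \<alpha> \<beta> q \<longleftrightarrow> p - q \<in> crowded_poly n k (x_of n \<alpha>) (x_of n \<beta>)"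
  using ring.quotient_eq_iff_same_a_r_cos[OF ring_Zu ideal_Rideal[OF assms(1,2)] assms(3,4)]
  by (simp add: Rclass_def Zu_minus assms Rideal_eq)

lemma Rclass_surj:
  assumes "\<alpha> \<in> P" "\<beta> \<in> P" "A \<in> carrier (Rtilde n eta \<alpha> \<beta>)"
  obtains p where "p \<in> carrier (Zu n)" "A = cs \<alpha> \<beta> p"
  using assms(3) unfolding Rtilde_def FactRing_def A_RCOSETS_def' Rclass_def by auto

lemma Rclass_closed: "\<alpha> \<in> P \<Longrightarrow> \<beta> \<in> P \<Longrightarrow> p \<in> carrier (Zu n) \<Longrightarrow> cs \<alpha> \<beta> p \<in> carrier (Rtilde n eta \<alpha> \<beta>)"
  using ring_hom_closed[OF Rclass_hom] by blast

lemma Rclass_add: "\<alpha> \<in> P \<Longrightarrow> \<beta> \<in> P \<Longrightarrow> p \<in> carrier (Zu n) \<Longrightarrow> q \<in> carrier (Zu n) \<Longrightarrow>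
  cs \<alpha> \<beta> p \<oplus>\<^bsub>Rtilde n eta \<alpha> \<beta>\<^esub> cs \<alpha> \<beta> q = cs \<alpha> \<beta> (p + q)"
  using ring_hom_add[OF Rclass_hom, of \<alpha> \<beta> p q] by (simp add: Zu_simps(5))

lemma Rclass_0: "\<alpha> \<in> P \<Longrightarrow> \<beta> \<in> P \<Longrightarrow> \<zero>\<^bsub>Rtilde n eta \<alpha> \<beta>\<^esub> = cs \<alpha> \<beta> 0"
  using ring_hom_zero[OF Rclass_hom ring_Zu ring_Rtilde, of \<alpha> \<beta>] by (simp add: Zu_simps(4))

lemma Rclass_1: "\<alpha> \<in> P \<Longrightarrow> \<beta> \<in> P \<Longrightarrow> \<one>\<^bsub>Rtilde n eta \<alpha> \<beta>\<^esub> = cs \<alpha> \<beta> 1"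
  using ring_hom_one[OF Rclass_hom, of \<alpha> \<beta>] by (simp add: Zu_simps(3))

lemma Rclass_sum:
  assumes "\<alpha> \<in> P" "\<beta> \<in> P" "finite I" "\<And>i. i \<in> I \<Longrightarrow> f i \<in> carrier (Zu n)"
  shows "finsum (Rtilde n eta \<alpha> \<beta>) (\<lambda>i. cs \<alpha> \<beta> (f i)) I = cs \<alpha> \<beta> (\<Sum>i\<in>I. f i)"
  using assms(3,4)
proof (induction I rule: finite_induct)
  case empty
  then show ?case using abelian_monoid.finsum_empty[of "Rtilde n eta \<alpha> \<beta>"] ring_Rtilde[OF
    assms(1,2)]
    by (simp add: Rclass_0 assms ring.is_abelian_group abelian_group.axioms(1))
next
  case (insert i I)
  interpret R: ring "Rtilde n eta \<alpha> \<beta>" by (rule ring_Rtilde[OF assms(1,2)])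
  have s: "(\<Sum>i\<in>I. f i) \<in> carrier (Zu n)"
    using insert.prems by (intro Zu_sum) simp
  show ?case
    using insert s by (simp add: R.finsum_insert Rclass_closed Rclass_add assms Pi_iff)
qed

text \<open>As there are only two signs, \<alpha> and \<gamma> agree against \<beta> exactly where
  the sign changes from \<alpha> to \<beta> and changes back.\<close>

lemma sep_dset:
  assumes "\<alpha> \<in> P" "\<beta> \<in> P" "\<gamma> \<in> P"
  shows "sep n \<alpha> \<beta> \<gamma> = dset n (x_of n \<alpha>) (x_of n \<beta>) \<inter> dset n (x_of n \<beta>) (x_of n \<gamma>)"
proof -
  have "i \<in> {1..n}" if "\<alpha> i \<noteq> \<beta> i" for i
    using that sign_outside[OF PP_D(1)[OF assms(1)]] sign_outside[OF PP_D(1)[OF assms(2)]]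
      by metis
  then show ?thesis
    unfolding sep_def dset_x_of[OF PP_D(1)[OF assms(1)] PP_D(1)[OF assms(2)]] dset_x_of[OF
      PP_D(1)[OF assms(2)] PP_D(1)[OF assms(3)]]
    using sign_cases[OF PP_D(1)[OF assms(1)]] sign_cases[OF PP_D(1)[OF assms(2)]] sign_cases[OF
      PP_D(1)[OF assms(3)]]
    by auto metis+
qed

lemma Rclass_self: "\<alpha> \<in> P \<Longrightarrow> \<beta> \<in> P \<Longrightarrow> p \<in> carrier (Zu n) \<Longrightarrow> p \<in> cs \<alpha> \<beta> p"
  unfolding Rclass_def using abelian_subgroup.a_rcos_self[OF
    abelian_subgroupI3[OF ideal.axioms(1)[OF ideal_Rideal] ring.is_abelian_group[OF ring_Zu]]]
    by blast

lemma Rclass_mem: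
  assumes "\<alpha> \<in> P" "\<beta> \<in> P" "p \<in> carrier (Zu n)" "q \<in> cs \<alpha> \<beta> p"
  shows "q \<in> carrier (Zu n)" "q - p \<in> crowded_poly n k (x_of n \<alpha>) (x_of n \<beta>)"
proof -
  obtain r where r: "r \<in> crowded_poly n k (x_of n \<alpha>) (x_of n \<beta>)" "q = r + p"
    using assms(4) unfolding Rclass_def Rideal_eq[OF assms(1,2)] a_r_coset_def'
      by (auto simp: Zu_simps(5))
  then show "q \<in> carrier (Zu n)" "q - p \<in> crowded_poly n k (x_of n \<alpha>) (x_of n \<beta>)"
    using Zu_add[of r n p] assms(3) by (auto simp: crowded_poly_def)
qed

text \<open>Changing a representative of either factor changes the product by crowded monomials, by
  \<open>crowded_poly_mult\<close>; so the union is a single coset.\<close>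

lemma Rtilde_mult_Rclass:
  assumes "\<alpha> \<in> P" "\<beta> \<in> P" "\<gamma> \<in> P" "a \<in> carrier (Zu n)" "b \<in> carrier (Zu n)"
  shows "Rtilde_mult n eta \<alpha> \<beta> \<gamma> (cs \<alpha> \<beta> a) (cs \<beta> \<gamma> b) = cs \<alpha> \<gamma> (umon (sep n \<alpha> \<beta> \<gamma>) * a * b)"
proof -
  let ?u = "umon (sep n \<alpha> \<beta> \<gamma>)"
  have u: "?u \<in> carrier (Zu n)" by (rule umon_Zu) (auto simp: sep_def)
  note V = x_of_Vset[OF assms(1)] x_of_Vset[OF assms(2)] x_of_Vset[OF assms(3)]
  have eq: "cs \<alpha> \<gamma> (?u * a' * b') = cs \<alpha> \<gamma> (?u * a * b)" if m: "a' \<in> cs \<alpha> \<beta> a" "b' \<in> cs \<beta> \<gamma> b"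
    for a' b'
  proof -
    note a' = Rclass_mem[OF assms(1,2,4) m(1)] and b' = Rclass_mem[OF assms(2,3,5) m(2)]
    have "?u * a' * b' - ?u * a * b = ?u * (a' - a) * b' + ?u * a * (b' - b)"
      by (simp add: algebra_simps)
    also have "\<dots> \<in> crowded_poly n k (x_of n \<alpha>) (x_of n \<gamma>)"
      unfolding sep_dset[OF assms(1-3)]
      by (intro crowded_poly_add crowded_poly_mult[OF V] Zu_diff) (use a' b' assms in auto)
    finally show ?thesis
      using Rclass_eq_iff[OF assms(1,3)] a' b' u assms by (simp add: Zu_mult)
  qed
  show ?thesis
    unfolding Rtilde_mult_def using eq Rclass_self[OF assms(1,2,4)] Rclass_self[OF assms(2,3,5)]
    unfolding Rclass_def by blast
qed

section \<open>The isomorphism\<close>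

abbreviation (input) "Bt \<equiv> Btilde n V eta xi"

text \<open>A class is sent to the polynomials of an arbitrary representative. The description of
  the ideal by crowded monomials makes this well defined and injective.\<close>

definition Phi0 :: "osz_free set \<Rightarrow> btilde" where
  "Phi0 A = (\<lambda>(\<alpha>, \<beta>)\<in>P \<times> P. cs \<alpha> \<beta> (path_poly (x_of n \<alpha>) (x_of n \<beta>) (SOME a.
    a \<in> carrier (Fr n k) \<and> osz_class n k a = A)))"

lemma Phi0_class:
  assumes "a \<in> carrier (Fr n k)"
  shows "Phi0 (osz_class n k a) = (\<lambda>(\<alpha>, \<beta>)\<in>P \<times> P. cs \<alpha> \<beta> (path_poly (x_of n \<alpha>) (x_of n \<beta>) a))"
proof -
  define b where "b = (SOME b. b \<in> carrier (Fr n k) \<and> osz_class n k b = osz_class n k a)"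
  have "b \<in> carrier (Fr n k) \<and> osz_class n k b = osz_class n k a"
    unfolding b_def by (rule someI[of _ a]) (simp add: assms)
  then have b: "b \<in> carrier (Fr n k)" "b - a \<in> osz_ideal n k" using osz_class_eq_iff assms
    by blast+
  have "cs \<alpha> \<beta> (path_poly (x_of n \<alpha>) (x_of n \<beta>) b) = cs \<alpha> \<beta> (path_poly (x_of n \<alpha>) (x_of n \<beta>) a)"
    if ab: "\<alpha> \<in> P" "\<beta> \<in> P" for \<alpha> \<beta>
  proof -
    have "path_poly (x_of n \<alpha>) (x_of n \<beta>) (b - a) \<in> crowded_poly n k (x_of n \<alpha>) (x_of n \<beta>)"
      using b(2) x_of_Vset[OF ab(1)] x_of_Vset[OF ab(2)] unfolding osz_ideal_eq by blast
    then show ?thesis using Rclass_eq_iff[OF ab path_poly_Zu[OF b(1)] path_poly_Zu[OF assms]]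
      by (simp add: path_poly_diff)
  qed
  then show ?thesis unfolding Phi0_def b_def[symmetric] by (auto intro!: restrict_ext)
qed

lemma Bt_simps:
  "carrier Bt = (\<Pi>\<^sub>E (\<alpha>, \<beta>)\<in>P \<times> P. carrier (Rtilde n eta \<alpha> \<beta>))"
  "monoid.mult Bt = (\<lambda>x y. \<lambda>(\<alpha>, \<gamma>)\<in>P \<times> P.
         \<Oplus>\<^bsub>Rtilde n eta \<alpha> \<gamma>\<^esub>\<beta>\<in>P. Rtilde_mult n eta \<alpha> \<beta> \<gamma> (x (\<alpha>, \<beta>)) (y (\<beta>, \<gamma>)))"
  "one Bt = (\<lambda>(\<alpha>, \<beta>)\<in>P \<times> P. if \<alpha> = \<beta> then \<one>\<^bsub>Rtilde n eta \<alpha> \<beta>\<^esub> else \<zero>\<^bsub>Rtilde n eta \<alpha> \<beta>\<^esub>)"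
  "zero Bt = (\<lambda>(\<alpha>, \<beta>)\<in>P \<times> P. \<zero>\<^bsub>Rtilde n eta \<alpha> \<beta>\<^esub>)"
  "add Bt = (\<lambda>x y. \<lambda>(\<alpha>, \<beta>)\<in>P \<times> P. x (\<alpha>, \<beta>) \<oplus>\<^bsub>Rtilde n eta \<alpha> \<beta>\<^esub> y (\<alpha>, \<beta>))"
  by (simp_all add: Btilde_def Let_def)

lemma Phi0_closed: "a \<in> carrier (Fr n k) \<Longrightarrow> Phi0 (osz_class n k a) \<in> carrier Bt"
  unfolding Phi0_class Bt_simps using Rclass_closed path_poly_Zu by (auto simp: PiE_iff)

lemma Phi0_add:
  assumes "a \<in> carrier (Fr n k)" "b \<in> carrier (Fr n k)"
  shows "Phi0 (osz_class n k (a + b)) = Phi0 (osz_class n k a) \<oplus>\<^bsub>Bt\<^esub> Phi0 (osz_class n k b)"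
  unfolding Phi0_class[OF assms(1)] Phi0_class[OF assms(2)] Phi0_class[OF Fr_add[OF assms]]
    Bt_simps
  by (auto intro!: restrict_ext simp: Rclass_add path_poly_Zu[OF assms(1)]
    path_poly_Zu[OF assms(2)] path_poly_add)

text \<open>\<open>path_poly_mult\<close> sums over all intermediate vertices. For combinations of
  left paths only left vertices contribute, and these correspond to the elements of
  \<open>PP\<close>.\<close>

lemma Phi0_mult:
  assumes a: "a \<in> left_paths n k" and b: "b \<in> left_paths n k"
  shows "Phi0 (osz_class n k (pmul a b)) = Phi0 (osz_class n k a) \<otimes>\<^bsub>Bt\<^esub> Phi0 (osz_class n k b)"
proof -
  note F = left_paths_Fr[OF a] left_paths_Fr[OF b]
  have "cs \<alpha> \<gamma> (path_poly (x_of n \<alpha>) (x_of n \<gamma>) (pmul a b)) =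
    (\<Oplus>\<^bsub>Rtilde n eta \<alpha> \<gamma>\<^esub>\<beta>\<in>P. Rtilde_mult n eta \<alpha> \<beta> \<gamma> (Phi0 (osz_class n k a) (\<alpha>, \<beta>))
      (Phi0 (osz_class n k b) (\<beta>, \<gamma>)))"
    if ag: "\<alpha> \<in> P" "\<gamma> \<in> P" for \<alpha> \<gamma>
  proof -
    let ?x = "x_of n \<alpha>" and ?z = "x_of n \<gamma>"
    let ?t = "\<lambda>y. umon (dset n ?x y \<inter> dset n y ?z) * path_poly ?x y a * path_poly y ?z b"
    have tZ: "?t y \<in> carrier (Zu n)" for y
      by (intro Zu_mult umon_Zu path_poly_Zu[OF F(1)] path_poly_Zu[OF F(2)]) (auto simp: dset_def)
    interpret R: ring "Rtilde n eta \<alpha> \<gamma>" by (rule ring_Rtilde[OF ag])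
    have "path_poly ?x ?z (pmul a b) = (\<Sum>y\<in>Vset n k. ?t y)"
      using path_poly_mult[OF F x_of_Vset[OF ag(1)] x_of_Vset[OF ag(2)]] .
    also have "\<dots> = (\<Sum>y\<in>Vl n k. ?t y)"
      by (rule sum.mono_neutral_right[OF finite_Vset Vl_Vset]) (auto simp:
        path_poly_left_paths_0[OF a])
    also have "\<dots> = (\<Sum>\<beta>\<in>P. ?t (x_of n \<beta>))"
      by (rule sum.reindex_bij_betw[OF bij_PP, symmetric])
    finally have "cs \<alpha> \<gamma> (path_poly ?x ?z (pmul a b)) = cs \<alpha> \<gamma> (\<Sum>\<beta>\<in>P. ?t (x_of n \<beta>))" by simp
    also have "\<dots> = (\<Oplus>\<^bsub>Rtilde n eta \<alpha> \<gamma>\<^esub>\<beta>\<in>P. cs \<alpha> \<gamma> (?t (x_of n \<beta>)))"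
      by (rule Rclass_sum[OF ag finite_PP, symmetric]) (rule tZ)
    also have "\<dots> = (\<Oplus>\<^bsub>Rtilde n eta \<alpha> \<gamma>\<^esub>\<beta>\<in>P. Rtilde_mult n eta \<alpha> \<beta> \<gamma> (Phi0 (osz_class n k a) (\<alpha>, \<beta>))
      (Phi0 (osz_class n k b) (\<beta>, \<gamma>)))"
    proof (rule R.finsum_cong'[OF refl])
      have eq: "cs \<alpha> \<gamma> (?t (x_of n \<beta>)) =
        Rtilde_mult n eta \<alpha> \<beta> \<gamma> (Phi0 (osz_class n k a) (\<alpha>, \<beta>)) (Phi0 (osz_class n k b) (\<beta>, \<gamma>))"
        if be: "\<beta> \<in> P" for \<beta>
        using Rtilde_mult_Rclass[OF ag(1) be ag(2) path_poly_Zu[OF F(1)] path_poly_Zu[OF F(2)]] ag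
          be
        by (simp add: Phi0_class[OF F(1)] Phi0_class[OF F(2)] sep_dset)
      then show "\<And>i. i \<in> P \<Longrightarrow> cs \<alpha> \<gamma> (?t (x_of n i)) =
        Rtilde_mult n eta \<alpha> i \<gamma> (Phi0 (osz_class n k a) (\<alpha>, i)) (Phi0 (osz_class n k b) (i, \<gamma>))" .
      show "(\<lambda>\<beta>. Rtilde_mult n eta \<alpha> \<beta> \<gamma> (Phi0 (osz_class n k a) (\<alpha>, \<beta>)) (Phi0 (osz_class n k b)
        (\<beta>, \<gamma>))) \<in> P \<rightarrow> carrier (Rtilde n eta \<alpha> \<gamma>)"
        using Rclass_closed[OF ag tZ] by (auto simp flip: eq)
    qed
    finally show ?thesis .
  qed
  then show ?thesis
    unfolding Phi0_class[OF Fr_pmul[OF F]] Bt_simps(2) by (auto intro!: restrict_ext)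
qed

section \<open>Unit, injectivity and surjectivity of the comparison map\<close>

lemma path_mon_Nil: "path_mon (osz_path x []) = 0"
  by (rule poly_mapping_eqI) (simp add: lookup_path_mon)

lemma x_of_inj: "\<alpha> \<in> P \<Longrightarrow> \<beta> \<in> P \<Longrightarrow> x_of n \<alpha> = x_of n \<beta> \<longleftrightarrow> \<alpha> = \<beta>"
  using bij_PP by (auto simp: bij_betw_def inj_on_def)

text \<open>Common to the unit, with the empty word, and to the element corresponding to
  \<open>u_i\<close>, with the word \<open>U_i\<close>.\<close>

lemma Phi0_diagonal:
  assumes ls: "\<And>x. x \<in> Vl n k \<Longrightarrow> valid_word n k x ls \<and> fold move ls x = x"
    and m: "\<And>x. path_mon (osz_path x ls) = m"
  shows "Phi0 (osz_class n k (\<Sum>x\<in>Vl n k. frag_of (osz_path x ls))) =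
    (\<lambda>(\<alpha>, \<beta>)\<in>P \<times> P. if \<alpha> = \<beta> then cs \<alpha> \<beta> (frag_of m) else cs \<alpha> \<beta> 0)"
proof -
  let ?a = "\<Sum>x\<in>Vl n k. frag_of (osz_path x ls)"
  have F: "?a \<in> carrier (Fr n k)" by (intro Fr_sum frag_of_osz_path) (use ls in blast)
  have "path_poly (x_of n \<alpha>) (x_of n \<beta>) ?a = (if \<alpha> = \<beta> then frag_of m else 0)"
    if ab: "\<alpha> \<in> P" "\<beta> \<in> P" for \<alpha> \<beta>
  proof -
    have "path_poly (x_of n \<alpha>) (x_of n \<beta>) ?a =
      (\<Sum>x\<in>Vl n k. if x = x_of n \<alpha> then (if \<alpha> = \<beta> then frag_of m else 0) else 0)"
      unfolding path_poly_sum
      by (intro sum.cong refl) (use ls m x_of_inj[OF ab] in \<open>auto simp: path_poly_osz_path\<close>)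
    also have "\<dots> = (if \<alpha> = \<beta> then frag_of m else 0)" using x_of_Vl[OF ab(1)] finite_Vl by simp
    finally show ?thesis .
  qed
  then show ?thesis unfolding Phi0_class[OF F] by (auto intro!: restrict_ext)
qed

lemma Phi0_one: "Phi0 (one (osz_l n k)) = one Bt"
proof -
  have "Phi0 (one (osz_l n k)) = (\<lambda>(\<alpha>, \<beta>)\<in>P \<times> P. if \<alpha> = \<beta> then cs \<alpha> \<beta> (frag_of 0) else cs \<alpha> \<beta> 0)"
    unfolding one_osz_l left_one_def
      by (rule Phi0_diagonal) (use valid_word_Nil_Vl path_mon_Nil in auto)
  then show ?thesis unfolding Bt_simps
    by (auto intro!: restrict_ext simp: Rclass_0 Rclass_1 single_one)
qed

lemma Phi0_zero: "Phi0 (zero (osz_l n k)) = zero Bt"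
  unfolding osz_l_simps osz_class_0[symmetric] Phi0_class[OF Fr_0] Bt_simps
  by (auto intro!: restrict_ext simp: Rclass_0)

lemma Phi0_hom: "Phi0 \<in> Ring.ring_hom (osz_l n k) Bt"
proof (rule ring_hom_memI)
  fix A B assume "A \<in> carrier (osz_l n k)" "B \<in> carrier (osz_l n k)"
  then obtain a b where ab: "a \<in> left_paths n k" "A = osz_class n k a" "b \<in> left_paths n k"
    "B = osz_class n k b"
    unfolding carrier_osz_l by blast
  note F = left_paths_Fr[OF ab(1)] left_paths_Fr[OF ab(3)]
  show "Phi0 A \<in> carrier Bt" using Phi0_closed[OF F(1)] ab by simp
  show "Phi0 (A \<otimes>\<^bsub>osz_l n k\<^esub> B) = Phi0 A \<otimes>\<^bsub>Bt\<^esub> Phi0 B"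
    using Phi0_mult[OF ab(1,3)] by (simp add: ab osz_l_simps osz_class_mult[OF F])
  show "Phi0 (A \<oplus>\<^bsub>osz_l n k\<^esub> B) = Phi0 A \<oplus>\<^bsub>Bt\<^esub> Phi0 B"
    using Phi0_add[OF F] by (simp add: ab osz_l_simps osz_class_add[OF F])
qed (rule Phi0_one)

text \<open>Equality of the images makes the polynomials of a - b crowded at pairs of left vertices;
  at all other pairs they are 0.\<close>

lemma Phi0_inj: "inj_on Phi0 (carrier (osz_l n k))"
proof (rule inj_onI)
  fix A B assume "A \<in> carrier (osz_l n k)" "B \<in> carrier (osz_l n k)" and eq: "Phi0 A = Phi0 B"
  then obtain a b where ab: "a \<in> left_paths n k" "A = osz_class n k a" "b \<in> left_paths n k"
    "B = osz_class n k b"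
    unfolding carrier_osz_l by blast
  note F = left_paths_Fr[OF ab(1)] left_paths_Fr[OF ab(3)]
  have "path_poly x y (a - b) \<in> crowded_poly n k x y" for x y
  proof (cases "x \<in> Vl n k \<and> y \<in> Vl n k")
    case True
    then have "x \<in> x_of n ` P" "y \<in> x_of n ` P" using bij_betw_imp_surj_on[OF bij_PP] by simp_all
    then obtain \<alpha> \<beta> where al: "\<alpha> \<in> P" "x = x_of n \<alpha>" "\<beta> \<in> P" "y = x_of n \<beta>" by blast
    have "Phi0 A (\<alpha>, \<beta>) = Phi0 B (\<alpha>, \<beta>)" using eq by simp
    then have "cs \<alpha> \<beta> (path_poly x y a) = cs \<alpha> \<beta> (path_poly x y b)" using al
      by (simp add: ab Phi0_class[OF F(1)] Phi0_class[OF F(2)])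
    then show ?thesis using Rclass_eq_iff[OF al(1,3) path_poly_Zu[OF F(1)] path_poly_Zu[OF F(2)]]
      al by (simp add: path_poly_diff)
  next
    case False
    then show ?thesis using path_poly_left_paths_0[OF left_paths_diff[OF ab(1,3)]]
      by (metis crowded_poly_0)
  qed
  then have "a - b \<in> osz_ideal n k" unfolding osz_ideal_eq using Fr_diff[OF F] by simp
  then show "A = B" using osz_class_eq_iff[OF F] ab by simp
qed

text \<open>A preimage under \<open>Phi0\<close> of the family with the given
  representatives.\<close>

definition lift_family :: "((nat \<Rightarrow> int) \<times> (nat \<Rightarrow> int) \<Rightarrow> mpoly) \<Rightarrow> osz_free" where
  "lift_family p = (\<Sum>z\<in>P \<times> P. lift n k (x_of n (fst z)) (x_of n (snd z)) (p z))"

lemma keys_lift_ends: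
  assumes "x \<in> Vset n k" "y \<in> Vset n k" "p \<in> carrier (Zu n)"
    "q \<in> Poly_Mapping.keys (lift n k x y p)"
  shows "fst q = x" "snd (snd q) = y"
proof -
  obtain m where "m \<in> Poly_Mapping.keys p" "\<not> crowded_mon n k x y m"
    "q = osz_path x (normal_word n k x y m)" "Poly_Mapping.keys m \<subseteq> {1..n}"
    by (rule keys_lift[OF assms])
  then show "fst q = x" "snd (snd q) = y" using normal_word(2)[OF assms(1,2)] by simp_all
qed

lemma lift_left_paths:
  assumes "\<alpha> \<in> P" "\<beta> \<in> P" "p \<in> carrier (Zu n)"
  shows "lift n k (x_of n \<alpha>) (x_of n \<beta>) p \<in> left_paths n k"
  using keys_lift_ends[OF x_of_Vset[OF assms(1)] x_of_Vset[OF assms(2)] assms(3)]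
    lift_closed[OF x_of_Vset[OF assms(1)] x_of_Vset[OF assms(2)] assms(3)] x_of_Vl assms
  by (auto simp: left_paths_def)

lemma lift_family_left_paths:
  assumes "p \<in> P \<times> P \<rightarrow> carrier (Zu n)"
  shows "lift_family p \<in> left_paths n k"
  unfolding lift_family_def
proof (rule left_paths_sum)
  fix z assume "z \<in> P \<times> P"
  then have "fst z \<in> P" "snd z \<in> P" "p z \<in> carrier (Zu n)" using assms by auto
  then show "lift n k (x_of n (fst z)) (x_of n (snd z)) (p z) \<in> left_paths n k"
    by (rule lift_left_paths)
qed

lemma Phi0_lift_family:
  assumes p: "p \<in> P \<times> P \<rightarrow> carrier (Zu n)"
  shows "Phi0 (osz_class n k (lift_family p)) = (\<lambda>(\<alpha>, \<beta>)\<in>P \<times> P. cs \<alpha> \<beta> (p (\<alpha>, \<beta>)))"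
proof -
  have F: "lift_family p \<in> carrier (Fr n k)" using left_paths_Fr[OF lift_family_left_paths[OF p]]
    by simp
  have pc: "p (\<alpha>, \<beta>) \<in> carrier (Zu n)" if "\<alpha> \<in> P" "\<beta> \<in> P" for \<alpha> \<beta> using p that by auto
  have "cs \<alpha> \<beta> (path_poly (x_of n \<alpha>) (x_of n \<beta>) (lift_family p)) = cs \<alpha> \<beta> (p (\<alpha>, \<beta>))"
    if ab: "\<alpha> \<in> P" "\<beta> \<in> P" for \<alpha> \<beta>
  proof -
    let ?x = "x_of n \<alpha>" and ?y = "x_of n \<beta>"
    have "path_poly ?x ?y (lift_family p) =
      (\<Sum>z\<in>P \<times> P. path_poly ?x ?y (lift n k (x_of n (fst z)) (x_of n (snd z)) (p z)))"
      unfolding lift_family_def path_poly_sum ..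
    also have "\<dots> = (\<Sum>z\<in>P \<times> P. if z =
      (\<alpha>, \<beta>) then path_poly ?x ?y (lift n k ?x ?y (p (\<alpha>, \<beta>))) else 0)"
    proof (rule sum.cong[OF refl])
      fix z assume z: "z \<in> P \<times> P"
      obtain \<alpha>' \<beta>' where z': "z = (\<alpha>', \<beta>')" "\<alpha>' \<in> P" "\<beta>' \<in> P" using z by auto
      show "path_poly ?x ?y (lift n k (x_of n (fst z)) (x_of n (snd z)) (p z)) =
        (if z = (\<alpha>, \<beta>) then path_poly ?x ?y (lift n k ?x ?y (p (\<alpha>, \<beta>))) else 0)"
      proof (cases "z = (\<alpha>, \<beta>)")
        case False
        then have "(?x, ?y) \<noteq> (x_of n \<alpha>', x_of n \<beta>')" using x_of_inj ab z' by auto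
        from path_poly_lift(2)[OF x_of_Vset[OF z'(2)] x_of_Vset[OF z'(3)] pc[OF z'(2,3)] this]
        have "path_poly ?x ?y (lift n k (x_of n (fst z)) (x_of n (snd z)) (p z)) = 0"
          by (simp add: z')
        then show ?thesis using False by simp
      qed simp
    qed
    also have "\<dots> = path_poly ?x ?y (lift n k ?x ?y (p (\<alpha>, \<beta>)))" using ab finite_PP by simp
    finally have "path_poly ?x ?y (lift_family p) - p (\<alpha>, \<beta>) \<in> crowded_poly n k ?x ?y"
      using path_poly_lift(1)[OF x_of_Vset[OF ab(1)] x_of_Vset[OF ab(2)] pc[OF ab]] by simp
    then show ?thesis using Rclass_eq_iff[OF ab path_poly_Zu[OF F] pc[OF ab]] by simp
  qed
  then show ?thesis unfolding Phi0_class[OF F] by (auto intro!: restrict_ext)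
qed

lemma Bt_family:
  assumes "b \<in> carrier Bt" "\<And>\<alpha> \<beta>. \<alpha> \<in> P \<Longrightarrow> \<beta> \<in> P \<Longrightarrow> b (\<alpha>, \<beta>) = cs \<alpha> \<beta> (p (\<alpha>, \<beta>))"
  shows "b = (\<lambda>(\<alpha>, \<beta>)\<in>P \<times> P. cs \<alpha> \<beta> (p (\<alpha>, \<beta>)))"
proof (rule extensionalityI[of _ "P \<times> P"])
  show "b \<in> extensional (P \<times> P)" using assms(1) by (simp add: Bt_simps PiE_iff)
qed (use assms(2) in auto)

lemma Phi0_image: "Phi0 ` carrier (osz_l n k) = carrier Bt"
proof
  show "Phi0 ` carrier (osz_l n k) \<subseteq> carrier Bt" using ring_hom_closed[OF Phi0_hom] by blast
  show "carrier Bt \<subseteq> Phi0 ` carrier (osz_l n k)"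
  proof
    fix b assume b: "b \<in> carrier Bt"
    have "\<exists>q. q \<in> carrier (Zu n) \<and> b z = cs (fst z) (snd z) q" if z: "z \<in> P \<times> P" for z
    proof -
      have "b z \<in> carrier (Rtilde n eta (fst z) (snd z))" using b z
        by (auto simp: Bt_simps PiE_iff)
      moreover have "fst z \<in> P" "snd z \<in> P" using z by auto
      ultimately obtain q where "q \<in> carrier (Zu n)" "b z = cs (fst z) (snd z) q"
        using Rclass_surj by blast
      then show ?thesis by blast
    qed
    then obtain p where p: "\<And>z. z \<in> P \<times> P \<Longrightarrow> p z \<in> carrier (Zu n) \<and> b z = cs (fst z) (snd z) (p z)"
      by metis
    have pc: "p \<in> P \<times> P \<rightarrow> carrier (Zu n)" using p by blast
    have pb: "b (\<alpha>, \<beta>) = cs \<alpha> \<beta> (p (\<alpha>, \<beta>))" if "\<alpha> \<in> P" "\<beta> \<in> P" for \<alpha> \<beta>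
      using p[of "(\<alpha>, \<beta>)"] that by auto
    have "b = Phi0 (osz_class n k (lift_family p))"
      unfolding Phi0_lift_family[OF pc] by (rule Bt_family[OF b pb])
    moreover have "osz_class n k (lift_family p) \<in> carrier (osz_l n k)"
      unfolding carrier_osz_l using lift_family_left_paths[OF pc] by blast
    ultimately show "b \<in> Phi0 ` carrier (osz_l n k)" by blast
  qed
qed

lemma Phi0_iso: "Phi0 \<in> ring_iso (osz_l n k) Bt"
  unfolding ring_iso_def bij_betw_def using Phi0_hom Phi0_inj Phi0_image by blast

text \<open>The ring axioms of the convolution algebra are carried over from \<open>osz_l\<close> by
  the bijection, which respects both operations. The transported zero is the image of 0, here the
  zero of the algebra itself.\<close>

lemma ring_Bt: "ring Bt"
proof -
  have "ring (Bt\<lparr>zero := Phi0 (zero (osz_l n k))\<rparr>)"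
    by (rule ring.ring_iso_imp_img_ring[OF ring_osz_l Phi0_iso])
  then show ?thesis by (simp add: Phi0_zero)
qed

section \<open>Values on generators and uniqueness\<close>

lemma Phi0_word:
  assumes "\<alpha> \<in> P" "\<beta> \<in> P" "valid_word n k (x_of n \<alpha>) ls" "fold move ls (x_of n \<alpha>) = x_of n \<beta>"
  shows "Phi0 (osz_word n k (x_of n \<alpha>) ls) =
    Bterm n V eta xi (frag_of (path_mon (osz_path (x_of n \<alpha>) ls))) \<alpha> \<beta>"
  unfolding Phi0_class[OF frag_of_osz_path[OF assms(3)]] Bterm_def
  by (auto intro!: restrict_ext simp: path_poly_osz_path assms Rclass_0 x_of_inj
    Rclass_def[symmetric])

lemma path_mon_label: "path_mon (osz_path x [Rarr i]) = 0" "path_mon (osz_path x [Larr i]) = 0"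
  "path_mon (osz_path x [Uarr i]) = Poly_Mapping.single i 1"
  by (rule poly_mapping_eqI; simp add: lookup_path_mon lookup_single when_def)+

lemma Vl_PE:
  assumes "x \<in> Vl n k"
  obtains \<alpha> where "\<alpha> \<in> P" "x = x_of n \<alpha>" "alpha_of n V eta xi x = \<alpha>"
proof -
  have "x \<in> x_of n ` P" using bij_betw_imp_surj_on[OF bij_PP] assms by simp
  then obtain \<alpha> where a: "\<alpha> \<in> P" "x = x_of n \<alpha>" by blast
  then have "alpha_of n V eta xi x = \<alpha>"
    unfolding alpha_of_def using the_inv_into_f_f[OF bij_betw_imp_inj_on[OF bij_PP]] by simp
  with a that show thesis by blast
qed

lemma Phi0_idem: "\<alpha> \<in> P \<Longrightarrow> Phi0 (osz_idem n k (x_of n \<alpha>)) = fgen n V eta xi \<alpha> \<alpha>"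
  using Phi0_word[of \<alpha> \<alpha> "[]"] valid_word_Nil_Vl[OF x_of_Vl]
    by (simp add: path_mon_Nil single_one)

lemma Phi0_arrow:
  assumes "\<alpha> \<in> P" "\<beta> \<in> P" "l = Rarr i \<or> l = Larr i" "(x_of n \<alpha>, l) \<in> arcs (osz_quiver n k)"
    "move l (x_of n \<alpha>) = x_of n \<beta>"
  shows "Phi0 (osz_word n k (x_of n \<alpha>) [l]) = fgen n V eta xi \<alpha> \<beta>"
proof -
  have "path_mon (osz_path (x_of n \<alpha>) [l]) = 0" using assms(3) path_mon_label by auto
  then show ?thesis
    using Phi0_word[OF assms(1,2), of "[l]"] assms(4,5) x_of_Vset[OF assms(2)]
    by (simp add: valid_word.simps(2) single_one)
qed

lemma Phi0_U:
  assumes "\<alpha> \<in> P" "i \<in> {1..n}"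
  shows "Phi0 (osz_word n k (x_of n \<alpha>) [Uarr i]) = Bterm n V eta xi (uvar i) \<alpha> \<alpha>"
  using Phi0_word[OF assms(1,1), of "[Uarr i]"] assms(2) x_of_Vset[OF assms(1)]
  by (simp add: valid_word_U path_mon_label(3) uvar_def)

lemma is_Phi_Phi0: "is_Phi n k V eta xi Phi0"
  unfolding is_Phi_def Let_def
proof (intro conjI ballI allI impI)
  show "ring_hom_ring (osz_l n k) Bt Phi0"
    by (rule ring_hom_ringI2[OF ring_osz_l ring_Bt Phi0_hom])
next
  fix x assume "x \<in> Vl n k"
  then show "Phi0 (osz_idem n k x) =
    fgen n V eta xi (alpha_of n V eta xi x) (alpha_of n V eta xi x)"
    by (rule Vl_PE) (simp add: Phi0_idem)
next
  fix x y i l assume x: "x \<in> Vl n k" and y: "y \<in> Vl n k" and l: "l \<in> {Rarr i, Larr i}"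
    "(x, l) \<in> arcs (osz_quiver n k) \<and> head (osz_quiver n k) (x, l) = y"
  obtain \<alpha> where a: "\<alpha> \<in> P" "x = x_of n \<alpha>" "alpha_of n V eta xi x = \<alpha>" using Vl_PE[OF x] .
  obtain \<beta> where b: "\<beta> \<in> P" "y = x_of n \<beta>" "alpha_of n V eta xi y = \<beta>" using Vl_PE[OF y] .
  show "Phi0 (osz_word n k x [l]) =
    fgen n V eta xi (alpha_of n V eta xi x) (alpha_of n V eta xi y)"
    using Phi0_arrow[OF a(1) b(1), of l i] l a b by simp
next
  fix x i assume x: "x \<in> Vl n k" and i: "i \<in> {1..n}"
  then show "Phi0 (osz_word n k x [Uarr i]) =
    Bterm n V eta xi (uvar i) (alpha_of n V eta xi x) (alpha_of n V eta xi x)"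
    by (elim Vl_PE) (simp add: Phi0_U i)
qed

definition Psi0 :: "btilde \<Rightarrow> osz_free set" where
  "Psi0 = inv_into (carrier (osz_l n k)) Phi0"

lemma Psi0_Phi0: "A \<in> carrier (osz_l n k) \<Longrightarrow> Psi0 (Phi0 A) = A"
  unfolding Psi0_def by (rule inv_into_f_f[OF Phi0_inj])

lemma U_sum:
  assumes "i \<in> {1..n}"
  defines "a \<equiv> \<Sum>x\<in>Vl n k. frag_of (osz_path x [Uarr i])"
  shows "a \<in> left_paths n k" "osz_class n k a = (\<Oplus>\<^bsub>osz n k\<^esub>x\<in>Vl n k. osz_word n k x [Uarr i])"
    "Phi0 (osz_class n k a) = Bscalar n V eta xi (uvar i)"
proof -
  have ok: "valid_word n k x [Uarr i]" if "x \<in> Vl n k" for x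
    using subsetD[OF Vl_Vset that] assms(1) by (simp add: valid_word_U)
  show "a \<in> left_paths n k" unfolding a_def
    by (intro left_paths_sum osz_word_left_paths ok) simp_all
  show "osz_class n k a = (\<Oplus>\<^bsub>osz n k\<^esub>x\<in>Vl n k. osz_word n k x [Uarr i])"
    unfolding a_def by (rule finsum_osz_class[OF finite_Vl, symmetric]) (rule
      frag_of_osz_path[OF ok])
  have "Phi0 (osz_class n k a) =
    (\<lambda>(\<alpha>, \<beta>)\<in>P \<times> P. if \<alpha> = \<beta> then cs \<alpha> \<beta> (frag_of (Poly_Mapping.single i 1)) else cs \<alpha> \<beta> 0)"
    unfolding a_def by (rule Phi0_diagonal) (simp_all add: ok path_mon_label)
  then show "Phi0 (osz_class n k a) = Bscalar n V eta xi (uvar i)"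
    by (auto simp: Bscalar_def uvar_def Rclass_0 Rclass_def[symmetric] intro!: restrict_ext)
qed

text \<open>The set equation alone does not exclude that i was already a change of \<alpha>. Since
  the flip reverses membership of both i - 1 and i, the arrow really exists.\<close>

lemma arc_of_flip:
  assumes "\<alpha> \<in> P" "\<beta> \<in> P" "i \<in> {1..n}" "\<beta> = \<alpha>(i := - \<alpha> i)"
  shows "x_of n \<beta> = (x_of n \<alpha> - {i - 1}) \<union> {i} \<Longrightarrow> (x_of n \<alpha>, Rarr i) \<in> arcs (osz_quiver n k)"
    and "x_of n \<beta> = (x_of n \<alpha> - {i}) \<union> {i - 1} \<Longrightarrow> (x_of n \<alpha>, Larr i) \<in> arcs (osz_quiver n k)"
proof -
  have "\<alpha> i \<noteq> - \<alpha> i" using sign_cases[OF PP_D(1)[OF assms(1)], of i] by auto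
  then have "{j. \<alpha> j \<noteq> \<beta> j} = {i}" unfolding assms(4) by auto
  then have "dset n (x_of n \<alpha>) (x_of n \<beta>) = {i}"
    using dset_x_of[OF PP_D(1)[OF assms(1)] PP_D(1)[OF assms(2)]] by simp
  then have "toggle {i} (x_of n \<alpha>) = x_of n \<beta>"
    using toggle_dset[OF x_of_Vset[OF assms(1)] x_of_Vset[OF assms(2)]] by simp
  then have toggle: "j \<in> x_of n \<beta> \<longleftrightarrow> (j \<in> x_of n \<alpha>) \<noteq> ((j = i) \<noteq> (Suc j = i))" for j
    by (auto simp: toggle_def)
  have ne: "i - 1 \<noteq> i" "Suc (i - 1) = i" using assms(3) by auto
  have *: "i \<in> x_of n \<beta> \<longleftrightarrow> i \<notin> x_of n \<alpha>" "i - 1 \<in> x_of n \<beta> \<longleftrightarrow> i - 1 \<notin> x_of n \<alpha>"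
    using toggle[of i] toggle[of "i - 1"] ne by simp_all
  show "(x_of n \<alpha>, Rarr i) \<in> arcs (osz_quiver n k)" if "x_of n \<beta> = (x_of n \<alpha> - {i - 1}) \<union> {i}"
    unfolding arc_Rarr using * ne assms(3) x_of_Vset[OF assms(1)] by (auto simp: that)
  show "(x_of n \<alpha>, Larr i) \<in> arcs (osz_quiver n k)" if "x_of n \<beta> = (x_of n \<alpha> - {i}) \<union> {i - 1}"
    unfolding arc_Larr using * ne assms(3) x_of_Vset[OF assms(1)] by (auto simp: that)
qed

lemma flip_of_arc:
  assumes "\<alpha> \<in> P" "\<beta> \<in> P" "l = Rarr i \<or> l = Larr i" "(x_of n \<alpha>, l) \<in> arcs (osz_quiver n k)"
    "move l (x_of n \<alpha>) = x_of n \<beta>"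
  shows "\<beta> = \<alpha>(i := - \<alpha> i)"
proof -
  have m: "movable (x_of n \<alpha>) i" "i \<in> {1..n}" "l = step (x_of n \<alpha>) i"
    using assms(3,4) by (auto simp: arc_Rarr arc_Larr movable_def step_def)
  have "{j. \<alpha> j \<noteq> \<beta> j} = dset n (x_of n \<alpha>) (toggle {i} (x_of n \<alpha>))"
    using dset_x_of[OF PP_D(1)[OF assms(1)] PP_D(1)[OF assms(2)]] assms(5) move_step[OF m(1)] m(3)
      by simp
  also have "\<dots> = {i}" using dset_toggle[of "{i}" n "x_of n \<alpha>" "x_of n \<alpha>"] m(2)
    by (simp add: dset_commute)
  finally have "\<alpha> j \<noteq> \<beta> j \<longleftrightarrow> j = i" for j by blast
  moreover have "\<beta> i = - \<alpha> i" if "\<alpha> i \<noteq> \<beta> i"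
    using that sign_cases[OF PP_D(1)[OF assms(1)], of i] sign_cases[OF PP_D(1)[OF assms(2)], of i]
      by auto
  ultimately show ?thesis by (metis fun_upd_apply ext)
qed

lemma is_Psi_Psi0: "is_Psi n k V eta xi Psi0"
  unfolding is_Psi_def Let_def
proof (intro conjI ballI impI)
  have "Psi0 \<in> ring_iso Bt (osz_l n k)" unfolding Psi0_def
    by (rule ring_iso_set_sym[OF ring_osz_l Phi0_iso])
  then show "ring_hom_ring Bt (osz_l n k) Psi0"
    by (intro ring_hom_ringI2[OF ring_Bt ring_osz_l]) (simp add: ring_iso_def)
next
  fix \<alpha> assume "\<alpha> \<in> P"
  then show "Psi0 (fgen n V eta xi \<alpha> \<alpha>) = osz_idem n k (x_of n \<alpha>)"
    using Psi0_Phi0[OF osz_word_osz_l[OF valid_word_Nil_Vl[OF x_of_Vl]]] x_of_Vl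
      by (simp add: Phi0_idem[symmetric])
next
  fix \<alpha> \<beta> i assume a: "\<alpha> \<in> P" "\<beta> \<in> P" "i \<in> {1..n}" "\<beta> = \<alpha>(i := - \<alpha> i)"
  have arrow: "Psi0 (fgen n V eta xi \<alpha> \<beta>) = osz_word n k (x_of n \<alpha>) [l]"
    if "l = Rarr i \<or> l = Larr i" "(x_of n \<alpha>, l) \<in> arcs (osz_quiver n k)"
      "move l (x_of n \<alpha>) = x_of n \<beta>" for l
    using Psi0_Phi0[OF osz_word_osz_l, of "x_of n \<alpha>" "[l]"] Phi0_arrow[OF a(1,2) that] that
      x_of_Vl[OF a(1)] x_of_Vl[OF a(2)] x_of_Vset[OF a(2)] by (simp add: valid_word.simps(2))
  show "Psi0 (fgen n V eta xi \<alpha> \<beta>) = osz_word n k (x_of n \<alpha>) [Rarr i]"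
    if "x_of n \<beta> = (x_of n \<alpha> - {i - 1}) \<union> {i}"
    using arrow[of "Rarr i"] arc_of_flip(1)[OF a that] that by simp
  show "Psi0 (fgen n V eta xi \<alpha> \<beta>) = osz_word n k (x_of n \<alpha>) [Larr i]"
    if "x_of n \<beta> = (x_of n \<alpha> - {i}) \<union> {i - 1}"
    using arrow[of "Larr i"] arc_of_flip(2)[OF a that] that by simp
next
  fix i assume "i \<in> {1..n}"
  from U_sum[OF this] Psi0_Phi0 show
    "Psi0 (Bscalar n V eta xi (uvar i)) = (\<Oplus>\<^bsub>osz n k\<^esub>x\<in>Vl n k. osz_word n k x [Uarr i])"
    unfolding carrier_osz_l by (metis imageI)
qed

lemma is_Phi_unique:
  assumes "is_Phi n k V eta xi \<Phi>" "A \<in> carrier (osz_l n k)"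
  shows "\<Phi> A = Phi0 A"
proof (rule osz_l_hom_unique[OF ring_Bt _ Phi0_hom _ _ assms(2)])
  note P = assms(1) is_Phi_Phi0
  show "\<Phi> \<in> Ring.ring_hom (osz_l n k) Bt" using P(1)
    by (simp add: is_Phi_def Let_def ring_hom_ring.homh)
  show "\<Phi> (osz_idem n k x) = Phi0 (osz_idem n k x)" if "x \<in> Vl n k" for x
    using P that by (simp add: is_Phi_def Let_def)
  show "\<Phi> (osz_word n k x [l]) = Phi0 (osz_word n k x [l])"
    if "x \<in> Vl n k" "move l x \<in> Vl n k" "(x, l) \<in> arcs (osz_quiver n k)" for x l
  proof (cases l)
    case (Uarr i)
    then have "i \<in> {1..n}" using that(3) by (simp add: arc_Uarr)
    then show ?thesis using P that(1) Uarr by (simp add: is_Phi_def Let_def)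
  qed (use P that in \<open>simp_all add: is_Phi_def Let_def\<close>)
qed

text \<open>The composite is an endomorphism that fixes the generators of \<open>osz_l\<close>. As
  \<open>is_Psi\<close> prescribes only the sum of all letters \<open>U_i\<close>, the single letter
  at x is recovered by multiplying this sum with the trivial path at x.\<close>

lemma is_Psi_Phi0:
  assumes Psi: "is_Psi n k V eta xi \<Psi>" and A: "A \<in> carrier (osz_l n k)"
  shows "\<Psi> (Phi0 A) = A"
proof -
  note P = Psi[unfolded is_Psi_def Let_def]
  have hom: "\<Psi> \<in> Ring.ring_hom Bt (osz_l n k)" using P by (simp add: ring_hom_ring.homh)
  have comp: "\<Psi> \<circ> Phi0 \<in> Ring.ring_hom (osz_l n k) (osz_l n k)"
    by (rule ring_hom_trans[OF Phi0_hom hom])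
  have idem: "(\<Psi> \<circ> Phi0) (osz_idem n k x) = id (osz_idem n k x)" if x: "x \<in> Vl n k" for x
  proof -
    obtain \<alpha> where "\<alpha> \<in> P" "x = x_of n \<alpha>" using Vl_PE[OF x] by metis
    then show ?thesis using P by (simp add: Phi0_idem)
  qed
  have "(\<Psi> \<circ> Phi0) A = id A"
  proof (rule osz_l_hom_unique[OF ring_osz_l comp _ idem _ A])
    show "id \<in> Ring.ring_hom (osz_l n k) (osz_l n k)" by (auto intro!: ring_hom_memI)
    fix x l assume x: "x \<in> Vl n k" and y: "move l x \<in> Vl n k"
      and arc: "(x, l) \<in> arcs (osz_quiver n k)"
    obtain \<alpha> where a: "\<alpha> \<in> P" "x = x_of n \<alpha>" using Vl_PE[OF x] by metis
    obtain \<beta> where b: "\<beta> \<in> P" "move l x = x_of n \<beta>" using Vl_PE[OF y] by metis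
    have arrow: "(\<Psi> \<circ> Phi0) (osz_word n k x [l]) = id (osz_word n k x [l])"
      if l: "l = Rarr i \<or> l = Larr i" for i
    proof -
      have i: "i \<in> {1..n}" using l arc by (auto simp: arc_Rarr arc_Larr)
      have be: "\<beta> = \<alpha>(i := - \<alpha> i)" using flip_of_arc[OF a(1) b(1) l] arc a b by simp
      have "Phi0 (osz_word n k x [l]) = fgen n V eta xi \<alpha> \<beta>"
        using Phi0_arrow[OF a(1) b(1) l] arc a b by simp
      moreover have "\<Psi> (fgen n V eta xi \<alpha> \<beta>) = osz_word n k x [l]"
        using P a b i be l by auto
      ultimately show ?thesis by simp
    qed
    show "(\<Psi> \<circ> Phi0) (osz_word n k x [l]) = id (osz_word n k x [l])"
    proof (cases l)
      case (Uarr i)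
      then have i: "i \<in> {1..n}" using arc by (simp add: arc_Uarr)
      note U = U_sum[OF i]
      let ?a = "\<Sum>x\<in>Vl n k. frag_of (osz_path x [Uarr i])"
      have mem: "osz_class n k ?a \<in> carrier (osz_l n k)" "osz_idem n k x \<in> carrier (osz_l n k)"
        unfolding carrier_osz_l using U(1) osz_word_left_paths[OF valid_word_Nil_Vl[OF x]] x
          by auto
      have "pmul ?a (frag_of (osz_path x [])) =
        (\<Sum>y\<in>Vl n k. if y = x then frag_of (osz_path x [Uarr i]) else 0)"
        unfolding pmul_sum by (rule sum.cong) (auto simp: path_mult_osz)
      also have "\<dots> = frag_of (osz_path x [Uarr i])" using finite_Vl x by simp
      finally have prod: "osz_word n k x [Uarr i] = osz_class n k ?a \<otimes>\<^bsub>osz_l n k\<^esub> osz_idem n k x"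
        using osz_class_mult[OF left_paths_Fr[OF U(1)]
          frag_of_osz_path[OF valid_word_Nil_Vl[OF x]]] by (simp add: osz_l_simps)
      have "\<Psi> (Phi0 (osz_class n k ?a)) = osz_class n k ?a" using P i U by simp
      then show ?thesis
        unfolding Uarr using prod ring_hom_mult[OF comp mem] idem[OF x] by simp
    qed (use arrow in auto)
  qed
  then show ?thesis by simp
qed

section \<open>Multi-degrees and involutions\<close>

lemma lookup_monomial_deg:
  "Poly_Mapping.lookup (monomial_deg m) i = 2 * int (Poly_Mapping.lookup m i)"
  by (simp add: monomial_deg_def lookup_sum lookup_single when_def in_keys_iff)

lemma lookup_fgen_deg: "Poly_Mapping.lookup (fgen_deg n \<alpha> \<beta>) i = of_bool (i \<in> {1..n} \<and> \<alpha> i \<noteq> \<beta> i)"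
  by (simp add: fgen_deg_def lookup_sum lookup_single when_def)

text \<open>A weight is twice its rounded half plus its parity, and the parity tells whether
  \<alpha> and \<beta> differ in this position.\<close>

lemma path_deg_split:
  assumes "\<alpha> \<in> P" "\<beta> \<in> P" "valid_word n k (x_of n \<alpha>) ls" "fold move ls (x_of n \<alpha>) = x_of n \<beta>"
  shows "monomial_deg (path_mon (osz_path (x_of n \<alpha>) ls)) + fgen_deg n \<alpha> \<beta> =
    path_deg (osz_path (x_of n \<alpha>) ls)"
proof (rule poly_mapping_eqI)
  fix i
  have "i \<in> {1..n} \<and> \<alpha> i \<noteq> \<beta> i \<longleftrightarrow> odd (wt ls i)"
    using odd_wt[OF assms(3), of i] dset_x_of[OF PP_D(1)[OF assms(1)] PP_D(1)[OF assms(2)]]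
      dset_subset[of n "x_of n \<alpha>" "x_of n \<beta>"] assms(4)
    by auto
  moreover have "2 * int (c div 2) + of_bool (odd c) = int c" for c :: nat
    by (cases "even c") (auto elim!: evenE oddE)
  ultimately show "Poly_Mapping.lookup (monomial_deg (path_mon (osz_path (x_of n \<alpha>) ls)) +
    fgen_deg n \<alpha> \<beta>) i =
      Poly_Mapping.lookup (path_deg (osz_path (x_of n \<alpha>) ls)) i"
    by (simp add: lookup_add lookup_monomial_deg lookup_fgen_deg lookup_path_mon
      path_deg_osz_path)
qed

lemma keys_path_poly:
  assumes "m \<in> Poly_Mapping.keys (path_poly x y a)"
  obtains p where "p \<in> Poly_Mapping.keys a" "fst p = x" "snd (snd p) = y" "m = path_mon p"
proof -
  obtain p where "p \<in> Poly_Mapping.keys a"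
    "m \<in> Poly_Mapping.keys (if fst p = x \<and> snd (snd p) = y then frag_of (path_mon p) else 0)"
    using subsetD[OF keys_frag_extend assms[unfolded path_poly_def]] by blast
  then show thesis using that[of p] by (simp split: if_splits)
qed

text \<open>Homogeneous combinations of paths have homogeneous polynomials. Conversely, homogeneous
  representatives lift to homogeneous elements, because a normal word has the degree of its monomial
  plus that of \<open>f_{\<alpha>,\<beta>}\<close>.\<close>

lemma Phi0_component: "Phi0 ` osz_l_component n k d = Btilde_component n V eta xi d"
proof
  show "Phi0 ` osz_l_component n k d \<subseteq> Btilde_component n V eta xi d"
  proof
    fix b assume "b \<in> Phi0 ` osz_l_component n k d"
    then obtain a where a: "a \<in> carrier (Fr n k)" "\<And>p. p \<in> Poly_Mapping.keys a \<Longrightarrow> path_deg p = d"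
      "b = Phi0 (osz_class n k a)"
      unfolding osz_l_component_def osz_component_def by blast
    have "monomial_deg m + fgen_deg n \<alpha> \<beta> = d"
      if ab: "\<alpha> \<in> P" "\<beta> \<in> P" and m: "m \<in> Poly_Mapping.keys (path_poly (x_of n \<alpha>) (x_of n \<beta>) a)"
        for \<alpha> \<beta> m
    proof -
      obtain p where p: "p \<in> Poly_Mapping.keys a" "fst p = x_of n \<alpha>" "snd (snd p) = x_of n \<beta>"
        "m = path_mon p"
        by (rule keys_path_poly[OF m])
      then have "p \<in> paths (osz_quiver n k)" using a(1) by (auto simp: Fr_simps)
      then obtain x ls where ls: "p = osz_path x ls" "valid_word n k x ls" by (rule paths_oszE)
      then show ?thesis using path_deg_split[OF ab, of ls] a(2)[OF p(1)] p by simp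
    qed
    then show "b \<in> Btilde_component n V eta xi d"
      using Phi0_closed[OF a(1)] path_poly_Zu[OF a(1)]
      unfolding Btilde_component_def a(3)
        by (auto simp: Phi0_class[OF a(1)] Rclass_def intro!: bexI)
  qed
  show "Btilde_component n V eta xi d \<subseteq> Phi0 ` osz_l_component n k d"
  proof
    fix b assume b: "b \<in> Btilde_component n V eta xi d"
    have "\<exists>q. q \<in> carrier (Zu n) \<and> b z = cs (fst z) (snd z) q \<and>
      (\<forall>m\<in>Poly_Mapping.keys q. monomial_deg m + fgen_deg n (fst z) (snd z) = d)" if z: "z \<in> P \<times>
        P" for z
    proof -
      have "fst z \<in> P" "snd z \<in> P" using z by auto
      then have "\<exists>q\<in>carrier (Zu n). b (fst z, snd z) = cs (fst z) (snd z) q \<and>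
        (\<forall>m\<in>Poly_Mapping.keys q. monomial_deg m + fgen_deg n (fst z) (snd z) = d)"
        using b unfolding Btilde_component_def Rclass_def by blast
      then show ?thesis by auto
    qed
    then obtain p where p: "\<And>z. z \<in> P \<times> P \<Longrightarrow> p z \<in> carrier (Zu n) \<and> b z =
      cs (fst z) (snd z) (p z) \<and>
      (\<forall>m\<in>Poly_Mapping.keys (p z). monomial_deg m + fgen_deg n (fst z) (snd z) = d)" by metis
    have pc: "p \<in> P \<times> P \<rightarrow> carrier (Zu n)" using p by blast
    have bc: "b \<in> carrier Bt" using b by (simp add: Btilde_component_def)
    have "b (\<alpha>, \<beta>) = cs \<alpha> \<beta> (p (\<alpha>, \<beta>))" if "\<alpha> \<in> P" "\<beta> \<in> P" for \<alpha> \<beta>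
      using p[of "(\<alpha>, \<beta>)"] that by auto
    from Bt_family[OF bc this] have "b = Phi0 (osz_class n k (lift_family p))"
      unfolding Phi0_lift_family[OF pc] .
    moreover have "path_deg q = d" if q: "q \<in> Poly_Mapping.keys (lift_family p)" for q
    proof -
      obtain z where z: "z \<in> P \<times> P"
        "q \<in> Poly_Mapping.keys (lift n k (x_of n (fst z)) (x_of n (snd z)) (p z))"
        using subsetD[OF keys_sum q[unfolded lift_family_def]] by (rule UN_E)
      obtain \<alpha> \<beta> where ab: "z = (\<alpha>, \<beta>)" "\<alpha> \<in> P" "\<beta> \<in> P" using z(1) by auto
      note xy = x_of_Vset[OF ab(2)] x_of_Vset[OF ab(3)]
      have pz: "p z \<in> carrier (Zu n)" using p[OF z(1)] by blast
      obtain m where m: "m \<in> Poly_Mapping.keys (p z)" "\<not> crowded_mon n k (x_of n \<alpha>) (x_of n \<beta>) m"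
        "q = osz_path (x_of n \<alpha>) (normal_word n k (x_of n \<alpha>) (x_of n \<beta>) m)"
          "Poly_Mapping.keys m \<subseteq> {1..n}"
        using keys_lift[OF xy pz, of q] z(2) unfolding ab(1) by auto
      note nf = normal_word[OF xy m(2,4)]
      show ?thesis using path_deg_split[OF ab(2,3) nf(1,2)] nf(3) p[OF z(1)] m(1,3)
        by (simp add: ab(1))
    qed
    ultimately show "b \<in> Phi0 ` osz_l_component n k d"
      unfolding osz_l_component_def osz_component_def carrier_osz_l
      using lift_family_left_paths[OF pc] left_paths_Fr[OF lift_family_left_paths[OF pc]] by blast
  qed
qed

lemma psi_OSz_closed: "A \<in> carrier (osz_l n k) \<Longrightarrow> psi_OSz A \<in> carrier (osz_l n k)"
  unfolding carrier_osz_l using psi_OSz_class[OF left_paths_Fr] path_rev_left_paths by fastforce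

text \<open>Reversal exchanges the ends in \<open>path_poly\<close>, and the ideals for \<alpha>,
  \<beta> and for \<beta>, \<alpha> coincide because the two regions are intersected.\<close>

lemma Phi0_psi:
  assumes "A \<in> carrier (osz_l n k)"
  shows "Phi0 (psi_OSz A) = psi_V n V eta xi (Phi0 A)"
proof -
  obtain a where a: "a \<in> left_paths n k" "A = osz_class n k a" using assms unfolding carrier_osz_l
    by blast
  note F = left_paths_Fr[OF a(1)]
  have "cs \<alpha> \<beta> = cs \<beta> \<alpha>" for \<alpha> \<beta>
    unfolding Rclass_def Rideal_def by (simp add: Int_commute)
  then show ?thesis
    unfolding a(2) psi_OSz_class[OF F] Phi0_class[OF F] Phi0_class[OF path_rev_Fr(1)[OF F]]
      psi_V_def
    by (auto intro!: restrict_ext simp: path_rev_Fr(3)[OF F])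
qed

text \<open>On the carriers, \<Phi> equals \<open>Phi0\<close> and \<Psi> inverts it. The properties
  of \<Psi> are then obtained from those of \<Phi> by writing each element of the target as an
  image.\<close>

lemma graded_isos:
  assumes Phi: "is_Phi n k V eta xi \<Phi>" and Psi: "is_Psi n k V eta xi \<Psi>"
  shows "graded_ring_iso (osz_l n k) (osz_l_component n k) Bt (Btilde_component n V eta xi) \<Phi>" (is
    ?A)
    and "graded_ring_iso Bt (Btilde_component n V eta xi) (osz_l n k) (osz_l_component n k) \<Psi>" (is
      ?B)
    and "A \<in> carrier (osz_l n k) \<Longrightarrow> \<Psi> (\<Phi> A) = A"
    and "b \<in> carrier Bt \<Longrightarrow> \<Phi> (\<Psi> b) = b"
    and "A \<in> carrier (osz_l n k) \<Longrightarrow> \<Phi> (psi_OSz A) = psi_V n V eta xi (\<Phi> A)"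
    and "b \<in> carrier Bt \<Longrightarrow> \<Psi> (psi_V n V eta xi b) = psi_OSz (\<Psi> b)"
proof -
  note eq = is_Phi_unique[OF Phi] and inv = is_Psi_Phi0[OF Psi]
  have hom: "\<Phi> \<in> Ring.ring_hom (osz_l n k) Bt" "\<Psi> \<in> Ring.ring_hom Bt (osz_l n k)"
    using Phi Psi by (simp_all add: is_Phi_def is_Psi_def Let_def ring_hom_ring.homh)
  have inv': "\<Psi> (\<Phi> A) = A" if "A \<in> carrier (osz_l n k)" for A using inv[OF that] eq[OF that]
    by simp
  have img: "\<exists>A\<in>carrier (osz_l n k). b = \<Phi> A" if b: "b \<in> carrier Bt" for b
  proof -
    obtain A where "A \<in> carrier (osz_l n k)" "b = Phi0 A" using b unfolding Phi0_image[symmetric]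
      by blast
    then show ?thesis using eq[of A] by metis
  qed
  have inv2: "\<Phi> (\<Psi> b) = b" if "b \<in> carrier Bt" for b using img[OF that] inv' by auto
  have bij: "bij_betw \<Phi> (carrier (osz_l n k)) (carrier Bt)"
    using Phi0_iso bij_betw_cong[of "carrier (osz_l n k)" \<Phi> Phi0] eq by (simp add: ring_iso_def)
  have bij': "bij_betw \<Psi> (carrier Bt) (carrier (osz_l n k))"
    by (rule bij_betw_byWitness[where f' = \<Phi>])
      (use inv2 inv' ring_hom_closed[OF hom(1)] ring_hom_closed[OF hom(2)] in auto)
  have comp: "\<Phi> ` osz_l_component n k d = Btilde_component n V eta xi d" for d
    unfolding Phi0_component[symmetric]
      by (rule image_cong[OF refl eq]) (simp add: osz_l_component_def)
  have comp': "\<Psi> ` Btilde_component n V eta xi d = osz_l_component n k d" for d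
  proof -
    have "(\<lambda>A. \<Psi> (\<Phi> A)) ` osz_l_component n k d = (\<lambda>A. A) ` osz_l_component n k d"
      by (rule image_cong[OF refl inv']) (simp add: osz_l_component_def)
    then show ?thesis unfolding comp[symmetric] image_image by simp
  qed
  show ?A ?B using hom bij bij' comp comp' by (simp_all add: graded_ring_iso_def ring_iso_def)
  show "\<Psi> (\<Phi> A) = A" if "A \<in> carrier (osz_l n k)" using inv'[OF that] .
  show "\<Phi> (\<Psi> b) = b" if "b \<in> carrier Bt" using inv2[OF that] .
  have psi: "\<Phi> (psi_OSz A) = psi_V n V eta xi (\<Phi> A)" if "A \<in> carrier (osz_l n k)" for A
    using Phi0_psi[OF that] eq[OF that] eq[OF psi_OSz_closed[OF that]] by simp
  then show "\<Phi> (psi_OSz A) = psi_V n V eta xi (\<Phi> A)" if "A \<in> carrier (osz_l n k)" using that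
    by blast
  show "\<Psi> (psi_V n V eta xi b) = psi_OSz (\<Psi> b)" if b: "b \<in> carrier Bt"
  proof -
    obtain A where A: "A \<in> carrier (osz_l n k)" "b = \<Phi> A" using img[OF b] by blast
    show ?thesis using inv'[OF psi_OSz_closed[OF A(1)]] inv'[OF A(1)] psi[OF A(1)]
      by (simp add: A(2))
  qed
qed

end

theorem theorem4p9:
  fixes n k :: nat and V eta xi :: "real vec set"
  assumes "polarized_arrangement n k V eta xi"
    and "left_cyclic n k V eta xi"
  shows "(\<exists>\<Phi>. is_Phi n k V eta xi \<Phi>) \<and> (\<exists>\<Psi>. is_Psi n k V eta xi \<Psi>) \<and>
    (\<forall>\<Phi> \<Psi>. is_Phi n k V eta xi \<Phi> \<and> is_Psi n k V eta xi \<Psi> \<longrightarrow>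
       graded_ring_iso (osz_l n k) (osz_l_component n k)
         (Btilde n V eta xi) (Btilde_component n V eta xi) \<Phi> \<and>
       graded_ring_iso (Btilde n V eta xi) (Btilde_component n V eta xi)
         (osz_l n k) (osz_l_component n k) \<Psi> \<and>
       (\<forall>a\<in>carrier (osz_l n k). \<Psi> (\<Phi> a) = a) \<and>
       (\<forall>b\<in>carrier (Btilde n V eta xi). \<Phi> (\<Psi> b) = b) \<and>
       (\<forall>a\<in>carrier (osz_l n k). \<Phi> (psi_OSz a) = psi_V n V eta xi (\<Phi> a)) \<and>
       (\<forall>b\<in>carrier (Btilde n V eta xi). \<Psi> (psi_V n V eta xi b) = psi_OSz (\<Psi> b)))"
proof (intro conjI allI impI)
  show "\<exists>\<Phi>. is_Phi n k V eta xi \<Phi>" using is_Phi_Phi0[OF assms] by blast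
  show "\<exists>\<Psi>. is_Psi n k V eta xi \<Psi>" using is_Psi_Psi0[OF assms] by blast
next
  fix \<Phi> \<Psi> assume h: "is_Phi n k V eta xi \<Phi> \<and> is_Psi n k V eta xi \<Psi>"
  note G = graded_isos[OF assms conjunct1[OF h] conjunct2[OF h]]
  show "graded_ring_iso (osz_l n k) (osz_l_component n k) (Btilde n V eta xi) (Btilde_component n
    V eta xi) \<Phi>"
    "graded_ring_iso (Btilde n V eta xi) (Btilde_component n V eta xi) (osz_l n k)
      (osz_l_component n k) \<Psi>"
    by (fact G(1) G(2))+
  show "\<forall>a\<in>carrier (osz_l n k). \<Psi> (\<Phi> a) = a" "\<forall>b\<in>carrier (Btilde n V eta xi). \<Phi> (\<Psi> b) = b"
    "\<forall>a\<in>carrier (osz_l n k). \<Phi> (psi_OSz a) = psi_V n V eta xi (\<Phi> a)"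
    "\<forall>b\<in>carrier (Btilde n V eta xi). \<Psi> (psi_V n V eta xi b) = psi_OSz (\<Psi> b)"
    using G(3-6) by simp_all
qed

end
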